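(* Let $E$ be a sequentially complete complex locally convex Hausdorff space, let $a\in\overline{\mathbb{R}}$ and let $K:=[a,\infty]$ or $K:=[-\infty,a]$, but $K\neq\overline{\mathbb{R}}$. Then the Fourier transform $$\mathcal{F}\colon bv_{K}(E)\to\mathcal{FO}_{K}(E),\quad \mathcal{F}([F])(\zeta):=\int_{\gamma_{K}}F(z)e^{-iz\zeta}\,dz,$$ is a topological isomorphism. Here $\zeta$ ranges over the open lower half-plane if $K=[a,\infty]$ and over the open upper half-plane if $K=[-\infty,a]$.
   Context: $\mathbb{N}=\{1,2,\dots\}$, $\overline{\mathbb{R}}:=\mathbb{R}\cup\{\pm\infty\}$, $\overline{\mathbb{C}}:=\overline{\mathbb{R}}+i\mathbb{R}$, $\mathbb{H}:=\{z\in\mathbb{C}\mid \operatorname{Im}z>0\}$. $E$ carries a directed system of seminorms $(p_\alpha)_{\alpha\in\mathfrak{A}}$ generating its topology; $\mathcal{O}(\Omega,E)$ is the space of $E$-valued holomorphic functions on an open set $\Omega\subset\mathbb{C}$. Put $d(z,M):=\inf_{w\in M}|z-w|$, $d(z,\emptyset):=\infty$. For compact $K\subset\overline{\mathbb{R}}$ and $c>0$, $U_{1/c}(K)$ is the union of $\{z\in\mathbb{C}\mid d(z,K\cap\mathbb{C})<c\}$ with the strip $]1/c,\infty[\,+\,i\,]-c,c[$ if $\infty\in K$ and with the strip $]-\infty,-1/c[\,+\,i\,]-c,c[$ if $-\infty\in K$. For $n\in\mathbb{N}$ put $S_n(K):=(\mathbb{C}\setminus\overline{U_n(K)})\cap\{z\mid|\operatorname{Im}z|<n\}$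 (so $U_n(K)$ is $U_{1/c}(K)$ with $c=1/n$). $\mathcal{O}^{exp}(\overline{\mathbb{C}}\setminus K,E)$ is the space of all $f\in\mathcal{O}(\mathbb{C}\setminus K,E)$ with $\sup_{z\in S_n(K)}p_\alpha(f(z))e^{-\frac1n|\operatorname{Re}z|}<\infty$ for all $n\in\mathbb{N}$, $\alpha\in\mathfrak{A}$, topologised by these seminorms, and $bv_K(E):=\mathcal{O}^{exp}(\overline{\mathbb{C}}\setminus K,E)/\mathcal{O}^{exp}(\overline{\mathbb{C}},E)$ with the quotient topology. For $-\infty<a\le\infty$, $\mathcal{FO}_{[a,\infty]}(E)$ is the space of all $f\in\mathcal{O}(-\mathbb{H},E)$ such that for all $k\in\mathbb{N}$, $\alpha\in\mathfrak{A}$ $$\sup_{\operatorname{Im}z\le-\frac1k}p_\alpha(f(z))e^{-\frac1k|z|+a|\operatorname{Im}z|}<\infty,$$ where $a$ in the exponent is replaced by $k$ if $a=\infty$. For $-\infty\le a<\infty$, $\mathcal{FO}_{[-\infty,a]}(E)$ is the space of all $f\in\mathcal{O}(\mathbb{H},E)$ such that for all $k\in\mathbb{N}$, $\alpha\in\mathfrak{A}$ $$\sup_{\operatorname{Im}z\ge\frac1k}p_\alpha(f(z))e^{-\frac1k|z|-a|\operatorname{Im}z|}<\infty,$$ where $a$ in the exponent is replaced by $-k$ if $a=-\infty$. Both spaces are topologised by these seminorms. $\gamma_K$ is the path along the boundary of $U_{1/c}(K)$ with clockwise orientation (i.e. $U_{1/c}(K)$ lies to the right of the path), $c>0$; for given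 $\zeta$, $c$ is taken small enough that the integral converges. The integral is a Pettis integral; it does not depend on the choice of $c$ or of the representative $F$. *)

theory Defs
  imports "HOL-Analysis.Analysis"
begin

section \<open>Seminorms and the topologies they generate\<close>

text \<open>A seminormed complex vector space is given by its scalar multiplication \<open>sc\<close> (the library has
  no class of complex vector spaces) and by a family \<open>p\<close> of seminorms indexed by the set \<open>A\<close>.\<close>

definition seminorm :: "(complex \<Rightarrow> 'e::ab_group_add \<Rightarrow> 'e) \<Rightarrow> ('e \<Rightarrow> real) \<Rightarrow> bool" where
  "seminorm sc q \<longleftrightarrow>
     (\<forall>x y. q (x + y) \<le> q x + q y) \<and> (\<forall>c x. q (sc c x) = cmod c * q x)"

definition directed_seminorms :: "'i set \<Rightarrow> ('i \<Rightarrow> 'e \<Rightarrow> real) \<Rightarrow> bool" where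
  "directed_seminorms A p \<longleftrightarrow>
     (\<forall>\<alpha>\<in>A. \<forall>\<beta>\<in>A. \<exists>\<gamma>\<in>A. \<exists>C\<ge>0. \<forall>x. max (p \<alpha> x) (p \<beta> x) \<le> C * p \<gamma> x)"

text \<open>The carrier \<open>V\<close> is inserted into the subbase so that it is open also if \<open>Q\<close> is empty.\<close>

definition seminorm_topology :: "'v::minus set \<Rightarrow> ('v \<Rightarrow> real) set \<Rightarrow> 'v topology" where
  "seminorm_topology V Q =
     topology_generated_by
       (insert V {{y \<in> V. q (y - x) < e} | x q e. x \<in> V \<and> q \<in> Q \<and> 0 < e})"

lemma topspace_seminorm_topology [simp]: "topspace (seminorm_topology V Q) = V"
  unfolding seminorm_topology_def topology_generated_by_topspace by auto

definition lc_topology :: "'i set \<Rightarrow> ('i \<Rightarrow> 'e::ab_group_add \<Rightarrow> real) \<Rightarrow> 'e topology" where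
  "lc_topology A p = seminorm_topology UNIV (p ` A)"

definition seq_complete :: "'i set \<Rightarrow> ('i \<Rightarrow> 'e::ab_group_add \<Rightarrow> real) \<Rightarrow> bool" where
  "seq_complete A p \<longleftrightarrow>
     (\<forall>x :: nat \<Rightarrow> 'e.
        (\<forall>\<alpha>\<in>A. \<forall>e>0. \<exists>N. \<forall>m\<ge>N. \<forall>n\<ge>N. p \<alpha> (x m - x n) < e) \<longrightarrow>
        (\<exists>l. limitin (lc_topology A p) x l sequentially))"

definition lc_dual ::
  "(complex \<Rightarrow> 'e::ab_group_add \<Rightarrow> 'e) \<Rightarrow> 'i set \<Rightarrow> ('i \<Rightarrow> 'e \<Rightarrow> real) \<Rightarrow> ('e \<Rightarrow> complex) set" where
  "lc_dual sc A p =
     {\<phi>. Vector_Spaces.linear sc (*) \<phi> \<and> continuous_map (lc_topology A p) euclidean \<phi>}"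

definition quotient_topology :: "'v topology \<Rightarrow> ('v \<Rightarrow> 'w) \<Rightarrow> 'w topology" where
  "quotient_topology T q =
     topology (\<lambda>U. U \<subseteq> q ` topspace T \<and> openin T {x \<in> topspace T. q x \<in> U})"

lemma openin_quotient_topology:
  "openin (quotient_topology T q) U \<longleftrightarrow>
     U \<subseteq> q ` topspace T \<and> openin T {x \<in> topspace T. q x \<in> U}"
proof -
  have "istopology (\<lambda>U. U \<subseteq> q ` topspace T \<and> openin T {x \<in> topspace T. q x \<in> U})"
    unfolding istopology_def
  proof (intro conjI allI impI)
    fix S U
    assume "S \<subseteq> q ` topspace T \<and> openin T {x \<in> topspace T. q x \<in> S}"
      and "U \<subseteq> q ` topspace T \<and> openin T {x \<in> topspace T. q x \<in> U}"
    moreover have "{x \<in> topspace T. q x \<in> S \<inter> U} =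
        {x \<in> topspace T. q x \<in> S} \<inter> {x \<in> topspace T. q x \<in> U}"
      by auto
    ultimately show "openin T {x \<in> topspace T. q x \<in> S \<inter> U}"
      by auto
  next
    fix \<K>
    assume K: "\<forall>K\<in>\<K>. K \<subseteq> q ` topspace T \<and> openin T {x \<in> topspace T. q x \<in> K}"
    have "{x \<in> topspace T. q x \<in> \<Union>\<K>} = (\<Union>K\<in>\<K>. {x \<in> topspace T. q x \<in> K})"
      by auto
    then show "openin T {x \<in> topspace T. q x \<in> \<Union>\<K>}"
      using K by auto
  qed auto
  then show ?thesis
    by (simp add: quotient_topology_def)
qed

lemma topspace_quotient_topology [simp]:
  "topspace (quotient_topology T q) = q ` topspace T"
proof
  have "{x \<in> topspace T. q x \<in> q ` topspace T} = topspace T"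
    by auto
  then have "openin (quotient_topology T q) (q ` topspace T)"
    by (simp add: openin_quotient_topology)
  then show "q ` topspace T \<subseteq> topspace (quotient_topology T q)"
    by (rule openin_subset)
  show "topspace (quotient_topology T q) \<subseteq> q ` topspace T"
    using openin_topspace[of "quotient_topology T q"] by (simp only: openin_quotient_topology)
qed

lemma quotient_map_quotient_topology: "quotient_map T (quotient_topology T q) q"
  by (simp add: quotient_map_def openin_quotient_topology)

section \<open>Vector-valued holomorphic functions and Pettis integrals\<close>

text \<open>A function on \<open>\<Omega>\<close> is represented by its extension by zero, so that distinct
  representatives are distinct functions on \<open>\<Omega>\<close>.\<close>

definition holo_space ::
  "(complex \<Rightarrow> 'e::ab_group_add \<Rightarrow> 'e) \<Rightarrow> 'i set \<Rightarrow> ('i \<Rightarrow> 'e \<Rightarrow> real) \<Rightarrow>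
   complex set \<Rightarrow> (complex \<Rightarrow> 'e) set" where
  "holo_space sc A p \<Omega> =
     {f. (\<forall>z\<in>\<Omega>. \<exists>l. limitin (lc_topology A p) (\<lambda>w. sc (1 / (w - z)) (f w - f z)) l (at z)) \<and>
         (\<forall>z. z \<notin> \<Omega> \<longrightarrow> f z = 0)}"

definition has_pettis_integral ::
  "(complex \<Rightarrow> 'e::ab_group_add \<Rightarrow> 'e) \<Rightarrow> 'i set \<Rightarrow> ('i \<Rightarrow> 'e \<Rightarrow> real) \<Rightarrow>
   'm measure \<Rightarrow> ('m \<Rightarrow> 'e) \<Rightarrow> 'e \<Rightarrow> bool" where
  "has_pettis_integral sc A p M f v \<longleftrightarrow>
     (\<forall>\<phi>\<in>lc_dual sc A p. has_bochner_integral M (\<lambda>t. \<phi> (f t)) (\<phi> v))"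

text \<open>Paths are parametrised by the whole real line, since they may be unbounded at both ends.\<close>

definition has_pettis_path_integral ::
  "(complex \<Rightarrow> 'e::ab_group_add \<Rightarrow> 'e) \<Rightarrow> 'i set \<Rightarrow> ('i \<Rightarrow> 'e \<Rightarrow> real) \<Rightarrow>
   (real \<Rightarrow> complex) \<Rightarrow> (complex \<Rightarrow> 'e) \<Rightarrow> 'e \<Rightarrow> bool" where
  "has_pettis_path_integral sc A p \<gamma> f v \<longleftrightarrow>
     has_pettis_integral sc A p lborel (\<lambda>t. sc (vector_derivative \<gamma> (at t)) (f (\<gamma> t))) v"

section \<open>The neighbourhoods \<open>U\<close>, the sets \<open>S\<^sub>n\<close> and the path along the boundary of \<open>U\<close>\<close>

definition fin_part :: "ereal set \<Rightarrow> complex set" where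
  "fin_part K = {complex_of_real x | x. ereal x \<in> K}"

text \<open>The infimum is taken in \<^typ>\<open>ereal\<close>, so the distance to the empty set is infinite.\<close>

definition edist :: "complex \<Rightarrow> complex set \<Rightarrow> ereal" where
  "edist z M = (INF w\<in>M. ereal (cmod (z - w)))"

text \<open>\<open>U_nbhd c K\<close> is $U_{1/c}(K)$; in particular $U_n(K)$ is \<open>U_nbhd (1 / n) K\<close>.\<close>

definition U_nbhd :: "real \<Rightarrow> ereal set \<Rightarrow> complex set" where
  "U_nbhd c K =
     {z. edist z (fin_part K) < ereal c} \<union>
     (if \<infinity> \<in> K then {z. Re z > 1 / c \<and> \<bar>Im z\<bar> < c} else {}) \<union>
     (if -\<infinity> \<in> K then {z. Re z < - (1 / c) \<and> \<bar>Im z\<bar> < c} else {})"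

definition S_set :: "nat \<Rightarrow> ereal set \<Rightarrow> complex set" where
  "S_set n K = - closure (U_nbhd (1 / real n) K) \<inter> {z. \<bar>Im z\<bar> < real n}"

text \<open>For \<open>a \<noteq> -\<infinity>\<close>, a point $x + i c \sin\theta$ with $|\theta| < \pi/2$ belongs to
  $U_{1/c}([a,\infty])$ iff $x > \min (a - c\cos\theta) (1/c)$, and this set has no other points.
  The path comes in from $+\infty - ic$, turns around the set on the left, and returns to
  $+\infty + ic$, so the set is on its right.\<close>

definition left_edge :: "ereal \<Rightarrow> real \<Rightarrow> real \<Rightarrow> real" where
  "left_edge a c \<theta> = real_of_ereal (min (a - ereal (c * cos \<theta>)) (ereal (1 / c)))"

definition gamma_right :: "ereal \<Rightarrow> real \<Rightarrow> real \<Rightarrow> complex" where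
  "gamma_right a c t =
     (if t < - (pi/2) then Complex (left_edge a c (- (pi/2)) + (- (pi/2) - t)) (- c)
      else if t \<le> pi/2 then Complex (left_edge a c t) (c * sin t)
      else Complex (left_edge a c (pi/2) + (t - pi/2)) c)"

text \<open>The set $U_{1/c}([-\infty,a])$ is $-U_{1/c}([-a,\infty])$, and rotation by \<open>\<pi>\<close> preserves the
  orientation. Below, \<open>gamma\<close>, \<open>half_plane\<close> and \<open>FO\<close> are meant for \<open>K = [a,\<infinity>]\<close> with \<open>a \<noteq> -\<infinity>\<close>
  (then \<open>a = Inf K\<close>) and for \<open>K = [-\<infinity>,a]\<close> with \<open>a \<noteq> \<infinity>\<close> (then \<open>a = Sup K\<close>); these are told apart
  by \<open>\<infinity> \<in> K\<close>.\<close>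

definition gamma :: "ereal set \<Rightarrow> real \<Rightarrow> real \<Rightarrow> complex" where
  "gamma K c = (if \<infinity> \<in> K then gamma_right (Inf K) c else (\<lambda>t. - gamma_right (- Sup K) c t))"

section \<open>The spaces \<open>O\<^sup>e\<^sup>x\<^sup>p\<close> and \<open>bv\<^sub>K\<close>\<close>

definition Oexp ::
  "(complex \<Rightarrow> 'e::ab_group_add \<Rightarrow> 'e) \<Rightarrow> 'i set \<Rightarrow> ('i \<Rightarrow> 'e \<Rightarrow> real) \<Rightarrow>
   ereal set \<Rightarrow> (complex \<Rightarrow> 'e) set" where
  "Oexp sc A p K =
     {f \<in> holo_space sc A p (- fin_part K).
        \<forall>n\<ge>1. \<forall>\<alpha>\<in>A. bdd_above ((\<lambda>z. p \<alpha> (f z) * exp (- (1 / real n) * \<bar>Re z\<bar>)) ` S_set n K)}"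

definition Oexp_seminorm ::
  "('i \<Rightarrow> 'e \<Rightarrow> real) \<Rightarrow> ereal set \<Rightarrow> nat \<Rightarrow> 'i \<Rightarrow> (complex \<Rightarrow> 'e) \<Rightarrow> real" where
  "Oexp_seminorm p K n \<alpha> f = (SUP z\<in>S_set n K. p \<alpha> (f z) * exp (- (1 / real n) * \<bar>Re z\<bar>))"

definition Oexp_topology ::
  "(complex \<Rightarrow> 'e::ab_group_add \<Rightarrow> 'e) \<Rightarrow> 'i set \<Rightarrow> ('i \<Rightarrow> 'e \<Rightarrow> real) \<Rightarrow>
   ereal set \<Rightarrow> (complex \<Rightarrow> 'e) topology" where
  "Oexp_topology sc A p K =
     seminorm_topology (Oexp sc A p K) {Oexp_seminorm p K n \<alpha> | n \<alpha>. n \<ge> 1 \<and> \<alpha> \<in> A}"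

text \<open>The subspace divided out is \<open>Oexp sc A p {}\<close>, restricted to the complement of \<open>K\<close>.\<close>

definition bv_rel ::
  "(complex \<Rightarrow> 'e::ab_group_add \<Rightarrow> 'e) \<Rightarrow> 'i set \<Rightarrow> ('i \<Rightarrow> 'e \<Rightarrow> real) \<Rightarrow>
   ereal set \<Rightarrow> ((complex \<Rightarrow> 'e) \<times> (complex \<Rightarrow> 'e)) set" where
  "bv_rel sc A p K =
     {(F, G). F \<in> Oexp sc A p K \<and> G \<in> Oexp sc A p K \<and>
        (\<exists>H\<in>Oexp sc A p {}. \<forall>z\<in>- fin_part K. F z - G z = H z)}"

definition bv_class ::
  "(complex \<Rightarrow> 'e::ab_group_add \<Rightarrow> 'e) \<Rightarrow> 'i set \<Rightarrow> ('i \<Rightarrow> 'e \<Rightarrow> real) \<Rightarrow>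
   ereal set \<Rightarrow> (complex \<Rightarrow> 'e) \<Rightarrow> (complex \<Rightarrow> 'e) set" where
  "bv_class sc A p K F = bv_rel sc A p K `` {F}"

definition bv_topology ::
  "(complex \<Rightarrow> 'e::ab_group_add \<Rightarrow> 'e) \<Rightarrow> 'i set \<Rightarrow> ('i \<Rightarrow> 'e \<Rightarrow> real) \<Rightarrow>
   ereal set \<Rightarrow> (complex \<Rightarrow> 'e) set topology" where
  "bv_topology sc A p K = quotient_topology (Oexp_topology sc A p K) (bv_class sc A p K)"

lemma topspace_bv_topology [simp]:
  "topspace (bv_topology sc A p K) = Oexp sc A p K // bv_rel sc A p K"
  by (auto simp: bv_topology_def Oexp_topology_def bv_class_def quotient_def)

definition bv_add ::
  "(complex \<Rightarrow> 'e::ab_group_add \<Rightarrow> 'e) \<Rightarrow> 'i set \<Rightarrow> ('i \<Rightarrow> 'e \<Rightarrow> real) \<Rightarrow> ereal set \<Rightarrow>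
   (complex \<Rightarrow> 'e) set \<Rightarrow> (complex \<Rightarrow> 'e) set \<Rightarrow> (complex \<Rightarrow> 'e) set" where
  "bv_add sc A p K X Y = (\<Union>F\<in>X. \<Union>G\<in>Y. bv_class sc A p K (\<lambda>z. F z + G z))"

definition bv_scale ::
  "(complex \<Rightarrow> 'e::ab_group_add \<Rightarrow> 'e) \<Rightarrow> 'i set \<Rightarrow> ('i \<Rightarrow> 'e \<Rightarrow> real) \<Rightarrow> ereal set \<Rightarrow>
   complex \<Rightarrow> (complex \<Rightarrow> 'e) set \<Rightarrow> (complex \<Rightarrow> 'e) set" where
  "bv_scale sc A p K c X = (\<Union>F\<in>X. bv_class sc A p K (\<lambda>z. sc c (F z)))"

section \<open>The spaces \<open>FO\<^sub>K\<close>\<close>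

definition half_plane :: "ereal set \<Rightarrow> complex set" where
  "half_plane K = (if \<infinity> \<in> K then {\<zeta>. Im \<zeta> < 0} else {\<zeta>. Im \<zeta> > 0})"

definition FO_domain :: "ereal set \<Rightarrow> nat \<Rightarrow> complex set" where
  "FO_domain K k =
     (if \<infinity> \<in> K then {z. Im z \<le> - (1 / real k)} else {z. Im z \<ge> 1 / real k})"

definition FO_weight :: "ereal set \<Rightarrow> nat \<Rightarrow> complex \<Rightarrow> real" where
  "FO_weight K k z =
     (if \<infinity> \<in> K
      then exp (- (1 / real k) * cmod z
                + (if Inf K = \<infinity> then real k else real_of_ereal (Inf K)) * \<bar>Im z\<bar>)
      else exp (- (1 / real k) * cmod z
                - (if Sup K = -\<infinity> then - real k else real_of_ereal (Sup K)) * \<bar>Im z\<bar>))"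

definition FO ::
  "(complex \<Rightarrow> 'e::ab_group_add \<Rightarrow> 'e) \<Rightarrow> 'i set \<Rightarrow> ('i \<Rightarrow> 'e \<Rightarrow> real) \<Rightarrow>
   ereal set \<Rightarrow> (complex \<Rightarrow> 'e) set" where
  "FO sc A p K =
     {f \<in> holo_space sc A p (half_plane K).
        \<forall>k\<ge>1. \<forall>\<alpha>\<in>A. bdd_above ((\<lambda>z. p \<alpha> (f z) * FO_weight K k z) ` FO_domain K k)}"

definition FO_seminorm ::
  "('i \<Rightarrow> 'e \<Rightarrow> real) \<Rightarrow> ereal set \<Rightarrow> nat \<Rightarrow> 'i \<Rightarrow> (complex \<Rightarrow> 'e) \<Rightarrow> real" where
  "FO_seminorm p K k \<alpha> f = (SUP z\<in>FO_domain K k. p \<alpha> (f z) * FO_weight K k z)"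

definition FO_topology ::
  "(complex \<Rightarrow> 'e::ab_group_add \<Rightarrow> 'e) \<Rightarrow> 'i set \<Rightarrow> ('i \<Rightarrow> 'e \<Rightarrow> real) \<Rightarrow>
   ereal set \<Rightarrow> (complex \<Rightarrow> 'e) topology" where
  "FO_topology sc A p K =
     seminorm_topology (FO sc A p K) {FO_seminorm p K k \<alpha> | k \<alpha>. k \<ge> 1 \<and> \<alpha> \<in> A}"

section \<open>The Fourier transform\<close>

definition has_fourier_integral ::
  "(complex \<Rightarrow> 'e::ab_group_add \<Rightarrow> 'e) \<Rightarrow> 'i set \<Rightarrow> ('i \<Rightarrow> 'e \<Rightarrow> real) \<Rightarrow>
   ereal set \<Rightarrow> real \<Rightarrow> (complex \<Rightarrow> 'e) \<Rightarrow> complex \<Rightarrow> 'e \<Rightarrow> bool" where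
  "has_fourier_integral sc A p K c F \<zeta> v \<longleftrightarrow>
     has_pettis_path_integral sc A p (gamma K c) (\<lambda>z. sc (exp (- \<i> * z * \<zeta>)) (F z)) v"

text \<open>The common value of the integrals for all representatives \<open>F\<close> of the class \<open>X\<close> and all
  sufficiently small \<open>c > 0\<close>.\<close>

definition fourier ::
  "(complex \<Rightarrow> 'e::ab_group_add \<Rightarrow> 'e) \<Rightarrow> 'i set \<Rightarrow> ('i \<Rightarrow> 'e \<Rightarrow> real) \<Rightarrow>
   ereal set \<Rightarrow> (complex \<Rightarrow> 'e) set \<Rightarrow> complex \<Rightarrow> 'e" where
  "fourier sc A p K X \<zeta> =
     (if \<zeta> \<in> half_plane K
      then THE v. \<forall>\<^sub>F c in at_right 0. \<forall>F\<in>X. has_fourier_integral sc A p K c F \<zeta> v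
      else 0)"

definition bv_FO_topological_isomorphism ::
  "(complex \<Rightarrow> 'e::ab_group_add \<Rightarrow> 'e) \<Rightarrow> 'i set \<Rightarrow> ('i \<Rightarrow> 'e \<Rightarrow> real) \<Rightarrow>
   ereal set \<Rightarrow> ((complex \<Rightarrow> 'e) set \<Rightarrow> complex \<Rightarrow> 'e) \<Rightarrow> bool" where
  "bv_FO_topological_isomorphism sc A p K \<Phi> \<longleftrightarrow>
     (\<forall>X\<in>Oexp sc A p K // bv_rel sc A p K. \<forall>Y\<in>Oexp sc A p K // bv_rel sc A p K.
        \<Phi> (bv_add sc A p K X Y) = (\<lambda>\<zeta>. \<Phi> X \<zeta> + \<Phi> Y \<zeta>)) \<and>
     (\<forall>c. \<forall>X\<in>Oexp sc A p K // bv_rel sc A p K.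
        \<Phi> (bv_scale sc A p K c X) = (\<lambda>\<zeta>. sc c (\<Phi> X \<zeta>))) \<and>
     homeomorphic_map (bv_topology sc A p K) (FO_topology sc A p K) \<Phi>"

end

(*
  A class [F] is recovered from its transform f by deforming the real line of the classical inversion
  formula into the lower half-plane and splitting it by an entire multiplier that decays like a
  Gaussian on one side. Above the real axis this gives 1/(2 pi) times the integral of
  m(s) f(s) exp(i z s), below it the same with m - 1, where m' is a normalised Gaussian. The two
  functions continue each other across the real points to the left of K, because shifting the contours
  down changes their difference only by integrals that converge there; a contour shift and the Cauchy
  formula show that their transform is f again.

  If the transform of F vanishes, then so do all integrals of F against w |-> exp(-(w-z)^2/4)/(w-z)
  over paths around K that do not surround z, since this kernel is a superposition of exponentials.
  The Cauchy formula for paths that do surround z then extends F across K with the same bounds.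

  Vector-valued statements are reduced to scalar ones through continuous functionals: Pettis integrals
  exist by sequential completeness, and Hahn-Banach returns the seminorm estimates. The half-line to
  the left follows by the reflection z |-> -z.
*)
theory Submission
  imports Defs "HOL-Complex_Analysis.Complex_Analysis"
begin

section \<open>Locally convex spaces\<close>

text \<open>Members of both spaces may grow like slow exponentials in the real direction, so neither
  the classical inversion integral nor a Cauchy integral along an unbounded path converges. One
  function m removes both obstacles: m tends to 0 on the left and m - 1 tends to 0 on the right
  faster than every exponential, while exp(i z s) supplies decay on the other side. The Fourier
  transform of m is i exp(-u^2/4)/u. For u = z - w this is, up to a constant, the Cauchy kernel
  times a Gaussian that equals 1 at w = z; the Gaussian leaves the residue alone and makes integrals
  around K converge. Hence the constant 1/4, and hence integrals of F against this kernel are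
  superpositions of values of its transform. On the lines Im z = 1 and Im z = -1 the constructed
  function has the transforms m f and (m - 1) f, whose difference is f. The resulting right inverse
  J of the transform T satisfies seminorm estimates. So F + J (f - T F) is a preimage of f near F
  when f is near T F, which makes T open; for the quotient topology only the kernel of T remains to
  be found.\<close>

lemma openin_seminorm_topology:
 assumes tri: "\<And>q x y z. q \<in> Q ==> x \<in> V ==> y \<in> V ==> z \<in> V ==> q (x - z) <= q (x - y) + q (y - z)"
  and zero: "\<And>q x. q \<in> Q ==> x \<in> V ==> q (x - x) = (0::real)"
 shows "openin (seminorm_topology V Q) U \<longleftrightarrow>
  U \<subseteq> V \<and> (\<forall>x\<in>U. \<exists>Q0 e. finite Q0 \<and> Q0 \<subseteq> Q \<and> 0 < e \<and> {y\<in>V. \<forall>q\<in>Q0. q (y - x) < e} \<subseteq> U)"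
  (is "?L \<longleftrightarrow> ?R")
proof
 let ?B = "insert V {{y \<in> V. q (y - x) < e} | x q e. x \<in> V \<and> q \<in> Q \<and> 0 < e}"
 assume ?L
 then have UV: "U \<subseteq> V" using openin_subset by fastforce
 from \<open>?L\<close> have "generate_topology_on ?B U" by (simp add: seminorm_topology_def openin_topology_generated_by_iff)
 define nbhd where "nbhd x T \<longleftrightarrow> (\<exists>Q0 e. finite Q0 \<and> Q0 \<subseteq> Q \<and> 0 < e \<and> {y\<in>V. \<forall>q\<in>Q0. q (y - x) < e} \<subseteq> T)"
  for x T
 have nbhdI: "nbhd x T" if "finite Q0" "Q0 \<subseteq> Q" "0 < e" "{y\<in>V. \<forall>q\<in>Q0. q (y - x) < e} \<subseteq> T" for x T Q0 e
  using that unfolding nbhd_def by (intro exI conjI)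
 have mono: "nbhd x T'" if "nbhd x T" "T \<subseteq> T'" for x T T'
 proof -
  obtain Q0 e where "finite Q0" "Q0 \<subseteq> Q" "0 < e" "{y\<in>V. \<forall>q\<in>Q0. q (y - x) < e} \<subseteq> T" using \<open>nbhd x T\<close> unfolding nbhd_def by (elim exE conjE)
  then show ?thesis using that(2) by (intro nbhdI[of Q0 e]) (assumption | erule subset_trans)+
 qed
 from \<open>generate_topology_on ?B U\<close> have "\<forall>x\<in>U. nbhd x U"
 proof induction
  case Empty
  then show ?case by simp
 next
  case (Int a b)
  show ?case
  proof
   fix x assume "x \<in> a \<inter> b"
   with Int.IH have "nbhd x a" "nbhd x b" by auto
   then obtain Q1 e1 Q2 e2 where
    1: "finite Q1" "Q1 \<subseteq> Q" "0 < e1" "{y\<in>V. \<forall>q\<in>Q1. q (y - x) < e1} \<subseteq> a" and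
    2: "finite Q2" "Q2 \<subseteq> Q" "0 < e2" "{y\<in>V. \<forall>q\<in>Q2. q (y - x) < e2} \<subseteq> b" unfolding nbhd_def by (elim exE conjE)
   show "nbhd x (a \<inter> b)"
   proof (rule nbhdI)
    have "{y\<in>V. \<forall>q\<in>Q1 \<union> Q2. q (y - x) < min e1 e2} \<subseteq> {y\<in>V. \<forall>q\<in>Q1. q (y - x) < e1}"
     "{y\<in>V. \<forall>q\<in>Q1 \<union> Q2. q (y - x) < min e1 e2} \<subseteq> {y\<in>V. \<forall>q\<in>Q2. q (y - x) < e2}" by force+
    then show "{y\<in>V. \<forall>q\<in>Q1 \<union> Q2. q (y - x) < min e1 e2} \<subseteq> a \<inter> b" using 1(4) 2(4) by (intro Int_greatest) (rule subset_trans, assumption+)+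
   qed (use 1(1-3) 2(1-3) in simp_all)
  qed
 next
  case (UN K)
  then show ?case by (metis Union_iff Union_upper mono)
 next
  case (Basis s)
  then consider "s = V" | x q e where "s = {y \<in> V. q (y - x) < e}" "x \<in> V" "q \<in> Q" "0 < e" by auto
  then show ?case
  proof cases
   case 1
   then show ?thesis by (intro ballI nbhdI[of "{}" 1]) auto
  next
   case 2
   show ?thesis
   proof
    fix x' assume x': "x' \<in> s"
    \<comment> \<open>The triangle inequality recentres a subbasic ball at any of its points
      x'.\<close>
    then have "q (y - x) < e" if "y \<in> V" "q (y - x') < e - q (x' - x)" for y using tri[of q y x' x] 2 that by auto
    then show "nbhd x' s" using 2 x' by (intro nbhdI[of "{q}" "e - q (x' - x)"]) auto
   qed
  qed
 qed
 with UV show ?R unfolding nbhd_def by simp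
next
 assume R: ?R
 have N: "openin (seminorm_topology V Q) {y\<in>V. \<forall>q\<in>Q0. q (y - x) < e}"
  if "x \<in> V" "finite Q0" "Q0 \<subseteq> Q" "0 < e" for x Q0 e using that(2,3)
 proof (induction Q0)
  case empty
  then show ?case using openin_topspace[of "seminorm_topology V Q"] by simp
 next
  case (insert q Q0)
  have "openin (seminorm_topology V Q) {y \<in> V. q (y - x) < e}" unfolding seminorm_topology_def openin_topology_generated_by_iff
   using that insert by (intro generate_topology_on.Basis) auto
  moreover have "{y\<in>V. \<forall>q\<in>insert q Q0. q (y - x) < e} =
    {y \<in> V. q (y - x) < e} \<inter> {y\<in>V. \<forall>q\<in>Q0. q (y - x) < e}" by auto
  ultimately show ?case using insert by (auto intro: openin_Int)
 qed
 have "\<exists>T. openin (seminorm_topology V Q) T \<and> x \<in> T \<and> T \<subseteq> U" if "x \<in> U" for x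
 proof -
  have "\<exists>Q0 e. finite Q0 \<and> Q0 \<subseteq> Q \<and> 0 < e \<and> {y\<in>V. \<forall>q\<in>Q0. q (y - x) < e} \<subseteq> U" using that by (rule conjunct2[OF R, THEN bspec])
  then obtain Q0 e where *: "finite Q0" "Q0 \<subseteq> Q" "0 < e" "{y\<in>V. \<forall>q\<in>Q0. q (y - x) < e} \<subseteq> U" by (elim exE conjE)
  moreover have "x \<in> V" using R that by auto
  moreover have "x \<in> {y\<in>V. \<forall>q\<in>Q0. q (y - x) < e}"
  proof (intro CollectI conjI ballI)
   fix q assume "q \<in> Q0"
   then have "q (x - x) = 0" using * \<open>x \<in> V\<close> by (intro zero) auto
   then show "q (x - x) < e" using * by simp
  qed fact
  ultimately show ?thesis using N by meson
 qed
 then show ?L by (subst openin_subopen) blast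
qed

section \<open>Seminormed spaces and their continuous linear functionals\<close>

locale seminormed_space = vector_space sc
 for sc :: "complex => 'e::ab_group_add => 'e" +
 fixes A :: "'i set" and p :: "'i => 'e => real"
 assumes seminorm: "\<And>j. j \<in> A ==> seminorm sc (p j)"
begin

lemma p_add: "j \<in> A ==> p j (x + y) <= p j x + p j y"
 and p_scale: "j \<in> A ==> p j (sc c x) = cmod c*p j x" using seminorm by (auto simp: seminorm_def)

lemma p_zero [simp]: "j \<in> A ==> p j 0 = 0" using p_scale[of j 0 0] by simp

lemma p_minus: "j \<in> A ==> p j (- x) = p j x" using p_scale[of j "-1" x] by (simp add: scale_minus_left)

lemma p_commute: "j \<in> A ==> p j (x - y) = p j (y - x)" using p_minus[of j "x - y"] by simp

lemma p_nonneg: "j \<in> A ==> 0 <= p j x" using p_add[of j x "- x"] p_minus[of j x] by simp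

lemma p_tri: "j \<in> A ==> p j (x - z) <= p j (x - y) + p j (y - z)" using p_add[of j "x - y" "y - z"] by simp

lemma p_diff_le: "j \<in> A ==> \<bar>p j x - p j y\<bar> <= p j (x - y)" using p_add[of j "x - y" y] p_add[of j "y - x" x] p_commute[of j x y] by simp

lemma openin_lc_topology:
 "openin (lc_topology A p) U \<longleftrightarrow>
  (\<forall>x\<in>U. \<exists>S e. finite S \<and> S \<subseteq> A \<and> 0 < e \<and> {y. \<forall>j\<in>S. p j (y - x) < e} \<subseteq> U)"
proof -
 have "openin (lc_topology A p) U \<longleftrightarrow>
  U \<subseteq> UNIV \<and> (\<forall>x\<in>U. \<exists>Q0 e. finite Q0 \<and> Q0 \<subseteq> p ` A \<and> 0 < e \<and> {y\<in>UNIV. \<forall>q\<in>Q0. q (y - x) < e} \<subseteq> U)"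
  unfolding lc_topology_def by (rule openin_seminorm_topology) (auto simp: p_tri)
 also have "\<dots> \<longleftrightarrow> (\<forall>x\<in>U. \<exists>S e. finite S \<and> S \<subseteq> A \<and> 0 < e \<and> {y. \<forall>j\<in>S. p j (y - x) < e} \<subseteq> U)"
 proof -
  have "(\<exists>Q0 e. finite Q0 \<and> Q0 \<subseteq> p ` A \<and> 0 < e \<and> {y\<in>UNIV. \<forall>q\<in>Q0. q (y - x) < e} \<subseteq> U) \<longleftrightarrow>
   (\<exists>S e. finite S \<and> S \<subseteq> A \<and> 0 < e \<and> {y. \<forall>j\<in>S. p j (y - x) < e} \<subseteq> U)" (is "?l = ?r") for x
  proof
   assume ?l
   then obtain Q0 e where *: "finite Q0" "Q0 \<subseteq> p ` A" "0 < e" "{y\<in>UNIV. \<forall>q\<in>Q0. q (y - x) < e} \<subseteq> U" by blast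
   from finite_subset_image[OF *(1,2)] obtain S where "S \<subseteq> A" "finite S" "Q0 = p ` S" by blast
   with * show ?r by (intro exI[of _ S] exI[of _ e]) auto
  next
   assume ?r
   then obtain S e where "finite S" "S \<subseteq> A" "0 < e" "{y. \<forall>j\<in>S. p j (y - x) < e} \<subseteq> U" by blast
   then show ?l by (intro exI[of _ "p ` S"] exI[of _ e]) auto
  qed
  then show ?thesis by simp
 qed
 finally show ?thesis .
qed

lemma openin_lc_topologyE:
 assumes "openin (lc_topology A p) U" "x \<in> U"
 obtains S e where "finite S" "S \<subseteq> A" "0 < e" "\<And>y. (\<And>j. j \<in> S ==> p j (y - x) < e) ==> y \<in> U"
proof -
 have "\<exists>S e. finite S \<and> S \<subseteq> A \<and> 0 < e \<and> {y. \<forall>j\<in>S. p j (y - x) < e} \<subseteq> U" using assms(1)[unfolded openin_lc_topology] assms(2) by (rule bspec)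
 then obtain S e where *: "finite S" "S \<subseteq> A" "0 < e" "{y. \<forall>j\<in>S. p j (y - x) < e} \<subseteq> U" by (elim exE conjE)
 show ?thesis by (rule that[OF *(1-3)]) (rule subsetD[OF *(4)], simp)
qed

lemma limitin_lc_topology:
 "limitin (lc_topology A p) f l F \<longleftrightarrow> (\<forall>j\<in>A. ((\<lambda>x. p j (f x - l)) \<longlongrightarrow> 0) F)"
proof
 assume L: "limitin (lc_topology A p) f l F"
 show "\<forall>j\<in>A. ((\<lambda>x. p j (f x - l)) \<longlongrightarrow> 0) F"
 proof
  fix j assume j: "j \<in> A"
  show "((\<lambda>x. p j (f x - l)) \<longlongrightarrow> 0) F"
  proof (rule tendstoI)
   fix e :: real assume e: "0 < e"
   have "openin (lc_topology A p) {y. p j (y - l) < e}" unfolding openin_lc_topology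
   proof
    fix x assume "x \<in> {y. p j (y - l) < e}"
    then show "\<exists>S e'. finite S \<and> S \<subseteq> A \<and> 0 < e' \<and> {y. \<forall>j\<in>S. p j (y - x) < e'} \<subseteq> {y. p j (y - l) < e}" using j p_tri[OF j, of _ l x]
     by (intro exI[of _ "{j}"] exI[of _ "e - p j (x - l)"]) (auto, smt (verit, best))
   qed
   moreover have "l \<in> {y. p j (y - l) < e}" using e j by simp
   ultimately have "\<forall>\<^sub>F x in F. f x \<in> {y. p j (y - l) < e}" using L by (auto simp: limitin_def)
   then show "\<forall>\<^sub>F x in F. dist (p j (f x - l)) 0 < e" using p_nonneg[OF j] by simp
  qed
 qed
next
 assume R: "\<forall>j\<in>A. ((\<lambda>x. p j (f x - l)) \<longlongrightarrow> 0) F"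
 show "limitin (lc_topology A p) f l F" unfolding limitin_def
 proof (intro conjI allI impI)
  show "l \<in> topspace (lc_topology A p)" by (simp add: lc_topology_def)
  fix U assume "openin (lc_topology A p) U \<and> l \<in> U"
  then obtain S e where *: "finite S" "S \<subseteq> A" "0 < e"
   "\<And>y. (\<And>j. j \<in> S ==> p j (y - l) < e) ==> y \<in> U" using openin_lc_topologyE by blast
  have "\<forall>\<^sub>F x in F. \<forall>j\<in>S. p j (f x - l) < e" unfolding eventually_ball_finite_distrib[OF *(1)]
   using R * by (auto dest!: bspec order_tendstoD(2)[where a = e])
  then show "\<forall>\<^sub>F x in F. f x \<in> U" by eventually_elim (use *(4) in auto)
 qed
qed

lemma lc_dualI:
 assumes "j \<in> A" and add: "\<And>x y. ph (x + y) = ph x + ph y" and scale: "\<And>c x. ph (sc c x) = c*ph x"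
  and bound: "\<And>x. cmod (ph x) <= p j x"
 shows "ph \<in> lc_dual sc A p"
proof -
 have "vector_space ((*) :: complex => complex => complex)" by unfold_locales (auto simp: algebra_simps)
 then have "Vector_Spaces.linear sc (*) ph" unfolding Vector_Spaces.linear_iff using vector_space_axioms add scale by simp
 moreover have "continuous_map (lc_topology A p) euclidean ph" unfolding continuous_map_def
 proof (intro conjI allI impI)
  fix U :: "complex set" assume "openin euclidean U"
  then have U: "open U" by simp
  have diff: "ph (y - x) = ph y - ph x" for x y using add[of "y - x" x] by simp
  show "openin (lc_topology A p) {x \<in> topspace (lc_topology A p). ph x \<in> U}" unfolding openin_lc_topology
  proof
   fix x assume "x \<in> {x \<in> topspace (lc_topology A p). ph x \<in> U}"
   with U obtain e where e: "0 < e" "ball (ph x) e \<subseteq> U" by (auto simp: open_contains_ball)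
   have "ph y \<in> U" if "p j (y - x) < e" for y
   proof -
    have "dist (ph x) (ph y) < e" using bound[of "y - x"] that by (simp add: diff dist_norm norm_minus_commute)
    then show ?thesis using e by auto
   qed
   then show "\<exists>S e. finite S \<and> S \<subseteq> A \<and> 0 < e \<and>
     {y. \<forall>j\<in>S. p j (y - x) < e} \<subseteq> {x \<in> topspace (lc_topology A p). ph x \<in> U}"
    using \<open>j \<in> A\<close> e by (intro exI[of _ "{j}"] exI[of _ e]) (auto simp: lc_topology_def)
  qed
 qed simp
 ultimately show ?thesis by (simp add: lc_dual_def)
qed

lemma lc_dual_add: "ph \<in> lc_dual sc A p ==> ph (x + y) = ph x + ph y"
 and lc_dual_scale: "ph \<in> lc_dual sc A p ==> ph (sc c x) = c*ph x" by (auto simp: lc_dual_def Vector_Spaces.linear_iff)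

lemma lc_dual_zero: "ph \<in> lc_dual sc A p ==> ph 0 = 0" using lc_dual_add[of ph 0 0] by simp

lemma lc_dual_diff: "ph \<in> lc_dual sc A p ==> ph (x - y) = ph x - ph y" using lc_dual_add[of ph "x - y" y] by simp

lemma lc_dual_sum: "ph \<in> lc_dual sc A p ==> ph (sum f S) = (\<Sum>i\<in>S. ph (f i))"
 by (induction S rule: infinite_finite_induct) (auto simp: lc_dual_add lc_dual_zero)

text \<open>The preimage of the unit disc contains a basic neighbourhood of 0, given by S and e;
  homogeneity turns this into an estimate with C = 1/e.\<close>

lemma lc_dual_bound:
 assumes ph: "ph \<in> lc_dual sc A p"
 obtains S C where "finite S" "S \<subseteq> A" "0 < C" "\<And>x. cmod (ph x) <= C*(\<Sum>j\<in>S. p j x)"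
proof -
 have "openin (lc_topology A p) {x \<in> topspace (lc_topology A p). ph x \<in> ball 0 1}"
  using ph by (intro openin_continuous_map_preimage[of _ euclidean]) (auto simp: lc_dual_def)
 moreover have "0 \<in> {x \<in> topspace (lc_topology A p). ph x \<in> ball 0 1}" using lc_dual_zero[OF ph] by (simp add: lc_topology_def)
 ultimately obtain S e where *: "finite S" "S \<subseteq> A" "0 < e"
  and **: "\<And>y. (\<And>j. j \<in> S ==> p j (y - 0) < e) ==> y \<in> {x \<in> topspace (lc_topology A p). ph x \<in> ball 0 1}" using openin_lc_topologyE by blast
 have 1: "cmod (ph y) < 1" if "\<forall>j\<in>S. p j y < e" for y using **[of y] that by simp
 have "cmod (ph x) <= (1/e)*(\<Sum>j\<in>S. p j x)" for x
 proof (rule field_le_epsilon)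
  fix d :: real assume d: "0 < d"
  \<comment> \<open>The term \<open>d*e\<close> keeps s positive when all \<open>p j x\<close> with
    j in S vanish; it disappears as d tends to 0.\<close>
  define s where "s = (\<Sum>j\<in>S. p j x) + d*e"
  have nn: "0 <= (\<Sum>j\<in>S. p j x)" using * p_nonneg by (auto intro!: sum_nonneg)
  then have s: "s > 0" using d * by (simp add: s_def add_nonneg_pos)
  have "p j (sc (of_real (e / s)) x) < e" if "j \<in> S" for j
  proof -
   have "p j x <= (\<Sum>j\<in>S. p j x)" using that * p_nonneg by (intro member_le_sum) auto
   also have "\<dots> < s" using d * by (simp add: s_def)
   finally show ?thesis using that * s by (auto simp: p_scale subset_iff norm_divide field_simps)
  qed
  then have "cmod (ph (sc (of_real (e / s)) x)) < 1" using 1 by blast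
  then have "e / s*cmod (ph x) < 1" using s * by (simp only: lc_dual_scale[OF ph] norm_mult norm_of_real) simp
  then show "cmod (ph x) <= (1/e)*(\<Sum>j\<in>S. p j x) + d" using s * d by (simp add: s_def field_simps)
 qed
 then show ?thesis using * that[of S "1/e"] by auto
qed

end

subsection \<open>The Hahn-Banach theorem\<close>

context seminormed_space
begin

definition sublinear :: "('e => real) => bool" where
 "sublinear q \<longleftrightarrow> (\<forall>x y. q (x + y) <= q x + q y) \<and> (\<forall>t\<ge>0. \<forall>x. q (sc (of_real t) x) = t*q x)"

lemma sublinear_zero: "sublinear q ==> q 0 = 0" unfolding sublinear_def using scale_zero_right by (metis mult_zero_left order_refl)

lemma sublinear_minus: "sublinear q ==> - q (- x) <= q x" using sublinear_zero[of q] unfolding sublinear_def by (smt (verit, best) add.right_inverse)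

text \<open>Zorn's lemma for the reversed order. The pointwise infimum of a chain is finite because
  every sublinear q below q0 satisfies q x >= - q0 (- x), and it is subadditive because the smaller
  of two members of the chain estimates both summands.\<close>

lemma sublinear_minimal:
 assumes q0: "sublinear q0"
 shows "\<exists>q. sublinear q \<and> q <= q0 \<and> (\<forall>r. sublinear r \<and> r <= q \<longrightarrow> r = q)"
proof -
 let ?A = "{q. sublinear q \<and> q <= q0}"
 have "\<exists>m\<in>?A. \<forall>a\<in>?A. a <= m \<longrightarrow> a = m"
 proof (rule predicate_Zorn[of ?A "\<lambda>a b. b <= a"])
  show "partial_order_on ?A (relation_of (\<lambda>a b. b <= a) ?A)" by (rule partial_order_on_relation_ofI) auto
  fix C assume "C \<in> Chains (relation_of (\<lambda>a b. b <= a) ?A)"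
  then have C: "\<And>q. q \<in> C ==> sublinear q \<and> q <= q0"
   and tot: "\<And>q r. q \<in> C ==> r \<in> C ==> q <= r \<or> r <= q" by (auto simp: Chains_def relation_of_def)
  show "\<exists>u\<in>?A. \<forall>a\<in>C. u <= a"
  proof (cases "C = {}")
   case True
   then show ?thesis using q0 by auto
  next
   case False
   define u where "u x = (INF q\<in>C. q x)" for x
   have bdd: "bdd_below ((\<lambda>q. q x) ` C)" for x
   proof (rule bdd_belowI2)
    fix q assume "q \<in> C"
    then show "- q0 (- x) <= q x" using C[of q] sublinear_minus[of q x] by (smt (verit, best) le_funD)
   qed
   have le: "u x <= q x" if "q \<in> C" for q x unfolding u_def using that bdd by (rule cINF_lower[rotated])
   have "u (x + y) <= u x + u y" for x y
   proof -
    have "u (x + y) <= q x + r y" if "q \<in> C" "r \<in> C" for q r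
    proof (cases "q <= r")
     case True
     then have "q y <= r y" by (rule le_funD)
     with le[OF that(1), of "x + y"] C[OF that(1)] show ?thesis unfolding sublinear_def by (smt (verit, best))
    next
     case False
     then have "r x <= q x" using tot[OF that] by (auto dest: le_funD)
     with le[OF that(2), of "x + y"] C[OF that(2)] show ?thesis unfolding sublinear_def by (smt (verit, best))
    qed
    then have *: "u (x + y) - q x <= r y" if "q \<in> C" "r \<in> C" for q r using that by (simp add: diff_le_eq add.commute)
    have "u (x + y) - q x <= u y" if "q \<in> C" for q unfolding u_def[of y] using False *[OF that] by (rule cINF_greatest)
    then have *: "u (x + y) - u y <= q x" if "q \<in> C" for q using that by (simp add: diff_le_eq add.commute)
    have "u (x + y) - u y <= u x" unfolding u_def[of x] using False * by (rule cINF_greatest)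
    then show ?thesis by simp
   qed
   moreover have "u (sc (of_real t) x) = t*u x" if "t >= 0" for t x
   proof (cases "t = 0")
    case True
    have "u 0 = (INF q\<in>C. 0)" unfolding u_def using C sublinear_zero by (intro INF_cong) auto
    then show ?thesis using True False by simp
   next
    case False
    with that have t: "t > 0" by simp
    \<comment> \<open>This inequality for t and for 1/t together gives positive homogeneity.\<close>
    have ge: "s*u y <= u (sc (of_real s) y)" if "s > 0" for s y
    proof -
     have "s*u y <= q (sc (of_real s) y)" if "q \<in> C" for q using C[OF that] le[OF that, of y] \<open>s > 0\<close> by (simp add: sublinear_def)
     then show ?thesis unfolding u_def[of "sc _ _"] using \<open>C ~= {}\<close> by (intro cINF_greatest)
    qed
    have "inverse t*u (sc (of_real t) x) <= u x" using ge[of "inverse t" "sc (of_real t) x"] t by (simp flip: of_real_mult)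
    with ge[OF t, of x] t show ?thesis by (simp add: field_simps)
   qed
   ultimately have "sublinear u" by (auto simp: sublinear_def)
   moreover have "u <= q0"
   proof (rule le_funI)
    fix x
    obtain q where "q \<in> C" using False by blast
    then show "u x <= q0 x" using le[of q x] C[of q] by (meson le_funD order_trans)
   qed
   ultimately show ?thesis using le by (auto simp: le_fun_def)
  qed
 qed
 then show ?thesis by (metis (mono_tags, lifting) mem_Collect_eq order_trans)
qed

text \<open>For a sublinear \<open>q\<close>, this is the largest sublinear functional below \<open>q\<close> whose value at \<open>-y\<close>
 is at most \<open>-q y\<close>; so a minimal sublinear functional is additive.\<close>

definition sublinear_shift :: "('e => real) => 'e => 'e => real" where
 "sublinear_shift q y x = (INF t\<in>{0..}. q (x + sc (of_real t) y) - t*q y)"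

text \<open>The terms of the infimum with parameters s for x and t for z add up to at least the term
  with parameter s + t for x + z, which gives subadditivity. The number - q (- x) is a lower bound,
  so the infimum is finite.\<close>

lemma sublinear_shift:
 assumes q: "sublinear q"
 shows "sublinear (sublinear_shift q y)"
  and "t >= 0 ==> sublinear_shift q y x <= q (x + sc (of_real t) y) - t*q y"
proof -
 let ?u = "sublinear_shift q y"
 have add: "q (x + z) <= q x + q z" for x z using q by (simp add: sublinear_def)
 have scale: "q (sc (of_real t) x) = t*q x" if "t >= 0" for t x using q that by (simp add: sublinear_def)
 have bdd: "bdd_below ((\<lambda>t. q (x + sc (of_real t) y) - t*q y) ` {0..})" for x
 proof (rule bdd_belowI2)
  fix t :: real assume "t \<in> {0..}"
  then show "- q (- x) <= q (x + sc (of_real t) y) - t*q y" using add[of "x + sc (of_real t) y" "- x"] scale[of t y] by simp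
 qed
 have le: "?u x <= q (x + sc (of_real t) y) - t*q y" if "t >= 0" for x t
  unfolding sublinear_shift_def by (rule cINF_lower[OF bdd]) (use that in auto)
 then show "t >= 0 ==> ?u x <= q (x + sc (of_real t) y) - t*q y" .
 have 1: "?u (x + z) <= ?u x + ?u z" for x z
 proof -
  have *: "?u (x + z) <= (q (x + sc (of_real s) y) - s*q y) + (q (z + sc (of_real t) y) - t*q y)"
   if "s >= 0" "t >= 0" for s t using le[of "s + t" "x + z"] add[of "x + sc (of_real s) y" "z + sc (of_real t) y"] that
   by (simp add: algebra_simps scale_left_distrib)
  have *: "?u (x + z) - (q (x + sc (of_real s) y) - s*q y) <= ?u z" if "s >= 0" for s unfolding sublinear_shift_def[of _ _ z]
  proof (rule cINF_greatest)
   fix t :: real assume "t \<in> {0..}"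
   then show "?u (x + z) - (q (x + sc (of_real s) y) - s*q y) <= q (z + sc (of_real t) y) - t*q y" using *[OF that, of t] by simp
  qed auto
  have "?u (x + z) - ?u z <= ?u x" unfolding sublinear_shift_def[of _ _ x]
  proof (rule cINF_greatest)
   fix s :: real assume "s \<in> {0..}"
   then show "?u (x + z) - ?u z <= q (x + sc (of_real s) y) - s*q y" using *[of s] by simp
  qed auto
  then show ?thesis by simp
 qed
 have ge: "s*?u x <= ?u (sc (of_real s) x)" if "s > 0" for s x unfolding sublinear_shift_def[of _ _ "sc _ _"]
 proof (rule cINF_greatest)
  fix t :: real assume t: "t \<in> {0..}"
  have "sc (of_real s) x + sc (of_real t) y = sc (of_real s) (x + sc (of_real (t / s)) y)" using that by (simp add: scale_right_distrib)
  then have "q (sc (of_real s) x + sc (of_real t) y) = s*q (x + sc (of_real (t / s)) y)" using scale[of s] that by simp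
  moreover have "s*?u x <= s*(q (x + sc (of_real (t / s)) y) - t / s*q y)" using le[of "t / s" x] that t by (intro mult_left_mono) auto
  ultimately show "s*?u x <= q (sc (of_real s) x + sc (of_real t) y) - t*q y" using that by (simp add: right_diff_distrib)
 qed auto
 have "?u (sc (of_real t) x) = t*?u x" if "t >= 0" for t x
 proof (cases "t = 0")
  case True
  have "?u 0 = (INF t\<in>{0::real..}. 0)" unfolding sublinear_shift_def using scale by (intro INF_cong) auto
  then show ?thesis using True by simp
 next
  case False
  with that have t: "t > 0" by simp
  have "inverse t*?u (sc (of_real t) x) <= ?u x" using ge[of "inverse t" "sc (of_real t) x"] t by (simp flip: of_real_mult)
  with ge[OF t, of x] t show ?thesis by (simp add: field_simps)
 qed
 with 1 show "sublinear ?u" by (auto simp: sublinear_def)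
qed

text \<open>A minimal sublinear functional f below the shift of \<open>p j\<close> at x0 is
  real-linear, and the shift forces f (- x0) <= - p j x0, hence equality at x0. The complex
  functional is f(x) - i f(i x); multiplying x by a unimodular number that makes its value positive
  carries the bound over from f.\<close>

lemma Hahn_Banach:
 assumes j: "j \<in> A"
 shows "\<exists>ph\<in>lc_dual sc A p. (\<forall>x. cmod (ph x) <= p j x) \<and> ph x0 = of_real (p j x0)"
proof -
 have p: "sublinear (p j)" using p_add[OF j] p_scale[OF j] by (simp add: sublinear_def)
 obtain f where f: "sublinear f" "f <= sublinear_shift (p j) x0"
  and min: "\<And>r. sublinear r ==> r <= f ==> r = f" using sublinear_minimal[OF sublinear_shift(1)[OF p]] by blast
 have add: "f (x + y) = f x + f y" for x y
 proof -
  \<comment> \<open>By minimality f coincides with its own shift in direction y; reading this at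
    parameter 1 gives the missing half of additivity.\<close>
  have "sublinear_shift f y = f" using sublinear_shift(2)[OF f(1), of 0 y] by (intro min sublinear_shift(1)[OF f(1)] le_funI) auto
  then have "f x <= f (x + y) - f y" using sublinear_shift(2)[OF f(1), of 1 y x] by simp
  then show ?thesis using f(1) by (auto simp: sublinear_def intro: antisym)
 qed
 have f0: "f 0 = 0" by (rule sublinear_zero[OF f(1)])
 have neg: "f (- x) = - f x" for x using add[of x "- x"] f0 by simp
 have scale: "f (sc (of_real t) x) = t*f x" for t x
 proof (cases "t >= 0")
  case True
  then show ?thesis using f(1) by (simp add: sublinear_def)
 next
  case False
  have "f (sc (of_real (- t)) x) = - t*f x" using f(1) False by (simp add: sublinear_def del: of_real_minus)
  then show ?thesis by (simp add: neg scale_minus_left)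
 qed
 have fp: "f x <= p j x" for x using le_funD[OF f(2), of x] sublinear_shift(2)[OF p, of 0 x0 x] by simp
 have "f (- x0) <= - p j x0" using le_funD[OF f(2), of "- x0"] sublinear_shift(2)[OF p, of 1 x0 "- x0"] j by simp
 then have fx0: "f x0 = p j x0" using neg[of x0] fp[of x0] by simp
 define ph where "ph x = Complex (f x) (- f (sc \<i> x))" for x
 have addph: "ph (x + y) = ph x + ph y" for x y by (simp add: ph_def add scale_right_distrib complex_eq_iff)
 have scaleph: "ph (sc c x) = c*ph x" for c x
 proof -
  have "sc c x = sc (of_real (Re c)) x + sc (of_real (Im c)) (sc \<i> x)" by (simp add: scale_left_distrib[symmetric] complex_eq_iff)
  moreover have "\<i>*c = of_real (Re c)*\<i> + of_real (- Im c)" by (simp add: complex_eq_iff)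
  then have "sc \<i> (sc c x) = sc (of_real (Re c)) (sc \<i> x) + sc (of_real (- Im c)) x" by (simp only: scale_scale scale_left_distrib[symmetric])
  ultimately show ?thesis unfolding ph_def by (simp only: add scale) (simp add: complex_eq_iff)
 qed
 have bound: "cmod (ph x) <= p j x" for x
 proof (cases "ph x = 0")
  case False
  define u where "u = cnj (sgn (ph x))"
  have "u*ph x = of_real (cmod (ph x))" using False unfolding u_def sgn_eq
   by (simp add: complex_norm_square[symmetric] power2_eq_square mult.commute[of _ "ph x"])
  then have "of_real (cmod (ph x)) = ph (sc u x)" by (simp add: scaleph)
  then have "cmod (ph x) = f (sc u x)" by (simp add: ph_def complex_eq_iff)
  also have "\<dots> <= p j (sc u x)" by (rule fp)
  also have "\<dots> = p j x" using False by (simp add: p_scale[OF j] u_def norm_sgn)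
  finally show ?thesis .
 qed (use p_nonneg j in auto)
 have "ph \<in> lc_dual sc A p" using j addph scaleph bound by (rule lc_dualI)
 moreover have "ph x0 = of_real (p j x0)"
 proof -
  have "Re (ph x0) = p j x0" by (simp add: ph_def fx0)
  moreover have "cmod (ph x0) <= p j x0" by (rule bound)
  ultimately have "Im (ph x0) = 0" using cmod_power2[of "ph x0"] p_nonneg[OF j, of x0]
   by (smt (verit) norm_ge_zero power_mono power2_less_eq_zero_iff)
  then show ?thesis using \<open>Re (ph x0) = p j x0\<close> by (simp add: complex_eq_iff)
 qed
 ultimately show ?thesis using bound by blast
qed

text \<open>The way back from scalar estimates: it suffices to test functionals dominated by the
  single seminorm \<open>p j\<close>, so a bound with a constant common to these functionals is a
  bound of the seminorm.\<close>

lemma seminorm_le_dual: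
 assumes "j \<in> A" "\<And>ph. ph \<in> lc_dual sc A p ==> (\<And>y. cmod (ph y) <= p j y) ==> cmod (ph x) <= B"
 shows "p j x <= B"
proof -
 obtain ph where "ph \<in> lc_dual sc A p" "\<And>y. cmod (ph y) <= p j y" "ph x = of_real (p j x)" using Hahn_Banach[OF assms(1)] by metis
 then show ?thesis using assms(2)[of ph] p_nonneg[OF assms(1), of x] by simp
qed

end

section \<open>Sequentially complete Hausdorff spaces\<close>

locale seq_complete_lc_space = seminormed_space +
 assumes Hausdorff: "Hausdorff_space (lc_topology A p)"
  and complete: "seq_complete A p"
begin

lemma eq_if_seminorms_zero:
 assumes "\<And>j. j \<in> A ==> p j (x - y) = 0"
 shows "x = y"
proof (rule ccontr)
 assume "x ~= y"
 then obtain U V where "openin (lc_topology A p) U" "x \<in> V" "y \<in> U" "disjnt U V" using Hausdorff unfolding Hausdorff_space_def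
  by (metis UNIV_I lc_topology_def topspace_seminorm_topology)
 from openin_lc_topologyE[OF this(1,3)] obtain S e where S: "finite S" "S \<subseteq> A" "0 < e"
  "\<And>z. (\<And>j. j \<in> S ==> p j (z - y) < e) ==> z \<in> U" by blast
 have "x \<in> U" using S(2,3) assms by (intro S(4)) auto
 then show False using \<open>x \<in> V\<close> \<open>disjnt U V\<close> by (auto simp: disjnt_iff)
qed

lemma eq_if_dual_eq:
 assumes "\<And>ph. ph \<in> lc_dual sc A p ==> ph x = ph y"
 shows "x = y"
proof (rule eq_if_seminorms_zero)
 fix j assume j: "j \<in> A"
 have "p j (x - y) <= 0" by (rule seminorm_le_dual[OF j]) (simp add: lc_dual_diff assms)
 then show "p j (x - y) = 0" using p_nonneg[OF j, of "x - y"] by simp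
qed

lemma Cauchy_limit:
 assumes "\<And>j e. j \<in> A ==> 0 < e ==> \<exists>N. \<forall>m\<ge>N. \<forall>n\<ge>N. p j (X m - X n) < e"
 obtains l where "\<And>j. j \<in> A ==> (\<lambda>n. p j (X n - l)) \<longlonglongrightarrow> 0"
proof -
 have "\<exists>l. limitin (lc_topology A p) X l sequentially" using complete assms by (simp add: seq_complete_def)
 then show ?thesis using that by (auto simp: limitin_lc_topology)
qed

lemma lc_dual_tendsto:
 assumes ph: "ph \<in> lc_dual sc A p" and "\<And>j. j \<in> A ==> ((\<lambda>x. p j (f x - l)) \<longlongrightarrow> 0) F"
 shows "((\<lambda>x. ph (f x)) \<longlongrightarrow> ph l) F"
proof -
 obtain S C where S: "S \<subseteq> A" and C: "\<And>x. cmod (ph x) <= C*(\<Sum>j\<in>S. p j x)" using lc_dual_bound[OF ph] by metis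
 have "((\<lambda>x. C*(\<Sum>j\<in>S. p j (f x - l))) \<longlongrightarrow> C*(\<Sum>j\<in>S. 0)) F" using S assms(2) by (intro tendsto_intros) auto
 then have "((\<lambda>x. ph (f x) - ph l) \<longlongrightarrow> 0) F" by (intro Lim_null_comparison[of "\<lambda>x. ph (f x) - ph l"])
    (use C in \<open>auto simp flip: lc_dual_diff[OF ph]\<close>)
 then show ?thesis by (simp add: LIM_zero_iff)
qed

end

section \<open>Integrals over the real line\<close>

lemma exp_decay_tendsto:
 assumes "(dl::real) > 0"
 shows "((\<lambda>t. exp (- dl*t)) \<longlongrightarrow> 0) at_top"
 using assms by (auto intro!: filterlim_compose[OF exp_at_bot] filterlim_tendsto_pos_mult_at_top[OF tendsto_const]
   filterlim_ident simp: filterlim_uminus_at_top[symmetric])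

lemma has_bochner_integral_exp_abs:
 assumes "dl > 0"
 shows "has_bochner_integral lborel (\<lambda>t::real. exp (- dl*abs t)) (2/dl)"
proof -
 have "(\<integral>\<^sup>+t. ennreal (exp (- dl*t))*indicator {0..} t \<partial>lborel) = 0 - (- exp (- dl*0)/dl)"
 proof (rule nn_integral_FTC_atLeast)
  show "((\<lambda>t. - exp (- dl*t)/dl) has_field_derivative exp (- dl*t)) (at t)" for t using assms by (auto intro!: derivative_eq_intros)
  from tendsto_divide[OF tendsto_minus[OF exp_decay_tendsto[OF assms]] tendsto_const[of dl at_top]]
  show "((\<lambda>t. - exp (- dl*t)/dl) \<longlongrightarrow> 0) at_top" using assms by simp
 qed auto
 also have "(\<integral>\<^sup>+t. ennreal (exp (- dl*t))*indicator {0..} t \<partial>lborel) =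
   (\<integral>\<^sup>+t. ennreal (indicator {0..} t *\<^sub>R exp (- dl*abs t)) \<partial>lborel)" by (intro nn_integral_cong) (auto split: split_indicator)
 finally have "has_bochner_integral lborel (\<lambda>t. indicator {0..} t *\<^sub>R exp (- dl*abs t)) (1/dl)"
  using assms by (intro has_bochner_integral_nn_integral) auto
 then have "has_bochner_integral lborel (\<lambda>t::real. exp (- dl*abs t)) (2 *\<^sub>R (1/dl))" by (rule has_bochner_integral_even_function) simp
 then show ?thesis by simp
qed

text \<open>Most integrals below are controlled by domination by a two-sided exponential, whose mass
  is 2/dl. The centre x is free because some kernels are centred at a moving real part; the finite
  set S absorbs corners of paths and jumps of weights.\<close>

lemma exp_decay_integrable:
 fixes h :: "real => complex"
 assumes S: "finite S" and cont: "\<And>t. t \<notin> S ==> isCont h t"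
  and bound: "\<And>t. t \<notin> S ==> cmod (h t) <= B*exp (- dl*\<bar>t - x\<bar>)" and dl: "dl > 0"
 shows "integrable lborel h" "cmod (integral\<^sup>L lborel h) <= 2*B/dl"
proof -
 have "has_bochner_integral lborel (\<lambda>t::real. exp (- dl*abs t)) (2/dl)" by (rule has_bochner_integral_exp_abs[OF dl])
 then have "has_bochner_integral lborel (\<lambda>t::real. exp (- dl*\<bar>- x + 1*t\<bar>)) ((2/dl) /\<^sub>R \<bar>1\<bar>)"
  by (subst (asm) lborel_has_bochner_integral_real_affine_iff[where c = 1 and t = "- x"]) auto
 then have e: "has_bochner_integral lborel (\<lambda>t::real. B*exp (- dl*\<bar>t - x\<bar>)) (B*(2/dl))"
  by (intro has_bochner_integral_mult_right) (simp add: algebra_simps)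
 have meas: "h \<in> borel_measurable borel" by (rule borel_measurable_continuous_countable_exceptions[of S])
    (use S cont in \<open>auto intro!: continuous_at_imp_continuous_on countable_finite\<close>)
 have AE: "AE t in lborel. cmod (h t) <= B*exp (- dl*\<bar>t - x\<bar>)"
  using AE_not_in[OF finite_imp_null_set_lborel[OF S]] by eventually_elim (rule bound)
 show int: "integrable lborel h" by (rule Bochner_Integration.integrable_bound[OF integrable.intros[OF e]])
    (use meas AE in \<open>auto elim!: eventually_mono\<close>)
 have "cmod (integral\<^sup>L lborel h) <= (\<integral>t. cmod (h t) \<partial>lborel)" by (rule integral_norm_bound)
 also have "\<dots> <= (\<integral>t. B*exp (- dl*\<bar>t - x\<bar>) \<partial>lborel)" using int AE integrable.intros[OF e] by (intro integral_mono_AE) auto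
 also have "\<dots> = 2*B/dl" using has_bochner_integral_integral_eq[OF e] by (simp add: mult.commute)
 finally show "cmod (integral\<^sup>L lborel h) <= 2*B/dl" .
qed

section \<open>Holomorphic functions: difference quotients and parameter integrals\<close>

text \<open>Cauchy's inequality on the disc of radius r/4 about w, which stays within distance 3r/4
  of z.\<close>

lemma Cauchy_deriv_bound:
 assumes g: "g holomorphic_on ball z r" and r: "r > 0" and M: "\<And>w. w \<in> ball z r ==> cmod (g w) <= M"
  and w: "w \<in> ball z (r/2)"
 shows "cmod ((deriv ^^ n) g w) <= fact n*M/(r/4) ^ n"
proof (rule Cauchy_inequality)
 have sub: "cball w (r/4) \<subseteq> ball z r"
 proof
  fix u assume "u \<in> cball w (r/4)"
  then show "u \<in> ball z r" using w dist_triangle[of z u w] r by auto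
 qed
 then show "g holomorphic_on ball w (r/4)" using g holomorphic_on_subset ball_subset_cball by blast
 show "continuous_on (cball w (r/4)) g" using g sub holomorphic_on_imp_continuous_on continuous_on_subset by blast
 show "0 < r/4" using r by simp
 show "cmod (g u) <= M" if "cmod (w - u) = r/4" for u using that sub by (intro M) (auto simp: dist_norm)
qed

lemma holomorphic_Lipschitz:
 assumes g: "g holomorphic_on ball z r" and r: "r > 0" and M: "\<And>w. w \<in> ball z r ==> cmod (g w) <= M"
  and w: "w \<in> ball z (r/2)"
 shows "cmod (g w - g z) <= 4*M/r*cmod (w - z)"
proof (rule field_differentiable_bound[of "ball z (r/2)"])
 fix u assume u: "u \<in> ball z (r/2)"
 have "(g has_field_derivative deriv g u) (at u)" using g u r by (intro holomorphic_derivI[of _ "ball z r"]) auto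
 then show "(g has_field_derivative deriv g u) (at u within ball z (r/2))" by (rule has_field_derivative_at_within)
 show "cmod (deriv g u) <= 4*M/r" using Cauchy_deriv_bound[OF g r M u, of 1] by (simp add: mult.commute)
qed (use w r in auto)

text \<open>Both quotients are compared with the derivative at z by the first-order Taylor formula;
  the second derivative is at most 2*M/(r/4)^2 = 32*M/r^2. The bound contains g only through M, so
  it holds simultaneously for all functionals dominated by one seminorm.\<close>

lemma holomorphic_diff_quotient:
 assumes g: "g holomorphic_on ball z r" and r: "r > 0" and M: "\<And>w. w \<in> ball z r ==> cmod (g w) <= M"
  and w: "w \<in> ball z (r/2)" "w ~= z" and w': "w' \<in> ball z (r/2)" "w' ~= z"
 shows "cmod ((g w - g z)/(w - z) - (g w' - g z)/(w' - z)) <=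
  32*M/r\<^sup>2*(cmod (w - z) + cmod (w' - z))"
proof -
 have *: "cmod ((g u - g z)/(u - z) - deriv g z) <= 32*M/r\<^sup>2*cmod (u - z)"
  if u: "u \<in> ball z (r/2)" "u ~= z" for u
 proof -
  have "cmod ((deriv ^^ 0) g u - (\<Sum>i\<le>1. (deriv ^^ i) g z*(u - z) ^ i/fact i))
    <= 32*M/r\<^sup>2*cmod (u - z) ^ Suc 1/fact 1"
  proof (rule field_Taylor[of "ball z (r/2)"])
   fix i x assume x: "x \<in> ball z (r/2)"
   have "(deriv ^^ i) g holomorphic_on ball z r" using g by (intro holomorphic_higher_deriv) auto
   then have "((deriv ^^ i) g has_field_derivative deriv ((deriv ^^ i) g) x) (at x)" using x r by (intro holomorphic_derivI[of _ "ball z r"]) auto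
   then show "((deriv ^^ i) g has_field_derivative (deriv ^^ Suc i) g x) (at x within ball z (r/2))" by (simp add: has_field_derivative_at_within)
  next
   fix x assume x: "x \<in> ball z (r/2)"
   show "cmod ((deriv ^^ Suc 1) g x) <= 32*M/r\<^sup>2" using Cauchy_deriv_bound[OF g r M x, of 2]
    by (simp add: field_simps power2_eq_square numeral_2_eq_2)
  qed (use u r in auto)
  then have "cmod (g u - g z - deriv g z*(u - z)) <= 32*M/r\<^sup>2*cmod (u - z)*cmod (u - z)" by (simp add: algebra_simps)
  moreover have "(g u - g z)/(u - z) - deriv g z = (g u - g z - deriv g z*(u - z))/(u - z)" using u by (simp add: field_simps)
  ultimately show ?thesis using u by (simp add: norm_divide divide_le_eq)
 qed
 have "cmod ((g w - g z)/(w - z) - (g w' - g z)/(w' - z)) <=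
   cmod ((g w - g z)/(w - z) - deriv g z) + cmod ((g w' - g z)/(w' - z) - deriv g z)" by (rule order_trans[OF _ norm_triangle_ineq4]) simp
 also have "\<dots> <= 32*M/r\<^sup>2*(cmod (w - z) + cmod (w' - z))" using *[OF w] *[OF w'] by (simp add: distrib_left)
 finally show ?thesis .
qed

text \<open>Dominated convergence of difference quotients. A holomorphic function bounded on a disc
  is Lipschitz on the half-size disc, so the local bound on h itself yields the dominating function
  4*B/r*exp (- dl*abs t).\<close>

lemma holomorphic_param_integral:
 fixes h :: "complex => real => complex"
 assumes \<Omega>: "open \<Omega>" and S: "finite S"
  and hol: "\<And>t. t \<notin> S ==> (\<lambda>z. h z t) holomorphic_on \<Omega>"
  and cont: "\<And>z t. z \<in> \<Omega> ==> t \<notin> S ==> isCont (h z) t"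
  and bound: "\<And>z. z \<in> \<Omega> ==> \<exists>r>0. \<exists>B. \<exists>dl>0. \<forall>w\<in>ball z r \<inter> \<Omega>. \<forall>t. t \<notin> S \<longrightarrow> cmod (h w t) <= B*exp (- dl*abs t)"
 shows "(\<lambda>z. integral\<^sup>L lborel (h z)) holomorphic_on \<Omega>" unfolding holomorphic_on_open[OF \<Omega>]
proof
 fix z assume z: "z \<in> \<Omega>"
 obtain r1 B dl where r1: "r1 > 0" and dl: "dl > 0"
  and B: "\<And>w t. w \<in> ball z r1 \<inter> \<Omega> ==> t \<notin> S ==> cmod (h w t) <= B*exp (- dl*abs t)" using bound[OF z] by blast
 obtain r2 where r2: "r2 > 0" "ball z r2 \<subseteq> \<Omega>" using \<Omega> z by (auto simp: open_contains_ball)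
 define r where "r = min r1 r2"
 have r: "r > 0" "ball z r \<subseteq> \<Omega>" "ball z r \<subseteq> ball z r1" using r1 r2 by (auto simp: r_def)
 let ?q = "\<lambda>w t. (h w t - h z t)/(w - z)"
 \<comment> \<open>With the value 0 on S, h' is the limit at every t of the measurable functions
   obtained by cutting off the quotients on S, and is therefore measurable.\<close>
 define h' where "h' t = (if t \<in> S then 0 else deriv (\<lambda>z. h z t) z)" for t
 have int: "integrable lborel (h w)" if "w \<in> ball z r" for w
 proof (rule exp_decay_integrable(1)[OF S _ _ dl])
  have w: "w \<in> ball z r1 \<inter> \<Omega>" using that r by blast
  then show "isCont (h w) t" if "t \<notin> S" for t using that by (intro cont) auto
  show "cmod (h w t) <= B*exp (- dl*\<bar>t - 0\<bar>)" if "t \<notin> S" for t using B[OF w that] by simp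
 qed
 have AES: "AE t in lborel. t \<notin> S" by (rule AE_not_in[OF finite_imp_null_set_lborel[OF S]])
 have lim: "((\<lambda>w. ?q w t) \<longlongrightarrow> h' t) (at z)" if "t \<notin> S" for t
 proof -
  have "((\<lambda>z. h z t) has_field_derivative deriv (\<lambda>z. h z t) z) (at z)" using hol[OF that] \<Omega> z by (rule holomorphic_derivI)
  then show ?thesis using that by (simp add: has_field_derivative_iff h'_def)
 qed
 have "((\<lambda>w. (integral\<^sup>L lborel (h w) - integral\<^sup>L lborel (h z))/(w - z)) \<longlongrightarrow> integral\<^sup>L lborel h') (at z)" unfolding tendsto_at_iff_sequentially
 proof (intro allI impI)
  fix X assume X: "\<forall>i. X i \<in> UNIV - {z}" "X \<longlonglongrightarrow> z"
  obtain N where N: "\<And>n. n >= N ==> X n \<in> ball z (r/2)"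
   using topological_tendstoD[OF X(2), of "ball z (r/2)"] r by (auto simp: eventually_sequentially)
  have Y: "X (i + N) \<in> ball z (r/2)" "X (i + N) \<in> ball z r" "X (i + N) ~= z" for i using N[of "i + N"] X r by auto
  have meas [measurable]: "h w \<in> borel_measurable borel" if "w \<in> ball z r" for w using borel_measurable_integrable[OF int[OF that]] by simp
  have [measurable]: "- S \<in> sets borel" using S by (intro borel_comp borel_closed finite_imp_closed)
  have m: "(\<lambda>t. indicator (-S) t *\<^sub>R ?q (X (i + N)) t) \<in> borel_measurable lborel" for i
  proof -
   have [measurable]: "h (X (i + N)) \<in> borel_measurable borel" "h z \<in> borel_measurable borel" using meas Y(2)[of i] r(1) by auto
   show ?thesis by simp
  qed
  have L: "(\<lambda>i. indicator (-S) t *\<^sub>R ?q (X (i + N)) t) \<longlonglongrightarrow> h' t" for t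
  proof (cases "t \<in> S")
   case False
   have "(\<lambda>i. ?q (X (i + N)) t) \<longlonglongrightarrow> h' t" using lim[OF False] X unfolding tendsto_at_iff_sequentially
    by (auto simp: o_def dest!: spec[of _ X] intro!: LIMSEQ_ignore_initial_segment)
   then show ?thesis using False by simp
  qed (simp add: h'_def)
  have "(\<lambda>i. integral\<^sup>L lborel (\<lambda>t. indicator (-S) t *\<^sub>R ?q (X (i + N)) t)) \<longlonglongrightarrow> integral\<^sup>L lborel h'"
  proof (rule integral_dominated_convergence[where w = "\<lambda>t. 4*B/r*exp (- dl*abs t)"])
   show "h' \<in> borel_measurable lborel" by (rule borel_measurable_LIMSEQ_metric[where f = "\<lambda>i t. indicator (-S) t *\<^sub>R ?q (X (i + N)) t"])
      (use L m in auto)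
   show "integrable lborel (\<lambda>t. 4*B/r*exp (- dl*abs t))" using has_bochner_integral_exp_abs[OF dl] by (auto simp: has_bochner_integral_iff)
   fix i
   show "AE t in lborel. cmod (indicator (-S) t *\<^sub>R ?q (X (i + N)) t) <= 4*B/r*exp (- dl*abs t)" using AES
   proof eventually_elim
    fix t assume t: "t \<notin> S"
    have "cmod (h (X (i + N)) t - h z t) <= 4*(B*exp (- dl*abs t))/r*cmod (X (i + N) - z)"
    proof (rule holomorphic_Lipschitz)
     show "(\<lambda>z. h z t) holomorphic_on ball z r" using hol[OF t] r(2) by (rule holomorphic_on_subset)
     show "cmod (h w t) <= B*exp (- dl*abs t)" if "w \<in> ball z r" for w using that r by (intro B[OF _ t]) blast
    qed (use r Y in auto)
    then show "cmod (indicator (-S) t *\<^sub>R ?q (X (i + N)) t) <= 4*B/r*exp (- dl*abs t)"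
     using Y(3)[of i] t by (simp add: norm_divide divide_le_eq algebra_simps)
   qed
  qed (use L m in auto)
  moreover have "integral\<^sup>L lborel (\<lambda>t. indicator (-S) t *\<^sub>R ?q (X (i + N)) t) =
    (integral\<^sup>L lborel (h (X (i + N))) - integral\<^sup>L lborel (h z))/(X (i + N) - z)" for i
  proof -
   have "integral\<^sup>L lborel (\<lambda>t. indicator (-S) t *\<^sub>R ?q (X (i + N)) t) = integral\<^sup>L lborel (?q (X (i + N)))"
    using AES int[OF Y(2)[of i]] int[of z] r by (intro integral_cong_AE) (auto elim!: eventually_mono)
   then show ?thesis using int[OF Y(2)[of i]] int[of z] r by simp
  qed
  ultimately show "((\<lambda>w. (integral\<^sup>L lborel (h w) - integral\<^sup>L lborel (h z))/(w - z)) \<circ> X) \<longlonglongrightarrow> integral\<^sup>L lborel h'"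
   by (simp add: o_def LIMSEQ_offset[of _ N])
 qed
 then show "\<exists>D. ((\<lambda>z. integral\<^sup>L lborel (h z)) has_field_derivative D) (at z)" by (auto simp: has_field_derivative_iff)
qed

section \<open>Pettis integrals and weakly holomorphic functions\<close>

context seq_complete_lc_space
begin

lemma p_tendsto_zero:
 assumes j: "j \<in> A" and le: "\<forall>\<^sub>F x in F. p j (g x) <= b x" and b: "(b \<longlongrightarrow> 0) F"
 shows "((\<lambda>x. p j (g x)) \<longlongrightarrow> 0) F"
proof (rule Lim_null_comparison[OF _ b])
 show "\<forall>\<^sub>F x in F. norm (p j (g x)) <= b x" using le by eventually_elim (simp add: p_nonneg[OF j])
qed

lemma dual_holomorphic:
 assumes f: "f \<in> holo_space sc A p \<Omega>" and \<Omega>: "open \<Omega>" and ph: "ph \<in> lc_dual sc A p"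
 shows "(\<lambda>z. ph (f z)) holomorphic_on \<Omega>" unfolding holomorphic_on_open[OF \<Omega>]
proof
 fix z assume "z \<in> \<Omega>"
 then obtain l where "limitin (lc_topology A p) (\<lambda>w. sc (1/(w - z)) (f w - f z)) l (at z)" using f by (auto simp: holo_space_def)
 then have "((\<lambda>w. ph (sc (1/(w - z)) (f w - f z))) \<longlongrightarrow> ph l) (at z)" by (intro lc_dual_tendsto[OF ph]) (auto simp: limitin_lc_topology)
 then show "\<exists>D. ((\<lambda>z. ph (f z)) has_field_derivative D) (at z)" by (auto simp: has_field_derivative_iff lc_dual_scale[OF ph] lc_dual_diff[OF ph])
qed

lemma holo_seminorm_continuous:
 assumes f: "f \<in> holo_space sc A p \<Omega>" and z: "z \<in> \<Omega>" and j: "j \<in> A"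
 shows "((\<lambda>w. p j (f w - f z)) \<longlongrightarrow> 0) (at z)"
proof -
 have "\<exists>l. limitin (lc_topology A p) (\<lambda>w. sc (1/(w - z)) (f w - f z)) l (at z)" using f z by (simp add: holo_space_def)
 then obtain l where l: "((\<lambda>w. p j (sc (1/(w - z)) (f w - f z) - l)) \<longlongrightarrow> 0) (at z)" using j unfolding limitin_lc_topology by blast
 have "((\<lambda>w. cmod (w - z)*(p j (sc (1/(w - z)) (f w - f z) - l) + p j l)) \<longlongrightarrow> 0*(0 + p j l)) (at z)"
  by (intro tendsto_intros l tendsto_norm_zero) (simp add: LIM_zero)
 moreover
 have "p j (f w - f z) <= cmod (w - z)*(p j (sc (1/(w - z)) (f w - f z) - l) + p j l)" if "w ~= z" for w
 proof -
  have "p j (f w - f z) = cmod (w - z)*p j (sc (1/(w - z)) (f w - f z))" using that j by (simp add: p_scale norm_divide)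
  also have "\<dots> <= cmod (w - z)*(p j (sc (1/(w - z)) (f w - f z) - l) + p j l)"
   using p_add[OF j, of "sc (1/(w - z)) (f w - f z) - l" l] by (intro mult_left_mono) auto
  finally show ?thesis .
 qed
 then have "\<forall>\<^sub>F w in at z. p j (f w - f z) <= cmod (w - z)*(p j (sc (1/(w - z)) (f w - f z) - l) + p j l)"
  unfolding eventually_at_filter by (intro always_eventually) blast
 ultimately show ?thesis by (intro p_tendsto_zero[OF j]) (assumption, simp)
qed

text \<open>For functionals dominated by \<open>p j\<close> the difference quotients satisfy one
  common estimate, hence so does \<open>p j\<close> itself. The quotients along one sequence tending
  to z are therefore Cauchy; sequential completeness gives a limit l, and the same estimate carries
  the convergence from the sequence to all w tending to z.\<close>

lemma weakly_holomorphic_imp_holo: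
 assumes \<Omega>: "open \<Omega>" and hol: "\<And>ph. ph \<in> lc_dual sc A p ==> (\<lambda>z. ph (f z)) holomorphic_on \<Omega>"
  and bound: "\<And>z j. z \<in> \<Omega> ==> j \<in> A ==> \<exists>r>0. \<exists>M. \<forall>w\<in>ball z r \<inter> \<Omega>. p j (f w) <= M"
  and zero: "\<And>z. z \<notin> \<Omega> ==> f z = 0"
 shows "f \<in> holo_space sc A p \<Omega>" unfolding holo_space_def
proof (intro CollectI conjI ballI allI impI zero)
 fix z assume z: "z \<in> \<Omega>"
 let ?Q = "\<lambda>w. sc (1/(w - z)) (f w - f z)"
 have Q: "\<exists>r>0. \<exists>C\<ge>0. \<forall>w\<in>ball z r - {z}. \<forall>w'\<in>ball z r - {z}. p j (?Q w - ?Q w') <= C*(cmod (w - z) + cmod (w' - z))"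
  if j: "j \<in> A" for j
 proof -
  obtain r1 M where r1: "r1 > 0" "\<And>w. w \<in> ball z r1 \<inter> \<Omega> ==> p j (f w) <= M" using bound[OF z j] by blast
  obtain r2 where r2: "r2 > 0" "ball z r2 \<subseteq> \<Omega>" using \<Omega> z by (auto simp: open_contains_ball)
  define r where "r = min r1 r2"
  have r: "r > 0" "ball z r \<subseteq> \<Omega>" "\<And>w. w \<in> ball z r ==> p j (f w) <= M" using r1 r2 by (auto simp: r_def)
  have M: "M >= 0" using r(3)[of z] p_nonneg[OF j, of "f z"] r(1) by simp
  have "p j (?Q w - ?Q w') <= 32*M/r\<^sup>2*(cmod (w - z) + cmod (w' - z))"
   if w: "w \<in> ball z (r/2) - {z}" "w' \<in> ball z (r/2) - {z}" for w w'
  proof (rule seminorm_le_dual[OF j])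
   fix ph assume ph: "ph \<in> lc_dual sc A p" and le: "\<And>y. cmod (ph y) <= p j y"
   have "cmod ((ph (f w) - ph (f z))/(w - z) - (ph (f w') - ph (f z))/(w' - z))
     <= 32*M/r\<^sup>2*(cmod (w - z) + cmod (w' - z))" using w r by (intro holomorphic_diff_quotient holomorphic_on_subset[OF hol[OF ph]])
     (auto intro: order_trans[OF le])
   then show "cmod (ph (?Q w - ?Q w')) <= 32*M/r\<^sup>2*(cmod (w - z) + cmod (w' - z))" by (simp add: lc_dual_scale[OF ph] lc_dual_diff[OF ph])
  qed
  then show ?thesis using r M by (intro exI[of _ "r/2"] exI[of _ "32*M/r\<^sup>2"] conjI) auto
 qed
 define w where "w n = z + of_real (inverse (real (Suc n)))" for n
 have wz: "w n ~= z" "cmod (w n - z) = inverse (real (Suc n))" for n by (simp_all add: w_def del: of_nat_Suc of_real_inverse)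
 have w0: "(\<lambda>n. cmod (w n - z)) \<longlonglongrightarrow> 0" unfolding wz(2) by (rule LIMSEQ_inverse_real_of_nat)
 have wball: "\<exists>N. \<forall>n\<ge>N. w n \<in> ball z r - {z} \<and> cmod (w n - z) < e" if "r > 0" "e > 0" for r e
 proof -
  have "\<forall>\<^sub>F n in sequentially. cmod (w n - z) < min r e" using that by (intro order_tendstoD(2)[OF w0]) simp
  then obtain N where N: "\<And>n. n >= N ==> cmod (w n - z) < min r e" unfolding eventually_sequentially by blast
  have "w n \<in> ball z r - {z} \<and> cmod (w n - z) < e" if "n >= N" for n using N[OF that] wz(1)[of n] by (auto simp: dist_norm norm_minus_commute)
  then show ?thesis by blast
 qed
 obtain l where l: "\<And>j. j \<in> A ==> (\<lambda>n. p j (?Q (w n) - l)) \<longlonglongrightarrow> 0"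
 proof (rule Cauchy_limit[of "\<lambda>n. ?Q (w n)"])
  fix j and e :: real assume j: "j \<in> A" and e: "0 < e"
  from Q[OF j] obtain r C where rC: "r > 0" "C >= 0" and
   C: "\<forall>u\<in>ball z r - {z}. \<forall>u'\<in>ball z r - {z}. p j (?Q u - ?Q u') <= C*(cmod (u - z) + cmod (u' - z))" by (elim exE conjE)
  obtain N where N: "\<And>n. n >= N ==> w n \<in> ball z r - {z} \<and> cmod (w n - z) < e/(2*C + 1)/2" using wball[of r "e/(2*C + 1)/2"] rC e by auto
  have "p j (?Q (w m) - ?Q (w n)) < e" if "m >= N" "n >= N" for m n
  proof -
   have "p j (?Q (w m) - ?Q (w n)) <= C*(cmod (w m - z) + cmod (w n - z))" using N[OF that(1)] N[OF that(2)] C by blast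
   also have "\<dots> <= C*(e/(2*C + 1))"
   proof (rule mult_left_mono)
    show "cmod (w m - z) + cmod (w n - z) <= e/(2*C + 1)" using N[OF that(1)] N[OF that(2)] by linarith
   qed fact
   also have "\<dots> < e" using mult_nonneg_nonneg[of C e] rC e by (simp add: field_simps add_pos_nonneg)
   finally show ?thesis .
  qed
  then show "\<exists>N. \<forall>m\<ge>N. \<forall>n\<ge>N. p j (?Q (w m) - ?Q (w n)) < e" by blast
 qed blast
 have "((\<lambda>u. p j (?Q u - l)) \<longlongrightarrow> 0) (at z)" if j: "j \<in> A" for j
 proof -
  from Q[OF j] obtain r C where rC: "r > 0" "C >= 0" and
   C: "\<forall>u\<in>ball z r - {z}. \<forall>u'\<in>ball z r - {z}. p j (?Q u - ?Q u') <= C*(cmod (u - z) + cmod (u' - z))" by (elim exE conjE)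
  obtain N where N: "\<And>n. n >= N ==> w n \<in> ball z r - {z}" using wball[of r 1] rC by auto
  have le: "p j (?Q u - l) <= C*cmod (u - z)" if u: "u \<in> ball z r - {z}" for u
  proof (rule LIMSEQ_le_const)
   show "(\<lambda>n. C*(cmod (u - z) + cmod (w n - z)) + p j (?Q (w n) - l)) \<longlonglongrightarrow> C*cmod (u - z)" by (rule tendsto_eq_intros w0 l j refl | simp)+
   show "\<exists>N. \<forall>n\<ge>N. p j (?Q u - l) <= C*(cmod (u - z) + cmod (w n - z)) + p j (?Q (w n) - l)"
   proof (intro exI[of _ N] allI impI)
    fix n assume "n >= N"
    then have "w n \<in> ball z r - {z}" by (rule N)
    from C[rule_format, OF u this] p_tri[OF j, of "?Q u" l "?Q (w n)"]
    show "p j (?Q u - l) <= C*(cmod (u - z) + cmod (w n - z)) + p j (?Q (w n) - l)" by linarith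
   qed
  qed
  have "((\<lambda>u. C*cmod (u - z)) \<longlongrightarrow> C*cmod (z - z)) (at z)" by (intro tendsto_intros)
  moreover have "\<forall>\<^sub>F u in at z. p j (?Q u - l) <= C*cmod (u - z)"
   unfolding eventually_at using rC le by (intro exI[of _ r]) (auto simp: dist_commute)
  ultimately show ?thesis by (intro p_tendsto_zero[OF j]) (assumption, simp)
 qed
 then have "limitin (lc_topology A p) ?Q l (at z)" unfolding limitin_lc_topology by (rule ballI)
 then show "\<exists>l. limitin (lc_topology A p) ?Q l (at z)" ..
qed

end

section \<open>Existence of Pettis integrals\<close>

context seq_complete_lc_space
begin

text \<open>The vector is the limit of Riemann sums x n over [-n, n] with mesh 1/(n+1). Tested with
  a functional dominated by \<open>p j\<close>, the error of a sum is at most the integral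
  \<open>D j n\<close> of the real function p j (hn - h), which tends to 0 by dominated convergence.
  So the sums are Cauchy, and sequential completeness applies although only scalar integrals
  occur.\<close>

lemma pettis_integral_exists:
 fixes c :: "real => complex" and g :: "real => complex"
 assumes f: "f \<in> holo_space sc A p \<Omega>" and S: "finite S" and dl: "dl > 0"
  and c: "\<And>t. t \<notin> S ==> isCont c t" and g: "\<And>t. t \<notin> S ==> isCont g t" "\<And>t. t \<notin> S ==> g t \<in> \<Omega>"
  and bound: "\<And>j. j \<in> A ==> \<exists>B. \<forall>t. t \<notin> S \<longrightarrow> cmod (c t)*p j (f (g t)) <= B*exp (- dl*abs t)"
 shows "\<exists>v. \<forall>ph\<in>lc_dual sc A p. has_bochner_integral lborel (\<lambda>t. c t*ph (f (g t))) (ph v)"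
proof -
 \<comment> \<open>The value 0 on S makes the exponential bound valid at every t, including grid
   points that happen to lie in S.\<close>
 define h where "h t = (if t \<in> S then 0 else sc (c t) (f (g t)))" for t
 have S_nhds: "\<forall>\<^sub>F s in nhds t. s \<notin> S" if "t \<notin> S" for t using eventually_nhds_in_open[of "- S" t] S that by (simp add: finite_imp_closed open_Compl)
 have hcont: "isCont (\<lambda>s. p j (h s - h t)) t" if t: "t \<notin> S" and j: "j \<in> A" for t j
 proof -
  have "isCont (\<lambda>w. p j (f w - f (g t))) (g t)" using holo_seminorm_continuous[OF f g(2)[OF t] j] j by (simp add: isCont_def)
  then have "isCont (\<lambda>s. p j (f (g s) - f (g t))) t" by (rule isCont_o2[OF g(1)[OF t]])
  then have "isCont (\<lambda>s. cmod (c s)*p j (f (g s) - f (g t)) + cmod (c s - c t)*p j (f (g t))) t" using c[OF t] by (intro continuous_intros)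
  then have lim: "((\<lambda>s. cmod (c s)*p j (f (g s) - f (g t)) + cmod (c s - c t)*p j (f (g t))) \<longlongrightarrow> 0) (at t)" using j by (simp add: isCont_def)
  have "\<forall>\<^sub>F s in at t. s \<notin> S" unfolding eventually_at_filter using S_nhds[OF t] by eventually_elim simp
  then have "\<forall>\<^sub>F s in at t. p j (h s - h t) <= cmod (c s)*p j (f (g s) - f (g t)) + cmod (c s - c t)*p j (f (g t))"
  proof eventually_elim
   fix s assume s: "s \<notin> S"
   have "h s - h t = sc (c s) (f (g s) - f (g t)) + sc (c s - c t) (f (g t))"
    using s t by (simp add: h_def scale_right_diff_distrib scale_left_diff_distrib)
   then show "p j (h s - h t) <= cmod (c s)*p j (f (g s) - f (g t)) + cmod (c s - c t)*p j (f (g t))"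
    using p_add[OF j] by (simp flip: p_scale[OF j])
  qed
  from p_tendsto_zero[OF j this lim] show ?thesis using j by (simp add: isCont_def)
 qed
 have meas: "(\<lambda>t. p j (x - h t)) \<in> borel_measurable borel" if j: "j \<in> A" for x j
 proof (rule borel_measurable_continuous_countable_exceptions[of S])
  have "isCont (\<lambda>t. p j (x - h t)) t" if t: "t \<notin> S" for t
  proof -
   have "((\<lambda>s. p j (h s - h t)) \<longlongrightarrow> 0) (at t)" using hcont[OF t j] j by (simp add: isCont_def)
   moreover have "norm (p j (x - h s) - p j (x - h t)) <= p j (h s - h t)" for s
    using p_diff_le[OF j, of "x - h s" "x - h t"] by (simp add: p_commute[OF j])
   ultimately have "((\<lambda>s. p j (x - h s) - p j (x - h t)) \<longlongrightarrow> 0) (at t)"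
    by (intro Lim_null_comparison[of "\<lambda>s. p j (x - h s) - p j (x - h t)" "\<lambda>s. p j (h s - h t)"]) simp_all
   then show ?thesis by (simp add: isCont_def LIM_zero_iff)
  qed
  then show "continuous_on (- S) (\<lambda>t. p j (x - h t))" by (intro continuous_at_imp_continuous_on) auto
 qed (use S in \<open>simp add: countable_finite\<close>)
 have "\<exists>B\<ge>0. \<forall>t. p j (h t) <= B*exp (- dl*abs t)" if j: "j \<in> A" for j
 proof -
  obtain B where B: "\<And>t. t \<notin> S ==> cmod (c t)*p j (f (g t)) <= B*exp (- dl*abs t)" using bound[OF j] by blast
  have "p j (h t) <= max 0 B*exp (- dl*abs t)" for t
  proof (cases "t \<in> S")
   case False
   have "p j (h t) <= B*exp (- dl*abs t)" using B[OF False] False by (simp add: h_def p_scale[OF j])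
   also have "\<dots> <= max 0 B*exp (- dl*abs t)" by (intro mult_right_mono) auto
   finally show ?thesis .
  qed (simp add: h_def j)
  then show ?thesis by (intro exI[of _ "max 0 B"]) simp
 qed
 then obtain B where B: "\<And>j. j \<in> A ==> B j >= 0" "\<And>j t. j \<in> A ==> p j (h t) <= B j*exp (- dl*abs t)" by metis
 define N where "N n = real (Suc n)" for n
 have N: "N n >= 1" for n by (simp add: N_def)
 define k where "k n t = \<lfloor>N n*t\<rfloor>" for n t
 define I where "I n = {- int (Suc n*n)..int (Suc n*n)}" for n
 define hn where "hn n t = (if k n t \<in> I n then h (k n t/N n) else 0)" for n t
 define x where "x n = (\<Sum>i\<in>I n. sc (of_real (1/N n)) (h (i/N n)))" for n
 have kt: "\<bar>k n t/N n - t\<bar> <= 1/N n" for n t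
 proof -
  have "\<bar>k n t - N n*t\<bar> <= 1" unfolding k_def by linarith
  moreover have "k n t/N n - t = (k n t - N n*t)/N n" using N[of n] by (simp add: field_simps)
  ultimately show ?thesis using N[of n] by (simp add: abs_divide divide_right_mono)
 qed
 \<comment> \<open>The step function samples h at distance at most 1/N n <= 1 from t, which costs
   the factor exp dl.\<close>
 have hn_bound: "p j (hn n t) <= B j*exp dl*exp (- dl*abs t)" if j: "j \<in> A" for j n t
 proof (cases "k n t \<in> I n")
  case True
  have "1/N n <= 1" using N[of n] by simp
  then have "abs t - 1 <= \<bar>k n t/N n\<bar>" using kt[of n t] by linarith
  then have "dl*(abs t - 1) <= dl*\<bar>k n t/N n\<bar>" using dl by (intro mult_left_mono) auto
  then have "exp (- dl*\<bar>k n t/N n\<bar>) <= exp (dl + - dl*abs t)" by (simp add: algebra_simps)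
  then have "B j*exp (- dl*\<bar>k n t/N n\<bar>) <= B j*exp (dl + - dl*abs t)" using B(1)[OF j] by (rule mult_left_mono)
  with B(2)[OF j, of "k n t/N n"] have "p j (h (k n t/N n)) <= B j*exp (dl + - dl*abs t)" by (rule order_trans)
  then show ?thesis using True by (simp only: hn_def exp_add mult.assoc if_True)
 qed (simp add: hn_def j B(1))
 have h_bound: "p j (h t) <= B j*exp dl*exp (- dl*abs t)" if j: "j \<in> A" for j t
 proof -
  have "B j*1 <= B j*exp dl" using B(1)[OF j] dl by (intro mult_left_mono) auto
  then have "B j*exp (- dl*abs t) <= B j*exp dl*exp (- dl*abs t)" by (intro mult_right_mono) auto
  with B(2)[OF j, of t] show ?thesis by linarith
 qed
 have diff_bound: "p j (hn n t - h t) <= 2*B j*exp dl*exp (- dl*abs t)" if j: "j \<in> A" for j n t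
  using p_add[OF j, of "hn n t" "- h t"] hn_bound[OF j, of n t] h_bound[OF j, of t] by (simp add: p_minus[OF j])
 have e_int: "integrable lborel (\<lambda>t::real. C*exp (- dl*abs t))" for C
  using has_bochner_integral_exp_abs[OF dl] by (auto simp: has_bochner_integral_iff)
 \<comment> \<open>The step function takes one value for each integer \<open>k n t\<close>, so
   measurability for a fixed vector x is glued over countably many pieces.\<close>
 have diff_meas: "(\<lambda>t. p j (hn n t - h t)) \<in> borel_measurable lborel" if j: "j \<in> A" for j n
 proof -
  have "(\<lambda>t. p j ((if k n t \<in> I n then h (k n t/N n) else 0) - h t)) \<in> borel_measurable borel"
  proof (rule measurable_compose_countable[where f = "\<lambda>i t. p j ((if i \<in> I n then h (real_of_int i/N n) else 0) - h t)" and g = "k n"])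
   show "k n \<in> measurable borel (count_space UNIV)" unfolding k_def by measurable
  qed (rule meas[OF j])
  then show ?thesis by (simp add: hn_def)
 qed
 have diff_int: "integrable lborel (\<lambda>t. p j (hn n t - h t))" if j: "j \<in> A" for j n
  by (rule Bochner_Integration.integrable_bound[OF e_int[of "2*B j*exp dl"] diff_meas[OF j]])
    (use diff_bound[OF j, of n] p_nonneg[OF j] B(1)[OF j] in simp)
 define D where "D j n = (\<integral>t. p j (hn n t - h t) \<partial>lborel)" for j n
 have D: "D j \<longlonglongrightarrow> 0" if j: "j \<in> A" for j
 proof -
  have "(\<lambda>n. (\<integral>t. p j (hn n t - h t) \<partial>lborel)) \<longlonglongrightarrow> (\<integral>t. 0 \<partial>(lborel :: real measure))"
  proof (rule integral_dominated_convergence[where w = "\<lambda>t. 2*B j*exp dl*exp (- dl*abs t)"])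
   show "(\<lambda>t. p j (hn n t - h t)) \<in> borel_measurable lborel" for n by (rule diff_meas[OF j])
   show "integrable lborel (\<lambda>t. 2*B j*exp dl*exp (- dl*abs t))" by (rule e_int)
   show "AE t in lborel. norm (p j (hn n t - h t)) <= 2*B j*exp dl*exp (- dl*abs t)" for n
    using diff_bound[OF j, of n] p_nonneg[OF j] by simp
   show "AE t in lborel. (\<lambda>n. p j (hn n t - h t)) \<longlonglongrightarrow> 0" using AE_not_in[OF finite_imp_null_set_lborel[OF S]]
   proof eventually_elim
    fix t assume t: "t \<notin> S"
    have "(\<lambda>n. 1/N n) \<longlonglongrightarrow> 0" unfolding N_def using LIMSEQ_inverse_real_of_nat by (simp add: inverse_eq_divide)
    then have "(\<lambda>n. k n t/N n - t) \<longlonglongrightarrow> 0" by (rule Lim_null_comparison[rotated]) (use kt[of _ t] in simp)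
    then have "(\<lambda>n. k n t/N n) \<longlonglongrightarrow> t" by (simp add: LIM_zero_iff)
    then have "(\<lambda>n. p j (h (k n t/N n) - h t)) \<longlonglongrightarrow> p j (h t - h t)" by (rule isCont_tendsto_compose[OF hcont[OF t j]])
    then have "(\<lambda>n. p j (h (k n t/N n) - h t)) \<longlonglongrightarrow> 0" using j by simp
    moreover have "\<forall>\<^sub>F n in sequentially. p j (hn n t - h t) = p j (h (k n t/N n) - h t)"
    proof -
     have "\<forall>\<^sub>F n in sequentially. real n >= abs t + 1" using filterlim_real_sequentially unfolding filterlim_at_top by blast
     then show ?thesis
     proof eventually_elim
      fix n assume n: "real n >= abs t + 1"
      have "\<bar>real_of_int (k n t)\<bar> <= \<bar>N n*t\<bar> + 1" unfolding k_def by linarith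
      also have "\<dots> <= N n*abs t + N n" using N[of n] by (simp add: abs_mult)
      also have "\<dots> <= N n*real n" using mult_left_mono[OF n, of "N n"] N[of n] by (simp add: distrib_left)
      also have "N n*real n = real_of_int (int (Suc n*n))" by (simp add: N_def algebra_simps)
      finally have "\<bar>real_of_int (k n t)\<bar> <= real_of_int (int (Suc n*n))" .
      then have "\<bar>k n t\<bar> <= int (Suc n*n)" by linarith
      then have "k n t \<in> I n" unfolding I_def by auto
      then show "p j (hn n t - h t) = p j (h (k n t/N n) - h t)" by (simp add: hn_def)
     qed
    qed
    ultimately show "(\<lambda>n. p j (hn n t - h t)) \<longlonglongrightarrow> 0" by (simp cong: tendsto_cong)
   qed
  qed simp
  then show ?thesis by (simp add: D_def[abs_def])
 qed
 have hn_integral: "has_bochner_integral lborel (\<lambda>t. ph (hn n t)) (ph (x n))" if ph: "ph \<in> lc_dual sc A p" for ph n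
 proof -
  have "has_bochner_integral lborel
    (\<lambda>t. \<Sum>i\<in>I n. indicator {i/N n..<(i + 1)/N n} t *\<^sub>R ph (h (i/N n)))
    (\<Sum>i\<in>I n. measure lborel {real_of_int i/N n..<(i + 1)/N n} *\<^sub>R ph (h (i/N n)))"
   using N[of n] by (intro has_bochner_integral_sum has_bochner_integral_indicator)
    (auto simp: divide_right_mono)
  moreover have "(\<Sum>i\<in>I n. measure lborel {real_of_int i/N n..<(i + 1)/N n} *\<^sub>R ph (h (i/N n))) = ph (x n)"
   using N[of n] unfolding x_def lc_dual_sum[OF ph] lc_dual_scale[OF ph]
   by (intro sum.cong) (auto simp: divide_right_mono scaleR_conv_of_real diff_divide_distrib[symmetric])
  moreover have "(\<Sum>i\<in>I n. indicator {i/N n..<(i + 1)/N n} t *\<^sub>R ph (h (i/N n))) = ph (hn n t)" for t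
  proof -
   have "t \<in> {i/N n..<(i + 1)/N n} \<longleftrightarrow> k n t = i" for i :: int using N[of n] by (auto simp: k_def floor_eq_iff field_simps)
   then have "(\<Sum>i\<in>I n. indicator {i/N n..<(i + 1)/N n} t *\<^sub>R ph (h (i/N n))) =
     (\<Sum>i\<in>I n. if k n t = i then ph (h (i/N n)) else 0)" by (intro sum.cong) (auto simp: indicator_def)
   also have "\<dots> = ph (hn n t)" by (simp add: hn_def I_def lc_dual_zero[OF ph])
   finally show ?thesis .
  qed
  ultimately show ?thesis by simp
 qed
 have phh: "integrable lborel (\<lambda>t. ph (h t))" if ph: "ph \<in> lc_dual sc A p" for ph
 proof -
  obtain T C where T: "finite T" "T \<subseteq> A" "0 < C" and C: "\<And>x. cmod (ph x) <= C*(\<Sum>j\<in>T. p j x)" using lc_dual_bound[OF ph] by metis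
  show ?thesis
  proof (rule exp_decay_integrable(1)[OF S _ _ dl])
   show "isCont (\<lambda>t. ph (h t)) t" if "t \<notin> S" for t unfolding isCont_def using hcont[OF that]
    by (intro lc_dual_tendsto[OF ph]) (simp add: isCont_def)
   show "cmod (ph (h t)) <= (C*(\<Sum>j\<in>T. B j))*exp (- dl*\<bar>t - 0\<bar>)" for t
   proof -
    have "(\<Sum>j\<in>T. p j (h t)) <= (\<Sum>j\<in>T. B j*exp (- dl*abs t))" using T B(2) by (intro sum_mono) auto
    then have "C*(\<Sum>j\<in>T. p j (h t)) <= C*((\<Sum>j\<in>T. B j)*exp (- dl*abs t))" using T by (intro mult_left_mono) (auto simp: sum_distrib_right)
    with C[of "h t"] show ?thesis by simp
   qed
  qed
 qed
 \<comment> \<open>Used twice: with T = {j}, to see that the sums are Cauchy, and with the set T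
   that bounds a general functional, to identify its value at the limit.\<close>
 have main: "cmod (ph (x n) - (\<integral>t. ph (h t) \<partial>lborel)) <= C*(\<Sum>j\<in>T. D j n)"
  if ph: "ph \<in> lc_dual sc A p" and T: "T \<subseteq> A" and C: "\<And>x. cmod (ph x) <= C*(\<Sum>j\<in>T. p j x)" for ph T C n
 proof -
  have "ph (x n) - (\<integral>t. ph (h t) \<partial>lborel) = (\<integral>t. ph (hn n t) - ph (h t) \<partial>lborel)"
   using hn_integral[OF ph, of n] phh[OF ph] by (simp add: has_bochner_integral_iff)
  also have "cmod \<dots> <= (\<integral>t. cmod (ph (hn n t) - ph (h t)) \<partial>lborel)" by (rule integral_norm_bound)
  also have "\<dots> <= (\<integral>t. C*(\<Sum>j\<in>T. p j (hn n t - h t)) \<partial>lborel)"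
  proof (rule integral_mono)
   show "integrable lborel (\<lambda>t. cmod (ph (hn n t) - ph (h t)))" using hn_integral[OF ph, of n] phh[OF ph] by (auto simp: has_bochner_integral_iff)
   show "integrable lborel (\<lambda>t. C*(\<Sum>j\<in>T. p j (hn n t - h t)))"
    using T diff_int by (intro integrable_mult_right Bochner_Integration.integrable_sum) auto
   show "cmod (ph (hn n t) - ph (h t)) <= C*(\<Sum>j\<in>T. p j (hn n t - h t))" for t using C[of "hn n t - h t"] by (simp add: lc_dual_diff[OF ph])
  qed
  also have "\<dots> = C*(\<Sum>j\<in>T. D j n)" unfolding D_def using T diff_int
   by (subst integral_mult_right_zero, subst Bochner_Integration.integral_sum) auto
  finally show ?thesis .
 qed
 obtain v where v: "\<And>j. j \<in> A ==> (\<lambda>n. p j (x n - v)) \<longlonglongrightarrow> 0"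
 proof (rule Cauchy_limit)
  fix j and e :: real assume j: "j \<in> A" and e: "0 < e"
  have le: "p j (x m - x n) <= D j m + D j n" for m n
  proof (rule seminorm_le_dual[OF j])
   fix ph assume ph: "ph \<in> lc_dual sc A p" and "\<And>y. cmod (ph y) <= p j y"
   then have "cmod (ph (x n) - (\<integral>t. ph (h t) \<partial>lborel)) <= D j n" for n using main[OF ph, of "{j}" 1 n] j by simp
   from this[of m] this[of n] show "cmod (ph (x m - x n)) <= D j m + D j n" unfolding lc_dual_diff[OF ph]
    using norm_triangle_ineq4[of "ph (x m) - (\<integral>t. ph (h t) \<partial>lborel)" "ph (x n) - (\<integral>t. ph (h t) \<partial>lborel)"] by simp
  qed
  have "\<forall>\<^sub>F n in sequentially. D j n < e/2" using e by (intro order_tendstoD(2)[OF D[OF j]]) simp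
  then obtain M where "\<And>n. n >= M ==> D j n < e/2" unfolding eventually_sequentially by blast
  then have "p j (x m - x n) < e" if "m >= M" "n >= M" for m n using le[of m n] that by (smt (verit, best) field_sum_of_halves)
  then show "\<exists>N. \<forall>m\<ge>N. \<forall>n\<ge>N. p j (x m - x n) < e" by blast
 qed blast
 have "has_bochner_integral lborel (\<lambda>t. c t*ph (f (g t))) (ph v)" if ph: "ph \<in> lc_dual sc A p" for ph
 proof -
  obtain T C where T: "finite T" "T \<subseteq> A" and C: "\<And>x. cmod (ph x) <= C*(\<Sum>j\<in>T. p j x)" using lc_dual_bound[OF ph] by metis
  have "(\<lambda>n. C*(\<Sum>j\<in>T. D j n)) \<longlonglongrightarrow> C*(\<Sum>j\<in>T. 0)" using T D by (intro tendsto_intros) auto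
  then have "(\<lambda>n. ph (x n) - (\<integral>t. ph (h t) \<partial>lborel)) \<longlonglongrightarrow> 0" using main[OF ph T(2) C]
   by (intro Lim_null_comparison[of "\<lambda>n. ph (x n) - (\<integral>t. ph (h t) \<partial>lborel)" "\<lambda>n. C*(\<Sum>j\<in>T. D j n)"]) simp_all
  then have "(\<lambda>n. ph (x n)) \<longlonglongrightarrow> (\<integral>t. ph (h t) \<partial>lborel)" by (simp add: LIM_zero_iff)
  moreover have "(\<lambda>n. ph (x n)) \<longlonglongrightarrow> ph v" by (rule lc_dual_tendsto[OF ph v])
  ultimately have "ph v = (\<integral>t. ph (h t) \<partial>lborel)" using LIMSEQ_unique by blast
  then have "has_bochner_integral lborel (\<lambda>t. ph (h t)) (ph v)" using phh[OF ph] by (simp add: has_bochner_integral_iff)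
  moreover have "has_bochner_integral lborel (\<lambda>t. ph (h t)) (ph v) \<longleftrightarrow>
    has_bochner_integral lborel (\<lambda>t. c t*ph (f (g t))) (ph v)" by (rule has_bochner_integral_discrete_difference[of S])
     (use S in \<open>auto simp: h_def lc_dual_scale[OF ph] countable_finite\<close>)
  ultimately show ?thesis by simp
 qed
 then show ?thesis by blast
qed

end

section \<open>Integrals along unbounded paths\<close>

lemma integral_Icc_limit:
 fixes F :: "real => complex"
 assumes int: "integrable lborel F"
 shows "((\<lambda>T. integral {-T..T} F) \<longlongrightarrow> integral\<^sup>L lborel F) at_top"
proof -
 have meas: "F \<in> borel_measurable lborel" using int by (rule borel_measurable_integrable)
 have "((\<lambda>T. \<integral>t. indicator {-T..T} t *\<^sub>R F t \<partial>lborel) \<longlongrightarrow> (\<integral>t. F t \<partial>lborel)) at_top"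
 proof (rule integral_dominated_convergence_at_top[where w = "\<lambda>t. norm (F t)"])
  show "AE t in lborel. ((\<lambda>T. indicator {-T..T} t *\<^sub>R F t) \<longlongrightarrow> F t) at_top"
  proof (rule AE_I2)
   fix t :: real
   have "\<forall>\<^sub>F T in at_top. indicator {-T..T} t *\<^sub>R F t = F t" using eventually_ge_at_top[of "abs t"] by eventually_elim (auto simp: indicator_def)
   then show "((\<lambda>T. indicator {-T..T} t *\<^sub>R F t) \<longlongrightarrow> F t) at_top" by (rule tendsto_eventually)
  qed
  show "\<forall>\<^sub>F T in at_top. AE t in lborel. norm (indicator {-T..T} t *\<^sub>R F t) <= norm (F t)" by (auto simp: indicator_def)
 qed (use meas int in auto)
 moreover have "(\<integral>t. indicator {-T..T} t *\<^sub>R F t \<partial>lborel) = integral {-T..T} F" for T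
 proof -
  have "set_integrable lborel {-T..T} F" unfolding set_integrable_def using int by (intro integrable_mult_indicator) auto
  then show ?thesis using set_borel_integral_eq_integral(2)[of "{-T..T}" F] by (simp add: set_lebesgue_integral_def)
 qed
 ultimately show ?thesis by simp
qed

text \<open>With a primitive P, an improper path integral is the limit of the differences of P at
  the two ends. Deforming an unbounded path thereby becomes a comparison of values of P far
  out.\<close>

lemma path_integral_limit:
 fixes \<gamma> :: "real => complex"
 assumes S: "finite S" and cont: "\<And>t. isCont \<gamma> t"
  and deriv: "\<And>t. t \<notin> S ==> (\<gamma> has_vector_derivative \<gamma>' t) (at t)"
  and P: "\<And>t. (P has_field_derivative h (\<gamma> t)) (at (\<gamma> t))"
  and int: "integrable lborel (\<lambda>t. \<gamma>' t*h (\<gamma> t))"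
 shows "((\<lambda>T. P (\<gamma> T) - P (\<gamma> (- T))) \<longlongrightarrow> (\<integral>t. \<gamma>' t*h (\<gamma> t) \<partial>lborel)) at_top"
proof -
 let ?F = "\<lambda>t. \<gamma>' t*h (\<gamma> t)"
 have "\<forall>\<^sub>F T in at_top. integral {-T..T} ?F = P (\<gamma> T) - P (\<gamma> (- T))" using eventually_ge_at_top[of 0]
 proof eventually_elim
  fix T :: real assume T: "0 <= T"
  have "(?F has_integral ((P \<circ> \<gamma>) T - (P \<circ> \<gamma>) (- T))) {-T..T}"
  proof (rule fundamental_theorem_of_calculus_interior_strong[OF S])
   show "(P \<circ> \<gamma> has_vector_derivative ?F t) (at t)" if "t \<in> {-T<..<T} - S" for t using that deriv P by (intro field_vector_diff_chain_at) auto
   have "isCont (P \<circ> \<gamma>) t" for t unfolding o_def by (rule isCont_o2[OF cont DERIV_isCont[OF P]])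
   then show "continuous_on {-T..T} (P \<circ> \<gamma>)" by (intro continuous_at_imp_continuous_on) auto
  qed (use T in auto)
  then show "integral {-T..T} ?F = P (\<gamma> T) - P (\<gamma> (- T))" by (simp add: integral_unique)
 qed
 with integral_Icc_limit[OF int] show ?thesis by (rule Lim_transform_eventually)
qed

text \<open>This closes contours at infinity. On the segment between u x and v x the derivative of P
  decays exponentially while the length grows at most linearly; half of the exponent absorbs the
  length, since 1 + x <= (1 + 2/dl)*exp (dl/2*x).\<close>

lemma primitive_difference_vanishes:
 fixes u v :: "real => complex"
 assumes dl: "dl > 0" and B: "B >= 0"
  and P: "\<And>x w. x >= x0 ==> w \<in> closed_segment (u x) (v x) ==> (P has_field_derivative h w) (at w)"
  and h: "\<And>x w. x >= x0 ==> w \<in> closed_segment (u x) (v x) ==> cmod (h w) <= B*exp (- dl*x)"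
  and L: "\<And>x. x >= x0 ==> cmod (u x - v x) <= L*(1 + abs x)"
 shows "((\<lambda>x. P (u x) - P (v x)) \<longlongrightarrow> 0) at_top"
proof (rule Lim_null_comparison)
 have "((\<lambda>x::real. exp (- (dl/2)*x)) \<longlongrightarrow> 0) at_top" using dl by (intro exp_decay_tendsto) simp
 from tendsto_mult_right_zero[OF this]
 show "((\<lambda>x. (B*abs L*(1 + 2/dl))*exp (- (dl/2)*x)) \<longlongrightarrow> 0) at_top" .
 show "\<forall>\<^sub>F x in at_top. norm (P (u x) - P (v x)) <= (B*abs L*(1 + 2/dl))*exp (- (dl/2)*x)"
  using eventually_ge_at_top[of x0] eventually_ge_at_top[of 0]
 proof eventually_elim
  fix x :: real assume x: "x0 <= x" "0 <= x"
  have "1 + x <= (1 + 2/dl)*exp (dl/2*x)"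
  proof -
   have "1 <= exp (dl/2*x)" using x dl by simp
   have "dl/2*x <= exp (dl/2*x)" using exp_ge_add_one_self[of "dl/2*x"] by linarith
   then have "x <= 2/dl*exp (dl/2*x)" using dl by (simp add: field_simps)
   with \<open>1 <= exp (dl/2 * x)\<close> show ?thesis unfolding distrib_right by linarith
  qed
  then have *: "(1 + x)*exp (- dl*x) <= (1 + 2/dl)*exp (dl/2*x)*exp (- dl*x)" by (intro mult_right_mono) auto
  have e: "exp (dl/2*x)*exp (- dl*x) = exp (- (dl/2)*x)" by (simp flip: exp_add)
  have "norm (P (u x) - P (v x)) <= (B*exp (- dl*x))*cmod (u x - v x)" by (rule field_differentiable_bound[of "closed_segment (u x) (v x)"])
     (use x P h in \<open>auto intro: has_field_derivative_at_within\<close>)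
  also have "\<dots> <= (B*exp (- dl*x))*(abs L*(1 + x))"
  proof (intro mult_left_mono)
   show "cmod (u x - v x) <= abs L*(1 + x)"
   proof -
    have "cmod (u x - v x) <= L*(1 + x)" using L[OF x(1)] x by simp
    also have "L*(1 + x) <= abs L*(1 + x)" using x by (intro mult_right_mono) auto
    finally show ?thesis .
   qed
  qed (use B in auto)
  also have "\<dots> = B*abs L*((1 + x)*exp (- dl*x))" by simp
  also have "\<dots> <= B*abs L*((1 + 2/dl)*exp (dl/2*x)*exp (- dl*x))" using * B by (intro mult_left_mono) auto
  also have "\<dots> = (B*abs L*(1 + 2/dl))*exp (- (dl/2)*x)" by (simp only: mult.assoc e)
  finally show "norm (P (u x) - P (v x)) <= (B*abs L*(1 + 2/dl))*exp (- (dl/2)*x)" .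
 qed
qed

lemma vertical_segment:
 "w \<in> closed_segment (Complex x a) (Complex x b) ==> Re w = x \<and> min a b <= Im w \<and> Im w <= max a b"
 by (auto simp: closed_segment_same_Re closed_segment_eq_real_ivl split: if_splits)

section \<open>Integrals along horizontal lines\<close>

definition line_integral :: "real => (complex => complex) => complex" where
 "line_integral c h = (\<integral>t. h (Complex t c) \<partial>lborel)"

lemma isCont_Complex: "isCont f t ==> isCont g t ==> isCont (\<lambda>t. Complex (f t) (g t)) t" unfolding isCont_def by (intro tendsto_Complex)

lemma line_integrable:
 assumes "\<And>t. isCont h (Complex t c)" "\<And>t. cmod (h (Complex t c)) <= B*exp (- dl*abs t)" "dl > 0"
 shows "integrable lborel (\<lambda>t. h (Complex t c))" "cmod (line_integral c h) <= 2*B/dl"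
proof -
 have "isCont (\<lambda>t. h (Complex t c)) t" for t by (rule isCont_o2[where f = "\<lambda>t. Complex t c" and g = h]) (auto intro!: isCont_Complex assms(1))
 note * = exp_decay_integrable[of "{}" "\<lambda>t. h (Complex t c)" B dl 0, OF _ this _ assms(3)]
 show "integrable lborel (\<lambda>t. h (Complex t c))" "cmod (line_integral c h) <= 2*B/dl"
  unfolding line_integral_def using assms(2) by (auto intro!: *)
qed

lemma line_integral_limit:
 assumes P: "\<And>t. (P has_field_derivative h (Complex t c)) (at (Complex t c))"
  and int: "integrable lborel (\<lambda>t. h (Complex t c))"
 shows "((\<lambda>x. P (Complex x c) - P (Complex (- x) c)) \<longlongrightarrow> line_integral c h) at_top"
proof -
 have "((\<lambda>T. P (Complex T c) - P (Complex (- T) c)) \<longlongrightarrow> (\<integral>t. 1*h (Complex t c) \<partial>lborel)) at_top"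
 proof (rule path_integral_limit[of "{}"])
  show "((\<lambda>t. Complex t c) has_vector_derivative 1) (at t)" for t by (auto simp: has_vector_derivative_complex_iff)
 qed (use P int in \<open>auto intro!: isCont_Complex\<close>)
 then show ?thesis by (simp add: line_integral_def)
qed

text \<open>The boundary of a half-strip, traversed as \<open>gamma_right\<close> is: \<open>kp = c\<close> gives a half-disc as
 end cap, \<open>kp = 0\<close> a vertical segment.\<close>

definition hairpin :: "real => real => real => real => complex" where
 "hairpin l kp c t =
   (if t < - (pi/2) then Complex (l + (- (pi/2) - t)) (- c)
   else if t <= pi/2 then Complex (l - kp*cos t) (c * sin t)
   else Complex (l + (t - pi/2)) c)"

definition hairpin_deriv :: "real => real => real => complex" where
 "hairpin_deriv kp c t =
   (if t < - (pi/2) then -1 else if t <= pi/2 then Complex (kp * sin t) (c*cos t) else 1)"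

definition hairpin_integral :: "real => real => real => (complex => complex) => complex" where
 "hairpin_integral l kp c h = (\<integral>t. hairpin_deriv kp c t*h (hairpin l kp c t) \<partial>lborel)"

text \<open>Clamping t to [-pi/2, pi/2] merges the three cases into one visibly continuous formula:
  s is the angle on the end cap and |t - s| the distance travelled along an arm.\<close>

lemma hairpin_alt:
 "hairpin l kp c t = (let s = max (- (pi/2)) (min (pi/2) t) in Complex (l - kp*cos s + \<bar>t - s\<bar>) (c * sin s))"
proof -
 consider "t < - (pi/2)" | "- (pi/2) <= t" "t <= pi/2" | "t > pi/2" by linarith
 then show ?thesis
 proof cases
  case 1
  moreover have "max (- (pi/2)) (min (pi/2) t) = - (pi/2)" using 1 by auto
  ultimately show ?thesis by (simp add: hairpin_def Let_def)
 next
  case 2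
  moreover have "max (- (pi/2)) (min (pi/2) t) = t" using 2 by auto
  ultimately show ?thesis by (simp add: hairpin_def Let_def)
 next
  case 3
  moreover have "max (- (pi/2)) (min (pi/2) t) = pi/2" using 3 by auto
  moreover have "\<not> t < - (pi/2)" "\<not> t <= pi/2" using 3 pi_gt_zero by linarith+
  ultimately show ?thesis by (simp add: hairpin_def Let_def)
 qed
qed

lemma isCont_hairpin: "isCont (hairpin l kp c) t"
proof -
 have *: "isCont (\<lambda>t. max (- (pi/2)) (min (pi/2) t)) t" by (intro continuous_intros)
 have "isCont (\<lambda>t. let s = max (- (pi/2)) (min (pi/2) t) in Complex (l - kp*cos s + \<bar>t - s\<bar>) (c * sin s)) t"
  unfolding Let_def by (intro isCont_Complex continuous_intros)
 then show ?thesis by (simp add: hairpin_alt[abs_def])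
qed

lemma hairpin_cases:
 obtains "t < - (pi/2)" | "t \<in> {- (pi/2)<..<pi/2}" | "t > pi/2" | "t \<in> {- (pi/2), pi/2}" using pi_gt_zero by fastforce

lemma hairpin_has_deriv:
 assumes "t \<notin> {- (pi/2), pi/2}"
 shows "(hairpin l kp c has_vector_derivative hairpin_deriv kp c t) (at t)"
proof (cases t rule: hairpin_cases)
 case 1
 have "((\<lambda>t. Complex (l + (- (pi/2) - t)) (- c)) has_vector_derivative -1) (at t)"
  by (auto simp: has_vector_derivative_complex_iff intro!: derivative_eq_intros)
 then have "(hairpin l kp c has_vector_derivative -1) (at t)"
  by (rule has_vector_derivative_transform_within_open[of _ _ _ "{..<- (pi/2)}"]) (use 1 in \<open>auto simp: hairpin_def\<close>)
 then show ?thesis using 1 by (simp add: hairpin_deriv_def)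
next
 case 2
 have "((\<lambda>t. Complex (l - kp*cos t) (c * sin t)) has_vector_derivative Complex (kp * sin t) (c*cos t)) (at t)"
  by (auto simp: has_vector_derivative_complex_iff intro!: derivative_eq_intros)
 then have "(hairpin l kp c has_vector_derivative Complex (kp * sin t) (c*cos t)) (at t)"
  by (rule has_vector_derivative_transform_within_open[of _ _ _ "{- (pi/2)<..<pi/2}"]) (use 2 in \<open>auto simp: hairpin_def\<close>)
 then show ?thesis using 2 by (simp add: hairpin_deriv_def)
next
 case 3
 have "((\<lambda>t. Complex (l + (t - pi/2)) c) has_vector_derivative 1) (at t)"
  by (auto simp: has_vector_derivative_complex_iff intro!: derivative_eq_intros)
 then have "(hairpin l kp c has_vector_derivative 1) (at t)"
 proof (rule has_vector_derivative_transform_within_open[of _ _ _ "{pi/2<..}"])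
  fix y assume "y \<in> {pi/2<..}"
  then have "\<not> y < - (pi/2)" "\<not> y <= pi/2" unfolding greaterThan_iff using pi_gt_zero by linarith+
  then show "Complex (l + (y - pi/2)) c = hairpin l kp c y" by (simp add: hairpin_def)
 qed (use 3 in auto)
 moreover have "\<not> t < - (pi/2)" "\<not> t <= pi/2" using 3 pi_gt_zero by linarith+
 ultimately show ?thesis by (simp add: hairpin_deriv_def)
qed (use assms in auto)

lemma isCont_hairpin_deriv:
 assumes "t \<notin> {- (pi/2), pi/2}"
 shows "isCont (hairpin_deriv kp c) t"
proof (cases t rule: hairpin_cases)
 case 1
 have "\<forall>\<^sub>F s in nhds t. s \<in> {..<- (pi/2)}" using 1 by (intro eventually_nhds_in_open) auto
 then have "\<forall>\<^sub>F s in nhds t. hairpin_deriv kp c s = -1" by eventually_elim (simp add: hairpin_deriv_def)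
 then show ?thesis by (simp add: isCont_cong)
next
 case 2
 have "\<forall>\<^sub>F s in nhds t. s \<in> {- (pi/2)<..<pi/2}" using 2 by (intro eventually_nhds_in_open) auto
 then have *: "\<forall>\<^sub>F s in nhds t. hairpin_deriv kp c s = Complex (kp * sin s) (c*cos s)" by eventually_elim (simp add: hairpin_deriv_def)
 have "isCont (\<lambda>s. Complex (kp * sin s) (c*cos s)) t" by (intro isCont_Complex continuous_intros)
 then show ?thesis using * by (simp add: isCont_cong)
next
 case 3
 have "\<forall>\<^sub>F s in nhds t. s \<in> {pi/2<..}" using 3 by (intro eventually_nhds_in_open) auto
 then have "\<forall>\<^sub>F s in nhds t. hairpin_deriv kp c s = 1"
 proof eventually_elim
  fix s assume "s \<in> {pi/2<..}"
  then have "\<not> s < - (pi/2)" "\<not> s <= pi/2" unfolding greaterThan_iff using pi_gt_zero by linarith+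
  then show "hairpin_deriv kp c s = 1" by (simp add: hairpin_deriv_def)
 qed
 then show ?thesis by (simp add: isCont_cong)
qed (use assms in auto)

text \<open>The 2 is an upper bound for pi/2. Since the real part differs from \<open>abs t\<close>
  by a bounded amount, exponential decay in the real part is exponential decay in the
  parameter.\<close>

lemma hairpin_bounds:
 assumes "0 <= kp"
 shows "abs t - 2 + l - kp <= Re (hairpin l kp c t)" "l - kp <= Re (hairpin l kp c t)"
  "Re (hairpin l kp c t) <= abs t + l + kp" "\<bar>Im (hairpin l kp c t)\<bar> <= abs c"
  "cmod (hairpin_deriv kp c t) <= 1 + kp + abs c"
proof -
 define s where "s = max (- (pi/2)) (min (pi/2) t)"
 have h: "hairpin l kp c t = Complex (l - kp*cos s + \<bar>t - s\<bar>) (c * sin s)" unfolding hairpin_alt s_def by (simp add: Let_def)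
 have s: "abs s <= pi/2" "abs t - pi/2 <= \<bar>t - s\<bar>" "\<bar>t - s\<bar> <= abs t" unfolding s_def using pi_gt_zero by linarith+
 have k: "\<bar>kp*cos s\<bar> <= kp*1" unfolding abs_mult using assms by (intro mult_mono) auto
 have "pi/2 <= 2" using pi_half_less_two by simp
 with s k show "abs t - 2 + l - kp <= Re (hairpin l kp c t)" "l - kp <= Re (hairpin l kp c t)"
  "Re (hairpin l kp c t) <= abs t + l + kp" unfolding h by auto
 have "\<bar>c * sin s\<bar> <= abs c*1" unfolding abs_mult by (intro mult_mono) auto
 then show "\<bar>Im (hairpin l kp c t)\<bar> <= abs c" unfolding h by simp
 have "cmod (Complex (kp * sin t) (c*cos t)) <= \<bar>kp * sin t\<bar> + \<bar>c*cos t\<bar>" using cmod_le[of "Complex (kp * sin t) (c*cos t)"] by simp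
 also have "\<dots> <= kp*1 + abs c*1" unfolding abs_mult using assms by (intro add_mono mult_mono) auto
 finally show "cmod (hairpin_deriv kp c t) <= 1 + kp + abs c" using assms by (auto simp: hairpin_deriv_def)
qed

lemma hairpin_integrable:
 assumes kp: "0 <= kp" and cont: "\<And>t. isCont h (hairpin l kp c t)" and dl: "dl > 0"
  and bound: "\<And>t. cmod (h (hairpin l kp c t)) <= B*exp (- dl*\<bar>t - x\<bar>)"
 shows "integrable lborel (\<lambda>t. hairpin_deriv kp c t*h (hairpin l kp c t))"
  "cmod (hairpin_integral l kp c h) <= 2*((1 + kp + abs c)*B)/dl"
proof -
 have c: "isCont (\<lambda>t. hairpin_deriv kp c t*h (hairpin l kp c t)) t" if "t \<notin> {- (pi/2), pi/2}" for t
  using isCont_hairpin_deriv[OF that] isCont_o2[OF isCont_hairpin cont] by (intro continuous_intros)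
 have b: "cmod (hairpin_deriv kp c t*h (hairpin l kp c t)) <= (1 + kp + abs c)*B*exp (- dl*\<bar>t - x\<bar>)" for t
  unfolding norm_mult mult.assoc using bound[of t] hairpin_bounds(5)[OF kp, of c t] kp by (intro mult_mono) auto
 show "integrable lborel (\<lambda>t. hairpin_deriv kp c t*h (hairpin l kp c t))"
  "cmod (hairpin_integral l kp c h) <= 2*((1 + kp + abs c)*B)/dl" unfolding hairpin_integral_def
  using exp_decay_integrable[of "{- (pi/2), pi/2}", OF _ c b dl] by simp_all
qed

text \<open>The ends are reparametrised by their common real part x: for x > l the parameters pi/2 -
  l + x and its negative give the points x + ic and x - ic. These depend neither on l nor on kp, so
  paths with different caps can be compared.\<close>

lemma hairpin_integral_limit:
 assumes P: "\<And>t. (P has_field_derivative h (hairpin l kp c t)) (at (hairpin l kp c t))"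
  and int: "integrable lborel (\<lambda>t. hairpin_deriv kp c t*h (hairpin l kp c t))"
 shows "((\<lambda>x. P (Complex x c) - P (Complex x (- c))) \<longlongrightarrow> hairpin_integral l kp c h) at_top"
proof -
 have "((\<lambda>T. P (hairpin l kp c T) - P (hairpin l kp c (- T))) \<longlongrightarrow> hairpin_integral l kp c h) at_top" unfolding hairpin_integral_def
  by (rule path_integral_limit[of "{- (pi/2), pi/2}"]) (use P int in \<open>auto intro!: isCont_hairpin hairpin_has_deriv\<close>)
 moreover have "filterlim (\<lambda>x. (pi/2 - l) + x) at_top at_top" by (rule filterlim_tendsto_add_at_top[OF tendsto_const filterlim_ident])
 ultimately have "((\<lambda>x. P (hairpin l kp c ((pi/2 - l) + x)) - P (hairpin l kp c (- ((pi/2 - l) + x))))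
   \<longlongrightarrow> hairpin_integral l kp c h) at_top" by (rule filterlim_compose)
 moreover have "\<forall>\<^sub>F x in at_top. P (hairpin l kp c ((pi/2 - l) + x)) - P (hairpin l kp c (- ((pi/2 - l) + x))) =
   P (Complex x c) - P (Complex x (- c))" using eventually_gt_at_top[of l]
 proof eventually_elim
  fix x assume x: "l < x"
  have 1: "\<not> (pi/2 - l) + x < - (pi/2)" "\<not> (pi/2 - l) + x <= pi/2" "- ((pi/2 - l) + x) < - (pi/2)" using x pi_gt_zero by linarith+
  have "hairpin l kp c ((pi/2 - l) + x) = Complex x c" "hairpin l kp c (- ((pi/2 - l) + x)) = Complex x (- c)"
   unfolding hairpin_def by (simp_all only: 1 if_True if_False) simp_all
  then show "P (hairpin l kp c ((pi/2 - l) + x)) - P (hairpin l kp c (- ((pi/2 - l) + x))) =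
   P (Complex x c) - P (Complex x (- c))" by simp
 qed
 ultimately show ?thesis by (rule Lim_transform_eventually)
qed

text \<open>Far to the right the ends of the two paths are joined by vertical segments between the
  heights c and c', and between -c and -c', along which the primitive changes by a null
  sequence.\<close>

lemma hairpin_integral_independent:
 assumes P: "\<And>w. w \<in> X ==> (P has_field_derivative h w) (at w)"
  and c: "0 < c" "0 < c'"
  and X: "\<And>t. hairpin l kp c t \<in> X" "\<And>t. hairpin l' kp' c' t \<in> X"
  and int: "integrable lborel (\<lambda>t. hairpin_deriv kp c t*h (hairpin l kp c t))"
   "integrable lborel (\<lambda>t. hairpin_deriv kp' c' t*h (hairpin l' kp' c' t))"
  and dl: "dl > 0" "B >= 0"
  and strip: "\<And>w. min c c' <= abs (Im w) ==> (abs (Im w)) <= max c c' ==> x0 <= Re w ==>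
   w \<in> X \<and> cmod (h w) <= B*exp (- dl * Re w)"
 shows "hairpin_integral l kp c h = hairpin_integral l' kp' c' h"
proof -
 have L: "((\<lambda>x. P (Complex x c) - P (Complex x (- c))) \<longlongrightarrow> hairpin_integral l kp c h) at_top"
  "((\<lambda>x. P (Complex x c') - P (Complex x (- c'))) \<longlongrightarrow> hairpin_integral l' kp' c' h) at_top" using P X int by (auto intro!: hairpin_integral_limit)
 have V: "((\<lambda>x. P (Complex x a) - P (Complex x b)) \<longlongrightarrow> 0) at_top"
  if ab: "\<And>y. min a b <= y ==> y <= max a b ==> min c c' <= abs y \<and> abs y <= max c c'" for a b
 proof (rule primitive_difference_vanishes[OF dl, where L = "\<bar>a - b\<bar>" and P = P and h = h
    and u = "\<lambda>x. Complex x a" and v = "\<lambda>x. Complex x b"])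
  fix x w assume x: "x0 <= x" and "w \<in> closed_segment (Complex x a) (Complex x b)"
  then have w: "Re w = x" "min a b <= Im w" "Im w <= max a b" using vertical_segment by auto
  then have "w \<in> X \<and> cmod (h w) <= B*exp (- dl * Re w)" using ab[OF w(2,3)] x by (intro strip) auto
  then show "(P has_field_derivative h w) (at w)" "cmod (h w) <= B*exp (- dl*x)" using P w by auto
 next
  fix x
  have "cmod (Complex x a - Complex x b) = \<bar>a - b\<bar>" by (simp add: cmod_def)
  then show "cmod (Complex x a - Complex x b) <= \<bar>a - b\<bar>*(1 + abs x)" by (simp add: distrib_left)
 qed
 have "((\<lambda>x. (P (Complex x c) - P (Complex x (- c))) - (P (Complex x c) - P (Complex x c')) +
   (P (Complex x (- c)) - P (Complex x (- c')))) \<longlongrightarrow> hairpin_integral l kp c h - 0 + 0) at_top" by (intro tendsto_intros L V) (use c in auto)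
 then have "((\<lambda>x. P (Complex x c') - P (Complex x (- c'))) \<longlongrightarrow> hairpin_integral l kp c h) at_top" by simp
 from tendsto_unique[OF _ this L(2)] show ?thesis by simp
qed

text \<open>If the integrand decays to the left as well, the left ends of the two horizontal lines
  can be joined by a vertical segment of vanishing contribution: the cap is pushed to
  -infinity.\<close>

lemma hairpin_integral_lines:
 assumes P: "\<And>w. w \<in> X ==> (P has_field_derivative h w) (at w)"
  and X: "\<And>t. hairpin l kp c t \<in> X" "\<And>t. Complex t c \<in> X" "\<And>t. Complex t (- c) \<in> X" "c >= 0"
  and int: "integrable lborel (\<lambda>t. hairpin_deriv kp c t*h (hairpin l kp c t))"
   "integrable lborel (\<lambda>t. h (Complex t c))" "integrable lborel (\<lambda>t. h (Complex t (- c)))"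
  and dl: "dl > 0" "B >= 0"
  and left: "\<And>w. abs (Im w) <= c ==> Re w <= - x0 ==> w \<in> X \<and> cmod (h w) <= B*exp (dl * Re w)"
 shows "hairpin_integral l kp c h = line_integral c h - line_integral (- c) h"
proof -
 have "((\<lambda>x. P (Complex (- x) c) - P (Complex (- x) (- c))) \<longlongrightarrow> 0) at_top"
 proof (rule primitive_difference_vanishes[OF dl, where L = "2*c" and P = P and h = h
    and u = "\<lambda>x. Complex (- x) c" and v = "\<lambda>x. Complex (- x) (- c)"])
  fix x w assume x: "x0 <= x" and "w \<in> closed_segment (Complex (- x) c) (Complex (- x) (- c))"
  then have w: "Re w = - x" "abs (Im w) <= c" using vertical_segment[of w "- x" c "- c"] X(4) by auto
  then have "w \<in> X \<and> cmod (h w) <= B*exp (dl * Re w)" using x by (intro left) auto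
  then show "(P has_field_derivative h w) (at w)" "cmod (h w) <= B*exp (- dl*x)" using P w by auto
 next
  fix x
  have "cmod (Complex (- x) c - Complex (- x) (- c)) = 2*c" using X(4) by (simp add: cmod_eq_Im)
  then show "cmod (Complex (- x) c - Complex (- x) (- c)) <= 2*c*(1 + abs x)" using X(4) by (simp add: distrib_left)
 qed
 moreover have "((\<lambda>x. P (Complex x c) - P (Complex (- x) c)) \<longlongrightarrow> line_integral c h) at_top"
  "((\<lambda>x. P (Complex x (- c)) - P (Complex (- x) (- c))) \<longlongrightarrow> line_integral (- c) h) at_top" using P X int by (auto intro!: line_integral_limit)
 ultimately have "((\<lambda>x. (P (Complex x c) - P (Complex (- x) c)) - (P (Complex x (- c)) - P (Complex (- x) (- c)))
   + (P (Complex (- x) c) - P (Complex (- x) (- c)))) \<longlongrightarrow> line_integral c h - line_integral (- c) h + 0) at_top" by (intro tendsto_intros)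
 then have "((\<lambda>x. P (Complex x c) - P (Complex x (- c))) \<longlongrightarrow> line_integral c h - line_integral (- c) h) at_top" by simp
 moreover have "((\<lambda>x. P (Complex x c) - P (Complex x (- c))) \<longlongrightarrow> hairpin_integral l kp c h) at_top"
  using P X int by (intro hairpin_integral_limit) auto
 ultimately show ?thesis using tendsto_unique by (metis trivial_limit_at_top_linorder)
qed

lemma line_integral_shift:
 assumes P: "\<And>w. Im w \<in> {min c c'..max c c'} ==> (P has_field_derivative h w) (at w)"
  and dl: "dl > 0" "B >= 0"
  and bound: "\<And>w. Im w \<in> {min c c'..max c c'} ==> cmod (h w) <= B*exp (- dl*abs (Re w))"
  and cont: "\<And>w. Im w \<in> {c, c'} ==> isCont h w"
 shows "line_integral c h = line_integral c' h"
proof -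
 have V: "((\<lambda>x. P (Complex (sg*x) c) - P (Complex (sg*x) c')) \<longlongrightarrow> 0) at_top" if sg: "abs sg = 1" for sg
 proof (rule primitive_difference_vanishes[OF dl, where L = "\<bar>c - c'\<bar>" and P = P and h = h
    and u = "\<lambda>x. Complex (sg*x) c" and v = "\<lambda>x. Complex (sg*x) c'"])
  fix x :: real and w assume x: "0 <= x" and "w \<in> closed_segment (Complex (sg*x) c) (Complex (sg*x) c')"
  then have w: "Re w = sg*x" "Im w \<in> {min c c'..max c c'}" using vertical_segment[of w] by auto
  then show "(P has_field_derivative h w) (at w)" "cmod (h w) <= B*exp (- dl*x)" using P[OF w(2)] bound[OF w(2)] sg x by (auto simp: abs_mult)
 next
  fix x
  have "cmod (Complex (sg*x) c - Complex (sg*x) c') = \<bar>c - c'\<bar>" by (simp add: cmod_def)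
  then show "cmod (Complex (sg*x) c - Complex (sg*x) c') <= \<bar>c - c'\<bar>*(1 + abs x)" by (simp add: distrib_left)
 qed
 have int: "integrable lborel (\<lambda>t. h (Complex t a))" if "a \<in> {c, c'}" for a
 proof (rule line_integrable(1)[OF _ _ dl(1)])
  show "cmod (h (Complex t a)) <= B*exp (- dl*abs t)" for t using bound[of "Complex t a"] that by auto
 qed (use cont that in auto)
 have L: "((\<lambda>x. P (Complex x a) - P (Complex (- x) a)) \<longlongrightarrow> line_integral a h) at_top" if "a \<in> {c, c'}" for a
  using that by (intro line_integral_limit P int) auto
 have "((\<lambda>x. (P (Complex x c') - P (Complex (- x) c')) + (P (Complex (1*x) c) - P (Complex (1*x) c'))
   - (P (Complex (- 1*x) c) - P (Complex (- 1*x) c'))) \<longlongrightarrow> line_integral c' h + 0 - 0) at_top" by (intro tendsto_intros L V) auto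
 then have "((\<lambda>x. P (Complex x c) - P (Complex (- x) c)) \<longlongrightarrow> line_integral c' h) at_top" by simp
 from tendsto_unique[OF _ L this] show ?thesis by simp
qed

section \<open>Integrals along rays\<close>

definition ray_integral :: "complex => complex => (complex => complex) => complex" where
 "ray_integral u d h = (\<integral>t. indicator {0<..} t *\<^sub>R (d*h (u + d * of_real t)) \<partial>lborel)"

lemma ray_integrable:
 assumes cont: "\<And>t. t > 0 ==> isCont h (u + d * of_real t)" and dl: "dl > 0"
  and bound: "\<And>t. t > 0 ==> cmod (h (u + d * of_real t)) <= B*exp (- dl*t)" and B: "B >= 0"
 shows "integrable lborel (\<lambda>t. indicator {0<..} t *\<^sub>R (d*h (u + d * of_real t)))"
  "cmod (ray_integral u d h) <= 2*(cmod d*B)/dl"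
proof -
 let ?f = "\<lambda>t::real. indicator {0<..} t *\<^sub>R (d*h (u + d * of_real t))"
 have c: "isCont ?f t" if t: "t \<notin> {0}" for t
 proof (cases "t > 0")
  case True
  have "\<forall>\<^sub>F s in nhds t. s \<in> {0<..}" using True by (intro eventually_nhds_in_open) auto
  then have *: "\<forall>\<^sub>F s in nhds t. ?f s = d*h (u + d * of_real s)" by eventually_elim simp
  have "isCont (\<lambda>s. d*h (u + d * of_real s)) t" by (intro continuous_intros isCont_o2[where f = "\<lambda>s. u + d * of_real s" and g = h] cont[OF True])
  then show ?thesis using * by (subst isCont_cong)
 next
  case False
  have "\<forall>\<^sub>F s in nhds t. s \<in> {..<0}" using False t by (intro eventually_nhds_in_open) auto
  then have *: "\<forall>\<^sub>F s in nhds t. ?f s = 0" by eventually_elim simp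
  show ?thesis by (subst isCont_cong[OF *]) simp
 qed
 have b: "cmod (?f t) <= cmod d*B*exp (- dl*\<bar>t - 0\<bar>)" for t
 proof (cases "t > 0")
  case True
  then show ?thesis using mult_left_mono[OF bound[OF True], of "cmod d"] by (simp add: norm_mult)
 qed (use B in simp)
 show "integrable lborel ?f" "cmod (ray_integral u d h) <= 2*(cmod d*B)/dl"
  unfolding ray_integral_def using exp_decay_integrable[of "{0}", OF _ c b dl] by simp_all
qed

lemma ray_integral_limit:
 assumes P: "\<And>t. t >= 0 ==> (P has_field_derivative h (u + d * of_real t)) (at (u + d * of_real t))"
  and int: "integrable lborel (\<lambda>t. indicator {0<..} t *\<^sub>R (d*h (u + d * of_real t)))"
 shows "((\<lambda>x. P (u + d * of_real x) - P u) \<longlongrightarrow> ray_integral u d h) at_top"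
proof -
 let ?\<gamma> = "\<lambda>t. u + d * of_real (max t 0)" and ?\<gamma>' = "\<lambda>t. indicator {0<..} t *\<^sub>R d"
 have eq: "?\<gamma>' t*h (?\<gamma> t) = indicator {0<..} t *\<^sub>R (d*h (u + d * of_real t))" for t by (simp add: indicator_def max_def)
 have "((\<lambda>T. P (?\<gamma> T) - P (?\<gamma> (- T))) \<longlongrightarrow> (\<integral>t. ?\<gamma>' t*h (?\<gamma> t) \<partial>lborel)) at_top"
 proof (rule path_integral_limit[of "{0}"])
  show "isCont ?\<gamma> t" for t by (intro continuous_intros)
  show "(?\<gamma> has_vector_derivative ?\<gamma>' t) (at t)" if t: "t \<notin> {0}" for t
  proof (cases "t > 0")
   case True
   have "((\<lambda>t. u + d * of_real t) has_vector_derivative d) (at t)" by (auto simp: has_vector_derivative_complex_iff intro!: derivative_eq_intros)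
   then have "(?\<gamma> has_vector_derivative d) (at t)" by (rule has_vector_derivative_transform_within_open[of _ _ _ "{0<..}"]) (use True in auto)
   then show ?thesis using True by simp
  next
   case False
   have "((\<lambda>t. u) has_vector_derivative 0) (at t)" by (rule has_vector_derivative_const)
   then have "(?\<gamma> has_vector_derivative 0) (at t)" by (rule has_vector_derivative_transform_within_open[of _ _ _ "{..<0}"]) (use False t in auto)
   then show ?thesis using False by simp
  qed
  show "(P has_field_derivative h (?\<gamma> t)) (at (?\<gamma> t))" for t by (rule P) simp
  show "integrable lborel (\<lambda>t. ?\<gamma>' t*h (?\<gamma> t))" unfolding eq by (rule int)
 qed simp
 then have "((\<lambda>T. P (?\<gamma> T) - P (?\<gamma> (- T))) \<longlongrightarrow> ray_integral u d h) at_top" unfolding eq ray_integral_def .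
 moreover have "\<forall>\<^sub>F x in at_top. P (?\<gamma> x) - P (?\<gamma> (- x)) = P (u + d * of_real x) - P u" using eventually_ge_at_top[of 0] by eventually_elim simp
 ultimately show ?thesis by (rule Lim_transform_eventually)
qed

text \<open>A horizontal ray is turned through a quadrant onto the downward ray. The integrand
  decays in r + q throughout the quadrant, and this sum is constant on the diagonal that joins the
  points at distance x on the two rays.\<close>

lemma ray_integral_rotate:
 assumes hol: "h holomorphic_on {w. Im w < 0}" and u: "Im u < 0" and sg: "sg \<in> {1, -1}" and dl: "dl > 0" "B >= 0"
  and bound: "\<And>r q. r >= 0 ==> q >= 0 ==> cmod (h (u + Complex (sg*r) (- q))) <= B*exp (- dl*(r + q))"
 shows "ray_integral u (of_real sg) h = ray_integral u (- \<i>) h"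
proof -
 have conv: "convex {w. Im w < 0}" and op: "open {w. Im w < 0}" by (rule convex_halfspace_Im_lt, rule open_halfspace_Im_lt)
 obtain P where P': "\<And>w. w \<in> {w. Im w < 0} ==> (P has_field_derivative h w) (at w within {w. Im w < 0})"
  using holomorphic_convex_primitive'[OF conv op hol] by blast
 have P: "(P has_field_derivative h w) (at w)" if "Im w < 0" for w using P'[of w] that op at_within_open by force
 have cont: "isCont h w" if "Im w < 0" for w using hol op that by (auto simp: continuous_on_eq_continuous_at dest!: holomorphic_on_imp_continuous_on)
 have e: "of_real sg * of_real x = Complex (sg*x) 0" "- \<i> * of_real x = Complex 0 (- x)" for x by (simp_all add: complex_eq_iff)
 have "integrable lborel (\<lambda>t. indicator {0<..} t *\<^sub>R (of_real sg*h (u + of_real sg * of_real t)))"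
  by (rule ray_integrable(1)[OF _ dl(1) _ dl(2)]) (use bound[of _ 0] u in \<open>auto simp: e intro!: cont\<close>)
 then have L1: "((\<lambda>x. P (u + of_real sg * of_real x) - P u) \<longlongrightarrow> ray_integral u (of_real sg) h) at_top"
  using u by (intro ray_integral_limit P) (auto simp: e)
 have "integrable lborel (\<lambda>t. indicator {0<..} t *\<^sub>R (- \<i>*h (u + - \<i> * of_real t)))"
  by (rule ray_integrable(1)[OF _ dl(1) _ dl(2)]) (use bound[of 0] u in \<open>auto simp only: e intro!: cont, auto simp: Complex_eq\<close>)
 then have L2: "((\<lambda>x. P (u + - \<i> * of_real x) - P u) \<longlongrightarrow> ray_integral u (- \<i>) h) at_top" using u by (intro ray_integral_limit P) (auto simp: e)
 have "((\<lambda>x. P (u + of_real sg * of_real x) - P (u + - \<i> * of_real x)) \<longlongrightarrow> 0) at_top"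
 proof (rule primitive_difference_vanishes[OF dl, where L = 2 and P = P and h = h
    and u = "\<lambda>x. u + of_real sg * of_real x" and v = "\<lambda>x. u + - \<i> * of_real x"])
  fix x :: real and w assume x: "0 <= x"
   and "w \<in> closed_segment (u + of_real sg * of_real x) (u + - \<i> * of_real x)"
  then obtain \<theta> where \<theta>: "0 <= \<theta>" "\<theta> <= 1" "w = (1 - \<theta>) *\<^sub>R (u + of_real sg * of_real x) + \<theta> *\<^sub>R (u + - \<i> * of_real x)" by (auto simp: in_segment)
  \<comment> \<open>On the diagonal r = (1 - \<theta>)*x and q = \<theta>*x, so that r + q =
    x.\<close>
  have w: "w = u + Complex (sg*((1 - \<theta>)*x)) (- (\<theta>*x))" using \<theta>(3) unfolding e by (simp add: complex_eq_iff algebra_simps)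
  have nn: "(1 - \<theta>)*x >= 0" "\<theta>*x >= 0" using \<theta> x by auto
  show "(P has_field_derivative h w) (at w)" using nn u by (intro P) (simp add: w)
  have "(1 - \<theta>)*x + \<theta>*x = x" by (simp add: algebra_simps)
  with bound[OF nn] show "cmod (h w) <= B*exp (- dl*x)" by (simp add: w)
 next
  fix x :: real assume x: "0 <= x"
  have "cmod (u + of_real sg * of_real x - (u + - \<i> * of_real x)) <= \<bar>sg*x\<bar> + abs x"
   using cmod_le[of "Complex (sg*x) x"] by (simp add: Complex_eq)
  also have "\<dots> <= 2*(1 + abs x)" using sg by (auto simp: abs_mult)
  finally show "cmod (u + of_real sg * of_real x - (u + - \<i> * of_real x)) <= 2*(1 + abs x)" .
 qed
 then have "((\<lambda>x. (P (u + of_real sg * of_real x) - P (u + - \<i> * of_real x)) + (P (u + - \<i> * of_real x) - P u))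
   \<longlongrightarrow> 0 + ray_integral u (- \<i>) h) at_top" by (intro tendsto_intros L2)
 then have "((\<lambda>x. P (u + of_real sg * of_real x) - P u) \<longlongrightarrow> ray_integral u (- \<i>) h) at_top" by simp
 from tendsto_unique[OF _ L1 this] show ?thesis by simp
qed

text \<open>Cauchy's formula on rectangles whose width tends to infinity. The pole at zt excludes a
  common primitive, so the horizontal sides use one primitive below and another above the height of
  zt, while the vertical sides V are estimated directly and vanish in the limit.\<close>

lemma strip_Cauchy_formula:
 assumes X: "open X" "convex X" and g: "g holomorphic_on X" and sub: "\<And>w. a <= Im w ==> Im w <= b ==> w \<in> X"
  and bound: "\<And>w. a <= Im w ==> Im w <= b ==> cmod (g w) <= B*exp (- dl*abs (Re w))"
  and dl: "dl > 0" "B >= 0" and zt: "a < Im zt" "Im zt < b"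
 shows "line_integral a (\<lambda>s. g s/(s - zt)) - line_integral b (\<lambda>s. g s/(s - zt)) = 2*pi*\<i>*g zt"
proof -
 define f where "f s = g s/(s - zt)" for s
 define d where "d = min (Im zt - a) (b - Im zt)"
 have d: "d > 0" using zt by (simp add: d_def)
 have hol: "f holomorphic_on X - {zt}" unfolding f_def by (intro holomorphic_intros holomorphic_on_subset[OF g]) auto
 have opn: "open (X - {zt})" using X(1) by auto
 have cont: "isCont f w" if "w \<in> X - {zt}" for w
  using hol opn that by (auto simp: continuous_on_eq_continuous_at dest!: holomorphic_on_imp_continuous_on)
 have fb: "cmod (f (Complex t c)) <= B/d*exp (- dl*abs t)" if "c \<in> {a, b}" for c t
 proof -
  have "d <= \<bar>Im (Complex t c - zt)\<bar>" using that zt by (auto simp: d_def)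
  also have "\<dots> <= cmod (Complex t c - zt)" by (rule abs_Im_le_cmod)
  finally have "d <= cmod (Complex t c - zt)" .
  moreover have "cmod (g (Complex t c)) <= B*exp (- dl*abs t)" using bound[of "Complex t c"] that zt by auto
  ultimately show ?thesis using d dl(2) unfolding f_def norm_divide by (simp add: frac_le)
 qed
 have int: "integrable lborel (\<lambda>t. f (Complex t c))" if "c \<in> {a, b}" for c
  by (rule line_integrable(1)[OF _ fb[OF that] dl(1)]) (use that zt in \<open>auto intro!: cont sub\<close>)
 have prim: "\<exists>P. \<forall>w\<in>Y. (P has_field_derivative f w) (at w)" if Y: "convex Y" "open Y" "Y \<subseteq> X - {zt}" for Y
 proof -
  obtain P where "\<And>w. w \<in> Y ==> (P has_field_derivative f w) (at w within Y)"
   using holomorphic_convex_primitive'[OF Y(1,2) holomorphic_on_subset[OF hol Y(3)]] by blast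
  then show ?thesis using at_within_open[OF _ Y(2)] by (intro exI[of _ P]) auto
 qed
 have 1: "convex (X \<inter> {w. Im w < Im zt})" "open (X \<inter> {w. Im w < Im zt})"
  "convex (X \<inter> {w. Im w > Im zt})" "open (X \<inter> {w. Im w > Im zt})"
  using X by (auto intro!: convex_Int open_Int convex_halfspace_Im_lt convex_halfspace_Im_gt open_halfspace_Im_lt open_halfspace_Im_gt)
 obtain P1 where P1: "\<And>w. w \<in> X ==> Im w < Im zt ==> (P1 has_field_derivative f w) (at w)" using prim[OF 1(1,2)] by auto
 obtain P2 where P2: "\<And>w. w \<in> X ==> Im w > Im zt ==> (P2 has_field_derivative f w) (at w)" using prim[OF 1(3,4)] by auto
 define V where "V x = contour_integral (linepath (Complex x a) (Complex x b)) f" for x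
 have seg: "Re w = x \<and> a <= Im w \<and> Im w <= b" if "w \<in> closed_segment (Complex x a) (Complex x b)" for w x using vertical_segment[OF that] zt by auto
 have vert: "f contour_integrable_on linepath (Complex x a) (Complex x b)"
  "f contour_integrable_on linepath (Complex x b) (Complex x a)"
  "contour_integral (linepath (Complex x b) (Complex x a)) f = - V x"
  "cmod (V x) <= B*exp (- dl*abs x)*(b - a)" if x: "abs x >= abs (Re zt) + 1" for x
 proof -
  have "continuous_on (closed_segment (Complex x a) (Complex x b)) f"
   using seg x by (intro continuous_at_imp_continuous_on ballI cont) (auto intro!: sub)
  then show 1: "f contour_integrable_on linepath (Complex x a) (Complex x b)"
   and "f contour_integrable_on linepath (Complex x b) (Complex x a)"
   and "contour_integral (linepath (Complex x b) (Complex x a)) f = - V x"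
   using contour_integral_reverse_linepath[of "Complex x a" "Complex x b" f]
   by (auto intro!: contour_integrable_continuous_linepath simp: closed_segment_commute V_def)
  have "cmod (f w) <= B*exp (- dl*abs x)" if "w \<in> closed_segment (Complex x a) (Complex x b)" for w
  proof -
   note w = seg[OF that]
   have "1 <= \<bar>Re (w - zt)\<bar>" using w x by auto
   then have "1 <= cmod (w - zt)" using abs_Re_le_cmod[of "w - zt"] by linarith
   moreover have "cmod (g w) <= B*exp (- dl*abs x)" using bound[of w] w by auto
   ultimately have "cmod (g w)/cmod (w - zt) <= B*exp (- dl*abs x)/1" using dl(2) by (intro frac_le) auto
   then show ?thesis by (simp add: f_def norm_divide)
  qed
  then have "cmod (V x) <= B*exp (- dl*abs x)*cmod (Complex x b - Complex x a)"
   unfolding V_def using dl(2) by (intro contour_integral_bound_linepath[OF 1]) auto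
  also have "cmod (Complex x b - Complex x a) = b - a" using zt by (simp add: cmod_eq_Im)
  finally show "cmod (V x) <= B*exp (- dl*abs x)*(b - a)" .
 qed
 have eq: "(P1 (Complex x a) - P1 (Complex (- x) a)) - (P2 (Complex x b) - P2 (Complex (- x) b))
   = 2*pi*\<i>*g zt - V x + V (- x)" if x: "x >= abs (Re zt) + 1" for x
 proof -
  let ?R = "rectpath (Complex (- x) a) (Complex x b)"
  have img: "path_image ?R \<subseteq> X - {zt}" using x zt by (subst path_image_rectpath) (auto intro!: sub)
  have "(f has_contour_integral (2*pi*\<i>*winding_number ?R zt*g zt)) ?R" unfolding f_def using X g x zt img
   by (intro Cauchy_integral_formula_convex_simple) (auto simp: interior_open intro!: sub)
  moreover have "winding_number ?R zt = 1" using x zt by (intro winding_number_rectpath) (auto simp: in_box_complex_iff)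
  ultimately have "contour_integral ?R f = 2*pi*\<i>*g zt" by (simp add: contour_integral_unique)
  moreover have h1: "(f has_contour_integral (P1 (Complex x a) - P1 (Complex (- x) a))) (linepath (Complex (- x) a) (Complex x a))"
  proof -
   have "(f has_contour_integral (P1 (pathfinish (linepath (Complex (- x) a) (Complex x a))) - P1 (pathstart (linepath (Complex (- x) a) (Complex x a)))))
     (linepath (Complex (- x) a) (Complex x a))"
   proof (rule contour_integral_primitive[where S = "closed_segment (Complex (- x) a) (Complex x a)"])
    fix w assume "w \<in> closed_segment (Complex (- x) a) (Complex x a)"
    then have "Im w = a" by (simp add: closed_segment_same_Im)
    then show "(P1 has_field_derivative f w) (at w within closed_segment (Complex (- x) a) (Complex x a))"
     using zt by (intro has_field_derivative_at_within[OF P1] sub) auto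
   qed auto
   then show ?thesis by simp
  qed
  have h3: "(f has_contour_integral (P2 (Complex (- x) b) - P2 (Complex x b))) (linepath (Complex x b) (Complex (- x) b))"
  proof -
   have "(f has_contour_integral (P2 (pathfinish (linepath (Complex x b) (Complex (- x) b))) - P2 (pathstart (linepath (Complex x b) (Complex (- x) b)))))
     (linepath (Complex x b) (Complex (- x) b))"
   proof (rule contour_integral_primitive[where S = "closed_segment (Complex x b) (Complex (- x) b)"])
    fix w assume "w \<in> closed_segment (Complex x b) (Complex (- x) b)"
    then have "Im w = b" by (simp add: closed_segment_same_Im)
    then show "(P2 has_field_derivative f w) (at w within closed_segment (Complex x b) (Complex (- x) b))"
     using zt by (intro has_field_derivative_at_within[OF P2] sub) auto
   qed auto
   then show ?thesis by simp
  qed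
  have "contour_integral ?R f = (P1 (Complex x a) - P1 (Complex (- x) a)) + (V x + ((P2 (Complex (- x) b) - P2 (Complex x b)) + - V (- x)))"
  proof (rule contour_integral_unique)
   have h2: "(f has_contour_integral V x) (linepath (Complex x a) (Complex x b))"
    unfolding V_def using vert(1)[of x] x by (intro has_contour_integral_integral) auto
   have h4: "(f has_contour_integral - V (- x)) (linepath (Complex (- x) b) (Complex (- x) a))"
    using vert(2,3)[of "- x"] x has_contour_integral_integral by fastforce
   show "(f has_contour_integral (P1 (Complex x a) - P1 (Complex (- x) a)) + (V x + ((P2 (Complex (- x) b) - P2 (Complex x b)) + - V (- x)))) ?R"
    unfolding rectpath_def Let_def complex.sel by (intro has_contour_integral_join h1 h2 h3 h4) auto
  qed
  ultimately show ?thesis by (simp add: algebra_simps)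
 qed
 have V0: "((\<lambda>x. V (sg*x)) \<longlongrightarrow> 0) at_top" if sg: "abs sg = 1" for sg
 proof (rule Lim_null_comparison)
  show "((\<lambda>x. B*(b - a)*exp (- dl*x)) \<longlongrightarrow> 0) at_top" by (intro tendsto_mult_right_zero exp_decay_tendsto dl)
  show "\<forall>\<^sub>F x in at_top. norm (V (sg*x)) <= B*(b - a)*exp (- dl*x)" using eventually_ge_at_top[of "abs (Re zt) + 1"]
  proof eventually_elim
   fix x assume x: "abs (Re zt) + 1 <= x"
   then have "\<bar>sg*x\<bar> = x" using sg by (simp add: abs_mult)
   with vert(4)[of "sg*x"] x show "norm (V (sg*x)) <= B*(b - a)*exp (- dl*x)" by (simp add: mult_ac)
  qed
 qed
 have "((\<lambda>x. 2*pi*\<i>*g zt - V (1*x) + V (- 1*x)) \<longlongrightarrow> 2*pi*\<i>*g zt - 0 + 0) at_top" by (intro tendsto_intros V0) auto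
 moreover have "\<forall>\<^sub>F x in at_top. 2*pi*\<i>*g zt - V (1*x) + V (- 1*x) =
   (P1 (Complex x a) - P1 (Complex (- x) a)) - (P2 (Complex x b) - P2 (Complex (- x) b))"
  using eventually_ge_at_top[of "abs (Re zt) + 1"] by eventually_elim (simp add: eq)
 ultimately have "((\<lambda>x. (P1 (Complex x a) - P1 (Complex (- x) a)) - (P2 (Complex x b) - P2 (Complex (- x) b)))
   \<longlongrightarrow> 2*pi*\<i>*g zt - 0 + 0) at_top" by (rule Lim_transform_eventually)
 moreover have "((\<lambda>x. (P1 (Complex x a) - P1 (Complex (- x) a)) - (P2 (Complex x b) - P2 (Complex (- x) b)))
   \<longlongrightarrow> line_integral a f - line_integral b f) at_top" using zt by (intro tendsto_diff line_integral_limit P1 P2 int sub) auto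
 ultimately have "line_integral a f - line_integral b f = 2*pi*\<i>*g zt - 0 + 0"
  by (rule tendsto_unique[OF trivial_limit_at_top_linorder, rotated])
 then show ?thesis by (simp add: f_def[abs_def])
qed

text \<open>Provides joint integrability for the exchanges of integrals below, where the integrand
  is always dominated by a product of two exponentials.\<close>

lemma integrable_product_bound:
 fixes f :: "real \<times> real => complex"
 assumes meas: "f \<in> borel_measurable borel"
  and u: "integrable lborel u" and v: "integrable lborel v"
  and bound: "\<And>x y. cmod (f (x, y)) <= u x * v y"
 shows "integrable (lborel \<Otimes>\<^sub>M lborel) f"
proof -
 have f: "f \<in> borel_measurable (lborel \<Otimes>\<^sub>M lborel)" using meas by (simp add: lborel_prod)
 have le: "cmod (f (x, y)) <= \<bar>u x\<bar>*\<bar>v y\<bar>" for x y using bound[of x y] by (metis abs_ge_self abs_mult order_trans)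
 have fx: "integrable lborel (\<lambda>y. f (x, y))" for x
 proof (rule Bochner_Integration.integrable_bound[of _ "\<lambda>y. \<bar>u x\<bar>*\<bar>v y\<bar>"])
  show "(\<lambda>y. f (x, y)) \<in> borel_measurable lborel" using f by measurable
 qed (use v le in \<open>auto intro!: integrable_mult_right integrable_abs\<close>)
 show ?thesis
 proof (rule lborel_pair.Fubini_integrable[OF f])
  show "integrable lborel (\<lambda>x. \<integral>y. norm (f (x, y)) \<partial>lborel)"
  proof (rule Bochner_Integration.integrable_bound)
   show "integrable lborel (\<lambda>x. \<bar>u x\<bar>*(\<integral>y. \<bar>v y\<bar> \<partial>lborel))" using u by (intro integrable_mult_left integrable_abs)
   show "(\<lambda>x. \<integral>y. norm (f (x, y)) \<partial>lborel) \<in> borel_measurable lborel" using f by measurable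
   show "AE x in lborel. norm (\<integral>y. norm (f (x, y)) \<partial>lborel) <= norm (\<bar>u x\<bar>*(\<integral>y. \<bar>v y\<bar> \<partial>lborel))"
   proof (rule AE_I2)
    fix x
    have "(\<integral>y. norm (f (x, y)) \<partial>lborel) <= (\<integral>y. \<bar>u x\<bar>*\<bar>v y\<bar> \<partial>lborel)"
     using fx v le by (intro integral_mono integrable_norm integrable_mult_right integrable_abs) auto
    then show "norm (\<integral>y. norm (f (x, y)) \<partial>lborel) <= norm (\<bar>u x\<bar>*(\<integral>y. \<bar>v y\<bar> \<partial>lborel))" by (simp add: abs_mult)
   qed
  qed
 qed (use fx in auto)
qed

section \<open>A smooth step function and the Gaussian kernel\<close>

text \<open>Completing the square in (Re w + sg*R/2)^2 >= 0 trades the Gaussian for an exponential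
  of any prescribed rate R, on either side according to sg.\<close>

lemma cmod_exp_minus_square:
 assumes "abs (Im w) <= Y" "abs sg = 1"
 shows "cmod (exp (- w\<^sup>2)) <= exp (Y\<^sup>2 + R\<^sup>2/4)*exp (R*(sg * Re w))"
proof -
 have "0 <= (Re w + sg * R/2)\<^sup>2" by simp
 moreover have "sg\<^sup>2 = 1" using assms(2) by (metis abs_one power2_abs one_power2)
 ultimately have "- (Re w)\<^sup>2 <= R\<^sup>2/4 + R*(sg * Re w)" by (simp add: power2_sum power_mult_distrib power_divide algebra_simps)
 moreover have "(Im w)\<^sup>2 <= Y\<^sup>2" using assms(1) by (metis abs_ge_zero power2_abs power_mono)
 ultimately have "(Im w)\<^sup>2 - (Re w)\<^sup>2 <= Y\<^sup>2 + R\<^sup>2/4 + R*(sg * Re w)" by linarith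
 then show ?thesis by (simp add: norm_exp_eq_Re power2_eq_square flip: exp_add)
qed

text \<open>The number sqrt pi, kept as an integral because it serves to normalise.\<close>

definition gauss_total :: real where
 "gauss_total = (\<integral>t. exp (- t\<^sup>2) \<partial>lborel)"

lemma gauss_integrable: "integrable lborel (\<lambda>t::real. exp (- t\<^sup>2))"
proof (rule Bochner_Integration.integrable_bound)
 show "integrable lborel (\<lambda>t::real. exp 1*exp (- 1*abs t))" using has_bochner_integral_exp_abs[of 1] by (auto simp: has_bochner_integral_iff)
 have "exp (- t\<^sup>2) <= exp (1 + - 1*abs t)" for t :: real
 proof -
  have "0 <= (abs t - 1/2)\<^sup>2" by simp
  then have "- t\<^sup>2 <= 1 + - 1*abs t" by (simp add: power2_diff power_divide)
  then show ?thesis by simp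
 qed
 then show "AE t::real in lborel. norm (exp (- t\<^sup>2)) <= norm (exp 1*exp (- 1*abs t))" unfolding exp_add by (intro AE_I2) auto
qed auto

lemma gauss_total_pos: "gauss_total > 0"
proof -
 have "(\<integral>t. indicator {0..1::real} t *\<^sub>R exp (-1) \<partial>lborel) <= gauss_total" unfolding gauss_total_def
 proof (rule integral_mono[OF _ gauss_integrable])
  show "integrable lborel (\<lambda>t::real. indicator {0..1::real} t *\<^sub>R exp (- 1::real))" by (intro integrable_scaleR_left integrable_real_indicator) auto
  show "indicator {0..1} t *\<^sub>R exp (- 1) <= exp (- t\<^sup>2)" for t :: real using power_le_one[of t 2] by (auto simp: indicator_def)
 qed
 moreover have "(\<integral>t. indicator {0..1::real} t *\<^sub>R exp (-1::real) \<partial>lborel) = exp (-1)" by simp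
 ultimately show ?thesis using exp_gt_zero[of "-1::real"] by linarith
qed

lemma gauss_primitive: "\<exists>P. \<forall>w::complex. (P has_field_derivative exp (- w\<^sup>2)) (at w)"
proof -
 have "(\<lambda>w::complex. exp (- w\<^sup>2)) holomorphic_on UNIV" by (intro holomorphic_intros)
 from holomorphic_convex_primitive'[OF convex_UNIV open_UNIV this]
 show ?thesis by (metis UNIV_I)
qed

lemma line_integral_gauss: "line_integral c (\<lambda>s. exp (- s\<^sup>2)) = of_real gauss_total"
proof -
 let ?h = "\<lambda>s::complex. exp (- s\<^sup>2)"
 obtain P where P: "\<And>w. (P has_field_derivative ?h w) (at w)" using gauss_primitive by blast
 have "line_integral c ?h = line_integral 0 ?h"
 proof (rule line_integral_shift[OF P])
  fix w assume "Im w \<in> {min c 0..max c 0}"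
  then have "abs (Im w) <= abs c" by auto
  then show "cmod (?h w) <= exp ((abs c)\<^sup>2 + 1\<^sup>2/4)*exp (- 1*abs (Re w))"
   using cmod_exp_minus_square[of w "abs c" 1 1] cmod_exp_minus_square[of w "abs c" "-1" 1] by (cases "Re w >= 0") auto
 qed (auto intro!: continuous_intros)
 also have "\<dots> = (\<integral>t. of_real (exp (- t\<^sup>2)) \<partial>lborel)"
  unfolding line_integral_def by (intro Bochner_Integration.integral_cong) (auto simp: complex_of_real_def[symmetric] exp_of_real[symmetric])
 also have "\<dots> = of_real gauss_total" unfolding gauss_total_def by simp
 finally show ?thesis .
qed

text \<open>Take m = (P - l 1)/gauss_total with an entire primitive P of the Gaussian and its limit
  l 1 at -infinity. The limit l (-1) at +infinity exceeds l 1 by the total mass, so m and m - 1 are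
  left and right tails of the Gaussian integral, and tails inherit decay at every exponential
  rate.\<close>

lemma smooth_step_exists:
 "\<exists>m. (\<forall>s. (m has_field_derivative exp (- s\<^sup>2) / of_real gauss_total) (at s)) \<and>
  (\<forall>R>0. \<forall>Y. \<exists>C\<ge>0. \<forall>s. abs (Im s) <= Y \<longrightarrow> cmod (m s) <= C*exp (R * Re s) \<and> cmod (m s - 1) <= C*exp (- R * Re s))"
proof -
 let ?h = "\<lambda>s::complex. exp (- s\<^sup>2)" and ?N = gauss_total
 obtain P where P: "\<And>w. (P has_field_derivative ?h w) (at w)" using gauss_primitive by blast
 \<comment> \<open>The sign sg = 1 belongs to the ray towards -infinity, sg = -1 to the ray towards
   +infinity.\<close>
 have ray: "integrable lborel (\<lambda>t. indicator {0<..} t *\<^sub>R (- of_real sg*?h (s + - of_real sg * of_real t)))"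
  "cmod (ray_integral s (- of_real sg) ?h) <= 2*(exp (Y\<^sup>2 + R\<^sup>2/4)*exp (R*(sg * Re s))) / R"
  if sg: "abs sg = 1" and "R > 0" "abs (Im s) <= Y" for sg R Y s
 proof -
  have b: "cmod (?h (s + - of_real sg * of_real t)) <= exp (Y\<^sup>2 + R\<^sup>2/4)*exp (R*(sg * Re s))*exp (- R*t)" for t
  proof -
   have "sg * sg = 1" using sg by (metis abs_mult_self_eq mult_1)
   then have "sg * Re (s + - of_real sg * of_real t) = sg * Re s - t" by (simp add: algebra_simps)
   moreover have "exp (R*(sg * Re s - t)) = exp (R*(sg * Re s))*exp (- R*t)" by (simp add: right_diff_distrib flip: exp_add)
   moreover have "\<bar>Im (s + - of_real sg * of_real t)\<bar> <= Y" using that(3) by simp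
   ultimately show ?thesis using cmod_exp_minus_square[of "s + - of_real sg * of_real t" Y sg R] sg by (simp only: mult.assoc)
  qed
  have c: "isCont ?h (s + - of_real sg * of_real t)" for t by (intro continuous_intros)
  show "integrable lborel (\<lambda>t. indicator {0<..} t *\<^sub>R (- of_real sg*?h (s + - of_real sg * of_real t)))"
   by (rule ray_integrable(1)[OF c that(2) b]) simp
  have "cmod (ray_integral s (- of_real sg) ?h) <=
    2*(cmod (- of_real sg)*(exp (Y\<^sup>2 + R\<^sup>2/4)*exp (R*(sg * Re s)))) / R" by (rule ray_integrable(2)[OF c that(2) b]) simp
  then show "cmod (ray_integral s (- of_real sg) ?h) <= 2*(exp (Y\<^sup>2 + R\<^sup>2/4)*exp (R*(sg * Re s))) / R" using sg by simp
 qed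
 have L: "((\<lambda>x. P (s + - of_real sg * of_real x)) \<longlongrightarrow> P s + ray_integral s (- of_real sg) ?h) at_top"
  if "abs sg = 1" for sg s
 proof -
  have "((\<lambda>x. P (s + - of_real sg * of_real x) - P s) \<longlongrightarrow> ray_integral s (- of_real sg) ?h) at_top"
   using ray(1)[OF that, of 1 s "abs (Im s)"] by (intro ray_integral_limit P) auto
  from tendsto_add[OF this tendsto_const[of "P s"]] show ?thesis by (simp add: add.commute)
 qed
 define l where "l sg = P 0 + ray_integral 0 (- of_real sg) ?h" for sg
 \<comment> \<open>The limit of P along the ray does not depend on the starting point: the values
   along the rays from s and from 0 are compared on segments of constant length.\<close>
 have l: "P s + ray_integral s (- of_real sg) ?h = l sg" if sg: "abs sg = 1" for sg s
 proof -
  have "((\<lambda>x. P (s + - of_real sg * of_real x) - P (0 + - of_real sg * of_real x)) \<longlongrightarrow> 0) at_top"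
  proof (rule primitive_difference_vanishes[where dl = 1 and B = "exp ((abs (Im s))\<^sup>2 + 1\<^sup>2/4)*exp (abs (Re s))" and L = "cmod s" and P = P and h = ?h
    and u = "\<lambda>x. s + - of_real sg * of_real x" and v = "\<lambda>x. 0 + - of_real sg * of_real x"])
   fix x :: real and w assume x: "0 <= x" and "w \<in> closed_segment (s + - of_real sg * of_real x) (0 + - of_real sg * of_real x)"
   then obtain \<theta> where \<theta>: "0 <= \<theta>" "\<theta> <= 1" "w = (1 - \<theta>) *\<^sub>R (s + - of_real sg * of_real x) + \<theta> *\<^sub>R (0 + - of_real sg * of_real x)"
    by (auto simp: in_segment)
   have w: "w = of_real (1 - \<theta>) * s - of_real (sg*x)" using \<theta>(3) by (simp add: scaleR_conv_of_real algebra_simps)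
   have "\<bar>1 - \<theta>\<bar>*abs (Im s) <= 1*abs (Im s)" using \<theta> by (intro mult_right_mono) auto
   then have 1: "abs (Im w) <= abs (Im s)" by (simp add: w abs_mult)
   have "sg * sg = 1" using sg by (metis abs_mult_self_eq mult_1)
   then have "sg * Re w = sg*((1 - \<theta>) * Re s) - x" by (simp add: w algebra_simps)
   moreover have "sg*((1 - \<theta>) * Re s) <= abs sg*(\<bar>1 - \<theta>\<bar>*abs (Re s))" by (simp flip: abs_mult)
   moreover have "\<bar>1 - \<theta>\<bar>*abs (Re s) <= 1*abs (Re s)" using \<theta> by (intro mult_right_mono) auto
   ultimately have 2: "sg * Re w <= abs (Re s) - x" using sg by simp
   have "cmod (?h w) <= exp ((abs (Im s))\<^sup>2 + 1\<^sup>2/4)*exp (1*(sg * Re w))" by (rule cmod_exp_minus_square[OF 1 sg])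
   also have "\<dots> <= exp ((abs (Im s))\<^sup>2 + 1\<^sup>2/4)*exp (abs (Re s) - x)" using 2 by (intro mult_left_mono) auto
   finally show "cmod (?h w) <= exp ((abs (Im s))\<^sup>2 + 1\<^sup>2/4)*exp (abs (Re s))*exp (- 1*x)" by (simp add: mult.assoc mult_exp_exp)
  next
   fix x :: real
   show "cmod (s + - of_real sg * of_real x - (0 + - of_real sg * of_real x)) <= cmod s*(1 + abs x)" by (simp add: distrib_left)
  qed (use P in auto)
  from tendsto_add[OF this L[OF sg, of 0]]
  have "((\<lambda>x. P (s + - of_real sg * of_real x)) \<longlongrightarrow> l sg) at_top" by (simp add: l_def)
  from tendsto_unique[OF _ L[OF sg] this] show ?thesis by simp
 qed
 have N: "l (-1) - l 1 = of_real ?N"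
 proof -
  have "((\<lambda>x. P (Complex x 0) - P (Complex (- x) 0)) \<longlongrightarrow> line_integral 0 ?h) at_top"
  proof (rule line_integral_limit[OF P])
   have "(\<lambda>t. ?h (Complex t 0)) = (\<lambda>t. complex_of_real (exp (- t\<^sup>2)))" by (auto simp: complex_of_real_def[symmetric] exp_of_real[symmetric])
   then show "integrable lborel (\<lambda>t. ?h (Complex t 0))" using gauss_integrable by simp
  qed
  moreover have "((\<lambda>x. P (0 + - of_real (- 1) * of_real x) - P (0 + - of_real 1 * of_real x)) \<longlongrightarrow> l (-1) - l 1) at_top"
   unfolding l_def by (intro tendsto_diff L) auto
  then have "((\<lambda>x. P (Complex x 0) - P (Complex (- x) 0)) \<longlongrightarrow> l (-1) - l 1) at_top" by (simp add: complex_of_real_def[symmetric])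
  ultimately have "l (-1) - l 1 = line_integral 0 ?h" by (rule tendsto_unique[OF trivial_limit_at_top_linorder, rotated])
  then show ?thesis by (simp add: line_integral_gauss)
 qed
 define m where "m s = (P s - l 1) / of_real ?N" for s
 have N0: "complex_of_real ?N ~= 0" using gauss_total_pos by simp
 have m1: "m s = - ray_integral s (- of_real 1) ?h / of_real ?N" for s using l[of 1 s, symmetric] by (simp add: m_def)
 have m2: "m s - 1 = - ray_integral s (- of_real (- 1)) ?h / of_real ?N" for s
 proof -
  have "m s - 1 = (P s - l (- 1)) / of_real ?N" unfolding m_def using N N0 by (simp add: field_simps)
  then show ?thesis using l[of "- 1" s, symmetric] by simp
 qed
 show ?thesis
 proof (intro exI[of _ m] conjI allI impI)
  show "(m has_field_derivative exp (- s\<^sup>2) / of_real ?N) (at s)" for s unfolding m_def using N0 by (auto intro!: derivative_eq_intros P)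
  fix R Y :: real assume R: "0 < R"
  let ?C = "2*exp (Y\<^sup>2 + R\<^sup>2/4) / R/?N"
  have "cmod (m s) <= ?C*exp (R * Re s) \<and> cmod (m s - 1) <= ?C*exp (- R * Re s)" if "abs (Im s) <= Y" for s
  proof -
   have "cmod (m s) = cmod (ray_integral s (- of_real 1) ?h)/?N"
    "cmod (m s - 1) = cmod (ray_integral s (- of_real (- 1)) ?h)/?N" unfolding m2 using gauss_total_pos by (simp_all add: m1 norm_divide)
   moreover have "cmod (ray_integral s (- of_real 1) ?h)/?N <= 2*(exp (Y\<^sup>2 + R\<^sup>2/4)*exp (R*(1 * Re s))) / R/?N"
    by (intro divide_right_mono ray(2)) (use R that gauss_total_pos in auto)
   moreover have "cmod (ray_integral s (- of_real (- 1)) ?h)/?N <= 2*(exp (Y\<^sup>2 + R\<^sup>2/4)*exp (R*(- 1 * Re s))) / R/?N"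
    by (intro divide_right_mono ray(2)) (use R that gauss_total_pos in auto)
   ultimately show ?thesis by simp
  qed
  then show "\<exists>C\<ge>0. \<forall>s. abs (Im s) <= Y \<longrightarrow> cmod (m s) <= C*exp (R * Re s) \<and> cmod (m s - 1) <= C*exp (- R * Re s)"
   using R gauss_total_pos by (intro exI[of _ ?C]) auto
 qed
qed

text \<open>This is (1 + erf s)/2: the derivative determines it up to a constant, and the decay on
  the left determines the constant.\<close>

definition smooth_step :: "complex => complex" where
 "smooth_step = (SOME m. (\<forall>s. (m has_field_derivative exp (- s\<^sup>2) / of_real gauss_total) (at s)) \<and>
  (\<forall>R>0. \<forall>Y. \<exists>C\<ge>0. \<forall>s. abs (Im s) <= Y \<longrightarrow> cmod (m s) <= C*exp (R * Re s) \<and> cmod (m s - 1) <= C*exp (- R * Re s)))"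

lemma smooth_step_deriv: "(smooth_step has_field_derivative exp (- s\<^sup>2) / of_real gauss_total) (at s)"
 and smooth_step_bound: "R > 0 ==> \<exists>C\<ge>0. \<forall>s. abs (Im s) <= Y \<longrightarrow>
  cmod (smooth_step s) <= C*exp (R * Re s) \<and> cmod (smooth_step s - 1) <= C*exp (- R * Re s)"
 using someI_ex[OF smooth_step_exists] by (simp_all add: smooth_step_def)

text \<open>The multiplier \<open>mu sg\<close> decays faster than exponentially on the side \<open>sg * Re s \<longrightarrow> - \<infinity>\<close>. The
 inverse transform uses \<open>mu 1\<close> above and \<open>mu (-1)\<close> below the real axis; that the two differ by a
 constant makes the resulting functions continue each other to the left of \<open>a\<close>.\<close>

definition mu :: "real => complex => complex" where
 "mu sg s = (if sg > 0 then smooth_step s else smooth_step s - 1)"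

lemma mu_deriv: "(mu sg has_field_derivative exp (- s\<^sup>2) / of_real gauss_total) (at s)"
proof (cases "sg > 0")
 case True
 then have "mu sg = smooth_step" by (auto simp: mu_def)
 then show ?thesis using smooth_step_deriv by simp
next
 case False
 then have "mu sg = (\<lambda>s. smooth_step s - 1)" by (auto simp: mu_def)
 then show ?thesis using DERIV_diff[OF smooth_step_deriv DERIV_const] by simp
qed

lemma mu_holomorphic: "mu sg holomorphic_on X"
 using mu_deriv by (auto simp: holomorphic_on_def field_differentiable_def intro: has_field_derivative_at_within)

lemma isCont_mu: "isCont (mu sg) s" by (rule DERIV_isCont[OF mu_deriv])

text \<open>On the side where the multiplier does not decay it differs by 1 from the other
  multiplier, which decays there; hence boundedness. One constant serves both estimates.\<close>

lemma mu_bound: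
 assumes "R > 0" "abs sg = 1"
 shows "\<exists>C\<ge>0. \<forall>s. abs (Im s) <= Y \<longrightarrow> cmod (mu sg s) <= C*exp (R*(sg * Re s)) \<and> cmod (mu sg s) <= C"
proof -
 obtain C where C: "C >= 0" "\<And>s. abs (Im s) <= Y ==> cmod (smooth_step s) <= C*exp (R * Re s)"
  "\<And>s. abs (Im s) <= Y ==> cmod (smooth_step s - 1) <= C*exp (- R * Re s)" using smooth_step_bound[OF assms(1)] by metis
 have "cmod (mu sg s) <= (1 + C)*exp (R*(sg * Re s)) \<and> cmod (mu sg s) <= 1 + C" if "abs (Im s) <= Y" for s
 proof -
  have e: "C*exp (- R*abs (Re s)) <= C*1" using C(1) assms(1) by (intro mult_left_mono) auto
  have n: "cmod (smooth_step s) <= 1 + cmod (smooth_step s - 1)" "cmod (smooth_step s - 1) <= 1 + cmod (smooth_step s)"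
   using norm_triangle_ineq[of "smooth_step s - 1" 1] norm_triangle_ineq4[of "smooth_step s" 1] by auto
  have g: "C*x <= (1 + C)*x" if "x >= 0" for x using that C(1) by (simp add: distrib_right)
  consider "sg = 1" | "sg = -1" using assms(2) by linarith
  then show ?thesis
  proof cases
   case 1
   have "cmod (smooth_step s) <= 1 + C"
   proof (cases "Re s <= 0")
    case True
    then show ?thesis using C(2)[OF that] e by simp
   next
    case False
    then show ?thesis using C(3)[OF that] e n(1) by simp
   qed
   moreover have "cmod (smooth_step s) <= (1 + C)*exp (R * Re s)" by (rule order_trans[OF C(2)[OF that] g[OF exp_ge_zero]])
   ultimately show ?thesis using 1 by (simp add: mu_def)
  next
   case 2
   have "cmod (smooth_step s - 1) <= 1 + C"
   proof (cases "Re s <= 0")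
    case True
    then show ?thesis using C(2)[OF that] e n(2) by simp
   next
    case False
    then show ?thesis using C(3)[OF that] e by simp
   qed
   moreover have "cmod (smooth_step s - 1) <= (1 + C)*exp (- R * Re s)" by (rule order_trans[OF C(3)[OF that] g[OF exp_ge_zero]])
   ultimately show ?thesis using 2 by (simp add: mu_def)
  qed
 qed
 then show ?thesis using C(1) by (intro exI[of _ "1 + C"]) auto
qed

text \<open>Where exp(i u s) decays, boundedness of the multiplier suffices. On the other side the
  exponential grows at a rate of at most H, and the multiplier is taken to decay at rate 2H, so at
  least the rate abs (Im u) is left over.\<close>

lemma mu_exp_bound:
 assumes "abs sg = 1"
 shows "\<exists>C\<ge>0. \<forall>s u. abs (Im s) <= Y \<longrightarrow> 0 < sg*Im u \<longrightarrow> (abs (Im u)) <= H \<longrightarrow>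
  cmod (mu sg s*exp (\<i>*u * s)) <= C*exp (- (Re u*Im s))*exp (- abs (Im u)*abs (Re s))"
proof (cases "H > 0")
 case False
 then have "\<not> (0 < sg*Im u \<and> abs (Im u) <= H)" for u
  by (metis abs_ge_zero abs_zero linorder_not_less mult_zero_right nle_le order_less_irrefl zero_less_abs_iff order_less_le_trans)
 then show ?thesis by (intro exI[of _ 0]) auto
next
 case True
 then have "2*H > 0" by simp
 then obtain C where C: "C >= 0" "\<And>s. abs (Im s) <= Y ==> cmod (mu sg s) <= C*exp (2*H*(sg * Re s))"
  "\<And>s. abs (Im s) <= Y ==> cmod (mu sg s) <= C" using mu_bound[OF _ assms, of "2*H" Y] by metis
 have "cmod (mu sg s*exp (\<i>*u * s)) <= C*exp (- (Re u*Im s))*exp (- abs (Im u)*abs (Re s))"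
  if s: "abs (Im s) <= Y" and u: "0 < sg*Im u" "abs (Im u) <= H" for s u
 proof -
  have e: "cmod (exp (\<i>*u * s)) = exp (- (Re u*Im s))*exp (- (Im u * Re s))" by (simp add: norm_exp_eq_Re flip: exp_add)
  have Imu: "Im u = sg*abs (Im u)" using u(1) assms by (auto simp: abs_if zero_less_mult_iff split: if_splits)
  have "cmod (mu sg s)*exp (- (Im u * Re s)) <= C*exp (- abs (Im u)*abs (Re s))"
  proof (cases "sg * Re s >= 0")
   case True
   then have "sg * Re s = abs (Re s)" using assms by (metis abs_mult abs_of_nonneg mult_1)
   then have "Im u * Re s = abs (Im u)*abs (Re s)" using Imu by (metis mult.assoc mult.commute)
   then show ?thesis using C(3)[OF s] by (simp add: mult_right_mono)
  next
   case False
   then have r: "sg * Re s = - abs (Re s)" using assms by (metis abs_mult abs_of_neg linorder_not_le minus_minus mult_1)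
   then have i: "Im u * Re s = - (abs (Im u)*abs (Re s))" using Imu by (metis mult.assoc mult.commute mult_minus_right)
   have "cmod (mu sg s)*exp (- (Im u * Re s)) <= (C*exp (2*H*(sg * Re s)))*exp (- (Im u * Re s))"
    using C(2)[OF s] by (intro mult_right_mono) auto
   also have "\<dots> = C*exp (- (2*H - abs (Im u))*abs (Re s))" unfolding r i by (simp add: mult.assoc algebra_simps flip: exp_add)
   also have "\<dots> <= C*exp (- abs (Im u)*abs (Re s))"
   proof (intro mult_left_mono C)
    have "abs (Im u)*abs (Re s) <= (2*H - abs (Im u))*abs (Re s)" using u by (intro mult_right_mono) auto
    then show "exp (- (2*H - abs (Im u))*abs (Re s)) <= exp (- abs (Im u)*abs (Re s))"
     unfolding exp_le_cancel_iff mult_minus_left by (rule le_imp_neg_le)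
   qed
   finally show ?thesis .
  qed
  then have "exp (- (Re u*Im s))*(cmod (mu sg s)*exp (- (Im u * Re s))) <= exp (- (Re u*Im s))*(C*exp (- abs (Im u)*abs (Re s)))"
   by (intro mult_left_mono) auto
  moreover have "cmod (mu sg s*exp (\<i>*u * s)) = exp (- (Re u*Im s))*(cmod (mu sg s)*exp (- (Im u * Re s)))"
   unfolding norm_mult[of "mu sg s"] e by simp
  ultimately show ?thesis by (simp only: mult_ac)
 qed
 then show ?thesis using C(1) by (intro exI[of _ C]) auto
qed

text \<open>Completing the square shifts the line to height c - Re u/2 and translates it by Im u/2;
  the Gaussian integral is the same on every horizontal line.\<close>

lemma gauss_fourier:
 "integrable lborel (\<lambda>t. exp (- (Complex t c)\<^sup>2)*exp (\<i>*u*Complex t c))"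
 "line_integral c (\<lambda>s. exp (- s\<^sup>2)*exp (\<i>*u * s)) = of_real gauss_total*exp (- u\<^sup>2/4)"
proof -
 have b: "cmod (exp (- (Complex t c)\<^sup>2)*exp (\<i>*u*Complex t c)) <=
   exp (c\<^sup>2 + (abs (Im u) + 1)\<^sup>2/4)*exp (- (Re u*c))*exp (- 1*abs t)" for t
 proof -
  have "cmod (exp (- (Complex t c)\<^sup>2)) <= exp (c\<^sup>2 + (abs (Im u) + 1)\<^sup>2/4)*exp ((abs (Im u) + 1)*- abs t)"
   using cmod_exp_minus_square[of "Complex t c" "abs c" 1 "abs (Im u) + 1"]
    cmod_exp_minus_square[of "Complex t c" "abs c" "-1" "abs (Im u) + 1"] by (cases "t >= 0") auto
  moreover have "cmod (exp (\<i>*u*Complex t c)) <= exp (- (Re u*c))*exp (abs (Im u)*abs t)"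
   using abs_ge_minus_self[of "Im u*t"] by (simp add: norm_exp_eq_Re abs_mult flip: exp_add)
  ultimately have "cmod (exp (- (Complex t c)\<^sup>2)*exp (\<i>*u*Complex t c)) <=
   (exp (c\<^sup>2 + (abs (Im u) + 1)\<^sup>2/4)*exp ((abs (Im u) + 1)*- abs t))*(exp (- (Re u*c))*exp (abs (Im u)*abs t))"
   unfolding norm_mult by (intro mult_mono) auto
  also have "\<dots> = exp (c\<^sup>2 + (abs (Im u) + 1)\<^sup>2/4)*exp (- (Re u*c))*exp (- 1*abs t)" by (simp add: algebra_simps flip: exp_add)
  finally show ?thesis .
 qed
 show "integrable lborel (\<lambda>t. exp (- (Complex t c)\<^sup>2)*exp (\<i>*u*Complex t c))"
  by (rule line_integrable(1)[OF _ b]) (auto intro!: continuous_intros)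
 have "exp (- s\<^sup>2)*exp (\<i>*u * s) = exp (- u\<^sup>2/4)*exp (- (s - \<i>*u/2)\<^sup>2)" for s
  by (simp add: power2_diff power_divide power_mult_distrib algebra_simps flip: exp_add)
 moreover have "Complex t c - \<i>*u/2 = Complex (Im u/2 + 1*t) (c - Re u/2)" for t by (simp add: complex_eq_iff)
 ultimately have "line_integral c (\<lambda>s. exp (- s\<^sup>2)*exp (\<i>*u * s)) =
   exp (- u\<^sup>2/4)*(\<integral>t. exp (- (Complex (Im u/2 + 1*t) (c - Re u/2))\<^sup>2) \<partial>lborel)" unfolding line_integral_def by simp
 also have "(\<integral>t. exp (- (Complex (Im u/2 + 1*t) (c - Re u/2))\<^sup>2) \<partial>lborel) = line_integral (c - Re u/2) (\<lambda>s. exp (- s\<^sup>2))"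
  unfolding line_integral_def by (subst (2) lborel_integral_real_affine[where c = 1 and t = "Im u/2"]) auto
 finally show "line_integral c (\<lambda>s. exp (- s\<^sup>2)*exp (\<i>*u * s)) = of_real gauss_total*exp (- u\<^sup>2/4)" by (simp add: line_integral_gauss)
qed

text \<open>Integration by parts: the derivative of mu exp(i u s) is a Gaussian part plus i u times
  the integrand, and the boundary values vanish. The factor exp(-u^2/4)/u obtained here is the
  kernel with which functions of vanishing transform are extended across K.\<close>

lemma mu_fourier:
 assumes sg: "abs sg = 1" and u: "0 < sg*Im u"
 shows "integrable lborel (\<lambda>t. mu sg (Complex t c)*exp (\<i>*u*Complex t c))"
  "line_integral c (\<lambda>s. mu sg s*exp (\<i>*u * s)) = \<i>*exp (- u\<^sup>2/4)/u"
proof -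
 let ?F = "\<lambda>s. mu sg s*exp (\<i>*u * s)" and ?N = "of_real gauss_total"
 let ?h = "\<lambda>s. exp (- s\<^sup>2)*exp (\<i>*u * s)/?N + \<i>*u*?F s"
 have u0: "u ~= 0" "abs (Im u) > 0" using u by auto
 obtain C where C: "C >= 0" "\<And>s. abs (Im s) <= abs c ==> cmod (?F s) <= C*exp (- (Re u*Im s))*exp (- abs (Im u)*abs (Re s))"
  using mu_exp_bound[OF sg, of "abs c" "abs (Im u)"] u by auto
 have b: "cmod (?F (Complex t c)) <= C*exp (- (Re u*c))*exp (- abs (Im u)*abs t)" for t using C(2)[of "Complex t c"] by simp
 show int: "integrable lborel (\<lambda>t. ?F (Complex t c))" by (rule line_integrable(1)[OF _ b u0(2)]) (auto intro!: continuous_intros isCont_mu)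
 have int2: "integrable lborel (\<lambda>t. exp (- (Complex t c)\<^sup>2)*exp (\<i>*u*Complex t c)/?N)" by (intro integrable_divide_zero gauss_fourier)
 have "((\<lambda>x. ?F (Complex x c) - ?F (Complex (- x) c)) \<longlongrightarrow> line_integral c ?h) at_top"
 proof (rule line_integral_limit)
  show "(?F has_field_derivative ?h w) (at w)" for w using mu_deriv[of sg w] by (auto intro!: derivative_eq_intros)
  show "integrable lborel (\<lambda>t. ?h (Complex t c))" by (intro Bochner_Integration.integrable_add int2 integrable_mult_right int)
 qed
 moreover have "((\<lambda>x. ?F (Complex x c) - ?F (Complex (- x) c)) \<longlongrightarrow> 0) at_top"
 proof (rule Lim_null_comparison)
  show "((\<lambda>x. 2*(C*exp (- (Re u*c)))*exp (- abs (Im u)*x)) \<longlongrightarrow> 0) at_top" by (intro tendsto_mult_right_zero exp_decay_tendsto u0)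
  show "\<forall>\<^sub>F x in at_top. norm (?F (Complex x c) - ?F (Complex (- x) c)) <= 2*(C*exp (- (Re u*c)))*exp (- abs (Im u)*x)"
   using eventually_ge_at_top[of 0]
  proof eventually_elim
   fix x :: real assume "0 <= x"
   then show "norm (?F (Complex x c) - ?F (Complex (- x) c)) <= 2*(C*exp (- (Re u*c)))*exp (- abs (Im u)*x)"
    using b[of x] b[of "- x"] norm_triangle_ineq4[of "?F (Complex x c)" "?F (Complex (- x) c)"] by simp
  qed
 qed
 ultimately have "line_integral c ?h = 0" by (rule tendsto_unique[OF trivial_limit_at_top_linorder])
 moreover have "line_integral c ?h = line_integral c (\<lambda>s. exp (- s\<^sup>2)*exp (\<i>*u * s))/?N + \<i>*u*line_integral c ?F"
  unfolding line_integral_def by (subst Bochner_Integration.integral_add[OF int2 integrable_mult_right[OF int]]) simp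
 ultimately have "exp (- u\<^sup>2/4) + \<i>*u*line_integral c ?F = 0" using gauss_total_pos by (simp add: gauss_fourier(2))
 then have "\<i>*u*line_integral c ?F = - exp (- u\<^sup>2/4)" unfolding eq_neg_iff_add_eq_0 by (simp only: add.commute)
 moreover have "\<i>*u*(\<i>*exp (- u\<^sup>2/4)/u) = - exp (- u\<^sup>2/4)" using u0 by simp
 ultimately have "\<i>*u*line_integral c ?F = \<i>*u*(\<i>*exp (- u\<^sup>2/4)/u)" by (simp only:)
 moreover have "\<i>*u ~= 0" using u0 by simp
 ultimately show "line_integral c ?F = \<i>*exp (- u\<^sup>2/4)/u" by (subst (asm) mult_left_cancel)
qed

section \<open>Fourier inversion\<close>

lemma half_line_exp_integral:
 assumes "Im u > 0"
 shows "integrable lborel (\<lambda>t. indicator {0<..} t *\<^sub>R exp (\<i>*u * of_real t))"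
  "(\<integral>t. indicator {0<..} t *\<^sub>R exp (\<i>*u * of_real t) \<partial>lborel) = \<i>/u"
proof -
 let ?h = "\<lambda>w. exp (\<i>*u*w)" and ?P = "\<lambda>w. exp (\<i>*u*w)/(\<i>*u)"
 have u: "u ~= 0" using assms by auto
 have b: "cmod (?h (0 + 1 * of_real t)) <= 1*exp (- Im u*t)" for t by (simp add: norm_exp_eq_Re)
 have i: "integrable lborel (\<lambda>t. indicator {0<..} t *\<^sub>R (1*?h (0 + 1 * of_real t)))"
  by (rule ray_integrable(1)[OF _ assms b]) (auto intro!: continuous_intros)
 then show "integrable lborel (\<lambda>t. indicator {0<..} t *\<^sub>R exp (\<i>*u * of_real t))" by simp
 have "((\<lambda>x. ?P (0 + 1 * of_real x) - ?P 0) \<longlongrightarrow> ray_integral 0 1 ?h) at_top"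
  by (rule ray_integral_limit[OF _ i]) (use u in \<open>auto intro!: derivative_eq_intros\<close>)
 moreover have "((\<lambda>x. ?P (0 + 1 * of_real x) - ?P 0) \<longlongrightarrow> 0 - ?P 0) at_top"
 proof (rule tendsto_diff[OF _ tendsto_const], rule Lim_null_comparison)
  show "((\<lambda>x. 1/cmod u*exp (- Im u*x)) \<longlongrightarrow> 0) at_top" by (intro tendsto_mult_right_zero exp_decay_tendsto assms)
  show "\<forall>\<^sub>F x in at_top. norm (?P (0 + 1 * of_real x)) <= 1/cmod u*exp (- Im u*x)" by (simp add: norm_divide norm_mult norm_exp_eq_Re)
 qed
 ultimately have "ray_integral 0 1 ?h = 0 - ?P 0" by (rule tendsto_unique[OF trivial_limit_at_top_linorder])
 also have "0 - ?P 0 = \<i>/u" using u by (simp add: divide_simps)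
 finally show "(\<integral>t. indicator {0<..} t *\<^sub>R exp (\<i>*u * of_real t) \<partial>lborel) = \<i>/u" by (simp add: ray_integral_def)
qed

text \<open>The t-integral is split at 0. On each half-line the height ht is chosen so that exp(i t
  (s - zt)) decays in t; Fubini and the elementary half-line integral then give a Cauchy-type
  integral over a line above zt and another over a line below zt. The strip formula evaluates their
  difference.\<close>

lemma fourier_inversion:
 fixes g :: "complex => complex" and \<Phi> :: "real => complex"
 assumes g: "g holomorphic_on {s. Im s < 0}"
  and bound: "\<And>a b. 0 < a ==> a <= b ==> \<exists>B\<ge>0. \<exists>dl>0. \<forall>s. - b <= Im s \<and> Im s <= - a \<longrightarrow> cmod (g s) <= B*exp (- dl*abs (Re s))"
  and \<Phi>: "\<And>t ht. ht > 0 ==> \<Phi> t = line_integral (- ht) (\<lambda>s. g s*exp (\<i> * of_real t * s))"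
  and zt: "Im zt < 0"
 shows "integrable lborel (\<lambda>t. \<Phi> t*exp (- \<i> * of_real t*zt))"
  "(\<integral>t. \<Phi> t*exp (- \<i> * of_real t*zt) \<partial>lborel) = 2*pi*g zt"
proof -
 define ta where "ta = - Im zt"
 have ta: "ta > 0" using zt by (simp add: ta_def)
 let ?G = "\<lambda>t. \<Phi> t*exp (- \<i> * of_real t*zt)"
 have cont: "isCont g s" if "Im s < 0" for s using g open_halfspace_Im_lt that
  by (auto simp: continuous_on_eq_continuous_at dest!: holomorphic_on_imp_continuous_on)
 have half: "integrable lborel (\<lambda>t. indicator {0<..} t *\<^sub>R ?G (sg*t)) \<and>
   (\<integral>t. indicator {0<..} t *\<^sub>R ?G (sg*t) \<partial>lborel) = sg*\<i>*line_integral (- ht) (\<lambda>s. g s/(s - zt))"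
  if sg: "abs sg = 1" and ht: "ht > 0" "sg*(ta - ht) > 0" for sg ht
 proof -
  obtain B dl where B: "B >= 0" "dl > 0" "\<And>s. Im s = - ht ==> cmod (g s) <= B*exp (- dl*abs (Re s))"
   using bound[OF ht(1) order_refl] by (metis order_refl)
  define f where "f = (\<lambda>(t, x). indicator {0<..} t *\<^sub>R
    (g (Complex x (- ht))*exp (\<i>*(of_real sg*(Complex x (- ht) - zt)) * of_real t)))"
  have "isCont (\<lambda>x. g (Complex x (- ht))) x" for x
   by (rule isCont_o2[where f = "\<lambda>x. Complex x (- ht)" and g = g]) (use ht in \<open>auto intro!: isCont_Complex cont\<close>)
  then have "continuous_on UNIV (\<lambda>x. g (Complex x (- ht)))" by (intro continuous_at_imp_continuous_on) auto
  then have [measurable]: "(\<lambda>x. g (Complex x (- ht))) \<in> borel_measurable borel" by (rule borel_measurable_continuous_onI)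
  have Com: "Complex x (- ht) = of_real x - \<i> * of_real ht" for x by (simp add: complex_eq_iff)
  have meas: "f \<in> borel_measurable borel"
  proof -
   have "f \<in> borel_measurable (borel \<Otimes>\<^sub>M borel)"
    unfolding f_def Com[of "_"] split_beta' using \<open>(\<lambda>x. g (Complex x (- ht))) \<in> borel_measurable borel\<close>[unfolded Com] by measurable
   then show ?thesis by (simp add: borel_prod)
  qed
  have fb: "cmod (f (t, x)) <= exp (- (sg*(ta - ht))*abs t)*(B*exp (- dl*abs x))" for t x
  proof (cases "t > 0")
   case True
   have e1: "cmod (exp (\<i>*(of_real sg*(Complex x (- ht) - zt)) * of_real t)) = exp (- (sg*(ta - ht))*t)"
    by (simp add: norm_exp_eq_Re ta_def algebra_simps)
   have e2: "cmod (g (Complex x (- ht))) <= B*exp (- dl*abs x)" using B(3)[of "Complex x (- ht)"] by simp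
   have e3: "cmod (f (t, x)) = cmod (exp (\<i>*(of_real sg*(Complex x (- ht) - zt)) * of_real t))*cmod (g (Complex x (- ht)))"
    using True unfolding f_def by (simp only: prod.case norm_scaleR norm_mult) simp
   have "abs t = t" using True by simp
   then show ?thesis unfolding e3 e1 by (simp only: mult_left_mono[OF e2] exp_ge_zero)
  qed (use B in \<open>simp add: f_def\<close>)
  have e: "integrable lborel (\<lambda>t::real. C*exp (- d*abs t))" if "d > 0" for d C
   using has_bochner_integral_exp_abs[OF that] by (auto simp: has_bochner_integral_iff)
  have fint: "integrable (lborel \<Otimes>\<^sub>M lborel) f" using integrable_product_bound[OF meas e[OF ht(2), of 1] e[OF B(2), of B]] fb by simp
  have in1: "(\<integral>x. f (t, x) \<partial>lborel) = indicator {0<..} t *\<^sub>R ?G (sg*t)" for t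
  proof -
   have "f (t, x) = indicator {0<..} t *\<^sub>R
     ((g (Complex x (- ht))*exp (\<i> * of_real (sg*t)*Complex x (- ht)))*exp (- \<i> * of_real (sg*t)*zt))" for x
    unfolding f_def by (simp add: mult.assoc algebra_simps flip: exp_add)
   then show ?thesis using \<Phi>[OF ht(1), of "sg*t"] by (simp add: line_integral_def)
  qed
  have in2: "(\<integral>t. f (t, x) \<partial>lborel) = sg*\<i>*(g (Complex x (- ht))/(Complex x (- ht) - zt))" for x
  proof -
   let ?u = "of_real sg*(Complex x (- ht) - zt)"
   have u: "Im ?u > 0" using ht by (simp add: ta_def algebra_simps)
   have "sg = 1 \<or> sg = -1" using sg by linarith
   then have "\<i>/(of_real sg*w) = sg*\<i>/w" for w by (elim disjE) simp_all
   then have s: "\<i>/?u = sg*\<i>/(Complex x (- ht) - zt)" .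
   have "(\<integral>t. f (t, x) \<partial>lborel) = (\<integral>t. g (Complex x (- ht))*(indicator {0<..} t *\<^sub>R exp (\<i>*?u * of_real t)) \<partial>lborel)"
    unfolding f_def by (simp add: mult.assoc)
   also have "\<dots> = g (Complex x (- ht))*(\<i>/?u)" by (subst integral_mult_right_zero) (simp only: half_line_exp_integral(2)[OF u])
   finally show ?thesis using s by (simp add: mult_ac)
  qed
  have "integrable lborel (\<lambda>t. \<integral>x. f (t, x) \<partial>lborel)" by (rule lborel_pair.integrable_fst'[OF fint])
  moreover have "(\<integral>x. (\<integral>t. f (t, x) \<partial>lborel) \<partial>lborel) = (\<integral>t. (\<integral>x. f (t, x) \<partial>lborel) \<partial>lborel)" using fint by (intro lborel_pair.Fubini_integral) simp
  ultimately show ?thesis unfolding in1 in2 integral_mult_right_zero line_integral_def by (intro conjI) (assumption | erule sym)+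
 qed
 \<comment> \<open>Since Im zt = - ta, the heights ta/2 and 2*ta put the lines above and below zt,
   as needed for t > 0 and t < 0.\<close>
 have h1: "integrable lborel (\<lambda>t. indicator {0<..} t *\<^sub>R ?G (1*t))"
  "(\<integral>t. indicator {0<..} t *\<^sub>R ?G (1*t) \<partial>lborel) = \<i>*line_integral (- (ta/2)) (\<lambda>s. g s/(s - zt))" using half[of 1 "ta/2"] ta by simp_all
 have h2: "integrable lborel (\<lambda>t. indicator {0<..} t *\<^sub>R ?G (- 1*t))"
  "(\<integral>t. indicator {0<..} t *\<^sub>R ?G (- 1*t) \<partial>lborel) = - \<i>*line_integral (- (2*ta)) (\<lambda>s. g s/(s - zt))"
  using half[of "-1" "2*ta"] ta by simp_all
 let ?k = "\<lambda>t. indicator {0<..} t *\<^sub>R ?G (- 1*t)"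
 have h3: "integrable lborel (\<lambda>t. ?k (0 + - 1*t))" using h2(1) by (intro lborel_integrable_real_affine) auto
 have h4: "(\<integral>t. ?k (0 + - 1*t) \<partial>lborel) = (\<integral>t. ?k t \<partial>lborel)" using lborel_integral_real_affine[of "-1" ?k 0] by simp
 have hb: "has_bochner_integral lborel (\<lambda>t. indicator {0<..} t *\<^sub>R ?G (1*t) + ?k (0 + - 1*t))
   (\<i>*line_integral (- (ta/2)) (\<lambda>s. g s/(s - zt)) + - \<i>*line_integral (- (2*ta)) (\<lambda>s. g s/(s - zt)))"
  by (intro has_bochner_integral_add) (use h1 h2 h3 h4 in \<open>simp_all add: has_bochner_integral_iff\<close>)
 \<comment> \<open>Only the point t = 0 is missing from the two half-lines.\<close>
 have "has_bochner_integral lborel (\<lambda>t. indicator {0<..} t *\<^sub>R ?G (1*t) + ?k (0 + - 1*t)) z \<longleftrightarrow>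
   has_bochner_integral lborel ?G z" for z by (rule has_bochner_integral_discrete_difference[of "{0}"]) (auto simp: indicator_def)
 then have G: "has_bochner_integral lborel ?G
   (\<i>*line_integral (- (ta/2)) (\<lambda>s. g s/(s - zt)) + - \<i>*line_integral (- (2*ta)) (\<lambda>s. g s/(s - zt)))" using hb by blast
 then show "integrable lborel ?G" by (simp add: has_bochner_integral_iff)
 obtain B dl where B: "B >= 0" "dl > 0" "\<And>s. - (2*ta) <= Im s ==> Im s <= - (ta/2) ==> cmod (g s) <= B*exp (- dl*abs (Re s))"
  using bound[of "ta/2" "2*ta"] ta by auto
 have "line_integral (- (2*ta)) (\<lambda>s. g s/(s - zt)) - line_integral (- (ta/2)) (\<lambda>s. g s/(s - zt)) = 2*pi*\<i>*g zt"
 proof (rule strip_Cauchy_formula[OF open_halfspace_Im_lt convex_halfspace_Im_lt g _ B(3) B(2,1)])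
  show "- (2*ta) < Im zt" "Im zt < - (ta/2)" using zt by (auto simp: ta_def)
 qed (use ta in auto)
 then have "line_integral (- (2*ta)) (\<lambda>s. g s/(s - zt)) = line_integral (- (ta/2)) (\<lambda>s. g s/(s - zt)) + 2*pi*\<i>*g zt"
  by (simp add: algebra_simps)
 with G show "(\<integral>t. ?G t \<partial>lborel) = 2*pi*g zt" by (simp add: has_bochner_integral_iff algebra_simps)
qed

section \<open>The scalar Fourier transform\<close>

text \<open>The plane without the real points of [a, infinity]; for a = \<infinity> it is the whole
  plane.\<close>

definition slit_plane :: "ereal => complex set" where
 "slit_plane a = {z. Im z ~= 0 \<or> ereal (Re z) < a}"

lemma open_slit_plane: "open (slit_plane a)"
proof (cases a)
 case (real r)
 then have "slit_plane a = {z. Im z ~= 0} \<union> {z. Re z < r}" by (auto simp: slit_plane_def)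
 moreover have "open {z. Im z ~= 0}"
 proof -
  have "{z. Im z ~= 0} = {z. Im z > 0} \<union> {z. Im z < 0}" by auto
  then show ?thesis by (simp add: open_Un open_halfspace_Im_gt open_halfspace_Im_lt)
 qed
 ultimately show ?thesis by (simp add: open_Un open_halfspace_Re_lt)
next
 case PInf
 then show ?thesis by (simp add: slit_plane_def)
next
 case MInf
 then have "slit_plane a = {z. Im z > 0} \<union> {z. Im z < 0}" by (auto simp: slit_plane_def)
 then show ?thesis by (simp add: open_Un open_halfspace_Im_gt open_halfspace_Im_lt)
qed

text \<open>Every real b < a is a centre: a segment from b to a non-real point meets the real axis
  only at b, and one to a real point stays to the left of the larger endpoint.\<close>

lemma starlike_slit_plane:
 assumes "ereal b < a"
 shows "starlike (slit_plane a)" unfolding starlike_def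
proof (intro bexI[of _ "of_real b"] ballI subsetI)
 show "of_real b \<in> slit_plane a" using assms by (simp add: slit_plane_def)
 fix z w assume z: "z \<in> slit_plane a" and "w \<in> closed_segment (of_real b) z"
 then obtain \<theta> where \<theta>: "0 <= \<theta>" "\<theta> <= 1" "w = (1 - \<theta>) *\<^sub>R of_real b + \<theta> *\<^sub>R z" by (auto simp: in_segment)
 show "w \<in> slit_plane a"
 proof (cases "Im z = 0 \<or> \<theta> = 0")
  case False
  then show ?thesis using \<theta> by (simp add: slit_plane_def)
 next
  case True
  have "(1 - \<theta>)*b + \<theta> * Re z <= (1 - \<theta>)*max b (Re z) + \<theta>*max b (Re z)" using \<theta> by (intro add_mono mult_left_mono) auto
  then have "(1 - \<theta>)*b + \<theta> * Re z <= max b (Re z)" by (simp add: algebra_simps)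
  then have le: "ereal ((1 - \<theta>)*b + \<theta> * Re z) <= ereal (max b (Re z))" by (simp only: ereal_less_eq)
  have "ereal ((1 - \<theta>)*b + \<theta> * Re z) < a"
  proof (cases "\<theta> = 0")
   case False
   then have "ereal (max b (Re z)) < a" using True z assms by (auto simp: slit_plane_def max_def)
   with le show ?thesis by (rule le_less_trans)
  qed (use assms in simp)
  then show ?thesis using \<theta>(3) by (simp add: slit_plane_def)
 qed
qed

text \<open>The finite set k allows for removable singularities, as they arise when a pole is
  cancelled by subtracting the value of the function there.\<close>

lemma slit_plane_primitive:
 assumes "ereal b < a" "finite k" "continuous_on (slit_plane a) h" "h holomorphic_on slit_plane a - k"
 shows "\<exists>P. \<forall>w\<in>slit_plane a. (P has_field_derivative h w) (at w)"
proof (rule holomorphic_starlike_primitive[OF assms(3) starlike_slit_plane[OF assms(1)] open_slit_plane assms(2)])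
 fix x assume "x \<in> slit_plane a - k"
 moreover have "open (slit_plane a - k)" using assms(2) by (intro open_Diff open_slit_plane finite_imp_closed)
 ultimately show "h field_differentiable at x" using assms(4) holomorphic_on_imp_differentiable_at by blast
qed

text \<open>Scalar form of membership in \<open>Oexp\<close> for [a, infinity]. Instead of the sets
  S_n it uses the regions Re z <= b or |Im z| >= c inside a strip of any width, each with every
  growth rate ep.\<close>

definition slow_growth :: "ereal => (complex => complex) => bool" where
 "slow_growth a F \<longleftrightarrow> F holomorphic_on slit_plane a \<and>
   (\<forall>b c Y ep. ereal b < a \<longrightarrow> 0 < c \<longrightarrow> 0 < ep \<longrightarrow>
    (\<exists>B\<ge>0. \<forall>z. Re z <= b \<or> c <= abs (Im z) \<longrightarrow> (abs (Im z)) <= Y \<longrightarrow> cmod (F z) <= B*exp (ep*abs (Re z))))"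

lemma slow_growthD:
 assumes "slow_growth a F" "ereal b < a" "0 < c" "0 < ep"
 obtains B where "B >= 0" "\<And>z. Re z <= b \<or> c <= abs (Im z) ==> (abs (Im z)) <= Y ==> cmod (F z) <= B*exp (ep*abs (Re z))"
 using assms unfolding slow_growth_def by meson

text \<open>Expresses that the path runs where \<open>slow_growth\<close> with the constants b and c
  gives a bound.\<close>

definition hairpin_avoids :: "real => real => real => real => real => bool" where
 "hairpin_avoids b c l kp d \<longleftrightarrow> 0 < c \<and> 0 <= kp \<and> 0 < d \<and>
   (\<forall>t. Re (hairpin l kp d t) <= b \<or> c <= \<bar>Im (hairpin l kp d t)\<bar>)"

lemma hairpin_avoids_rectangle: "d > 0 ==> hairpin_avoids b d b 0 d" by (auto simp: hairpin_avoids_def hairpin_def)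

text \<open>On the half-disc either cos t >= 1/2, and the real part is at most l - d/2, or |sin t|
  >= 1/2, and the height is at least d/2.\<close>

lemma hairpin_avoids_disc:
 assumes "d > 0"
 shows "hairpin_avoids (l - d/2) (d/2) l d d"
proof -
 have "l - d*cos t <= l - d/2 \<or> d/2 <= \<bar>d * sin t\<bar>" if "- (pi/2) <= t" "t <= pi/2" for t
 proof (cases "cos t >= 1/2")
  case True
  then show ?thesis using assms mult_left_mono[OF True, of d] by simp
 next
  case False
  moreover have "cos t >= 0" using that by (intro cos_ge_zero) auto
  ultimately have "(cos t)\<^sup>2 <= (1/2)\<^sup>2" by (intro power_mono) auto
  moreover have "(1/2::real)\<^sup>2 = 1/4" by (simp add: power_divide)
  ultimately have "(1/2)\<^sup>2 <= \<bar>sin t\<bar>\<^sup>2" using sin_cos_squared_add[of t] unfolding power2_abs by linarith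
  then have "1/2 <= \<bar>sin t\<bar>" by (rule power2_le_imp_le) simp
  then show ?thesis using assms mult_left_mono[of "1/2" "\<bar>sin t\<bar>" d] by (simp add: abs_mult)
 qed
 then show ?thesis using assms by (auto simp: hairpin_avoids_def hairpin_def)
qed

lemma hairpin_in_slit_plane:
 "hairpin_avoids b c l kp d ==> ereal b < a ==> hairpin l kp d t \<in> slit_plane a"
 unfolding hairpin_avoids_def slit_plane_def by (auto dest!: spec[of _ t] intro: le_less_trans[of _ "ereal b"])

section \<open>The scalar transform along a hairpin\<close>

definition fourier_integrand :: "(complex => complex) => complex => complex => complex" where
 "fourier_integrand F zt w = F w*exp (- \<i>*w*zt)"

lemma cmod_exp_fourier: "cmod (exp (- \<i>*w*zt)) = exp (Re w*Im zt + Im w * Re zt)" by (simp add: norm_exp_eq_Re)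

text \<open>With q the distance of Re w to the lower bound l - kp, the exponent splits into (l -
  kp)*Im zt and q*Im zt, and q >= abs t - 2 turns the second part into decay in t. The first part is
  kept exactly because it becomes the growth of the transform. F enters only through the number x,
  so that x may also be a seminorm of a vector.\<close>

lemma fourier_weight_bound:
 assumes kp: "0 <= kp" and ta: "0 < ep" "ep < ta" "ta <= - Im zt" and M: "0 <= M"
  and F: "x <= M*exp (ep*\<bar>Re (hairpin l kp d t)\<bar>)"
 shows "x*cmod (exp (- \<i>*hairpin l kp d t*zt)) <=
  M*exp (ep*(abs l + kp + 2) + 2*ta)*exp ((l - kp)*Im zt + abs d*abs (Re zt))*exp (- (ta - ep)*abs t)"
proof -
 let ?w = "hairpin l kp d t"
 note b = hairpin_bounds(1-4)[OF kp, where t = t and l = l and c = d]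
 define q where "q = Re ?w - (l - kp)"
 have q: "q >= 0" "q >= abs t - 2" using b by (auto simp: q_def)
 have "Re ?w*Im zt = (l - kp)*Im zt + q*Im zt" by (simp add: q_def algebra_simps)
 moreover have "q*Im zt <= q*(- ta)" using q ta by (intro mult_left_mono) auto
 moreover have "q*(- ta) <= - ta*(abs t - 2)" using q(2) ta by (simp add: mult.commute)
 moreover have "Im ?w * Re zt <= abs d*abs (Re zt)"
  using mult_mono[OF b(4) order_refl[of "abs (Re zt)"]] abs_ge_self[of "Im ?w * Re zt"] by (simp add: abs_mult)
 moreover have "ep*\<bar>Re ?w\<bar> <= ep*(abs t + abs l + kp + 2)" using b ta kp by (intro mult_left_mono) auto
 ultimately have "ep*\<bar>Re ?w\<bar> + (Re ?w*Im zt + Im ?w * Re zt) <=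
   (ep*(abs l + kp + 2) + 2*ta) + (((l - kp)*Im zt + abs d*abs (Re zt)) + (- (ta - ep)*abs t))" by (simp add: algebra_simps)
 then have "exp (ep*\<bar>Re ?w\<bar> + (Re ?w*Im zt + Im ?w * Re zt)) <=
   exp (ep*(abs l + kp + 2) + 2*ta)*(exp ((l - kp)*Im zt + abs d*abs (Re zt))*exp (- (ta - ep)*abs t))"
  unfolding exp_add[symmetric] exp_le_cancel_iff .
 then have "M*(exp (ep*\<bar>Re ?w\<bar>)*exp (Re ?w*Im zt + Im ?w * Re zt)) <=
   M*(exp (ep*(abs l + kp + 2) + 2*ta)*(exp ((l - kp)*Im zt + abs d*abs (Re zt))*exp (- (ta - ep)*abs t)))"
  using M unfolding exp_add[of "ep*\<bar>Re ?w\<bar>"] by (intro mult_left_mono)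
 moreover have "x*cmod (exp (- \<i>*?w*zt)) <= M*exp (ep*\<bar>Re ?w\<bar>)*exp (Re ?w*Im zt + Im ?w * Re zt)"
  unfolding cmod_exp_fourier using F by (intro mult_right_mono) auto
 ultimately show ?thesis by (simp only: mult.assoc)
qed

lemma fourier_integrand_holomorphic:
 "F holomorphic_on X ==> fourier_integrand F zt holomorphic_on X" unfolding fourier_integrand_def[abs_def] by (intro holomorphic_intros)

lemma holomorphic_isCont: "f holomorphic_on X ==> open X ==> z \<in> X ==> isCont f z"
 by (auto simp: continuous_on_eq_continuous_at dest!: holomorphic_on_imp_continuous_on)

text \<open>The third bound is linear in M, which later means continuity. Its dependence on zt
  through exp((l - kp)*Im zt + d*abs (Re zt)) is the growth permitted to a transform when l - kp is
  taken close to a and d small.\<close>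

lemma fourier_hairpin_bound:
 assumes F: "F holomorphic_on slit_plane a" and a: "ereal b < a" and av: "hairpin_avoids b c l kp d"
  and ta: "0 < ep" "ep < ta" "ta <= - Im zt" and M: "0 <= M"
  and bound: "\<And>z. Re z <= b \<or> c <= abs (Im z) ==> (abs (Im z)) <= d ==> cmod (F z) <= M*exp (ep*abs (Re z))"
 shows "cmod (fourier_integrand F zt (hairpin l kp d t)) <=
   M*exp (ep*(abs l + kp + 2) + 2*ta)*exp ((l - kp)*Im zt + d*abs (Re zt))*exp (- (ta - ep)*\<bar>t - 0\<bar>)"
  "integrable lborel (\<lambda>t. hairpin_deriv kp d t*fourier_integrand F zt (hairpin l kp d t))"
  "cmod (hairpin_integral l kp d (fourier_integrand F zt)) <=
   2*((1 + kp + d)*(M*exp (ep*(abs l + kp + 2) + 2*ta)*exp ((l - kp)*Im zt + d*abs (Re zt))))/(ta - ep)"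
proof -
 have kp: "0 <= kp" and d: "abs d = d" using av by (auto simp: hairpin_avoids_def)
 show b: "cmod (fourier_integrand F zt (hairpin l kp d t)) <=
   M*exp (ep*(abs l + kp + 2) + 2*ta)*exp ((l - kp)*Im zt + d*abs (Re zt))*exp (- (ta - ep)*\<bar>t - 0\<bar>)" for t
 proof -
  have "cmod (F (hairpin l kp d t)) <= M*exp (ep*\<bar>Re (hairpin l kp d t)\<bar>)"
   using av hairpin_bounds(4)[OF kp, of l d t] d by (intro bound) (auto simp: hairpin_avoids_def)
  from fourier_weight_bound[OF kp ta M this] show ?thesis unfolding fourier_integrand_def norm_mult d diff_zero .
 qed
 have cont: "isCont (fourier_integrand F zt) (hairpin l kp d t)" for t
  by (rule holomorphic_isCont[OF fourier_integrand_holomorphic[OF F] open_slit_plane hairpin_in_slit_plane[OF av a]])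
 have dl: "ta - ep > 0" using ta by simp
 show "integrable lborel (\<lambda>t. hairpin_deriv kp d t*fourier_integrand F zt (hairpin l kp d t))" by (rule hairpin_integrable(1)[OF kp cont dl b])
 show "cmod (hairpin_integral l kp d (fourier_integrand F zt)) <=
   2*((1 + kp + d)*(M*exp (ep*(abs l + kp + 2) + 2*ta)*exp ((l - kp)*Im zt + d*abs (Re zt))))/(ta - ep)"
  using hairpin_integrable(2)[OF kp cont dl b] unfolding d .
qed

lemma fourier_hairpin_integrable:
 assumes F: "slow_growth a F" and a: "ereal b < a" and av: "hairpin_avoids b c l kp d" and zt: "Im zt < 0"
 shows "integrable lborel (\<lambda>t. hairpin_deriv kp d t*fourier_integrand F zt (hairpin l kp d t))"
proof -
 obtain B where B: "B >= 0" "\<And>z. Re z <= b \<or> c <= abs (Im z) ==> (abs (Im z)) <= d ==> cmod (F z) <= B*exp (- Im zt/2*abs (Re z))"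
  using slow_growthD[OF F a, of c "- Im zt/2" d] zt av by (auto simp: hairpin_avoids_def)
 show ?thesis by (rule fourier_hairpin_bound(2)[OF _ a av _ _ _ B, where ta = "- Im zt"])
    (use F zt in \<open>auto simp: slow_growth_def\<close>)
qed

text \<open>Besides independence of c, this allows the half-disc caps of the given path to be
  exchanged for rectangular ones at any b < a and any height.\<close>

lemma fourier_hairpin_independent:
 assumes F: "slow_growth a F" and zt: "Im zt < 0"
  and 1: "ereal b < a" "hairpin_avoids b c l kp d" and 2: "ereal b' < a" "hairpin_avoids b' c' l' kp' d'"
 shows "hairpin_integral l kp d (fourier_integrand F zt) = hairpin_integral l' kp' d' (fourier_integrand F zt)"
proof -
 have hol: "fourier_integrand F zt holomorphic_on slit_plane a" using F by (intro fourier_integrand_holomorphic) (simp add: slow_growth_def)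
 have "\<exists>P. \<forall>w\<in>slit_plane a. (P has_field_derivative fourier_integrand F zt w) (at w)"
  by (rule slit_plane_primitive[OF 1(1), of "{}"]) (use hol in \<open>auto dest: holomorphic_on_imp_continuous_on\<close>)
 then obtain P where P: "\<And>w. w \<in> slit_plane a ==> (P has_field_derivative fourier_integrand F zt w) (at w)" by blast
 have d: "0 < d" "0 < d'" using 1 2 by (auto simp: hairpin_avoids_def)
 define Y where "Y = max d d'"
 \<comment> \<open>Half of the decay rate of the exponential is spent on the growth of F.\<close>
 have "0 < min d d'" "0 < - Im zt/2" using d zt by auto
 then obtain B where B: "B >= 0" "\<And>z. Re z <= b \<or> min d d' <= abs (Im z) ==> (abs (Im z)) <= Y ==> cmod (F z) <= B*exp (- Im zt/2*abs (Re z))"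
  using slow_growthD[OF F 1(1), of "min d d'" "- Im zt/2" Y] by blast
 show ?thesis
 proof (rule hairpin_integral_independent[OF P d, where dl = "- Im zt/2" and B = "B*exp (Y*abs (Re zt))"])
  fix w assume w: "min d d' <= abs (Im w)" "abs (Im w) <= max d d'" "0 <= Re w"
  have "w \<in> slit_plane a" using w d by (auto simp: slit_plane_def)
  have "abs (Im w)*abs (Re zt) <= Y*abs (Re zt)" using w(2) by (intro mult_right_mono) (auto simp: Y_def)
  then have "Im w * Re zt <= Y*abs (Re zt)" using abs_ge_self[of "Im w * Re zt"] by (simp add: abs_mult)
  then have "exp (Re w*Im zt + Im w * Re zt) <= exp (Re w*Im zt + Y*abs (Re zt))" by simp
  moreover have "cmod (F w) <= B*exp (- Im zt/2 * Re w)" using B(2)[of w] w by (simp add: Y_def)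
  ultimately have "cmod (fourier_integrand F zt w) <= (B*exp (- Im zt/2 * Re w))*exp (Re w*Im zt + Y*abs (Re zt))"
   unfolding fourier_integrand_def norm_mult cmod_exp_fourier using B(1) by (intro mult_mono) auto
  also have "\<dots> = B*(exp (- Im zt/2 * Re w)*exp (Re w*Im zt + Y*abs (Re zt)))" by simp
  also have "exp (- Im zt/2 * Re w)*exp (Re w*Im zt + Y*abs (Re zt)) = exp (Y*abs (Re zt))*exp (- (- Im zt/2) * Re w)"
   by (simp add: mult_exp_exp algebra_simps)
  finally show "w \<in> slit_plane a \<and> cmod (fourier_integrand F zt w) <= B*exp (Y*abs (Re zt))*exp (- (- Im zt/2) * Re w)"
   using \<open>w \<in> slit_plane a\<close> by (simp only: mult.assoc simp_thms)
 qed (use fourier_hairpin_integrable[OF F 1(1) 1(2) zt] fourier_hairpin_integrable[OF F 2(1) 2(2) zt]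
   hairpin_in_slit_plane[OF 1(2,1)] hairpin_in_slit_plane[OF 2(2,1)] zt B in auto)
qed

lemma fourier_holomorphic:
 assumes F: "slow_growth a F" and a: "ereal b < a" and av: "hairpin_avoids b c l kp d"
 shows "(\<lambda>zt. hairpin_integral l kp d (fourier_integrand F zt)) holomorphic_on {zt. Im zt < 0}" unfolding hairpin_integral_def
proof (rule holomorphic_param_integral[where S = "{- (pi/2), pi/2}"])
 show "(\<lambda>z. hairpin_deriv kp d t*fourier_integrand F z (hairpin l kp d t)) holomorphic_on {zt. Im zt < 0}" for t
  unfolding fourier_integrand_def by (intro holomorphic_intros)
 have hol: "F holomorphic_on slit_plane a" using F by (simp add: slow_growth_def)
 have kp: "0 <= kp" "0 < d" "0 < c" using av by (auto simp: hairpin_avoids_def)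
 show "isCont (\<lambda>t. hairpin_deriv kp d t*fourier_integrand F z (hairpin l kp d t)) t" if "t \<notin> {- (pi/2), pi/2}" for z t
  by (intro continuous_intros isCont_hairpin_deriv[OF that] isCont_o2[OF isCont_hairpin]
    holomorphic_isCont[OF fourier_integrand_holomorphic[OF hol] open_slit_plane hairpin_in_slit_plane[OF av a]])
 fix z assume "z \<in> {zt. Im zt < 0}"
 then have z: "Im z < 0" by simp
 define ta where "ta = - Im z/2"
 have ta: "ta > 0" using z by (simp add: ta_def)
 then obtain B where B: "B >= 0" "\<And>z. Re z <= b \<or> c <= abs (Im z) ==> (abs (Im z)) <= d ==> cmod (F z) <= B*exp (ta/2*abs (Re z))"
  using slow_growthD[OF F a kp(3), of "ta/2" d] by auto
 \<comment> \<open>E bounds the zt-dependent exponent uniformly on the disc of radius ta about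
   z.\<close>
 define E where "E = \<bar>l - kp\<bar>*(abs (Im z) + ta) + d*(abs (Re z) + ta)"
 have "cmod (hairpin_deriv kp d t*fourier_integrand F w (hairpin l kp d t)) <=
   (1 + kp + d)*(B*exp (ta/2*(abs l + kp + 2) + 2*ta)*exp E)*exp (- (ta/2)*abs t)"
  if w: "w \<in> ball z ta" for w t
 proof -
  have "\<bar>Im (w - z)\<bar> < ta" "\<bar>Re (w - z)\<bar> < ta"
   using w abs_Im_le_cmod[of "w - z"] abs_Re_le_cmod[of "w - z"] by (auto simp: dist_norm norm_minus_commute)
  then have w': "ta <= - Im w" "abs (Im w) <= abs (Im z) + ta" "abs (Re w) <= abs (Re z) + ta" by (auto simp: ta_def)
  have "(l - kp)*Im w <= \<bar>l - kp\<bar>*abs (Im w)" by (simp flip: abs_mult)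
  also have "\<dots> <= \<bar>l - kp\<bar>*(abs (Im z) + ta)" using w' by (intro mult_left_mono) auto
  finally have "(l - kp)*Im w + d*abs (Re w) <= E" using w'(3) kp unfolding E_def by (intro add_mono mult_left_mono) auto
  then have "B*exp (ta/2*(abs l + kp + 2) + 2*ta)*exp ((l - kp)*Im w + d*abs (Re w))*exp (- (ta - ta/2)*\<bar>t - 0\<bar>)
    <= B*exp (ta/2*(abs l + kp + 2) + 2*ta)*exp E*exp (- (ta/2)*abs t)" using B(1) by (intro mult_mono) auto
  moreover have "cmod (fourier_integrand F w (hairpin l kp d t)) <=
    B*exp (ta/2*(abs l + kp + 2) + 2*ta)*exp ((l - kp)*Im w + d*abs (Re w))*exp (- (ta - ta/2)*\<bar>t - 0\<bar>)"
   by (rule fourier_hairpin_bound(1)[OF hol a av _ _ w'(1) B]) (use ta in auto)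
  ultimately have "cmod (fourier_integrand F w (hairpin l kp d t)) <=
    B*exp (ta/2*(abs l + kp + 2) + 2*ta)*exp E*exp (- (ta/2)*abs t)" by (rule order_trans[rotated])
  moreover have "cmod (hairpin_deriv kp d t) <= 1 + kp + d" using hairpin_bounds(5)[OF kp(1), of d t] kp by simp
  ultimately show ?thesis unfolding norm_mult mult.assoc[of "1 + kp + d"] using kp by (intro mult_mono) auto
 qed
 then show "\<exists>r>0. \<exists>B. \<exists>dl>0. \<forall>w\<in>ball z r \<inter> {zt. Im zt < 0}. \<forall>t. t \<notin> {- (pi/2), pi/2} \<longrightarrow>
   cmod (hairpin_deriv kp d t*fourier_integrand F w (hairpin l kp d t)) <= B*exp (- dl*abs t)"
  using ta by (intro exI[of _ ta] conjI exI[of _ "(1 + kp + d)*(B*exp (ta/2*(abs l + kp + 2) + 2*ta)*exp E)"] exI[of _ "ta/2"]) auto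
qed (auto simp: open_halfspace_Im_lt)

section \<open>The scalar inverse transform\<close>

text \<open>Scalar form of membership in \<open>FO\<close>. All b < a and all ep > 0 replace the
  weights, which treats a = \<infinity> and finite a alike.\<close>

definition half_plane_growth :: "ereal => (complex => complex) => bool" where
 "half_plane_growth a f \<longleftrightarrow> f holomorphic_on {s. Im s < 0} \<and>
   (\<forall>b ep ht. ereal b < a \<longrightarrow> 0 < ep \<longrightarrow> 0 < ht \<longrightarrow>
    (\<exists>B\<ge>0. \<forall>s. Im s <= - ht \<longrightarrow> cmod (f s) <= B*exp (ep*cmod s + b*Im s)))"

lemma half_plane_growthD:
 assumes "half_plane_growth a f" "ereal b < a" "0 < ep" "0 < ht"
 obtains B where "B >= 0" "\<And>s. Im s <= - ht ==> cmod (f s) <= B*exp (ep*cmod s + b*Im s)"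
 using assms(1)[unfolded half_plane_growth_def, THEN conjunct2, rule_format, OF assms(2-4)] by blast

definition inverse_integrand :: "(complex => complex) => complex => complex => complex" where
 "inverse_integrand f z s = f s*exp (\<i>*z * s)"

lemma cmod_exp_inverse: "cmod (exp (\<i>*z * s)) = exp (- (Re z*Im s) - Im z * Re s)" by (simp add: norm_exp_eq_Re)

text \<open>The multiplier minus the Heaviside function: it decays faster than every exponential on
  both sides, so the integral formed with it is entire in z.\<close>

definition step_weight :: "real => real => complex" where
 "step_weight ht t = mu 1 (Complex t (- ht)) - indicator {0<..} t"

definition step_integral :: "real => (complex => complex) => complex => complex" where
 "step_integral ht f z = (\<integral>t. step_weight ht t*inverse_integrand f z (Complex t (- ht)) \<partial>lborel)"

text \<open>A form of the inverse for Re z < a that distinguishes no sign of Im z. Subtracting the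
  Heaviside function from the multiplier leaves a horizontal ray integral without multiplier, and
  this ray is turned downwards, where exp(i z s) and the bound of f together decay.\<close>

definition left_inverse :: "real => (complex => complex) => complex => complex" where
 "left_inverse ht f z = step_integral ht f z + ray_integral (Complex 0 (- ht)) (- \<i>) (inverse_integrand f z)"

text \<open>The height 1 is one choice among all; \<open>inverse_fourier_mu\<close> and
  \<open>inverse_fourier_left\<close> show that every positive height gives the same values.\<close>

definition inverse_fourier :: "(complex => complex) => complex => complex" where
 "inverse_fourier f z = 1/(2*pi) *
   (if Im z > 0 then line_integral (-1) (\<lambda>s. mu 1 s*inverse_integrand f z s)
   else if Im z < 0 then line_integral (-1) (\<lambda>s. mu (-1) s*inverse_integrand f z s)
   else left_inverse 1 f z)"

lemma step_weight_mu: "step_weight ht t = (if t > 0 then mu (-1) (Complex t (- ht)) else mu 1 (Complex t (- ht)))"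
 by (simp add: step_weight_def mu_def)

lemma step_weight_bound:
 assumes "R > 0"
 shows "\<exists>C\<ge>0. \<forall>t. cmod (step_weight ht t) <= C*exp (- R*abs t)"
proof -
 obtain C1 where C1: "C1 >= 0" "\<And>s. abs (Im s) <= abs ht ==> cmod (mu 1 s) <= C1*exp (R*(1 * Re s))" using mu_bound[OF assms, of 1 "abs ht"] by auto
 obtain C2 where C2: "C2 >= 0" "\<And>s. abs (Im s) <= abs ht ==> cmod (mu (-1) s) <= C2*exp (R*(- 1 * Re s))"
  using mu_bound[OF assms, of "-1" "abs ht"] by auto
 have "cmod (step_weight ht t) <= (C1 + C2)*exp (- R*abs t)" for t
 proof (cases "t > 0")
  case True
  have "cmod (step_weight ht t) <= C2*exp (- R*abs t)" using C2(2)[of "Complex t (- ht)"] True by (simp add: step_weight_mu)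
  also have "\<dots> <= (C1 + C2)*exp (- R*abs t)" using C1(1) by (intro mult_right_mono) auto
  finally show ?thesis .
 next
  case False
  have "cmod (step_weight ht t) <= C1*exp (- R*abs t)" using C1(2)[of "Complex t (- ht)"] False by (simp add: step_weight_mu)
  also have "\<dots> <= (C1 + C2)*exp (- R*abs t)" using C2(1) by (intro mult_right_mono) auto
  finally show ?thesis .
 qed
 then show ?thesis using C1(1) C2(1) by (intro exI[of _ "C1 + C2"]) auto
qed

lemma isCont_step_weight: "t ~= 0 ==> isCont (step_weight ht) t"
proof -
 assume t: "t ~= 0"
 have c: "isCont (\<lambda>t. mu sg (Complex t (- ht))) t" for sg
  by (rule isCont_o2[where f = "\<lambda>t. Complex t (- ht)" and g = "mu sg"]) (auto intro!: isCont_Complex isCont_mu)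
 show ?thesis
 proof (cases "t > 0")
  case True
  have "\<forall>\<^sub>F s in nhds t. s \<in> {0<..}" using True by (intro eventually_nhds_in_open) auto
  then have *: "\<forall>\<^sub>F s in nhds t. step_weight ht s = mu (-1) (Complex s (- ht))" by eventually_elim (simp add: step_weight_mu)
  show ?thesis using c[of "-1"] unfolding isCont_cong[OF *] .
 next
  case False
  have "\<forall>\<^sub>F s in nhds t. s \<in> {..<0}" using False t by (intro eventually_nhds_in_open) auto
  then have *: "\<forall>\<^sub>F s in nhds t. step_weight ht s = mu 1 (Complex s (- ht))" by eventually_elim (simp add: step_weight_mu)
  show ?thesis using c[of 1] unfolding isCont_cong[OF *] .
 qed
qed

lemma isCont_inverse_integrand:
 "f holomorphic_on {s. Im s < 0} ==> Im s < 0 ==> isCont (inverse_integrand f z) s" unfolding inverse_integrand_def[abs_def]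
 by (intro continuous_intros holomorphic_isCont[of f "{s. Im s < 0}"]) (auto simp: open_halfspace_Im_lt)

lemma inverse_integrand_holomorphic:
 "f holomorphic_on X ==> inverse_integrand f z holomorphic_on X" unfolding inverse_integrand_def[abs_def] by (intro holomorphic_intros)

text \<open>Pointwise bounds of the three integrands, linear in the growth constant \<open>M\<close> of \<open>f\<close>. They are
 needed with \<open>f\<close> real-valued as well, namely for seminorms of a vector-valued function; so only the
 number \<open>x\<close> bounding the value of \<open>f\<close> at \<open>s\<close> enters.\<close>

lemma mu_weight_bound:
 assumes sg: "abs sg = 1" and c: "ep <= c/2" "0 <= ep"
 shows "\<exists>C\<ge>0. \<forall>M\<ge>0. \<forall>x z s. x <= M*exp (ep*cmod s + b*Im s) \<longrightarrow> 0 < c \<longrightarrow> c <= sg*Im z \<longrightarrow> (abs (Im z)) <= Y \<longrightarrow>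
  (abs (Im s)) <= H \<longrightarrow> cmod (mu sg s*exp (\<i>*z * s))*x <= C*M*exp (- (Re z*Im s))*exp (- (c/2)*abs (Re s))"
proof -
 obtain C where C: "C >= 0" "\<And>s z. abs (Im s) <= H ==> 0 < sg*Im z ==> (abs (Im z)) <= Y ==>
  cmod (mu sg s*exp (\<i>*z * s)) <= C*exp (- (Re z*Im s))*exp (- abs (Im z)*abs (Re s))" using mu_exp_bound[OF sg, of H Y] by metis
 \<comment> \<open>K absorbs the part of exp (ep*cmod s + b*Im s) that stays bounded while abs (Im
   s) <= H.\<close>
 define K where "K = exp (ep*H + abs b*H)"
 have "cmod (mu sg s*exp (\<i>*z * s))*x <= C*K*M*exp (- (Re z*Im s))*exp (- (c/2)*abs (Re s))"
  if M: "M >= 0" and x: "x <= M*exp (ep*cmod s + b*Im s)" and z: "0 < c" "c <= sg*Im z" "abs (Im z) <= Y" and s: "abs (Im s) <= H"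
  for M x z s
 proof -
  have "\<bar>sg*Im z\<bar> = abs (Im z)" using sg by (simp add: abs_mult)
  then have cz: "c <= abs (Im z)" using z(2) by linarith
  have "ep*cmod s <= ep*(abs (Re s) + H)" using c cmod_le[of s] s by (intro mult_left_mono) auto
  moreover have "b*Im s <= abs b*H"
  proof -
   have "b*Im s <= abs b*abs (Im s)" by (simp flip: abs_mult)
   also have "\<dots> <= abs b*H" using s by (intro mult_left_mono) auto
   finally show ?thesis .
  qed
  ultimately have "exp (ep*cmod s + b*Im s) <= exp (ep*H + abs b*H + ep*abs (Re s))" by (simp add: algebra_simps)
  then have x': "x <= M*(K*exp (ep*abs (Re s)))" unfolding K_def exp_add[symmetric] using M by (intro order_trans[OF x] mult_left_mono) auto
  have "cmod (mu sg s*exp (\<i>*z * s))*x <=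
    (C*exp (- (Re z*Im s))*exp (- abs (Im z)*abs (Re s)))*(M*(K*exp (ep*abs (Re s))))"
  proof (cases "x >= 0")
   case True
   then show ?thesis using z s C x' M by (intro mult_mono) (auto simp: K_def)
  next
   case False
   then have "cmod (mu sg s*exp (\<i>*z * s))*x <= 0" by (simp add: mult_nonneg_nonpos)
   also have "0 <= (C*exp (- (Re z*Im s))*exp (- abs (Im z)*abs (Re s)))*(M*(K*exp (ep*abs (Re s))))" using C M by (simp add: K_def)
   finally show ?thesis .
  qed
  also have "\<dots> = C*K*M*exp (- (Re z*Im s))*(exp (- abs (Im z)*abs (Re s))*exp (ep*abs (Re s)))" by simp
  also have "\<dots> <= C*K*M*exp (- (Re z*Im s))*exp (- (c/2)*abs (Re s))"
  proof (intro mult_left_mono)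
   \<comment> \<open>The decay rate is at least c, and at most c/2 of it is spent on the growth rate
     ep.\<close>
   have "(ep + c/2)*abs (Re s) <= abs (Im z)*abs (Re s)" using cz c by (intro mult_right_mono) auto
   then show "exp (- abs (Im z)*abs (Re s))*exp (ep*abs (Re s)) <= exp (- (c/2)*abs (Re s))"
    unfolding exp_add[symmetric] by (simp add: algebra_simps)
  qed (use C M in \<open>auto simp: K_def\<close>)
  finally show ?thesis .
 qed
 then show ?thesis using C(1) by (intro exI[of _ "C*K"]) (auto simp: K_def)
qed

lemma step_weight_exp_bound:
 assumes "0 < ht" "0 <= ep"
 shows "\<exists>C\<ge>0. \<forall>M\<ge>0. \<forall>x z t. x <= M*exp (ep*cmod (Complex t (- ht)) + b*- ht) \<longrightarrow> (abs (Im z)) <= Y \<longrightarrow>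
  cmod (step_weight ht t*exp (\<i>*z*Complex t (- ht)))*x <= C*M*exp (ht * Re z)*exp (- 1*abs t)"
proof -
 \<comment> \<open>The rate pays for the growth ep of f and for the growth abs Y of the exponential,
   and leaves decay at rate 1.\<close>
 have "0 < ep + abs Y + 1" using assms by simp
 then obtain C where C: "C >= 0" "\<And>t. cmod (step_weight ht t) <= C*exp (- (ep + abs Y + 1)*abs t)" using step_weight_bound by metis
 define K where "K = exp (ep*ht + abs b*ht)"
 have "cmod (step_weight ht t*exp (\<i>*z*Complex t (- ht)))*x <= C*K*M*exp (ht * Re z)*exp (- 1*abs t)"
  if M: "M >= 0" and x: "x <= M*exp (ep*cmod (Complex t (- ht)) + b*- ht)" and z: "abs (Im z) <= Y" for M x z t
 proof -
  have "ep*cmod (Complex t (- ht)) <= ep*(abs t + ht)" using assms cmod_le[of "Complex t (- ht)"] by (intro mult_left_mono) auto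
  moreover have "b*- ht <= abs b*ht" using assms abs_ge_minus_self[of b] mult_right_mono[of "- b" "abs b" ht] by simp
  ultimately have "exp (ep*cmod (Complex t (- ht)) + b*- ht) <= K*exp (ep*abs t)"
   unfolding K_def exp_add[symmetric] by (simp add: algebra_simps)
  then have x': "x <= M*(K*exp (ep*abs t))" using M by (intro order_trans[OF x] mult_left_mono) auto
  have "- (Im z*t) <= abs (Im z)*abs t" using abs_ge_minus_self[of "Im z*t"] by (simp add: abs_mult)
  also have "\<dots> <= abs Y*abs t" using z by (intro mult_right_mono) auto
  finally have "cmod (exp (\<i>*z*Complex t (- ht))) <= exp (ht * Re z)*exp (abs Y*abs t)"
   unfolding cmod_exp_inverse exp_add[symmetric] by (simp add: mult.commute)
  then have sw: "cmod (step_weight ht t*exp (\<i>*z*Complex t (- ht))) <=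
    (C*exp (- (ep + abs Y + 1)*abs t))*(exp (ht * Re z)*exp (abs Y*abs t))" unfolding norm_mult using C by (intro mult_mono) auto
  have "cmod (step_weight ht t*exp (\<i>*z*Complex t (- ht)))*x <=
    ((C*exp (- (ep + abs Y + 1)*abs t))*(exp (ht * Re z)*exp (abs Y*abs t)))*(M*(K*exp (ep*abs t)))"
  proof (cases "x >= 0")
   case True
   then show ?thesis using sw x' C M by (intro mult_mono) (auto simp: K_def)
  next
   case False
   then have "cmod (step_weight ht t*exp (\<i>*z*Complex t (- ht)))*x <= 0" by (simp add: mult_nonneg_nonpos)
   also have "0 <= ((C*exp (- (ep + abs Y + 1)*abs t))*(exp (ht * Re z)*exp (abs Y*abs t)))*(M*(K*exp (ep*abs t)))"
    using C M by (simp add: K_def)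
   finally show ?thesis .
  qed
  also have "\<dots> = C*K*M*exp (ht * Re z)*(exp (- (ep + abs Y + 1)*abs t)*exp (abs Y*abs t)*exp (ep*abs t))" by simp
  also have "exp (- (ep + abs Y + 1)*abs t)*exp (abs Y*abs t)*exp (ep*abs t) = exp (- 1*abs t)"
   unfolding exp_add[symmetric] by (simp add: algebra_simps)
  finally show ?thesis .
 qed
 then show ?thesis using C(1) by (intro exI[of _ "C*K"]) (auto simp: K_def)
qed

lemma down_ray_bound:
 assumes "0 < ht" "0 <= ep" "0 <= t" "0 <= M" and x: "x <= M*exp (ep*cmod (Complex 0 (- ht - t)) + b'*(- ht - t))"
  and z: "Re z <= b" "ep <= (b' - b)/2"
 shows "cmod (exp (\<i>*z*Complex 0 (- ht - t)))*x <= M*exp (ht*(ep - b'))*exp (ht * Re z)*exp (- ((b' - b)/2)*t)"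
proof -
 have n: "cmod (Complex 0 (- ht - t)) = ht + t" using assms by (simp add: cmod_eq_Im)
 have "Re z*t <= b*t" using z(1) assms(3) by (rule mult_right_mono)
 \<comment> \<open>Since Re z <= b, the weights together decay at rate b' - b along the ray; d is
   half of it, and ep takes at most the other half.\<close>
 moreover obtain d where d: "(b' - b)/2 = d" by blast
 then have b': "b' = b + 2*d" by simp
 moreover have "ep*t <= d*t" using z(2)[unfolded d] assms(3) by (rule mult_right_mono)
 ultimately have "(Re z*(ht + t)) + (ep*(ht + t) + b'*(- ht - t)) <= ht*(ep - b') + ht * Re z + (- ((b' - b)/2)*t)"
  unfolding d unfolding b' by (simp add: algebra_simps)
 then have "exp (Re z*(ht + t))*exp (ep*(ht + t) + b'*(- ht - t)) <= exp (ht*(ep - b'))*exp (ht * Re z)*exp (- ((b' - b)/2)*t)"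
  unfolding exp_add[symmetric] exp_le_cancel_iff .
 then have "M*(exp (Re z*(ht + t))*exp (ep*(ht + t) + b'*(- ht - t))) <= M*(exp (ht*(ep - b'))*exp (ht * Re z)*exp (- ((b' - b)/2)*t))"
  using assms by (intro mult_left_mono)
 moreover have A2: "cmod (exp (\<i>*z*Complex 0 (- ht - t))) = exp (Re z*(ht + t))" unfolding cmod_exp_inverse by (simp add: algebra_simps)
 moreover have "exp (Re z*(ht + t))*x <= exp (Re z*(ht + t))*(M*exp (ep*(ht + t) + b'*(- ht - t)))"
  using x n by (intro mult_left_mono) auto
 ultimately show ?thesis unfolding A2 mult.assoc[of M] mult.left_commute[of "exp (Re z*(ht + t))" M] by (blast intro: order_trans)
qed

context
 fixes a :: ereal and f :: "complex => complex"
 assumes f: "half_plane_growth a f" and a: "a ~= - \<infinity>"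
begin

lemma f_hol: "f holomorphic_on {s. Im s < 0}" using f by (simp add: half_plane_growth_def)

lemma exists_below: "\<exists>b. ereal b < a"
proof (cases a)
 case (real r)
 then show ?thesis by (intro exI[of _ "r - 1"]) simp
qed (use a in auto)

lemma mu_integrand_strip:
 assumes sg: "abs sg = 1" "0 < sg*Im z" and ht: "0 < ht"
 shows "\<exists>B\<ge>0. \<exists>dl>0. \<forall>s. - H <= Im s \<and> Im s <= - ht \<longrightarrow> cmod (mu sg s*inverse_integrand f z s) <= B*exp (- dl*abs (Re s))"
proof -
 define c where "c = sg*Im z"
 have c: "c > 0" "c/2 > 0" using sg by (auto simp: c_def)
 obtain b where b: "ereal b < a" using exists_below by blast
 obtain B where B: "B >= 0" "\<And>s. Im s <= - ht ==> cmod (f s) <= B*exp (c/2*cmod s + b*Im s)" using half_plane_growthD[OF f b c(2) ht] by blast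
 obtain C where C: "C >= 0" "\<And>M x z s. M >= 0 ==> x <= M*exp (c/2*cmod s + b*Im s) ==> 0 < c ==> c <= sg*Im z ==> (abs (Im z)) <= c ==>
  (abs (Im s)) <= H ==> cmod (mu sg s*exp (\<i>*z * s))*x <= C*M*exp (- (Re z*Im s))*exp (- (c/2)*abs (Re s))"
  using mu_weight_bound[OF sg(1), of "c/2" c b c H] c by auto
 have cz: "abs (Im z) = c" using sg unfolding c_def by (metis abs_mult abs_of_pos mult_1)
 have "cmod (mu sg s*inverse_integrand f z s) <= (C*B*exp (abs (Re z)*H))*exp (- (c/2)*abs (Re s))"
  if s: "- H <= Im s" "Im s <= - ht" for s
 proof -
  have "- (Re z*Im s) <= abs (Re z)*abs (Im s)" using abs_ge_minus_self[of "Re z*Im s"] by (simp add: abs_mult)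
  also have "\<dots> <= abs (Re z)*H" using s ht by (intro mult_left_mono) auto
  finally have "C*B*exp (- (Re z*Im s))*exp (- (c/2)*abs (Re s)) <= C*B*exp (abs (Re z)*H)*exp (- (c/2)*abs (Re s))"
   using C(1) B(1) by (intro mult_right_mono mult_left_mono) auto
  moreover have "cmod (mu sg s*exp (\<i>*z * s))*cmod (f s) <= C*B*exp (- (Re z*Im s))*exp (- (c/2)*abs (Re s))"
   using s ht cz c by (intro C B) (auto simp: c_def)
  ultimately show ?thesis unfolding inverse_integrand_def norm_mult by (simp add: mult_ac)
 qed
 then show ?thesis using C(1) B(1) c by (intro exI[of _ "C*B*exp (abs (Re z)*H)"] conjI exI[of _ "c/2"]) auto
qed

lemma mu_integrand_holomorphic: "(\<lambda>s. mu sg s*inverse_integrand f z s) holomorphic_on {s. Im s < 0}"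
 by (intro holomorphic_intros mu_holomorphic inverse_integrand_holomorphic f_hol)

lemma mu_line_shift:
 assumes sg: "abs sg = 1" "0 < sg*Im z" and ht: "0 < ht" "0 < ht'"
 shows "line_integral (- ht) (\<lambda>s. mu sg s*inverse_integrand f z s) = line_integral (- ht') (\<lambda>s. mu sg s*inverse_integrand f z s)"
proof -
 let ?h = "\<lambda>s. mu sg s*inverse_integrand f z s"
 obtain P where "\<And>w. w \<in> {w. Im w < 0} ==> (P has_field_derivative ?h w) (at w within {w. Im w < 0})"
  using holomorphic_convex_primitive'[OF convex_halfspace_Im_lt open_halfspace_Im_lt mu_integrand_holomorphic] by blast
 then have P: "(P has_field_derivative ?h w) (at w)" if "Im w < 0" for w
  using that open_halfspace_Im_lt at_within_open[of w "{w. Im w < 0}"] by force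
 have "0 < min ht ht'" using ht by simp
 then obtain B dl where B: "B >= 0" "dl > 0" "\<And>s. - max ht ht' <= Im s ==> Im s <= - min ht ht' ==> cmod (?h s) <= B*exp (- dl*abs (Re s))"
  using mu_integrand_strip[OF sg, of "min ht ht'" "max ht ht'"] by blast
 show ?thesis
 proof (rule line_integral_shift[OF _ B(2,1)])
  fix w assume "Im w \<in> {min (- ht) (- ht')..max (- ht) (- ht')}"
  then have w: "- max ht ht' <= Im w" "Im w <= - min ht ht'" by auto
  then show "cmod (?h w) <= B*exp (- dl*abs (Re w))" by (rule B(3))
  show "(P has_field_derivative ?h w) (at w)" using w ht by (intro P) auto
 qed (use ht holomorphic_isCont[OF mu_integrand_holomorphic open_halfspace_Im_lt] in auto)
qed

lemma mu_line_integrable: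
 assumes sg: "abs sg = 1" "0 < sg*Im z" and ht: "0 < ht"
 shows "integrable lborel (\<lambda>t. mu sg (Complex t (- ht))*inverse_integrand f z (Complex t (- ht)))"
proof -
 obtain B dl where B: "B >= 0" "dl > 0" "\<And>s. - ht <= Im s ==> Im s <= - ht ==> cmod (mu sg s*inverse_integrand f z s) <= B*exp (- dl*abs (Re s))"
  using mu_integrand_strip[OF sg ht, of ht] by blast
 show ?thesis by (rule line_integrable(1)[OF _ _ B(2)])
    (use B(3)[of "Complex _ (- ht)"] ht in \<open>auto intro!: holomorphic_isCont[OF mu_integrand_holomorphic open_halfspace_Im_lt]\<close>)
qed

lemma step_integrable:
 assumes ht: "0 < ht"
 shows "integrable lborel (\<lambda>t. step_weight ht t*inverse_integrand f z (Complex t (- ht)))"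
proof -
 obtain b where b: "ereal b < a" using exists_below by blast
 obtain B where B: "B >= 0" "\<And>s. Im s <= - ht ==> cmod (f s) <= B*exp (1*cmod s + b*Im s)"
  using half_plane_growthD[OF f b zero_less_one ht] by blast
 obtain C where C: "C >= 0" "\<And>M x z' t. M >= 0 ==> x <= M*exp (1*cmod (Complex t (- ht)) + b*- ht) ==> (abs (Im z')) <= abs (Im z) ==>
  cmod (step_weight ht t*exp (\<i>*z'*Complex t (- ht)))*x <= C*M*exp (ht * Re z')*exp (- 1*abs t)"
  using step_weight_exp_bound[OF ht, of 1 b "abs (Im z)"] by auto
 have b: "cmod (step_weight ht t*inverse_integrand f z (Complex t (- ht))) <= C*B*exp (ht * Re z)*exp (- 1*\<bar>t - 0\<bar>)" for t
  using C(2)[OF B(1), of "cmod (f (Complex t (- ht)))" t z] B(2)[of "Complex t (- ht)"] by (simp add: inverse_integrand_def norm_mult mult_ac)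
 show ?thesis
 proof (rule exp_decay_integrable(1)[OF _ _ b])
  have "isCont (\<lambda>t. inverse_integrand f z (Complex t (- ht))) t" for t
   by (rule isCont_o2[where f = "\<lambda>t. Complex t (- ht)" and g = "inverse_integrand f z"])
     (use ht in \<open>auto intro!: isCont_Complex isCont_inverse_integrand f_hol\<close>)
  then show "isCont (\<lambda>t. step_weight ht t*inverse_integrand f z (Complex t (- ht))) t" if "t \<notin> {0}" for t
   using isCont_step_weight[of t ht] that by (intro continuous_intros) auto
 qed auto
qed

text \<open>On the side where the multiplier tends to sg, splitting off this constant leaves sg
  times the integral of f exp(i z s) over a horizontal ray. For Re z < b < a the integrand decays in
  the whole quadrant below that ray, which can therefore be turned onto the downward ray. The result
  no longer contains sg, so the upper and the lower definition continue each other.\<close>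

lemma mu_line_eq_left_inverse:
 assumes sg: "abs sg = 1" "0 < sg*Im z" and ht: "0 < ht" and z: "ereal (Re z) < a"
 shows "line_integral (- ht) (\<lambda>s. mu sg s*inverse_integrand f z s) = left_inverse ht f z"
proof -
 let ?h = "inverse_integrand f z" and ?u = "Complex 0 (- ht)"
 have sg1: "sg = 1 \<or> sg = -1" using sg(1) by linarith
 have absz: "abs (Im z) = sg*Im z" using sg by (metis abs_mult abs_of_pos mult_1)
 obtain b where b: "ereal (Re z) < ereal b" "ereal b < a" using z ereal_dense2 by blast
 \<comment> \<open>The horizontal decay rate is abs (Im z) and the vertical one is b - Re z; half of
   the smaller one pays for the growth exp (dl*cmod s) of f.\<close>
 define dl where "dl = min (abs (Im z)) (b - Re z)/2"
 have dl: "dl > 0" using b sg absz by (simp add: dl_def)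
 obtain B where B: "B >= 0" "\<And>s. Im s <= - ht ==> cmod (f s) <= B*exp (dl*cmod s + b*Im s)" using half_plane_growthD[OF f b(2) dl ht] by blast
 have bound: "cmod (?h (?u + Complex (sg*r) (- q))) <= B*exp (dl*ht + (Re z - b)*ht)*exp (- dl*(r + q))"
  if rq: "r >= 0" "q >= 0" for r q
 proof -
  have s: "?u + Complex (sg*r) (- q) = Complex (sg*r) (- ht - q)" by (simp add: complex_eq_iff)
  have "cmod (Complex (sg*r) (- ht - q)) <= r + (ht + q)" using cmod_le[of "Complex (sg*r) (- ht - q)"] sg(1) rq ht by (simp add: abs_mult)
  then have 1: "dl*cmod (Complex (sg*r) (- ht - q)) <= dl*(r + (ht + q))" using dl by (intro mult_left_mono) auto
  have 2: "2*dl*r <= abs (Im z)*r" "2*dl*q <= (b - Re z)*q" using rq by (auto simp: dl_def intro!: mult_right_mono)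
  have 3: "Im z*(sg*r) = abs (Im z)*r" using absz by (simp add: mult_ac)
  have "(dl*cmod (Complex (sg*r) (- ht - q)) + b*(- ht - q)) + (- (Re z*(- ht - q)) - Im z*(sg*r)) <=
    (dl*ht + (Re z - b)*ht) + (- dl*(r + q))" unfolding 3 using 1 2 by (simp add: algebra_simps)
  then have e: "exp (dl*cmod (Complex (sg*r) (- ht - q)) + b*(- ht - q))*exp (- (Re z*(- ht - q)) - Im z*(sg*r)) <=
    exp (dl*ht + (Re z - b)*ht)*exp (- dl*(r + q))" unfolding mult_exp_exp exp_le_cancel_iff .
  have "cmod (?h (Complex (sg*r) (- ht - q))) <=
    (B*exp (dl*cmod (Complex (sg*r) (- ht - q)) + b*(- ht - q)))*exp (- (Re z*(- ht - q)) - Im z*(sg*r))"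
   unfolding inverse_integrand_def norm_mult cmod_exp_inverse using B(2)[of "Complex (sg*r) (- ht - q)"] rq by (simp add: mult_right_mono)
  also have "\<dots> <= B*(exp (dl*ht + (Re z - b)*ht)*exp (- dl*(r + q)))" unfolding mult.assoc using e B(1) by (intro mult_left_mono)
  finally show ?thesis unfolding s by (simp only: mult.assoc)
 qed
 have rot: "ray_integral ?u (of_real sg) ?h = ray_integral ?u (- \<i>) ?h"
  by (rule ray_integral_rotate[OF inverse_integrand_holomorphic[OF f_hol] _ _ dl _ bound]) (use ht sg1 B in auto)
 have ray: "integrable lborel (\<lambda>t. indicator {0<..} t *\<^sub>R (of_real sg*?h (?u + of_real sg * of_real t)))"
 proof (rule ray_integrable(1)[OF _ dl, where B = "B*exp (dl*ht + (Re z - b)*ht)"])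
  fix t :: real assume "t > 0"
  have e: "of_real sg * of_real t = Complex (sg*t) (- 0)" by (simp add: complex_eq_iff)
  show "cmod (?h (?u + of_real sg * of_real t)) <= B*exp (dl*ht + (Re z - b)*ht)*exp (- dl*t)"
   using bound[of t 0] \<open>t > 0\<close> unfolding e by simp
  show "isCont ?h (?u + of_real sg * of_real t)" using ht by (intro isCont_inverse_integrand f_hol) simp
 qed (use B in auto)
 \<comment> \<open>At t = 0 both indicators vanish, and for sg = -1 the two sides may differ there;
   hence almost everywhere.\<close>
 have mu_eq: "AE t in lborel. mu sg (Complex t (- ht))*?h (Complex t (- ht)) =
   step_weight ht t*?h (Complex t (- ht)) + indicator {0<..} (sg*t) *\<^sub>R (of_real sg*?h (?u + of_real t))" using AE_lborel_singleton[of 0]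
 proof eventually_elim
  fix t :: real assume "t ~= 0"
  have e: "?u + of_real t = Complex t (- ht)" by (simp add: complex_eq_iff)
  show "mu sg (Complex t (- ht))*?h (Complex t (- ht)) =
   step_weight ht t*?h (Complex t (- ht)) + indicator {0<..} (sg*t) *\<^sub>R (of_real sg*?h (?u + of_real t))"
   unfolding e using sg1 \<open>t ~= 0\<close> by (auto simp: step_weight_def mu_def algebra_simps indicator_def)
 qed
 let ?k = "\<lambda>t. indicator {0<..} t *\<^sub>R (of_real sg*?h (?u + of_real sg * of_real t))"
 have sgsg: "of_real sg*(of_real sg * of_real t) = (of_real t :: complex)" for t using sg1 by auto
 have k: "?k (0 + sg*t) = indicator {0<..} (sg*t) *\<^sub>R (of_real sg*?h (?u + of_real t))" for t by (simp add: sgsg)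
 have k1: "integrable lborel (\<lambda>t. ?k (0 + sg*t))" by (rule lborel_integrable_real_affine[OF ray]) (use sg1 in auto)
 have k2: "(\<integral>t. ?k (0 + sg*t) \<partial>lborel) = ray_integral ?u (of_real sg) ?h"
  using sg1 lborel_integral_real_affine[of sg ?k 0] by (auto simp: ray_integral_def)
 note k_int = k1 k2
 have "line_integral (- ht) (\<lambda>s. mu sg s*?h s) =
   (\<integral>t. step_weight ht t*?h (Complex t (- ht)) + ?k (0 + sg*t) \<partial>lborel)" unfolding line_integral_def k by (rule integral_cong_AE[OF _ _ mu_eq])
    (use mu_line_integrable[OF sg ht] step_integrable[OF ht, of z] k_int(1)[unfolded k] in \<open>auto intro: borel_measurable_integrable\<close>)
 also have "\<dots> = step_integral ht f z + ray_integral ?u (of_real sg) ?h"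
  using step_integrable[OF ht, of z] k_int by (subst Bochner_Integration.integral_add) (auto simp: step_integral_def)
 finally show ?thesis by (simp add: left_inverse_def rot)
qed

end

section \<open>Holomorphy of the inverse transform\<close>

lemma open_Re_less_ereal: "open {z. ereal (Re z) < a}"
proof (cases a)
 case (real r)
 then show ?thesis by (simp add: open_halfspace_Re_lt)
qed auto

lemma mu_line_holomorphic:
 assumes f: "half_plane_growth a f" and a: "a ~= - \<infinity>" and sg: "abs sg = 1" and ht: "0 < ht"
 shows "(\<lambda>z. line_integral (- ht) (\<lambda>s. mu sg s*inverse_integrand f z s)) holomorphic_on {z. 0 < sg*Im z}" unfolding line_integral_def
proof (rule holomorphic_param_integral[where S = "{}"])
 have "{z. 0 < sg*Im z} = (if sg = 1 then {z. Im z > 0} else {z. Im z < 0})" using sg by (auto simp: abs_if split: if_splits)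
 then show "open {z. 0 < sg*Im z}" by (simp add: open_halfspace_Im_gt open_halfspace_Im_lt)
 show "(\<lambda>z. mu sg (Complex t (- ht))*inverse_integrand f z (Complex t (- ht))) holomorphic_on {z. 0 < sg*Im z}" for t
  unfolding inverse_integrand_def by (intro holomorphic_intros)
 show "isCont (\<lambda>t. mu sg (Complex t (- ht))*inverse_integrand f z (Complex t (- ht))) t" for z t
  by (rule isCont_o2[where f = "\<lambda>t. Complex t (- ht)" and g = "\<lambda>s. mu sg s*inverse_integrand f z s"])
    (use ht in \<open>auto intro!: isCont_Complex isCont_mult isCont_mu isCont_inverse_integrand f_hol[OF f a]\<close>)
 fix z assume "z \<in> {z. 0 < sg*Im z}"
 then have z: "0 < sg*Im z" by simp
 \<comment> \<open>With sg*Im z = 2*c, every w in the disc of radius c about z satisfies c <= sg*Im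
   w <= 3*c.\<close>
 define c where "c = sg*Im z/2"
 have c: "c > 0" "c/2 > 0" using z by (auto simp: c_def)
 obtain b where b: "ereal b < a" using exists_below[OF f a] by blast
 obtain B where B: "B >= 0" "\<And>s. Im s <= - ht ==> cmod (f s) <= B*exp (c/2*cmod s + b*Im s)" using half_plane_growthD[OF f b c(2) ht] by blast
 obtain C where C: "C >= 0" "\<And>M x z s. M >= 0 ==> x <= M*exp (c/2*cmod s + b*Im s) ==> 0 < c ==> c <= sg*Im z ==> (abs (Im z)) <= 3*c ==>
  (abs (Im s)) <= ht ==> cmod (mu sg s*exp (\<i>*z * s))*x <= C*M*exp (- (Re z*Im s))*exp (- (c/2)*abs (Re s))"
  using mu_weight_bound[OF sg(1), of "c/2" c b "3*c" ht] c by auto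
 have "cmod (mu sg (Complex t (- ht))*inverse_integrand f w (Complex t (- ht))) <= (C*B*exp ((abs (Re z) + c)*ht))*exp (- (c/2)*abs t)"
  if w: "w \<in> ball z c" for w t
 proof -
  have d: "\<bar>Im (w - z)\<bar> < c" "\<bar>Re (w - z)\<bar> < c"
   using w abs_Im_le_cmod[of "w - z"] abs_Re_le_cmod[of "w - z"] by (auto simp: dist_norm norm_minus_commute)
  have "sg = 1 \<or> sg = -1" using sg by linarith
  then have "sg*Im w = Im w \<and> sg*Im z = Im z \<or> sg*Im w = - Im w \<and> sg*Im z = - Im z" by auto
  moreover have "\<bar>Im w - Im z\<bar> < c" "\<bar>Re w - Re z\<bar> < c" "sg*Im z = 2*c" using d by (simp_all add: c_def)
  ultimately have w': "c <= sg*Im w" "abs (Im w) <= 3*c" "Re w <= abs (Re z) + c" by linarith+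
  have "cmod (mu sg (Complex t (- ht))*exp (\<i>*w*Complex t (- ht)))*cmod (f (Complex t (- ht))) <=
    C*B*exp (- (Re w*Im (Complex t (- ht))))*exp (- (c/2)*\<bar>Re (Complex t (- ht))\<bar>)" using w' ht c by (intro C B) auto
  also have "\<dots> <= (C*B*exp ((abs (Re z) + c)*ht))*exp (- (c/2)*abs t)"
   using w'(3) ht C(1) B(1) by (simp add: mult_left_mono mult_right_mono)
  finally show ?thesis unfolding inverse_integrand_def norm_mult by (simp add: mult_ac)
 qed
 then show "\<exists>r>0. \<exists>B. \<exists>dl>0. \<forall>w\<in>ball z r \<inter> {z. 0 < sg*Im z}. \<forall>t. t \<notin> {} \<longrightarrow>
   cmod (mu sg (Complex t (- ht))*inverse_integrand f w (Complex t (- ht))) <= B*exp (- dl*abs t)"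
  using c by (intro exI[of _ c] conjI exI[of _ "C*B*exp ((abs (Re z) + c)*ht)"] exI[of _ "c/2"]) auto
qed auto

lemma step_integral_holomorphic:
 assumes f: "half_plane_growth a f" and a: "a ~= - \<infinity>" and ht: "0 < ht"
 shows "step_integral ht f holomorphic_on UNIV" unfolding step_integral_def[abs_def]
proof (rule holomorphic_param_integral[where S = "{0}"])
 show "(\<lambda>z. step_weight ht t*inverse_integrand f z (Complex t (- ht))) holomorphic_on UNIV" for t
  unfolding inverse_integrand_def by (intro holomorphic_intros)
 show "isCont (\<lambda>t. step_weight ht t*inverse_integrand f z (Complex t (- ht))) t" if "t \<notin> {0}" for z t
 proof -
  have "isCont (\<lambda>t. inverse_integrand f z (Complex t (- ht))) t"
   by (rule isCont_o2[where f = "\<lambda>t. Complex t (- ht)" and g = "inverse_integrand f z"])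
     (use ht in \<open>auto intro!: isCont_Complex isCont_inverse_integrand f_hol[OF f a]\<close>)
  then show ?thesis using isCont_step_weight[of t ht] that by (intro continuous_intros) auto
 qed
 fix z :: complex
 obtain b where b: "ereal b < a" using exists_below[OF f a] by blast
 obtain B where B: "B >= 0" "\<And>s. Im s <= - ht ==> cmod (f s) <= B*exp (1*cmod s + b*Im s)"
  using half_plane_growthD[OF f b zero_less_one ht] by blast
 obtain C where C: "C >= 0" "\<And>M x z' t. M >= 0 ==> x <= M*exp (1*cmod (Complex t (- ht)) + b*- ht) ==> (abs (Im z')) <= abs (Im z) + 1 ==>
  cmod (step_weight ht t*exp (\<i>*z'*Complex t (- ht)))*x <= C*M*exp (ht * Re z')*exp (- 1*abs t)"
  using step_weight_exp_bound[OF ht, of 1 b "abs (Im z) + 1"] by auto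
 have "cmod (step_weight ht t*inverse_integrand f w (Complex t (- ht))) <= (C*B*exp (ht*(abs (Re z) + 1)))*exp (- 1*abs t)"
  if w: "w \<in> ball z 1" for w t
 proof -
  have d: "\<bar>Im (w - z)\<bar> < 1" "\<bar>Re (w - z)\<bar> < 1"
   using w abs_Im_le_cmod[of "w - z"] abs_Re_le_cmod[of "w - z"] by (auto simp: dist_norm norm_minus_commute)
  then have w': "abs (Im w) <= abs (Im z) + 1" "Re w <= abs (Re z) + 1" by auto
  have "cmod (step_weight ht t*exp (\<i>*w*Complex t (- ht)))*cmod (f (Complex t (- ht))) <= C*B*exp (ht * Re w)*exp (- 1*abs t)"
   by (rule C(2)[OF B(1) _ w'(1)]) (use B(2)[of "Complex t (- ht)"] in simp)
  also have "\<dots> <= (C*B*exp (ht*(abs (Re z) + 1)))*exp (- 1*abs t)" using w'(2) ht C(1) B(1) by (intro mult_right_mono mult_left_mono) auto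
  finally show ?thesis unfolding inverse_integrand_def norm_mult by (simp add: mult_ac)
 qed
 then show "\<exists>r>0. \<exists>B. \<exists>dl>0. \<forall>w\<in>ball z r \<inter> UNIV. \<forall>t. t \<notin> {0} \<longrightarrow>
   cmod (step_weight ht t*inverse_integrand f w (Complex t (- ht))) <= B*exp (- dl*abs t)"
  by (intro exI[of _ 1] conjI exI[of _ "C*B*exp (ht*(abs (Re z) + 1))"]) auto
qed auto

lemma down_ray_point: "Complex 0 (- ht) + - \<i> * of_real t = Complex 0 (- ht - t)" by (simp add: complex_eq_iff)

lemma down_ray_integrand:
 assumes f: "half_plane_growth a f" and a: "a ~= - \<infinity>" and ht: "0 < ht" and "t > 0"
 shows "isCont (inverse_integrand f z) (Complex 0 (- ht) + - \<i> * of_real t)"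
 unfolding down_ray_point using assms by (intro isCont_inverse_integrand f_hol[OF f a]) auto

lemma down_ray_holomorphic:
 assumes f: "half_plane_growth a f" and a: "a ~= - \<infinity>" and ht: "0 < ht"
 shows "(\<lambda>z. ray_integral (Complex 0 (- ht)) (- \<i>) (inverse_integrand f z)) holomorphic_on {z. ereal (Re z) < a}" unfolding ray_integral_def
proof (rule holomorphic_param_integral[OF open_Re_less_ereal, where S = "{0}"])
 let ?h = "\<lambda>z t. indicator {0<..} t *\<^sub>R (- \<i>*inverse_integrand f z (Complex 0 (- ht) + - \<i> * of_real t))"
 show "(\<lambda>z. ?h z t) holomorphic_on {z. ereal (Re z) < a}" for t unfolding inverse_integrand_def scaleR_conv_of_real by (intro holomorphic_intros)
 show "isCont (?h z) t" if t: "t \<notin> {0}" for z t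
 proof (cases "t > 0")
  case True
  have "\<forall>\<^sub>F s in nhds t. s \<in> {0<..}" using True by (intro eventually_nhds_in_open) auto
  then have *: "\<forall>\<^sub>F s in nhds t. ?h z s = - \<i>*inverse_integrand f z (Complex 0 (- ht) + - \<i> * of_real s)" by eventually_elim simp
  show ?thesis unfolding isCont_cong[OF *]
   by (intro continuous_intros isCont_o2[where f = "\<lambda>s. Complex 0 (- ht) + - \<i> * of_real s" and g = "inverse_integrand f z"]
     down_ray_integrand[OF f a ht True])
 next
  case False
  have "\<forall>\<^sub>F s in nhds t. s \<in> {..<0}" using False t by (intro eventually_nhds_in_open) auto
  then have *: "\<forall>\<^sub>F s in nhds t. ?h z s = 0" by eventually_elim simp
  show ?thesis unfolding isCont_cong[OF *] by simp
 qed
 fix z assume "z \<in> {z. ereal (Re z) < a}"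
 then obtain b' where b': "Re z < b'" "ereal b' < a" using ereal_dense2[of "ereal (Re z)" a] by auto
 \<comment> \<open>The point b lies midway between Re z and b', so that the disc of radius d about z
   stays in Re w <= b and the gap b' - b = d remains.\<close>
 define d where "d = (b' - Re z)/2"
 define b where "b = Re z + d"
 have d: "d > 0" "b' - b = d" using b' by (auto simp: d_def b_def field_simps)
 have ep: "(b' - b)/2 > 0" using d by simp
 obtain B where B: "B >= 0" "\<And>s. Im s <= - ht ==> cmod (f s) <= B*exp ((b' - b)/2*cmod s + b'*Im s)"
  using half_plane_growthD[OF f b'(2) ep ht] by blast
 have "cmod (?h w t) <= (B*exp (ht*((b' - b)/2 - b'))*exp (ht*b))*exp (- ((b' - b)/2)*abs t)"
  if w: "w \<in> ball z d" for w t
 proof (cases "t > 0")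
  case True
  have "\<bar>Re (w - z)\<bar> < d" using w abs_Re_le_cmod[of "w - z"] by (auto simp: dist_norm norm_minus_commute)
  then have w': "Re w <= b" by (auto simp: b_def)
  have "cmod (exp (\<i>*w*Complex 0 (- ht - t)))*cmod (f (Complex 0 (- ht - t))) <=
    B*exp (ht*((b' - b)/2 - b'))*exp (ht * Re w)*exp (- ((b' - b)/2)*t)"
   by (rule down_ray_bound[OF ht _ _ B(1) _ w']) (use B(2)[of "Complex 0 (- ht - t)"] True ep in auto)
  also have "\<dots> <= (B*exp (ht*((b' - b)/2 - b'))*exp (ht*b))*exp (- ((b' - b)/2)*t)"
   using w' ht B(1) by (intro mult_right_mono mult_left_mono) auto
  finally show ?thesis using True unfolding down_ray_point by (simp add: inverse_integrand_def norm_mult mult.commute)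
 qed (use B in simp)
 then show "\<exists>r>0. \<exists>B. \<exists>dl>0. \<forall>w\<in>ball z r \<inter> {z. ereal (Re z) < a}. \<forall>t. t \<notin> {0} \<longrightarrow> cmod (?h w t) <= B*exp (- dl*abs t)"
  using d(1) ep by (intro exI[of _ d] conjI exI[of _ "B*exp (ht*((b' - b)/2 - b'))*exp (ht*b)"] exI[of _ "(b' - b)/2"]) auto
qed auto

lemma left_inverse_holomorphic:
 assumes "half_plane_growth a f" "a ~= - \<infinity>" "0 < ht"
 shows "left_inverse ht f holomorphic_on {z. ereal (Re z) < a}" unfolding left_inverse_def[abs_def]
 by (intro holomorphic_on_add down_ray_holomorphic[OF assms] holomorphic_on_subset[OF step_integral_holomorphic[OF assms]]) auto

lemma inverse_fourier_mu:
 assumes f: "half_plane_growth a f" and a: "a ~= - \<infinity>" and sg: "abs sg = 1" "0 < sg*Im z" and ht: "0 < ht"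
 shows "inverse_fourier f z = 1/(2*pi)*line_integral (- ht) (\<lambda>s. mu sg s*inverse_integrand f z s)"
proof -
 have "sg = 1 \<or> sg = -1" using sg by linarith
 then have "inverse_fourier f z = 1/(2*pi)*line_integral (- 1) (\<lambda>s. mu sg s*inverse_integrand f z s)"
  using sg(2) by (auto simp: inverse_fourier_def)
 then show ?thesis using mu_line_shift[OF f a sg ht, of 1] by simp
qed

lemma Im_sign: "Im z ~= 0 ==> \<exists>sg. abs sg = 1 \<and> 0 < sg*Im z" by (intro exI[of _ "sgn (Im z)"]) (auto simp: abs_sgn_eq sgn_mult_self_eq sgn_if)

text \<open>Off the real axis both sides equal an integral with the multiplier. At a real point the
  forms with heights ht and 1 are holomorphic near z and agree at points approaching z from
  above.\<close>

lemma inverse_fourier_left: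
 assumes f: "half_plane_growth a f" and a: "a ~= - \<infinity>" and ht: "0 < ht" and z: "ereal (Re z) < a"
 shows "inverse_fourier f z = 1/(2*pi)*left_inverse ht f z"
proof (cases "Im z = 0")
 case False
 then obtain sg where sg: "abs sg = 1" "0 < sg*Im z" using Im_sign by blast
 show ?thesis unfolding inverse_fourier_mu[OF f a sg ht] mu_line_eq_left_inverse[OF f a sg ht z] ..
next
 case True
 let ?D = "\<lambda>w. left_inverse ht f w - left_inverse 1 f w"
 have "?D holomorphic_on {z. ereal (Re z) < a}" by (intro holomorphic_on_diff left_inverse_holomorphic[OF f a]) (use ht in auto)
 then have "isCont ?D z" using z by (intro holomorphic_isCont[OF _ open_Re_less_ereal]) auto
 moreover have "(\<lambda>n. z + \<i> * of_real (inverse (real (Suc n)))) \<longlonglongrightarrow> z + \<i> * of_real 0" by (intro tendsto_intros LIMSEQ_inverse_real_of_nat)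
 ultimately have "(\<lambda>n. ?D (z + \<i> * of_real (inverse (real (Suc n))))) \<longlonglongrightarrow> ?D z" by (intro isCont_tendsto_compose[of z ?D]) simp_all
 moreover have "?D (z + \<i> * of_real (inverse (real (Suc n)))) = 0" for n
 proof -
  let ?w = "z + \<i> * of_real (inverse (real (Suc n)))"
  have w: "0 < 1*Im ?w" "ereal (Re ?w) < a" using True z by (simp_all del: of_nat_Suc)
  have "left_inverse ht f ?w = line_integral (- ht) (\<lambda>s. mu 1 s*inverse_integrand f ?w s)"
   by (rule mu_line_eq_left_inverse[OF f a _ w(1) ht w(2), symmetric]) simp
  also have "\<dots> = line_integral (- 1) (\<lambda>s. mu 1 s*inverse_integrand f ?w s)" by (rule mu_line_shift[OF f a _ w(1) ht]) auto
  also have "\<dots> = left_inverse 1 f ?w" by (rule mu_line_eq_left_inverse[OF f a _ w(1) _ w(2)]) auto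
  finally show ?thesis by simp
 qed
 ultimately have "(\<lambda>n::nat. 0::complex) \<longlonglongrightarrow> ?D z" by (simp only:)
 then have "?D z = 0" by (simp add: LIMSEQ_const_iff)
 then show ?thesis using True by (simp add: inverse_fourier_def)
qed

lemma inverse_fourier_holomorphic:
 assumes f: "half_plane_growth a f" and a: "a ~= - \<infinity>"
 shows "inverse_fourier f holomorphic_on slit_plane a" unfolding holomorphic_on_open[OF open_slit_plane]
proof
 fix z assume z: "z \<in> slit_plane a"
 show "\<exists>D. (inverse_fourier f has_field_derivative D) (at z)"
 proof (cases "ereal (Re z) < a")
  case True
  let ?g = "\<lambda>z. 1/(2*pi)*left_inverse 1 f z"
  have "?g holomorphic_on {z. ereal (Re z) < a}" by (intro holomorphic_intros left_inverse_holomorphic[OF f a]) auto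
  then have "(?g has_field_derivative deriv ?g z) (at z)" using True by (intro holomorphic_derivI[OF _ open_Re_less_ereal]) auto
  then have "(inverse_fourier f has_field_derivative deriv ?g z) (at z)"
   by (rule has_field_derivative_transform_within_open[OF _ open_Re_less_ereal[of a]])
     (use True inverse_fourier_left[OF f a zero_less_one] in auto)
  then show ?thesis by blast
 next
  case False
  then have "Im z ~= 0" using z by (simp add: slit_plane_def)
  then obtain sg where sg: "abs sg = 1" "0 < sg*Im z" using Im_sign by blast
  let ?g = "\<lambda>z. 1/(2*pi)*line_integral (- 1) (\<lambda>s. mu sg s*inverse_integrand f z s)"
  have op: "open {z. 0 < sg*Im z}" by (intro open_Collect_less continuous_intros)
  have "?g holomorphic_on {z. 0 < sg*Im z}" by (intro holomorphic_intros mu_line_holomorphic[OF f a sg(1)]) auto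
  then have "(?g has_field_derivative deriv ?g z) (at z)" using sg by (intro holomorphic_derivI[OF _ op]) auto
  then have "(inverse_fourier f has_field_derivative deriv ?g z) (at z)" by (rule has_field_derivative_transform_within_open[OF _ op])
     (use sg inverse_fourier_mu[OF f a sg(1) _ zero_less_one] in auto)
  then show ?thesis by blast
 qed
qed

text \<open>C precedes f and M, so the linear dependence on M becomes continuity of the inverse. The
  factor exp (ht * Re z) stems from the height of the line: a small ht gives slow growth to the
  right, a large ht strong decay to the left. Points with |Im z| >= c use the multiplier, points
  with Re z <= b the form \<open>left_inverse\<close>.\<close>

lemma inverse_fourier_bound:
 assumes b: "b < b'" "ereal b < a" and c: "0 < c" and ht: "0 < ht" and a: "a ~= - \<infinity>"
  and ep: "0 < ep" "ep <= c/2" "ep <= (b' - b)/2"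
 shows "\<exists>C\<ge>0. \<forall>M\<ge>0. \<forall>f z. half_plane_growth a f \<longrightarrow> (\<forall>s. Im s <= - ht \<longrightarrow> cmod (f s) <= M*exp (ep*cmod s + b'*Im s)) \<longrightarrow>
  (Re z <= b \<or> c <= abs (Im z)) \<longrightarrow> (abs (Im z)) <= Y \<longrightarrow> cmod (inverse_fourier f z) <= C*M*exp (ht * Re z)"
proof -
 have "\<exists>C\<ge>0. \<forall>M\<ge>0. \<forall>x z s. x <= M*exp (ep*cmod s + b'*Im s) \<longrightarrow> 0 < c \<longrightarrow> c <= sg*Im z \<longrightarrow> (abs (Im z)) <= Y \<longrightarrow>
  (abs (Im s)) <= ht \<longrightarrow> cmod (mu sg s*exp (\<i>*z * s))*x <= C*M*exp (- (Re z*Im s))*exp (- (c/2)*abs (Re s))"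
  if "abs sg = 1" for sg by (rule mu_weight_bound[OF that]) (use ep in auto)
 then obtain C where C: "\<And>sg. abs sg = 1 ==> C sg >= 0" "\<And>sg M x z s. abs sg = 1 ==> M >= 0 ==> x <= M*exp (ep*cmod s + b'*Im s) ==> 0 < c ==> c <= sg*Im z ==>
  (abs (Im z)) <= Y ==> (abs (Im s)) <= ht ==> cmod (mu sg s*exp (\<i>*z * s))*x <= C sg*M*exp (- (Re z*Im s))*exp (- (c/2)*abs (Re s))"
  by metis
 obtain D where D: "D >= 0" "\<And>M x z t. M >= 0 ==> x <= M*exp (ep*cmod (Complex t (- ht)) + b'*- ht) ==> (abs (Im z)) <= Y ==>
  cmod (step_weight ht t*exp (\<i>*z*Complex t (- ht)))*x <= D*M*exp (ht * Re z)*exp (- 1*abs t)"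
  using step_weight_exp_bound[OF ht, of ep b' Y] ep by auto
 define C1 where "C1 = C 1 + C (-1)"
 define K where "K = 2*C1/(c/2)"
 define L where "L = 2*D + 2*exp (ht*(ep - b'))/((b' - b)/2)"
 have C1: "C1 >= 0" "K >= 0" "L >= 0" using C(1)[of 1] C(1)[of "-1"] c D(1) b by (auto simp: C1_def K_def L_def)
 have "cmod (inverse_fourier f z) <= (K + L)*M*exp (ht * Re z)"
  if M: "M >= 0" and f: "half_plane_growth a f" and fM: "\<And>s. Im s <= - ht ==> cmod (f s) <= M*exp (ep*cmod s + b'*Im s)"
   and z: "Re z <= b \<or> c <= abs (Im z)" "abs (Im z) <= Y" for M f z
 proof -
  have pi1: "cmod (1/(2*pi)*x) <= cmod x" for x :: complex
  proof -
   have "1/(2*pi) <= 1" using pi_ge_two by (simp add: field_simps)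
   then show ?thesis using mult_right_mono[of "1/(2*pi)" 1 "cmod x"] by (simp add: norm_mult norm_divide)
  qed
  consider "c <= abs (Im z)" | "Re z <= b" using z by blast
  then have "cmod (inverse_fourier f z) <= K*M*exp (ht * Re z) \<or> cmod (inverse_fourier f z) <= L*M*exp (ht * Re z)"
  proof cases
   case 1
   then have "Im z ~= 0" using c by auto
   then obtain sg where sg: "abs sg = 1" "0 < sg*Im z" using Im_sign by blast
   have "abs (Im z) = sg*Im z" using sg by (metis abs_mult abs_of_pos mult_1)
   then have cz: "c <= sg*Im z" using 1 by simp
   have "sg = 1 \<or> sg = -1" using sg by linarith
   then have "C sg <= C1" using C(1)[of 1] C(1)[of "-1"] by (auto simp: C1_def)
   have b1: "cmod (mu sg (Complex t (- ht))*inverse_integrand f z (Complex t (- ht))) <= C1*M*exp (ht * Re z)*exp (- (c/2)*abs t)" for t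
   proof -
    have "cmod (mu sg (Complex t (- ht))*exp (\<i>*z*Complex t (- ht)))*cmod (f (Complex t (- ht))) <=
     C sg*M*exp (- (Re z*Im (Complex t (- ht))))*exp (- (c/2)*\<bar>Re (Complex t (- ht))\<bar>)" using ht c by (intro C sg M fM cz z) auto
    also have "\<dots> <= C1*M*exp (ht * Re z)*exp (- (c/2)*abs t)" using \<open>C sg <= C1\<close> M by (simp add: mult_right_mono mult.commute[of "Re z"])
    finally show ?thesis unfolding inverse_integrand_def norm_mult by (simp add: mult_ac)
   qed
   have "cmod (line_integral (- ht) (\<lambda>s. mu sg s*inverse_integrand f z s)) <= 2*(C1*M*exp (ht * Re z))/(c/2)"
    by (rule line_integrable(2)[OF _ b1]) (use ht c in \<open>auto intro!: isCont_mult isCont_mu isCont_inverse_integrand f_hol[OF f a]\<close>)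
   then have "cmod (inverse_fourier f z) <= K*M*exp (ht * Re z)"
    unfolding inverse_fourier_mu[OF f a sg ht] K_def by (intro order_trans[OF pi1]) (simp add: mult_ac)
   then show ?thesis ..
  next
   case 2
   then have za: "ereal (Re z) < a" using b(2) by (auto intro: le_less_trans[of _ "ereal b"])
   have b2: "cmod (step_weight ht t*inverse_integrand f z (Complex t (- ht))) <= D*M*exp (ht * Re z)*exp (- 1*\<bar>t - 0\<bar>)" for t
    using D(2)[OF M, of "cmod (f (Complex t (- ht)))" t z] fM[of "Complex t (- ht)"] z by (simp add: inverse_integrand_def norm_mult mult_ac)
   have "cmod (step_integral ht f z) <= 2*(D*M*exp (ht * Re z))/1" unfolding step_integral_def
   proof (rule exp_decay_integrable(2)[OF _ _ b2])
    have "isCont (\<lambda>t. inverse_integrand f z (Complex t (- ht))) t" for t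
     by (rule isCont_o2[where f = "\<lambda>t. Complex t (- ht)" and g = "inverse_integrand f z"])
       (use ht in \<open>auto intro!: isCont_Complex isCont_inverse_integrand f_hol[OF f a]\<close>)
    then show "isCont (\<lambda>t. step_weight ht t*inverse_integrand f z (Complex t (- ht))) t" if "t \<notin> {0}" for t
     using isCont_step_weight[of t ht] that by (intro continuous_intros) auto
   qed auto
   moreover have "cmod (ray_integral (Complex 0 (- ht)) (- \<i>) (inverse_integrand f z)) <=
     2*(cmod (- \<i>)*(M*exp (ht*(ep - b'))*exp (ht * Re z)))/((b' - b)/2)"
   proof (rule ray_integrable(2)[OF down_ray_integrand[OF f a ht]])
    fix t :: real assume t: "t > 0"
    have "cmod (exp (\<i>*z*Complex 0 (- ht - t)))*cmod (f (Complex 0 (- ht - t))) <=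
      M*exp (ht*(ep - b'))*exp (ht * Re z)*exp (- ((b' - b)/2)*t)"
     by (rule down_ray_bound[OF ht _ _ M _ 2]) (use fM[of "Complex 0 (- ht - t)"] t ep in auto)
    then show "cmod (inverse_integrand f z (Complex 0 (- ht) + - \<i> * of_real t)) <=
      M*exp (ht*(ep - b'))*exp (ht * Re z)*exp (- ((b' - b)/2)*t)"
     unfolding down_ray_point inverse_integrand_def norm_mult by (simp add: mult.commute)
   qed (use b M in auto)
   ultimately have "cmod (left_inverse ht f z) <= 2*(D*M*exp (ht * Re z))/1 + 2*(cmod (- \<i>)*(M*exp (ht*(ep - b'))*exp (ht * Re z)))/((b' - b)/2)"
    unfolding left_inverse_def by (rule norm_triangle_mono)
   also have "\<dots> = L*M*exp (ht * Re z)" by (simp add: L_def distrib_right)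
   finally have "cmod (inverse_fourier f z) <= L*M*exp (ht * Re z)" unfolding inverse_fourier_left[OF f a ht za] by (rule order_trans[OF pi1])
   then show ?thesis ..
  qed
  moreover have "K*M*exp (ht * Re z) <= (K + L)*M*exp (ht * Re z)" "L*M*exp (ht * Re z) <= (K + L)*M*exp (ht * Re z)"
   using C1 M by (auto intro!: mult_right_mono)
  ultimately show ?thesis by linarith
 qed
 then show ?thesis using C1 by (intro exI[of _ "K + L"]) auto
qed

lemma inverse_fourier_growth:
 assumes f: "half_plane_growth a f" and b: "ereal b < a" and c: "0 < c" and ht: "0 < ht"
 shows "\<exists>B\<ge>0. \<forall>z. Re z <= b \<or> c <= abs (Im z) \<longrightarrow> (abs (Im z)) <= Y \<longrightarrow> cmod (inverse_fourier f z) <= B*exp (ht * Re z)"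
proof -
 have a: "a ~= - \<infinity>" using b by auto
 obtain b' where b': "b < b'" "ereal b' < a" using ereal_dense2[OF b] by auto
 define ep where "ep = min (c/2) ((b' - b)/2)"
 have ep: "0 < ep" "ep <= c/2" "ep <= (b' - b)/2" using c b' by (auto simp: ep_def min_def)
 obtain M where M: "M >= 0" "\<And>s. Im s <= - ht ==> cmod (f s) <= M*exp (ep*cmod s + b'*Im s)" using half_plane_growthD[OF f b'(2) ep(1) ht] by blast
 obtain C where C: "C >= 0" "\<And>M f z. M >= 0 ==> half_plane_growth a f ==> (\<And>s. Im s <= - ht ==> cmod (f s) <= M*exp (ep*cmod s + b'*Im s)) ==>
  (Re z <= b \<or> c <= abs (Im z)) ==> (abs (Im z)) <= Y ==> cmod (inverse_fourier f z) <= C*M*exp (ht * Re z)"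
  using inverse_fourier_bound[OF b'(1) b c ht a ep, of Y] by blast
 show ?thesis using C(2)[OF M(1) f M(2)] C(1) M(1) by (intro exI[of _ "C*M"]) auto
qed

lemma inverse_fourier_slow_growth:
 assumes f: "half_plane_growth a f" and a: "a ~= - \<infinity>"
 shows "slow_growth a (inverse_fourier f)" unfolding slow_growth_def
proof (intro conjI allI impI inverse_fourier_holomorphic[OF f a])
 fix b c Y ep :: real assume *: "ereal b < a" "0 < c" "0 < ep"
 obtain B where B: "B >= 0" "\<And>z. Re z <= b \<or> c <= abs (Im z) ==> (abs (Im z)) <= Y ==> cmod (inverse_fourier f z) <= B*exp (ep * Re z)"
  using inverse_fourier_growth[OF f *] by blast
 have "B*exp (ep * Re z) <= B*exp (ep*abs (Re z))" for z using B(1) * by (intro mult_left_mono) auto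
 then show "\<exists>B\<ge>0. \<forall>z. Re z <= b \<or> c <= abs (Im z) \<longrightarrow> (abs (Im z)) <= Y \<longrightarrow> cmod (inverse_fourier f z) <= B*exp (ep*abs (Re z))"
  using B by (intro exI[of _ B]) (auto intro: order_trans)
qed

text \<open>To the left the inverse decays faster than the exponential grows, so the path around K
  may be replaced by the lines Im z = 1 and Im z = -1. Fourier inversion yields mu 1 zt * f zt and
  mu (-1) zt * f zt on them, and the two multipliers differ by 1.\<close>

lemma fourier_inverse_fourier:
 assumes f: "half_plane_growth a f" and b: "ereal b < a" and zt: "Im zt < 0"
 shows "hairpin_integral b 0 1 (fourier_integrand (inverse_fourier f) zt) = f zt"
proof -
 have a: "a ~= - \<infinity>" using b by auto
 let ?h = "fourier_integrand (inverse_fourier f) zt"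
 have slow: "slow_growth a (inverse_fourier f)" by (rule inverse_fourier_slow_growth[OF f a])
 have hol: "?h holomorphic_on slit_plane a" by (intro fourier_integrand_holomorphic inverse_fourier_holomorphic[OF f a])
 have "\<exists>P. \<forall>w\<in>slit_plane a. (P has_field_derivative ?h w) (at w)"
  by (rule slit_plane_primitive[OF b, of "{}"]) (use hol in \<open>auto dest: holomorphic_on_imp_continuous_on\<close>)
 then obtain P where P: "\<And>w. w \<in> slit_plane a ==> (P has_field_derivative ?h w) (at w)" by blast
 have line: "integrable lborel (\<lambda>t. ?h (Complex t sg)) \<and> line_integral sg ?h = mu sg zt*f zt" if sg: "abs sg = 1" for sg
 proof -
  have sgsg: "0 < sg * sg" using sg by (metis abs_mult_self_eq mult_1 zero_less_one)
  \<comment> \<open>On the line z = t + i sg the factor exp(i z s) splits into exp(i t s), the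
    Fourier kernel, and exp(- sg s), which is put into g.\<close>
  define g where "g s = mu sg s*inverse_integrand f (Complex 0 sg) s" for s
  define \<Phi> where "\<Phi> t = 2*pi*inverse_fourier f (Complex t sg)" for t
  have ghol: "g holomorphic_on {s. Im s < 0}" unfolding g_def by (rule mu_integrand_holomorphic[OF f a])
  have gb: "\<exists>B\<ge>0. \<exists>dl>0. \<forall>s. - H <= Im s \<and> Im s <= - ht \<longrightarrow> cmod (g s) <= B*exp (- dl*abs (Re s))" if "0 < ht" "ht <= H" for ht H
   unfolding g_def by (rule mu_integrand_strip[OF f a sg _ that(1)]) (use sgsg in simp)
  have \<Phi>: "\<Phi> t = line_integral (- ht) (\<lambda>s. g s*exp (\<i> * of_real t * s))" if "ht > 0" for t ht
  proof -
   have "inverse_integrand f (Complex t sg) s = inverse_integrand f (Complex 0 sg) s*exp (\<i> * of_real t * s)" for s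
   proof -
    have "\<i>*Complex t sg * s = \<i>*Complex 0 sg * s + \<i> * of_real t * s" by (simp add: complex_eq_iff)
    then show ?thesis by (simp add: inverse_integrand_def exp_add)
   qed
   then show ?thesis unfolding \<Phi>_def g_def using inverse_fourier_mu[OF f a sg _ that, of "Complex t sg"] sgsg by (simp add: mult.assoc)
  qed
  have inv1: "integrable lborel (\<lambda>t. \<Phi> t*exp (- \<i> * of_real t*zt))" by (rule fourier_inversion(1)[OF ghol gb \<Phi> zt])
  have inv2: "(\<integral>t. \<Phi> t*exp (- \<i> * of_real t*zt) \<partial>lborel) = 2*pi*g zt" by (rule fourier_inversion(2)[OF ghol gb \<Phi> zt])
  have eq: "?h (Complex t sg) = (1/(2*pi)*exp (sg*zt))*(\<Phi> t*exp (- \<i> * of_real t*zt))" for t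
  proof -
   have "- \<i>*Complex t sg*zt = sg*zt + - \<i> * of_real t*zt" by (simp add: complex_eq_iff)
   then show ?thesis unfolding fourier_integrand_def \<Phi>_def by (simp only: exp_add) simp
  qed
  have "line_integral sg ?h = (1/(2*pi)*exp (sg*zt))*(2*pi*g zt)"
   unfolding line_integral_def eq integral_mult_right_zero by (simp only: inv2)
  also have "\<dots> = exp (sg*zt)*g zt" by simp
  also have "\<dots> = mu sg zt*f zt"
  proof -
   have "sg*zt + \<i>*Complex 0 sg*zt = 0" by (simp add: complex_eq_iff)
   then have "exp (sg*zt)*exp (\<i>*Complex 0 sg*zt) = 1" by (metis exp_add exp_zero)
   then show ?thesis by (simp add: g_def inverse_integrand_def mult_ac)
  qed
  finally show ?thesis unfolding eq by (intro conjI integrable_mult_right inv1)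
 qed
 define ta where "ta = - Im zt"
 have ta: "ta > 0" using zt by (simp add: ta_def)
 \<comment> \<open>The rate 2*ta to the left is weighed against the growth at rate ta of exp(-i w
   zt) in that direction.\<close>
 obtain B where B: "B >= 0" "\<And>z. Re z <= b \<or> 1 <= abs (Im z) ==> (abs (Im z)) <= 1 ==> cmod (inverse_fourier f z) <= B*exp (2*ta * Re z)"
  using inverse_fourier_growth[OF f b zero_less_one, of "2*ta" 1] ta by (meson mult_pos_pos zero_less_numeral)
 have av: "hairpin_avoids b 1 b 0 1" by (rule hairpin_avoids_rectangle) simp
 have "hairpin_integral b 0 1 ?h = line_integral 1 ?h - line_integral (- 1) ?h"
 proof (rule hairpin_integral_lines[OF P, where dl = ta and B = "B*exp (abs (Re zt))"])
  show "hairpin b 0 1 t \<in> slit_plane a" for t by (rule hairpin_in_slit_plane[OF av b])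
  show "integrable lborel (\<lambda>t. hairpin_deriv 0 1 t*?h (hairpin b 0 1 t))" by (rule fourier_hairpin_integrable[OF slow b av zt])
  fix w assume w: "abs (Im w) <= 1" "Re w <= - (- b)"
  have "cmod (?h w) <= B*exp (2*ta * Re w)*exp (Re w*Im zt + Im w * Re zt)"
   unfolding fourier_integrand_def norm_mult cmod_exp_fourier using B(2)[of w] w by (intro mult_right_mono) auto
  also have "\<dots> <= B*exp (2*ta * Re w)*exp (Re w*Im zt + abs (Re zt))"
  proof -
   have "Im w * Re zt <= abs (Im w)*abs (Re zt)" by (simp flip: abs_mult)
   also have "\<dots> <= 1*abs (Re zt)" using w by (intro mult_right_mono) auto
   finally show ?thesis using B(1) by (intro mult_left_mono) auto
  qed
  also have "\<dots> = B*(exp (2*ta * Re w)*exp (Re w*Im zt + abs (Re zt)))" by simp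
  also have "exp (2*ta * Re w)*exp (Re w*Im zt + abs (Re zt)) = exp (abs (Re zt))*exp (ta * Re w)"
   unfolding mult_exp_exp by (simp add: ta_def algebra_simps)
  finally have "cmod (?h w) <= B*exp (abs (Re zt))*exp (ta * Re w)" by (simp only: mult.assoc)
  moreover have "w \<in> slit_plane a" using w b by (auto simp: slit_plane_def intro: le_less_trans[of _ "ereal b"])
  ultimately show "w \<in> slit_plane a \<and> cmod (?h w) <= B*exp (abs (Re zt))*exp (ta * Re w)" by blast
 qed (use line[of 1] line[of "-1"] ta B in \<open>auto simp: slit_plane_def\<close>)
 also have "\<dots> = f zt" using line[of 1] line[of "-1"] by (simp add: mu_def algebra_simps)
 finally show ?thesis .
qed

section \<open>Functions whose Fourier transform vanishes\<close>

definition gauss_kernel :: "complex => complex => complex" where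
 "gauss_kernel z w = exp (- (w - z)\<^sup>2/4)"

text \<open>The estimate \<open>cmod_exp_minus_square\<close> with R = 2 at the point (w - z)/2,
  with the sign opposite to that of Re (w - z).\<close>

lemma gauss_kernel_bound:
 assumes "\<bar>Im (w - z)\<bar> <= Y"
 shows "cmod (gauss_kernel z w) <= exp (Y\<^sup>2/4 + 1)*exp (- \<bar>Re (w - z)\<bar>)"
proof -
 have "\<bar>Im ((w - z)/2)\<bar> <= Y/2" using assms by simp
 then have *: "cmod (exp (- ((w - z)/2)\<^sup>2)) <= exp ((Y/2)\<^sup>2 + 2\<^sup>2/4)*exp (2*(sg * Re ((w - z)/2)))" if "abs sg = 1" for sg
  by (rule cmod_exp_minus_square) (rule that)
 have eqs: "- (w - z)\<^sup>2/4 = - ((w - z)/2)\<^sup>2" "(Y/2)\<^sup>2 + 2\<^sup>2/4 = Y\<^sup>2/4 + 1" "2*(sg * Re ((w - z)/2)) = sg * Re (w - z)" for sg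
  by (simp_all add: power_divide)
 show ?thesis using *[of 1] *[of "- 1"] unfolding gauss_kernel_def eqs by (cases "Re (w - z) >= 0") simp_all
qed

lemma gauss_kernel_holomorphic: "gauss_kernel z holomorphic_on X" unfolding gauss_kernel_def[abs_def] by (intro holomorphic_intros) auto

text \<open>The strip |Im w| <= c lies in a half-plane that excludes the pole z, so there is a
  primitive, and the Gaussian closes the path at +infinity.\<close>

lemma hairpin_kernel_outside:
 assumes z: "abs sg = 1" "0 < c" "c < sg*Im z" and int: "integrable lborel (\<lambda>t. hairpin_deriv 0 c t*(gauss_kernel z (hairpin b 0 c t)/(hairpin b 0 c t - z)))"
 shows "hairpin_integral b 0 c (\<lambda>w. gauss_kernel z w/(w - z)) = 0"
proof -
 let ?h = "\<lambda>w. gauss_kernel z w/(w - z)" and ?X = "{w. sg*Im w < sg*Im z}"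
 have X: "open ?X" "convex ?X"
 proof -
  show "open ?X" by (intro open_Collect_less continuous_intros)
  have "?X = {w. inner (of_real sg*\<i>) w < sg*Im z}" by (simp add: inner_complex_def)
  then show "convex ?X" by (simp only: convex_halfspace_lt)
 qed
 have "?h holomorphic_on ?X" by (intro holomorphic_intros gauss_kernel_holomorphic) auto
 from holomorphic_convex_primitive'[OF X(2,1) this]
 obtain P where "\<And>w. w \<in> ?X ==> (P has_field_derivative ?h w) (at w within ?X)" by blast
 then have P: "(P has_field_derivative ?h w) (at w)" if "w \<in> ?X" for w using that at_within_open[OF that X(1)] by metis
 have in_X: "w \<in> ?X" if "abs (Im w) <= c" for w
 proof -
  have "sg*Im w <= abs sg*abs (Im w)" by (simp flip: abs_mult)
  then show ?thesis using that z by simp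
 qed
 have "((\<lambda>x. P (Complex x c) - P (Complex x (- c))) \<longlongrightarrow> hairpin_integral b 0 c ?h) at_top"
 proof (rule hairpin_integral_limit[OF P int])
  show "hairpin b 0 c t \<in> ?X" for t using hairpin_bounds(4)[of 0 b c t] z by (intro in_X) auto
 qed
 moreover have "((\<lambda>x. P (Complex x c) - P (Complex x (- c))) \<longlongrightarrow> 0) at_top"
 proof (rule primitive_difference_vanishes[where dl = 1 and B = "exp ((c + abs (Im z))\<^sup>2/4 + 1)*exp (abs (Re z))" and L = "2*c" and P = P and h = ?h
   and u = "\<lambda>x. Complex x c" and v = "\<lambda>x. Complex x (- c)"])
  fix x w assume x: "abs (Re z) + 1 <= x" and "w \<in> closed_segment (Complex x c) (Complex x (- c))"
  then have w: "Re w = x" "abs (Im w) <= c" using vertical_segment[of w x c "- c"] z by auto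
  show "(P has_field_derivative ?h w) (at w)" by (rule P[OF in_X[OF w(2)]])
  have "\<bar>Im (w - z)\<bar> <= c + abs (Im z)" using w by auto
  from gauss_kernel_bound[OF this] have "cmod (gauss_kernel z w) <= exp ((c + abs (Im z))\<^sup>2/4 + 1)*exp (- \<bar>Re (w - z)\<bar>)" .
  also have "exp (- \<bar>Re (w - z)\<bar>) <= exp (abs (Re z))*exp (- 1*x)" unfolding mult_exp_exp using w x by simp
  finally (order_trans[OF _ mult_left_mono[OF _ exp_ge_zero]]) have *: "cmod (gauss_kernel z w) <= exp ((c + abs (Im z))\<^sup>2/4 + 1)*exp (abs (Re z))*exp (- 1*x)" by (simp only: mult.assoc)
  have "1 <= cmod (w - z)" using abs_Re_le_cmod[of "w - z"] w x by auto
  then have "cmod (?h w) <= cmod (gauss_kernel z w)/1" unfolding norm_divide by (intro divide_left_mono) auto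
  with * show "cmod (?h w) <= exp ((c + abs (Im z))\<^sup>2/4 + 1)*exp (abs (Re z))*exp (- 1*x)" by simp
 next
  fix x
  have "cmod (Complex x c - Complex x (- c)) = 2*c" using z by (simp add: cmod_eq_Im)
  then show "cmod (Complex x c - Complex x (- c)) <= 2*c*(1 + abs x)" using z by (simp add: distrib_left)
 qed auto
 ultimately show ?thesis by (rule tendsto_unique[OF trivial_limit_at_top_linorder])
qed

text \<open>The plane slit from z to the right contains the path and the lines Im w = 1 and Im w =
  -1, and admits a primitive; so the path is replaced by the two lines and the strip formula gives
  the residue. The minus sign reflects the clockwise orientation.\<close>

lemma hairpin_kernel_inside:
 assumes z: "b < Re z" "abs (Im z) < 1" and int: "integrable lborel (\<lambda>t. hairpin_deriv 0 1 t*(gauss_kernel z (hairpin b 0 1 t)/(hairpin b 0 1 t - z)))"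
 shows "hairpin_integral b 0 1 (\<lambda>w. gauss_kernel z w/(w - z)) = - (2*pi*\<i>)"
proof -
 let ?h = "\<lambda>w. gauss_kernel z w/(w - z)" and ?X = "{w. w - z \<in> slit_plane 0}"
 have z0: "0 \<notin> slit_plane 0" by (simp add: slit_plane_def)
 have hol: "(\<lambda>v. exp (- v\<^sup>2/4) / v) holomorphic_on slit_plane 0" by (intro holomorphic_intros) (use z0 in auto)
 have "ereal (- 1) < 0" by simp
 then have "\<exists>P. \<forall>w\<in>slit_plane 0. (P has_field_derivative exp (- w\<^sup>2/4)/w) (at w)"
  by (rule slit_plane_primitive[of _ _ "{}"]) (use hol in \<open>auto dest: holomorphic_on_imp_continuous_on\<close>)
 then obtain P0 where P0: "\<And>w. w \<in> slit_plane 0 ==> (P0 has_field_derivative exp (- w\<^sup>2/4)/w) (at w)" by blast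
 define P where "P w = P0 (w - z)" for w
 have P: "(P has_field_derivative ?h w) (at w)" if "w \<in> ?X" for w unfolding P_def gauss_kernel_def
  using DERIV_chain2[where f = P0 and g = "\<lambda>w. w - z" and Db = 1 and x = w and s = UNIV, OF P0[of "w - z"]] that
   DERIV_diff[OF DERIV_ident DERIV_const[where k = z]] by simp
 have X: "w \<in> ?X" if "Re w < Re z \<or> Im w ~= Im z" for w using that by (auto simp: slit_plane_def zero_ereal_def)
 define Y where "Y = 1 + abs (Im z)"
 have kb: "cmod (gauss_kernel z w) <= exp (Y\<^sup>2/4 + 1)*exp (- \<bar>Re (w - z)\<bar>)" if "abs (Im w) <= 1" for w
  using that by (intro gauss_kernel_bound) (auto simp: Y_def)
 have line: "integrable lborel (\<lambda>t. ?h (Complex t sg))" if "abs sg = 1" for sg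
 proof (rule exp_decay_integrable(1)[of "{}" _ "exp (Y\<^sup>2/4 + 1)/(1 - abs (Im z))" 1 "Re z"])
  fix t
  have ne: "Complex t sg - z ~= 0" using that z(2) by (auto simp: complex_eq_iff)
  have "isCont ?h (Complex t sg)" using ne holomorphic_isCont[OF gauss_kernel_holomorphic, of UNIV] by (intro continuous_intros) auto
  then show "isCont (\<lambda>t. ?h (Complex t sg)) t" by (intro isCont_o2[where f = "\<lambda>t. Complex t sg" and g = ?h] isCont_Complex) auto
  have "1 - abs (Im z) <= cmod (Complex t sg - z)" using abs_Im_le_cmod[of "Complex t sg - z"] that by auto
  then show "cmod (?h (Complex t sg)) <= exp (Y\<^sup>2/4 + 1)/(1 - abs (Im z))*exp (- 1*\<bar>t - Re z\<bar>)"
   unfolding norm_divide using kb[of "Complex t sg"] that z(2) by (simp add: frac_le)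
 qed auto
 have "hairpin_integral b 0 1 ?h = line_integral 1 ?h - line_integral (- 1) ?h"
 proof (rule hairpin_integral_lines[OF P, where dl = 1 and B = "exp (Y\<^sup>2/4 + 1)*exp (abs (Re z))"])
  have av: "hairpin_avoids b 1 b 0 1" by (rule hairpin_avoids_rectangle) simp
  show "hairpin b 0 1 t \<in> ?X" for t using av z by (intro X) (force simp: hairpin_avoids_def dest!: spec[of _ t])
  show "Complex t 1 \<in> ?X" "Complex t (- 1) \<in> ?X" for t using z by (auto simp: slit_plane_def)
  fix w assume w: "abs (Im w) <= 1" "Re w <= - (1 - Re z)"
  have "exp (- \<bar>Re (w - z)\<bar>) <= exp (abs (Re z))*exp (1 * Re w)" unfolding mult_exp_exp using w by simp
  then have "cmod (gauss_kernel z w) <= exp (Y\<^sup>2/4 + 1)*(exp (abs (Re z))*exp (1 * Re w))"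
   by (intro order_trans[OF kb[OF w(1)]] mult_left_mono) auto
  moreover have "1 <= cmod (w - z)" using abs_Re_le_cmod[of "w - z"] w by auto
  then have "cmod (?h w) <= cmod (gauss_kernel z w)/1" unfolding norm_divide by (intro divide_left_mono) auto
  ultimately show "w \<in> ?X \<and> cmod (?h w) <= exp (Y\<^sup>2/4 + 1)*exp (abs (Re z))*exp (1 * Re w)" using w X[of w] by (auto simp: mult.assoc)
 qed (use line[of 1] line[of "-1"] z int in auto)
 also have "line_integral (- 1) ?h - line_integral 1 ?h = 2*pi*\<i>*gauss_kernel z z"
 proof (rule strip_Cauchy_formula[of UNIV])
  fix w assume "- 1 <= Im w" "Im w <= 1"
  then have "cmod (gauss_kernel z w) <= exp (Y\<^sup>2/4 + 1)*exp (- \<bar>Re (w - z)\<bar>)" by (intro kb) auto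
  also have "exp (- \<bar>Re (w - z)\<bar>) <= exp (abs (Re z))*exp (- 1*abs (Re w))" unfolding mult_exp_exp by simp
  finally (order_trans[OF _ mult_left_mono[OF _ exp_ge_zero]]) show "cmod (gauss_kernel z w) <= exp (Y\<^sup>2/4 + 1)*exp (abs (Re z))*exp (- 1*abs (Re w))" by (simp only: mult.assoc)
 qed (use z in \<open>auto intro: gauss_kernel_holomorphic\<close>)
 then have "line_integral 1 ?h - line_integral (- 1) ?h = - (2*pi*\<i>)" by (simp add: gauss_kernel_def algebra_simps)
 finally show ?thesis .
qed

text \<open>Along this path sg*Im (z - w) > 0, so by \<open>mu_fourier\<close> the kernel is a
  constant times the integral of mu(s) exp(i (z - w) s) over the line Im s = -1. After exchanging
  the integrals the inner one is the transform of F at s, which vanishes.\<close>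

lemma hairpin_kernel_vanishes:
 assumes F: "slow_growth a F" and b: "ereal b < a"
  and zero: "\<And>zt. Im zt < 0 ==> hairpin_integral b 0 1 (fourier_integrand F zt) = 0"
  and z: "abs sg = 1" "0 < c" "c < sg*Im z"
 shows "hairpin_integral b 0 c (\<lambda>w. F w*(gauss_kernel z w/(w - z))) = 0"
proof -
 let ?\<Gamma> = "hairpin b 0 c"
 have hol: "F holomorphic_on slit_plane a" using F by (simp add: slow_growth_def)
 have av: "hairpin_avoids b c b 0 c" "hairpin_avoids b 1 b 0 1" using z by (auto intro: hairpin_avoids_rectangle)
 note in_slit = hairpin_in_slit_plane[OF av(1) b]
 obtain B where B: "B >= 0" "\<And>w. Re w <= b \<or> c <= abs (Im w) ==> (abs (Im w)) <= c ==> cmod (F w) <= B*exp (1/2*abs (Re w))"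
  using slow_growthD[OF F b z(2), of "1/2" c] by auto
 define K where "K = B*exp (1/2*(abs b + 0 + 2) + 2*1)*exp ((b - 0)*Im (- \<i>) + c*\<bar>Re (- \<i>)\<bar>)"
 \<comment> \<open>On Im s = -1 the exponential contributes exp (Re (z - w)); its part in w is what
   makes F integrable along the path.\<close>
 have FK: "cmod (F (?\<Gamma> t))*exp (- Re (?\<Gamma> t)) <= K*exp (- (1/2)*abs t)" for t
  using fourier_hairpin_bound(1)[OF hol b av(1) _ _ _ B, of "1" "- \<i>" t] unfolding K_def fourier_integrand_def norm_mult cmod_exp_fourier by simp
 define d where "d = sg*Im z - c"
 define H where "H = abs (Im z) + c"
 have d: "d > 0" using z by (simp add: d_def)
 obtain C where C: "C >= 0" "\<And>s u. abs (Im s) <= 1 ==> 0 < sg*Im u ==> (abs (Im u)) <= H ==>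
  cmod (mu sg s*exp (\<i>*u * s)) <= C*exp (- (Re u*Im s))*exp (- abs (Im u)*abs (Re s))" using mu_exp_bound[OF z(1), of 1 H] by blast
 have u: "d <= sg*Im (z - ?\<Gamma> t)" "\<bar>Im (z - ?\<Gamma> t)\<bar> <= H" for t
 proof -
  have i: "\<bar>Im (?\<Gamma> t)\<bar> <= c" using hairpin_bounds(4)[of 0 b c t] z by simp
  have "sg*Im (?\<Gamma> t) <= abs sg*\<bar>Im (?\<Gamma> t)\<bar>" by (simp flip: abs_mult)
  then show "d <= sg*Im (z - ?\<Gamma> t)" using i z by (simp add: d_def right_diff_distrib)
  show "\<bar>Im (z - ?\<Gamma> t)\<bar> <= H" using i by (simp add: H_def)
 qed
 define f where "f = (\<lambda>(t, x). (hairpin_deriv 0 c t*F (?\<Gamma> t)) *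
  (mu sg (Complex x (- 1))*exp (\<i>*(z - ?\<Gamma> t)*Complex x (- 1))))"
 have fb: "cmod (f (t, x)) <= ((1 + c)*(K*C*exp (Re z))*exp (- (1/2)*abs t))*exp (- d*abs x)" for t x
 proof -
  let ?u = "z - ?\<Gamma> t" and ?s = "Complex x (- 1)"
  have "sg*Im ?u <= abs sg*\<bar>Im ?u\<bar>" by (simp flip: abs_mult)
  then have "d <= \<bar>Im ?u\<bar>" using u(1)[of t] z(1) by simp
  then have "d*abs x <= \<bar>Im ?u\<bar>*abs x" by (intro mult_right_mono) auto
  then have "C*exp (- (Re ?u*Im ?s))*exp (- \<bar>Im ?u\<bar>*\<bar>Re ?s\<bar>) <= C*exp (Re ?u)*exp (- d*abs x)" using C(1) by (intro mult_mono) auto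
  moreover have "cmod (mu sg ?s*exp (\<i>*?u*?s)) <= C*exp (- (Re ?u*Im ?s))*exp (- \<bar>Im ?u\<bar>*\<bar>Re ?s\<bar>)" using u[of t] d by (intro C) auto
  ultimately have "cmod (mu sg ?s*exp (\<i>*?u*?s)) <= C*exp (Re ?u)*exp (- d*abs x)" by linarith
  then have "cmod (F (?\<Gamma> t))*cmod (mu sg ?s*exp (\<i>*?u*?s)) <= cmod (F (?\<Gamma> t))*(C*exp (Re ?u)*exp (- d*abs x))"
   by (intro mult_left_mono) auto
  also have "\<dots> = (cmod (F (?\<Gamma> t))*exp (- Re (?\<Gamma> t)))*(C*exp (Re z)*exp (- d*abs x))" by (simp add: exp_diff exp_minus field_simps)
  also have "\<dots> <= (K*exp (- (1/2)*abs t))*(C*exp (Re z)*exp (- d*abs x))" using C(1) by (intro mult_right_mono FK) auto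
  finally have "cmod (F (?\<Gamma> t))*cmod (mu sg ?s*exp (\<i>*?u*?s)) <= K*C*exp (Re z)*exp (- (1/2)*abs t)*exp (- d*abs x)"
   by (simp only: mult_ac)
  moreover have "cmod (hairpin_deriv 0 c t) <= 1 + c" using hairpin_bounds(5)[of 0 c t] z by simp
  ultimately have "cmod (hairpin_deriv 0 c t)*(cmod (F (?\<Gamma> t))*cmod (mu sg ?s*exp (\<i>*?u*?s))) <=
    (1 + c)*(K*C*exp (Re z)*exp (- (1/2)*abs t)*exp (- d*abs x))"
   using z by (intro mult_mono[OF _ _ add_nonneg_nonneg mult_nonneg_nonneg]) auto
  then show ?thesis unfolding f_def prod.case norm_mult[of "_*_" "_*exp _"] norm_mult[of "hairpin_deriv 0 c t"] by (simp only: mult.assoc)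
 qed
 have meas: "f \<in> borel_measurable borel"
 proof -
  have [measurable]: "?\<Gamma> \<in> borel_measurable borel"
   by (intro borel_measurable_continuous_onI continuous_at_imp_continuous_on) (auto intro: isCont_hairpin)
  have [measurable]: "(\<lambda>t. F (?\<Gamma> t)) \<in> borel_measurable borel" by (intro borel_measurable_continuous_onI continuous_at_imp_continuous_on)
     (auto intro!: isCont_o2[OF isCont_hairpin] holomorphic_isCont[OF hol open_slit_plane] in_slit)
  have [measurable]: "hairpin_deriv 0 c \<in> borel_measurable borel" by (rule borel_measurable_continuous_countable_exceptions[of "{- (pi/2), pi/2}"])
     (auto intro!: continuous_at_imp_continuous_on isCont_hairpin_deriv)
  have [measurable]: "(\<lambda>x. mu sg (Complex x (- 1))) \<in> borel_measurable borel"
   by (intro borel_measurable_continuous_onI continuous_at_imp_continuous_on)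
     (auto intro!: isCont_o2[where f = "\<lambda>x. Complex x (- 1)" and g = "mu sg"] isCont_Complex isCont_mu)
  have [measurable]: "(\<lambda>x. Complex x (- 1)) \<in> borel_measurable borel"
   by (intro borel_measurable_continuous_onI continuous_at_imp_continuous_on) (auto intro!: isCont_Complex)
  have "f \<in> borel_measurable (borel \<Otimes>\<^sub>M borel)" unfolding f_def split_beta' by measurable
  then show ?thesis by (simp add: borel_prod)
 qed
 have e: "integrable lborel (\<lambda>t::real. D*exp (- r*abs t))" if "r > 0" for r D
  using has_bochner_integral_exp_abs[OF that] by (auto simp: has_bochner_integral_iff)
 have fint: "integrable (lborel \<Otimes>\<^sub>M lborel) f"
  using integrable_product_bound[OF meas e[of "1/2" "(1 + c)*(K*C*exp (Re z))"] e[OF d, of 1]] fb by simp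
 have in1: "(\<integral>x. f (t, x) \<partial>lborel) = - \<i>*(hairpin_deriv 0 c t*(F (?\<Gamma> t)*(gauss_kernel z (?\<Gamma> t)/(?\<Gamma> t - z))))" for t
 proof -
  let ?u = "z - ?\<Gamma> t"
  have u0: "0 < sg*Im ?u" using u(1)[of t] d by simp
  have "(\<integral>x. f (t, x) \<partial>lborel) = (hairpin_deriv 0 c t*F (?\<Gamma> t))*line_integral (- 1) (\<lambda>s. mu sg s*exp (\<i>*?u * s))"
   unfolding f_def prod.case integral_mult_right_zero line_integral_def ..
  also have "\<dots> = (hairpin_deriv 0 c t*F (?\<Gamma> t))*(\<i>*exp (- ?u\<^sup>2/4)/?u)" unfolding mu_fourier(2)[OF z(1) u0] ..
  also have "\<i>*exp (- ?u\<^sup>2/4)/?u = - \<i>*(gauss_kernel z (?\<Gamma> t)/(?\<Gamma> t - z))"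
  proof -
   have "?u\<^sup>2 = (?\<Gamma> t - z)\<^sup>2" by (rule power2_commute)
   moreover have "x/?u = - (x/(?\<Gamma> t - z))" for x by (metis minus_diff_eq minus_divide_right)
   ultimately show ?thesis by (simp add: gauss_kernel_def)
  qed
  finally show ?thesis by (simp only: mult_ac)
 qed
 have in2: "(\<integral>t. f (t, x) \<partial>lborel) = 0" for x
 proof -
  let ?s = "Complex x (- 1)"
  have "f (t, x) = (mu sg ?s*exp (\<i>*z*?s))*(hairpin_deriv 0 c t*fourier_integrand F ?s (?\<Gamma> t))" for t
  proof -
   have "\<i>*(z - ?\<Gamma> t)*?s = \<i>*z*?s + - \<i>*?\<Gamma> t*?s" by (simp add: algebra_simps)
   then have "exp (\<i>*(z - ?\<Gamma> t)*?s) = exp (\<i>*z*?s)*exp (- \<i>*?\<Gamma> t*?s)" by (simp only: exp_add)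
   then show ?thesis unfolding f_def fourier_integrand_def prod.case by (simp only: mult_ac)
  qed
  then have "(\<integral>t. f (t, x) \<partial>lborel) = (mu sg ?s*exp (\<i>*z*?s))*hairpin_integral b 0 c (fourier_integrand F ?s)"
   by (simp only: integral_mult_right_zero hairpin_integral_def)
  also have "hairpin_integral b 0 c (fourier_integrand F ?s) = hairpin_integral b 0 1 (fourier_integrand F ?s)"
   by (rule fourier_hairpin_independent[OF F _ b av(1) b av(2)]) simp
  also have "\<dots> = 0" by (rule zero) simp
  finally show ?thesis by simp
 qed
 have "(\<integral>x. (\<integral>t. f (t, x) \<partial>lborel) \<partial>lborel) = (\<integral>t. (\<integral>x. f (t, x) \<partial>lborel) \<partial>lborel)" using fint by (intro lborel_pair.Fubini_integral) simp
 then have "- \<i>*hairpin_integral b 0 c (\<lambda>w. F w*(gauss_kernel z w/(w - z))) = 0"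
  unfolding in1 in2 integral_mult_right_zero hairpin_integral_def by simp
 then show ?thesis by simp
qed

text \<open>The singularity of (F w - F z) times the kernel is removable, so its integrals along a
  path around z and along a narrower one that leaves z outside agree. Three of the four resulting
  integrals are known: the kernel alone gives -2 pi i and 0, and F times the kernel gives 0 on the
  narrow path.\<close>

lemma kernel_representation:
 assumes F: "slow_growth a F" and b: "ereal b < a"
  and zero: "\<And>zt. Im zt < 0 ==> hairpin_integral b 0 1 (fourier_integrand F zt) = 0"
  and z: "b < Re z" "abs (Im z) < 1" "Im z ~= 0"
 shows "hairpin_integral b 0 1 (\<lambda>w. F w*(gauss_kernel z w/(w - z))) = - (2*pi*\<i>)*F z"
proof -
 obtain sg where sg: "abs sg = 1" "0 < sg*Im z" using Im_sign[OF z(3)] by blast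
 \<comment> \<open>The path at half the height of z leaves z outside; the one at height 1 surrounds
   it.\<close>
 define c where "c = sg*Im z/2"
 have absz: "abs (Im z) = sg*Im z" using sg by (metis abs_mult abs_of_pos mult_1)
 have c: "0 < c" "c < sg*Im z" "c <= 1" "c < abs (Im z)" using sg absz z(2) by (auto simp: c_def)
 have hol: "F holomorphic_on slit_plane a" using F by (simp add: slow_growth_def)
 have zs: "z \<in> slit_plane a" using z(3) by (simp add: slit_plane_def)
 have av: "hairpin_avoids b d b 0 d" if "d > 0" for d using that by (rule hairpin_avoids_rectangle)
 note in_slit = hairpin_in_slit_plane[OF av b]
 obtain B where B: "B >= 0" "\<And>w. Re w <= b \<or> c <= abs (Im w) ==> (abs (Im w)) <= 1 ==> cmod (F w) <= B*exp (1/2*abs (Re w))"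
  using slow_growthD[OF F b c(1), of "1/2" 1] by auto
 define Y where "Y = 1 + abs (Im z)"
 define K where "K = exp (Y\<^sup>2/4 + 1)"
 have K: "K > 0" by (simp add: K_def)
 have kb: "cmod (gauss_kernel z w) <= K*exp (- \<bar>Re w - Re z\<bar>)" if "abs (Im w) <= 1" for w
  unfolding K_def using that gauss_kernel_bound[of w z Y] by (auto simp: Y_def)
 have dist: "\<exists>r>0. \<forall>t. r <= cmod (hairpin b 0 d t - z)" if d: "d = 1 \<or> d = c" for d
 proof (intro exI[of _ "min (Re z - b) \<bar>(abs (Im z)) - d\<bar>"] conjI allI)
  show "0 < min (Re z - b) \<bar>(abs (Im z)) - d\<bar>" using z c d by auto
  fix t
  have d0: "d > 0" using d c by auto
  have "Re (hairpin b 0 d t) <= b \<or> \<bar>Im (hairpin b 0 d t)\<bar> = d"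
   using av[OF d0] hairpin_bounds(4)[of 0 b d t] d0 by (auto simp: hairpin_avoids_def dest!: spec[of _ t])
  then show "min (Re z - b) \<bar>(abs (Im z)) - d\<bar> <= cmod (hairpin b 0 d t - z)"
   using abs_Re_le_cmod[of "hairpin b 0 d t - z"] abs_Im_le_cmod[of "hairpin b 0 d t - z"] by auto
 qed
 \<comment> \<open>G stands for F and also for the constant F z, so that the difference of the two
   can be integrated term by term.\<close>
 have ints: "integrable lborel (\<lambda>t. hairpin_deriv 0 d t*(G (hairpin b 0 d t)*(gauss_kernel z (hairpin b 0 d t)/(hairpin b 0 d t - z))))"
  if d: "d = 1 \<or> d = c" and G: "\<And>t. isCont G (hairpin b 0 d t)" "D >= 0" "\<And>t. cmod (G (hairpin b 0 d t)) <= D*exp (1/2*\<bar>Re (hairpin b 0 d t)\<bar>)" for d G D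
 proof -
  have d0: "d > 0" "d <= 1" using d c by auto
  obtain r where r: "r > 0" "\<And>t. r <= cmod (hairpin b 0 d t - z)" using dist[OF d] by blast
  have ne: "hairpin b 0 d t ~= z" for t using r(2)[of t] r(1) by auto
  show ?thesis
  proof (rule hairpin_integrable(1)[where kp = 0 and h = "\<lambda>w. G w*(gauss_kernel z w/(w - z))" and l = b and c = d and dl = "1/2" and B = "D*(K*exp (abs (Re z) + 2*abs b + 1))/r" and x = 0])
   fix t
   let ?w = "hairpin b 0 d t"
   show "isCont (\<lambda>w. G w*(gauss_kernel z w/(w - z))) ?w"
    using ne G holomorphic_isCont[OF gauss_kernel_holomorphic, of UNIV] by (intro continuous_intros) auto
   have R: "abs t - 2 + b <= Re ?w" "b <= Re ?w" using hairpin_bounds(1,2)[of 0 t b d] hairpin_bounds(2)[of 0 b d t] by auto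
   have "1/2*\<bar>Re ?w\<bar> + - \<bar>Re ?w - Re z\<bar> <= (abs (Re z) + 2*abs b + 1) + - (1/2)*\<bar>t - 0\<bar>" using R by (simp add: abs_if split: if_splits)
   then have "exp (1/2*\<bar>Re ?w\<bar>)*exp (- \<bar>Re ?w - Re z\<bar>) <= exp (abs (Re z) + 2*abs b + 1)*exp (- (1/2)*\<bar>t - 0\<bar>)"
    unfolding mult_exp_exp exp_le_cancel_iff .
   then have "(D*K/r)*(exp (1/2*\<bar>Re ?w\<bar>)*exp (- \<bar>Re ?w - Re z\<bar>)) <= (D*K/r)*(exp (abs (Re z) + 2*abs b + 1)*exp (- (1/2)*\<bar>t - 0\<bar>))"
    using G(2) K r by (intro mult_left_mono) auto
   moreover have "cmod (G ?w*(gauss_kernel z ?w/(?w - z))) <= (D*exp (1/2*\<bar>Re ?w\<bar>))*((K*exp (- \<bar>Re ?w - Re z\<bar>))/r)"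
    unfolding norm_mult norm_divide using G(3)[of t] kb[of ?w] r hairpin_bounds(4)[of 0 b d t] d0 K G(2) by (intro mult_mono frac_le) auto
   ultimately show "cmod (G ?w*(gauss_kernel z ?w/(?w - z))) <= D*(K*exp (abs (Re z) + 2*abs b + 1))/r*exp (- (1/2)*\<bar>t - 0\<bar>)"
    by (simp add: mult_ac)
  qed auto
 qed
 have Fint: "integrable lborel (\<lambda>t. hairpin_deriv 0 d t*(F (hairpin b 0 d t)*(gauss_kernel z (hairpin b 0 d t)/(hairpin b 0 d t - z))))"
  if d: "d = 1 \<or> d = c" for d
 proof (rule ints[OF d _ B(1)])
  have d0: "d > 0" "c <= d" "d <= 1" using d c by auto
  show "isCont F (hairpin b 0 d t)" for t by (rule holomorphic_isCont[OF hol open_slit_plane in_slit[OF d0(1)]])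
  show "cmod (F (hairpin b 0 d t)) <= B*exp (1/2*\<bar>Re (hairpin b 0 d t)\<bar>)" for t
  proof (rule B(2))
   show "Re (hairpin b 0 d t) <= b \<or> c <= \<bar>Im (hairpin b 0 d t)\<bar>" using av[OF d0(1)] d0 by (auto simp: hairpin_avoids_def dest!: spec[of _ t])
   show "\<bar>Im (hairpin b 0 d t)\<bar> <= 1" using hairpin_bounds(4)[of 0 b d t] d0 by auto
  qed
 qed
 have cint: "integrable lborel (\<lambda>t. hairpin_deriv 0 d t*(x*(gauss_kernel z (hairpin b 0 d t)/(hairpin b 0 d t - z))))"
  if d: "d = 1 \<or> d = c" for d x by (rule ints[OF d, where D = "cmod x" and G = "\<lambda>_. x"]) (auto simp: mult_le_cancel_left1)
 \<comment> \<open>The value at z is the limit, which makes the function continuous there, as the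
   existence of a primitive requires.\<close>
 define \<Phi> where "\<Phi> w = (if w = z then deriv F z*gauss_kernel z z else (F w - F z)*(gauss_kernel z w/(w - z)))" for w
 have \<Phi>_eq: "\<Phi> w = (F w - F z)*(gauss_kernel z w/(w - z))" if "w ~= z" for w using that by (simp add: \<Phi>_def)
 have "\<Phi> holomorphic_on slit_plane a - {z}"
 proof (rule holomorphic_transform)
  show "(\<lambda>w. (F w - F z)*(gauss_kernel z w/(w - z))) holomorphic_on slit_plane a - {z}"
   by (intro holomorphic_intros gauss_kernel_holomorphic holomorphic_on_subset[OF hol]) auto
 qed (use \<Phi>_eq in auto)
 moreover have "continuous_on (slit_plane a) \<Phi>"
 proof (rule continuous_at_imp_continuous_on, rule ballI)
  fix w assume w: "w \<in> slit_plane a"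
  show "isCont \<Phi> w"
  proof (cases "w = z")
   case True
   have "(F has_field_derivative deriv F z) (at z)" by (rule holomorphic_derivI[OF hol open_slit_plane zs])
   then have "((\<lambda>w. (F w - F z)/(w - z)) \<longlongrightarrow> deriv F z) (at z)" by (simp add: has_field_derivative_iff)
   moreover have "((\<lambda>w. gauss_kernel z w) \<longlongrightarrow> gauss_kernel z z) (at z)"
    using holomorphic_isCont[OF gauss_kernel_holomorphic, of UNIV] by (simp add: isCont_def)
   ultimately have "((\<lambda>w. (F w - F z)/(w - z)*gauss_kernel z w) \<longlongrightarrow> deriv F z*gauss_kernel z z) (at z)" by (rule tendsto_mult)
   then have "(\<Phi> \<longlongrightarrow> deriv F z*gauss_kernel z z) (at z)" by (rule Lim_transform_eventually) (auto simp: eventually_at_filter \<Phi>_def)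
   then show ?thesis using True by (simp add: isCont_def \<Phi>_def)
  next
   case False
   then have "\<forall>\<^sub>F v in nhds w. v \<in> - {z}" by (intro eventually_nhds_in_open) auto
   then have *: "\<forall>\<^sub>F v in nhds w. \<Phi> v = (F v - F z)*(gauss_kernel z v / (v - z))" by eventually_elim (simp add: \<Phi>_def)
   show ?thesis unfolding isCont_cong[OF *]
    using False holomorphic_isCont[OF hol open_slit_plane w] holomorphic_isCont[OF gauss_kernel_holomorphic, of UNIV]
    by (intro continuous_intros) auto
  qed
 qed
 ultimately have "\<exists>P. \<forall>w\<in>slit_plane a. (P has_field_derivative \<Phi> w) (at w)" by (intro slit_plane_primitive[OF b, of "{z}"]) auto
 then obtain P where P: "\<And>w. w \<in> slit_plane a ==> (P has_field_derivative \<Phi> w) (at w)" by blast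
 have ne: "hairpin b 0 d t ~= z" if "d = 1 \<or> d = c" for d t using dist[OF that] by (auto dest!: spec[of _ t])
 have \<Phi>h: "hairpin_deriv 0 d t*\<Phi> (hairpin b 0 d t) =
   hairpin_deriv 0 d t*(F (hairpin b 0 d t)*(gauss_kernel z (hairpin b 0 d t)/(hairpin b 0 d t - z))) -
   hairpin_deriv 0 d t*(F z*(gauss_kernel z (hairpin b 0 d t)/(hairpin b 0 d t - z)))" if "d = 1 \<or> d = c" for d t
  unfolding \<Phi>_eq[OF ne[OF that]] by (simp only: left_diff_distrib right_diff_distrib)
 have \<Phi>int: "integrable lborel (\<lambda>t. hairpin_deriv 0 d t*\<Phi> (hairpin b 0 d t))" if "d = 1 \<or> d = c" for d
  unfolding \<Phi>h[OF that] by (intro Bochner_Integration.integrable_diff Fint cint that)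
 have "hairpin_integral b 0 1 \<Phi> = hairpin_integral b 0 c \<Phi>"
 proof (rule hairpin_integral_independent[OF P zero_less_one c(1), where dl = "1/2" and B = "(B + cmod (F z))*(K*exp (Re z))"])
  show "hairpin b 0 1 t \<in> slit_plane a" "hairpin b 0 c t \<in> slit_plane a" for t using c in_slit by auto
  fix w assume "min 1 c <= abs (Im w)" "abs (Im w) <= max 1 c" and Re: "abs (Re z) + 1 <= Re w"
  then have w: "c <= abs (Im w)" "abs (Im w) <= 1" using c by auto
  have wz: "w ~= z" "1 <= cmod (w - z)" using abs_Re_le_cmod[of "w - z"] Re by auto
  have E: "1 <= exp (1/2 * Re w)" using Re by simp
  have "cmod (F w) <= B*exp (1/2 * Re w)" using B(2)[of w] w Re by simp
  moreover have "cmod (F z)*1 <= cmod (F z)*exp (1/2 * Re w)" using E by (intro mult_left_mono) auto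
  ultimately have 1: "cmod (F w - F z) <= (B + cmod (F z))*exp (1/2 * Re w)" using norm_triangle_ineq4[of "F w" "F z"] by (simp add: distrib_right)
  have "cmod (gauss_kernel z w/(w - z)) <= K*exp (- \<bar>Re w - Re z\<bar>)/1" unfolding norm_divide using wz K by (intro frac_le kb w) auto
  then have 2: "cmod (gauss_kernel z w/(w - z)) <= K*exp (Re z - Re w)" using Re by (simp add: abs_if split: if_splits)
  have "cmod (\<Phi> w) <= ((B + cmod (F z))*exp (1/2 * Re w))*(K*exp (Re z - Re w))"
   unfolding \<Phi>_eq[OF wz(1)] norm_mult using 1 2 B(1) by (intro mult_mono) auto
  also have "\<dots> = (B + cmod (F z))*K*(exp (1/2 * Re w)*exp (Re z - Re w))" by simp
  also have "exp (1/2 * Re w)*exp (Re z - Re w) = exp (Re z)*exp (- (1/2) * Re w)" unfolding mult_exp_exp by simp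
  finally have "cmod (\<Phi> w) <= (B + cmod (F z))*(K*exp (Re z))*exp (- (1/2) * Re w)" by (simp only: mult.assoc)
  moreover have "w \<in> slit_plane a" using w c by (auto simp: slit_plane_def)
  ultimately show "w \<in> slit_plane a \<and> cmod (\<Phi> w) <= (B + cmod (F z))*(K*exp (Re z))*exp (- (1/2) * Re w)" by blast
 qed (use \<Phi>int[of 1] \<Phi>int[of c] B K in auto)
 moreover have "hairpin_integral b 0 d \<Phi> = hairpin_integral b 0 d (\<lambda>w. F w*(gauss_kernel z w/(w - z))) -
   F z*hairpin_integral b 0 d (\<lambda>w. gauss_kernel z w/(w - z))" if "d = 1 \<or> d = c" for d
 proof -
  have "hairpin_integral b 0 d \<Phi> = hairpin_integral b 0 d (\<lambda>w. F w*(gauss_kernel z w/(w - z))) -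
   (\<integral>t. hairpin_deriv 0 d t*(F z*(gauss_kernel z (hairpin b 0 d t)/(hairpin b 0 d t - z))) \<partial>lborel)"
   unfolding hairpin_integral_def \<Phi>h[OF that] by (rule Bochner_Integration.integral_diff[OF Fint[OF that] cint[OF that]])
  also have "(\<integral>t. hairpin_deriv 0 d t*(F z*(gauss_kernel z (hairpin b 0 d t)/(hairpin b 0 d t - z))) \<partial>lborel) =
    F z*hairpin_integral b 0 d (\<lambda>w. gauss_kernel z w/(w - z))"
   unfolding hairpin_integral_def mult.left_commute[of _ "F z"] integral_mult_right_zero ..
  finally show ?thesis .
 qed
 moreover have "hairpin_integral b 0 1 (\<lambda>w. gauss_kernel z w/(w - z)) = - (2*pi*\<i>)" using cint[of 1 1] by (intro hairpin_kernel_inside z) simp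
 moreover have "hairpin_integral b 0 c (\<lambda>w. gauss_kernel z w/(w - z)) = 0"
  using cint[of c 1] by (intro hairpin_kernel_outside[OF sg(1) c(1,2)]) simp
 moreover have "hairpin_integral b 0 c (\<lambda>w. F w*(gauss_kernel z w/(w - z))) = 0" by (rule hairpin_kernel_vanishes[OF F b zero sg(1) c(1,2)])
 ultimately show ?thesis by (simp add: algebra_simps add_eq_0_iff)
qed

section \<open>The sets and the path for a right half-line\<close>

lemma fin_part_empty [simp]: "fin_part {} = {}" by (simp add: fin_part_def)

lemma compl_fin_part_right: "- fin_part {a..\<infinity>} = slit_plane a"
proof -
 have "z \<in> fin_part {a..\<infinity>} \<longleftrightarrow> Im z = 0 \<and> a <= ereal (Re z)" for z
 proof
  assume "Im z = 0 \<and> a <= ereal (Re z)"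
  then have "z = complex_of_real (Re z)" "ereal (Re z) \<in> {a..\<infinity>}" by (simp_all add: complex_eq_iff)
  then show "z \<in> fin_part {a..\<infinity>}" unfolding fin_part_def by blast
 qed (auto simp: fin_part_def)
 then show ?thesis unfolding slit_plane_def by (intro set_eqI) (simp only: Compl_iff mem_Collect_eq de_Morgan_conj not_le)
qed

lemma S_set_empty: "S_set n {} = {z. abs (Im z) < real n}" by (simp add: S_set_def U_nbhd_def edist_def)

lemma mem_fin_part: "complex_of_real x \<in> fin_part K \<longleftrightarrow> ereal x \<in> K" by (auto simp: fin_part_def)

lemma edist_less: "edist z M < e \<longleftrightarrow> (\<exists>w\<in>M. ereal (cmod (z - w)) < e)" unfolding edist_def by (rule INF_less_iff)

text \<open>The condition b <= 1/c covers the strip at infinity, and b + c <= a covers the points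
  within distance c of the real points of K.\<close>

lemma U_nbhd_right_subset:
 assumes c: "0 < c" and b: "b <= 1/c" "ereal (b + c) <= a"
 shows "closure (U_nbhd c {a..\<infinity>}) \<subseteq> {z. abs (Im z) <= c \<and> b <= Re z}"
proof (rule closure_minimal)
 show "closed {z. abs (Im z) <= c \<and> b <= Re z}" by (intro closed_Collect_conj closed_Collect_le continuous_intros)
 have a: "-\<infinity> \<notin> {a..\<infinity>}" using b by auto
 show "U_nbhd c {a..\<infinity>} \<subseteq> {z. abs (Im z) <= c \<and> b <= Re z}"
 proof
  fix z assume "z \<in> U_nbhd c {a..\<infinity>}"
  then consider "edist z (fin_part {a..\<infinity>}) < ereal c" | "Re z > 1/c" "abs (Im z) < c" using a unfolding U_nbhd_def by (auto split: if_splits)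
  then show "z \<in> {z. abs (Im z) <= c \<and> b <= Re z}"
  proof cases
   case 1
   then obtain x where x: "a <= ereal x" "cmod (z - of_real x) < c" unfolding edist_less fin_part_def by auto
   have "ereal (b + c) <= ereal x" using b(2) x(1) by (rule order_trans)
   then show ?thesis using x(2) abs_Re_le_cmod[of "z - of_real x"] abs_Im_le_cmod[of "z - of_real x"] by auto
  qed (use b in auto)
 qed
qed

text \<open>Translates bounds on the sets S_n into bounds on the regions given by b and c that
  \<open>slow_growth\<close> uses; n only has to be large enough. The number r between b and a gives
  room for taking the closure of the neighbourhood.\<close>

lemma S_set_right_superset:
 assumes b: "ereal b < a" and c: "0 < c" and ep: "0 < ep"
 obtains n where "n >= 1" "1/real n <= ep" "\<And>z. Re z <= b \<or> c <= abs (Im z) ==> (abs (Im z)) <= Y ==> z \<in> S_set n {a..\<infinity>}"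
proof -
 obtain r where r: "b < r" "ereal r < a" using ereal_dense2[OF b] by auto
 obtain e where e: "0 < e" "ereal (r + e) <= a"
 proof (cases a)
  case (real x)
  then show ?thesis using r by (intro that[of "x - r"]) auto
 qed (use r in \<open>auto intro: that[of 1]\<close>)
 \<comment> \<open>The summands 1 make Y < n and 1/c < n strict, because S_n is defined by strict
   inequalities.\<close>
 define n where "n = nat \<lceil>max (max (1/e) (1/ep)) (max (max r (Y + 1)) (1/c + 1))\<rceil>"
 have "max (max (1/e) (1/ep)) (max (max r (Y + 1)) (1/c + 1)) <= real n" unfolding n_def by (rule real_nat_ceiling_ge)
 then have n: "1/e <= real n" "1/ep <= real n" "r <= real n" "Y < real n" "1/c < real n" by linarith+
 have n1: "n >= 1"
 proof -
  have "0 < real n" using n(5) c by (meson divide_pos_pos less_trans zero_less_one)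
  then show ?thesis by simp
 qed
 have i: "1/real n <= e" "1/real n <= ep" "1/real n < c" using n(1,2,5) n1 e ep c by (simp_all add: field_simps)
 have sub: "closure (U_nbhd (1/real n) {a..\<infinity>}) \<subseteq> {z. abs (Im z) <= 1/real n \<and> r <= Re z}"
 proof (rule U_nbhd_right_subset)
  show "ereal (r + 1/real n) <= a" using i(1) by (intro order_trans[OF _ e(2)]) simp
 qed (use n n1 in auto)
 show ?thesis
 proof (rule that[OF n1 i(2)])
  fix z assume "Re z <= b \<or> c <= abs (Im z)" "abs (Im z) <= Y"
  then show "z \<in> S_set n {a..\<infinity>}" using sub r i n by (auto simp: S_set_def)
 qed
qed

text \<open>For finite a, a point whose two coordinates deviate from K by less than 1/(2n) each has
  distance less than 1/n from K and so belongs to the excluded neighbourhood. For a = \<infinity>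
  the neighbourhood is a half-strip that starts at n.\<close>

lemma S_set_right_subset:
 assumes a: "a ~= -\<infinity>" and n: "n >= 1"
 obtains b c where "ereal b < a" "0 < c" "\<And>z. z \<in> S_set n {a..\<infinity>} ==> (Re z <= b \<or> c <= abs (Im z)) \<and> abs (Im z) < real n"
proof -
 let ?c = "1/(2*real n)"
 have c: "0 < ?c" "?c < 1/real n" using n by (auto simp: field_simps)
 show ?thesis
 proof (cases "a = \<infinity>")
  case True
  show ?thesis
  proof (rule that[of "real n" ?c])
   fix z assume z: "z \<in> S_set n {a..\<infinity>}"
   have "z \<in> U_nbhd (1/real n) {a..\<infinity>}" if "\<not> (Re z <= real n \<or> ?c <= abs (Im z))" using that True c unfolding U_nbhd_def by auto
   then show "(Re z <= real n \<or> ?c <= abs (Im z)) \<and> abs (Im z) < real n"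
    using z closure_subset[of "U_nbhd (1/real n) {a..\<infinity>}"] by (auto simp: S_set_def)
  qed (use True c in auto)
 next
  case False
  then obtain r where r: "a = ereal r" using a by (cases a) auto
  show ?thesis
  proof (rule that[of "r - ?c" ?c])
   fix z assume z: "z \<in> S_set n {a..\<infinity>}"
   have "z \<in> U_nbhd (1/real n) {a..\<infinity>}" if *: "\<not> (Re z <= r - ?c \<or> ?c <= abs (Im z))"
   proof -
    have "cmod (z - of_real (max r (Re z))) <= \<bar>Re (z - of_real (max r (Re z)))\<bar> + \<bar>Im (z - of_real (max r (Re z)))\<bar>" by (rule cmod_le)
    also have "\<dots> < ?c + ?c" using * by (auto simp: max_def)
    finally have "ereal (cmod (z - of_real (max r (Re z)))) < ereal (1/real n)" by simp
    moreover have "complex_of_real (max r (Re z)) \<in> fin_part {a..\<infinity>}" unfolding mem_fin_part using r by simp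
    ultimately show ?thesis unfolding U_nbhd_def edist_less by blast
   qed
   then show "(Re z <= r - ?c \<or> ?c <= abs (Im z)) \<and> abs (Im z) < real n"
    using z closure_subset[of "U_nbhd (1/real n) {a..\<infinity>}"] by (auto simp: S_set_def)
  qed (use r c in auto)
 qed
qed

text \<open>Needed because the seminorms are suprema over these sets, and the supremum of an empty
  set of reals has no definite meaning.\<close>

lemma S_set_right_nonempty:
 assumes a: "a ~= -\<infinity>" and n: "n >= 1"
 shows "S_set n {a..\<infinity>} ~= {}"
proof -
 obtain b where b: "b <= real n" "ereal (b + 1/real n) <= a"
 proof (cases a)
  case (real r)
  then show ?thesis by (intro that[of "min (real n) (r - 1/real n)"]) auto
 next
  case PInf
  then show ?thesis by (intro that[of "real n"]) auto
 qed (use a in auto)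
 have "closure (U_nbhd (1/real n) {a..\<infinity>}) \<subseteq> {z. abs (Im z) <= 1/real n \<and> b <= Re z}" using b n by (intro U_nbhd_right_subset) auto
 then have "of_real (b - 1) \<in> S_set n {a..\<infinity>}" using n by (auto simp: S_set_def)
 then show ?thesis by blast
qed

lemma Inf_right: "Inf {a..\<infinity>::ereal} = a" by (rule Inf_eqI) auto

lemma FO_domain_right: "FO_domain {a..\<infinity>} k = {z. Im z <= - (1/real k)}" by (simp add: FO_domain_def)

lemma half_plane_right: "half_plane {a..\<infinity>} = {zt. Im zt < 0}" by (simp add: half_plane_def)

lemma FO_domain_nonempty: "FO_domain K k ~= {}"
proof -
 have "Complex 0 (- (1/real k)) \<in> FO_domain K k \<or> Complex 0 (1/real k) \<in> FO_domain K k" by (auto simp: FO_domain_def)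
 then show ?thesis by blast
qed

text \<open>Turns a bound in \<open>FO\<close> into one with prescribed ep, ht and b < a: k exceeds
  1/ep, 1/ht and, with a view to a = \<infinity>, also b.\<close>

lemma FO_weight_right_lower:
 assumes b: "ereal b < a" and ep: "0 < ep" and ht: "0 < ht"
 obtains k where "k >= 1" "\<And>zt. Im zt <= - ht ==> zt \<in> FO_domain {a..\<infinity>} k \<and>
  exp (- (ep*cmod zt + b*Im zt)) <= FO_weight {a..\<infinity>} k zt"
proof -
 define k where "k = nat \<lceil>max (max (1/ep) (1/ht)) b\<rceil>"
 have "max (max (1/ep) (1/ht)) b <= real k" unfolding k_def by (rule real_nat_ceiling_ge)
 then have k: "1/ep <= real k" "1/ht <= real k" "b <= real k" by linarith+
 have k0: "0 < real k" using k(1) ep by (meson divide_pos_pos less_le_trans zero_less_one)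
 have i: "1/real k <= ep" "1/real k <= ht" using k k0 ep ht by (simp_all add: field_simps)
 define w where "w = (if a = \<infinity> then real k else real_of_ereal a)"
 have w: "b <= w" using b k(3) unfolding w_def by (cases a) auto
 show ?thesis
 proof (rule that[of k])
  show "k >= 1" using k0 by simp
  fix zt assume zt: "Im zt <= - ht"
  have "1/real k*cmod zt <= ep*cmod zt" using i by (intro mult_right_mono) auto
  moreover have "b*- Im zt <= w*- Im zt" using w zt ht by (intro mult_right_mono) auto
  ultimately have "- (ep*cmod zt + b*Im zt) <= - (1/real k)*cmod zt + w*- Im zt" by linarith
  moreover have "abs (Im zt) = - Im zt" using zt ht by simp
  moreover have "FO_weight {a..\<infinity>} k zt = exp (- (1/real k)*cmod zt + w*abs (Im zt))" unfolding w_def FO_weight_def Inf_right by simp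
  ultimately have W: "exp (- (ep*cmod zt + b*Im zt)) <= FO_weight {a..\<infinity>} k zt" by (simp only: exp_le_cancel_iff)
  then show "zt \<in> FO_domain {a..\<infinity>} k \<and> exp (- (ep*cmod zt + b*Im zt)) <= FO_weight {a..\<infinity>} k zt" using i zt W by (simp add: FO_domain_right)
 qed
qed

text \<open>Lowering the coefficient of |Im z| by e costs e*|Im z| <= e*|z|; this is paid for by
  using only half of 1/k = 2*e as growth rate.\<close>

lemma FO_weight_right_upper:
 assumes a: "a ~= -\<infinity>" and k: "k >= 1"
 obtains b ep where "ereal b < a" "0 < ep" "ep < 1/real k"
  "\<And>zt. zt \<in> FO_domain {a..\<infinity>} k ==> exp (ep*cmod zt + b*Im zt)*FO_weight {a..\<infinity>} k zt <= 1"
proof -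
 define w where "w = (if a = \<infinity> then real k else real_of_ereal a)"
 define e where "e = 1/(2*real k)"
 have e: "0 < e" "1/real k = e + e" using k by (auto simp: e_def field_simps)
 show ?thesis
 proof (rule that[of "w - e" e])
  show "ereal (w - e) < a" using a e(1) unfolding w_def by (cases a) auto
  show "0 < e" "e < 1/real k" unfolding e(2) using e(1) by simp_all
  fix zt assume "zt \<in> FO_domain {a..\<infinity>} k"
  then have "Im zt <= - (e + e)" unfolding FO_domain_right e(2) by simp
  then have zt: "abs (Im zt) = - Im zt" using e(1) by simp
  have "e*abs (Im zt) <= e*cmod zt" using e(1) abs_Im_le_cmod[of zt] by (intro mult_left_mono) auto
  then have "(e*cmod zt + (w - e)*Im zt) + (- (e + e)*cmod zt + w*abs (Im zt)) <= 0" unfolding zt by (simp add: algebra_simps)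
  moreover have "FO_weight {a..\<infinity>} k zt = exp (- (e + e)*cmod zt + w*abs (Im zt))"
   unfolding e(2)[symmetric] w_def FO_weight_def Inf_right by simp
  ultimately show "exp (e*cmod zt + (w - e)*Im zt)*FO_weight {a..\<infinity>} k zt <= 1" by (simp only: mult_exp_exp exp_le_one_iff)
 qed
qed

lemma FO_weight_pos: "0 < FO_weight K k zt" by (simp add: FO_weight_def)

text \<open>For a = \<infinity> the left edge is constantly 1/c and the cap a vertical segment. For
  finite a and c < 1/(|a| + 1) the minimum in \<open>left_edge\<close> is attained by the half-disc,
  so the cap is round.\<close>

lemma gamma_right_hairpin:
 assumes a: "a ~= -\<infinity>"
 obtains c0 where "0 < c0" "\<And>c. 0 < c ==> c < c0 ==>
  \<exists>b c' l kp. ereal b < a \<and> hairpin_avoids b c' l kp c \<and> gamma {a..\<infinity>} c = hairpin l kp c"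
proof (cases "a = \<infinity>")
 case True
 have "\<exists>b c' l kp. ereal b < a \<and> hairpin_avoids b c' l kp c \<and> gamma {a..\<infinity>} c = hairpin l kp c" if "0 < c" for c
 proof (intro exI conjI)
  show "hairpin_avoids (1/c) c (1/c) 0 c" using that by (rule hairpin_avoids_rectangle)
  show "gamma {a..\<infinity>} c = hairpin (1/c) 0 c"
   using True by (auto simp: gamma_def gamma_right_def left_edge_def hairpin_def Inf_right min_def fun_eq_iff)
 qed (use True in auto)
 then show ?thesis by (intro that[of 1]) auto
next
 case False
 then obtain r where r: "a = ereal r" using a by (cases a) auto
 have "\<exists>b c' l kp. ereal b < a \<and> hairpin_avoids b c' l kp c \<and> gamma {a..\<infinity>} c = hairpin l kp c"
  if c: "0 < c" "c < 1/(abs r + 1)" for c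
 proof (intro exI conjI)
  show "hairpin_avoids (r - c/2) (c/2) r c c" using c(1) by (rule hairpin_avoids_disc)
  have "abs r + 1 <= 1/c" using c by (simp add: field_simps)
  then have "left_edge a c t = r - c*cos t" if "0 <= cos t" for t
  proof -
   have "0 <= c*cos t" using that c by simp
   then have "r - c*cos t <= 1/c" using \<open>abs r + 1 <= 1 / c\<close> by linarith
   then show ?thesis using r by (simp add: left_edge_def min_def)
  qed
  moreover have "0 <= cos t" if "\<not> t < - (pi/2)" "t <= pi/2" for t using that by (intro cos_ge_zero) auto
  ultimately show "gamma {a..\<infinity>} c = hairpin r c c" by (auto simp: gamma_def gamma_right_def hairpin_def Inf_right fun_eq_iff)
 qed (use r c in auto)
 then show ?thesis by (intro that[of "1/(abs r + 1)"]) auto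
qed

section \<open>The Fourier transform of vector-valued functions\<close>

context seq_complete_lc_space
begin

lemma OexpI:
 assumes "F \<in> holo_space sc A p (- fin_part K)"
  and bound: "\<And>n j. n >= 1 ==> j \<in> A ==> \<exists>C. \<forall>z\<in>S_set n K. p j (F z) <= C*exp (1/real n*abs (Re z))"
 shows "F \<in> Oexp sc A p K"
proof -
 have "bdd_above ((\<lambda>z. p j (F z)*exp (- (1/real n)*abs (Re z))) ` S_set n K)" if n: "n >= 1" and j: "j \<in> A" for n j
 proof -
  obtain C where C: "\<And>z. z \<in> S_set n K ==> p j (F z) <= C*exp (1/real n*abs (Re z))" using bound[OF n j] by blast
  show ?thesis
  proof (rule bdd_aboveI2)
   fix z assume "z \<in> S_set n K"
   from C[OF this] show "p j (F z)*exp (- (1/real n)*abs (Re z)) <= C" by (simp add: exp_minus divide_simps)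
  qed
 qed
 with assms(1) show ?thesis by (simp add: Oexp_def)
qed

lemma Oexp_seminorm_upper:
 assumes F: "F \<in> Oexp sc A p K" and n: "n >= 1" and j: "j \<in> A" and z: "z \<in> S_set n K"
 shows "p j (F z) <= Oexp_seminorm p K n j F*exp (1/real n*abs (Re z))"
proof -
 have "bdd_above ((\<lambda>z. p j (F z)*exp (- (1/real n)*abs (Re z))) ` S_set n K)" using F n j by (simp add: Oexp_def)
 from cSUP_upper[OF z this] show ?thesis unfolding Oexp_seminorm_def by (simp add: exp_minus divide_simps)
qed

lemma Oexp_seminorm_nonneg:
 assumes F: "F \<in> Oexp sc A p K" and n: "n >= 1" and j: "j \<in> A" and "S_set n K ~= {}"
 shows "0 <= Oexp_seminorm p K n j F"
proof -
 obtain z where "z \<in> S_set n K" using assms by blast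
 from Oexp_seminorm_upper[OF F n j this] have "0 <= Oexp_seminorm p K n j F*exp (1/real n*abs (Re z))"
  using p_nonneg[OF j, of "F z"] by linarith
 then show ?thesis by (simp add: zero_le_mult_iff)
qed

lemma Oexp_seminorm_least:
 assumes "S_set n K ~= {}" and C: "\<And>z. z \<in> S_set n K ==> p j (F z) <= C*exp (1/real n*abs (Re z))"
 shows "Oexp_seminorm p K n j F <= C" unfolding Oexp_seminorm_def
proof (rule cSUP_least[OF assms(1)])
 fix z assume "z \<in> S_set n K"
 from C[OF this] show "p j (F z)*exp (- (1/real n)*abs (Re z)) <= C" by (simp add: exp_minus divide_simps)
qed

lemma FO_seminorm_upper:
 assumes f: "f \<in> FO sc A p K" and k: "k >= 1" and j: "j \<in> A" and z: "z \<in> FO_domain K k"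
 shows "p j (f z)*FO_weight K k z <= FO_seminorm p K k j f"
proof -
 have "bdd_above ((\<lambda>z. p j (f z)*FO_weight K k z) ` FO_domain K k)" using f k j by (simp add: FO_def)
 from cSUP_upper[OF z this] show ?thesis unfolding FO_seminorm_def .
qed

lemma FO_seminorm_nonneg:
 assumes f: "f \<in> FO sc A p K" and k: "k >= 1" and j: "j \<in> A"
 shows "0 <= FO_seminorm p K k j f"
proof -
 obtain z where "z \<in> FO_domain K k" using FO_domain_nonempty by blast
 from FO_seminorm_upper[OF f k j this] show ?thesis
  using mult_nonneg_nonneg[OF p_nonneg[OF j, of "f z"] less_imp_le[OF FO_weight_pos[of K k z]]] by linarith
qed

lemma Oexp_right_holo: "F \<in> Oexp sc A p {a..\<infinity>} ==> F \<in> holo_space sc A p (slit_plane a)"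
 unfolding Oexp_def compl_fin_part_right by (elim CollectE conjE)

lemma FO_right_holo: "f \<in> FO sc A p {a..\<infinity>} ==> f \<in> holo_space sc A p {s. Im s < 0}" unfolding FO_def half_plane_right by (elim CollectE conjE)

text \<open>The index n is found before F and j, and this order of quantifiers is what later makes
  the transform continuous.\<close>

lemma Oexp_right_bound:
 assumes b: "ereal b < a" and c: "0 < c" and ep: "0 < ep"
 obtains n where "n >= 1" "\<And>F j z. F \<in> Oexp sc A p {a..\<infinity>} ==> j \<in> A ==> Re z <= b \<or> c <= abs (Im z) ==> (abs (Im z)) <= Y ==>
  p j (F z) <= Oexp_seminorm p {a..\<infinity>} n j F*exp (ep*abs (Re z))"
proof -
 obtain n where n: "n >= 1" "1/real n <= ep" "\<And>z. Re z <= b \<or> c <= abs (Im z) ==> (abs (Im z)) <= Y ==> z \<in> S_set n {a..\<infinity>}"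
  using S_set_right_superset[OF b c ep, of Y] by blast
 have a: "a ~= -\<infinity>" using b by auto
 show ?thesis
 proof (rule that[OF n(1)])
  fix F j z assume F: "F \<in> Oexp sc A p {a..\<infinity>}" and j: "j \<in> A" and z: "Re z <= b \<or> c <= abs (Im z)" "abs (Im z) <= Y"
  have "p j (F z) <= Oexp_seminorm p {a..\<infinity>} n j F*exp (1/real n*abs (Re z))" by (rule Oexp_seminorm_upper[OF F n(1) j n(3)[OF z]])
  also have "\<dots> <= Oexp_seminorm p {a..\<infinity>} n j F*exp (ep*abs (Re z))"
  proof (rule mult_left_mono)
   show "exp (1/real n*abs (Re z)) <= exp (ep*abs (Re z))" unfolding exp_le_cancel_iff using n(2) by (intro mult_right_mono) auto
  qed (rule Oexp_seminorm_nonneg[OF F n(1) j S_set_right_nonempty[OF a n(1)]])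
  finally show "p j (F z) <= Oexp_seminorm p {a..\<infinity>} n j F*exp (ep*abs (Re z))" .
 qed
qed

lemma FO_right_bound:
 assumes b: "ereal b < a" and ep: "0 < ep" and ht: "0 < ht"
 obtains k where "k >= 1" "\<And>f j s. f \<in> FO sc A p {a..\<infinity>} ==> j \<in> A ==> Im s <= - ht ==>
  p j (f s) <= FO_seminorm p {a..\<infinity>} k j f*exp (ep*cmod s + b*Im s)"
proof -
 obtain k where k: "k >= 1" "\<And>zt. Im zt <= - ht ==> zt \<in> FO_domain {a..\<infinity>} k \<and>
  exp (- (ep*cmod zt + b*Im zt)) <= FO_weight {a..\<infinity>} k zt" using FO_weight_right_lower[OF b ep ht] by metis
 show ?thesis
 proof (rule that[OF k(1)])
  fix f j s assume f: "f \<in> FO sc A p {a..\<infinity>}" and j: "j \<in> A" and s: "Im s <= - ht"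
  have "p j (f s)*exp (- (ep*cmod s + b*Im s)) <= p j (f s)*FO_weight {a..\<infinity>} k s"
   using k(2)[OF s] p_nonneg[OF j] by (intro mult_left_mono) auto
  also have "\<dots> <= FO_seminorm p {a..\<infinity>} k j f" using k(2)[OF s] by (intro FO_seminorm_upper[OF f k(1) j]) auto
  finally show "p j (f s) <= FO_seminorm p {a..\<infinity>} k j f*exp (ep*cmod s + b*Im s)" unfolding exp_minus by (simp add: divide_simps)
 qed
qed

lemma lc_dual_le_sum:
 assumes "\<And>j. j \<in> S ==> p j x <= M j*(y::real)" "cmod (ph x) <= C*(\<Sum>j\<in>S. p j x)" "0 < C"
 shows "cmod (ph x) <= (C*(\<Sum>j\<in>S. M j))*y"
proof -
 have "(\<Sum>j\<in>S. p j x) <= (\<Sum>j\<in>S. M j)*y" unfolding sum_distrib_right by (rule sum_mono) (rule assms(1))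
 then have "C*(\<Sum>j\<in>S. p j x) <= C*((\<Sum>j\<in>S. M j)*y)" using assms(3) by (intro mult_left_mono) auto
 with assms(2) show ?thesis by (simp only: mult.assoc)
qed

lemma Oexp_right_slow_growth:
 assumes F: "F \<in> Oexp sc A p {a..\<infinity>}" and ph: "ph \<in> lc_dual sc A p"
 shows "slow_growth a (\<lambda>z. ph (F z))"
proof -
 obtain S C where S: "finite S" "S \<subseteq> A" "0 < C" "\<And>x. cmod (ph x) <= C*(\<Sum>j\<in>S. p j x)" using lc_dual_bound[OF ph] by blast
 have "\<exists>B\<ge>0. \<forall>z. Re z <= b \<or> c <= abs (Im z) \<longrightarrow> (abs (Im z)) <= Y \<longrightarrow> cmod (ph (F z)) <= B*exp (ep*abs (Re z))"
  if b: "ereal b < a" and c: "0 < c" "0 < ep" for b c Y ep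
 proof -
  obtain n where n: "n >= 1" "\<And>F j z. F \<in> Oexp sc A p {a..\<infinity>} ==> j \<in> A ==> Re z <= b \<or> c <= abs (Im z) ==> (abs (Im z)) <= Y ==>
   p j (F z) <= Oexp_seminorm p {a..\<infinity>} n j F*exp (ep*abs (Re z))" using Oexp_right_bound[OF b c, of Y] by blast
  have a: "a ~= -\<infinity>" using b by auto
  show ?thesis
  proof (intro exI conjI allI impI)
   show "0 <= C*(\<Sum>j\<in>S. Oexp_seminorm p {a..\<infinity>} n j F)"
    using S Oexp_seminorm_nonneg[OF F n(1) _ S_set_right_nonempty[OF a n(1)]] by (intro mult_nonneg_nonneg sum_nonneg) auto
   fix z assume "Re z <= b \<or> c <= abs (Im z)" "abs (Im z) <= Y"
   then show "cmod (ph (F z)) <= C*(\<Sum>j\<in>S. Oexp_seminorm p {a..\<infinity>} n j F)*exp (ep*abs (Re z))" using S n(2)[OF F] by (intro lc_dual_le_sum) auto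
  qed
 qed
 then show ?thesis unfolding slow_growth_def using dual_holomorphic[OF Oexp_right_holo[OF F] open_slit_plane ph] by blast
qed

lemma FO_right_half_plane_growth:
 assumes f: "f \<in> FO sc A p {a..\<infinity>}" and ph: "ph \<in> lc_dual sc A p"
 shows "half_plane_growth a (\<lambda>z. ph (f z))"
proof -
 obtain S C where S: "finite S" "S \<subseteq> A" "0 < C" "\<And>x. cmod (ph x) <= C*(\<Sum>j\<in>S. p j x)" using lc_dual_bound[OF ph] by blast
 have "\<exists>B\<ge>0. \<forall>s. Im s <= - ht \<longrightarrow> cmod (ph (f s)) <= B*exp (ep*cmod s + b*Im s)"
  if b: "ereal b < a" and ep: "0 < ep" "0 < ht" for b ep ht
 proof -
  obtain k where k: "k >= 1" "\<And>f j s. f \<in> FO sc A p {a..\<infinity>} ==> j \<in> A ==> Im s <= - ht ==>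
   p j (f s) <= FO_seminorm p {a..\<infinity>} k j f*exp (ep*cmod s + b*Im s)" using FO_right_bound[OF b ep] by blast
  show ?thesis
  proof (intro exI conjI allI impI)
   show "0 <= C*(\<Sum>j\<in>S. FO_seminorm p {a..\<infinity>} k j f)" using S FO_seminorm_nonneg[OF f k(1)] by (intro mult_nonneg_nonneg sum_nonneg) auto
   fix s assume "Im s <= - ht"
   then show "cmod (ph (f s)) <= C*(\<Sum>j\<in>S. FO_seminorm p {a..\<infinity>} k j f)*exp (ep*cmod s + b*Im s)"
    using S k(2)[OF f] by (intro lc_dual_le_sum) auto
  qed
 qed
 moreover have "open {s. Im s < 0}" by (intro open_Collect_less continuous_intros)
 ultimately show ?thesis unfolding half_plane_growth_def using dual_holomorphic[OF FO_right_holo[OF f] _ ph] by blast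
qed

text \<open>The vector is specified by the values of all functionals, and for all b at once, so that
  any convenient path may be chosen afterwards.\<close>

definition fourier_right :: "ereal => (complex => 'a) => complex => 'a" where
 "fourier_right a F zt = (if Im zt < 0
   then SOME v. \<forall>ph\<in>lc_dual sc A p. \<forall>b. ereal b < a \<longrightarrow> ph v = hairpin_integral b 0 1 (fourier_integrand (\<lambda>z. ph (F z)) zt)
   else 0)"

text \<open>Existence is the Pettis integral along one rectangular path; the scalar independence
  result passes to every other admissible path, including the round one.\<close>

lemma dual_fourier_right:
 assumes F: "F \<in> Oexp sc A p {a..\<infinity>}" and zt: "Im zt < 0" and ph: "ph \<in> lc_dual sc A p"
  and b: "ereal b < a" and av: "hairpin_avoids b c l kp d"
 shows "ph (fourier_right a F zt) = hairpin_integral l kp d (fourier_integrand (\<lambda>z. ph (F z)) zt)"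
proof -
 let ?\<Gamma> = "hairpin b 0 1" and ?S = "{- (pi/2), pi/2}"
 let ?c = "\<lambda>t. hairpin_deriv 0 1 t*exp (- \<i>*?\<Gamma> t*zt)"
 have avb: "hairpin_avoids b 1 b 0 1" by (rule hairpin_avoids_rectangle) simp
 have "\<exists>v. \<forall>ph\<in>lc_dual sc A p. has_bochner_integral lborel (\<lambda>t. ?c t*ph (F (?\<Gamma> t))) (ph v)"
 proof (rule pettis_integral_exists[OF Oexp_right_holo[OF F], of ?S "- Im zt/2"])
  show "isCont ?c t" "isCont ?\<Gamma> t" if "t \<notin> ?S" for t by (intro continuous_intros isCont_hairpin_deriv[OF that] isCont_hairpin)+
  show "?\<Gamma> t \<in> slit_plane a" for t by (rule hairpin_in_slit_plane[OF avb b])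
  fix j assume j: "j \<in> A"
  define ta where "ta = - Im zt"
  have ta: "0 < ta" using zt by (simp add: ta_def)
  obtain n where n: "n >= 1" "\<And>F j z. F \<in> Oexp sc A p {a..\<infinity>} ==> j \<in> A ==> Re z <= b \<or> 1 <= abs (Im z) ==> (abs (Im z)) <= 1 ==>
   p j (F z) <= Oexp_seminorm p {a..\<infinity>} n j F*exp (ta/2*abs (Re z))" using Oexp_right_bound[OF b, of 1 "ta/2" 1] ta by auto
  have M: "0 <= Oexp_seminorm p {a..\<infinity>} n j F" using b by (intro Oexp_seminorm_nonneg[OF F n(1) j] S_set_right_nonempty n) auto
  let ?B = "Oexp_seminorm p {a..\<infinity>} n j F*exp (ta/2*(abs b + 0 + 2) + 2*ta)*exp ((b - 0)*Im zt + \<bar>1\<bar>*abs (Re zt))"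
  have "cmod (?c t)*p j (F (?\<Gamma> t)) <= 2*?B*exp (- (- Im zt/2)*abs t)" for t
  proof -
   have "p j (F (?\<Gamma> t)) <= Oexp_seminorm p {a..\<infinity>} n j F*exp (ta/2*\<bar>Re (?\<Gamma> t)\<bar>)"
    using avb hairpin_bounds(4)[of 0 b 1 t] by (intro n(2) F j) (auto simp: hairpin_avoids_def)
   then have "p j (F (?\<Gamma> t))*cmod (exp (- \<i>*?\<Gamma> t*zt)) <= ?B*exp (- (ta - ta/2)*abs t)"
    using ta M by (intro fourier_weight_bound) (auto simp: ta_def)
   moreover have "cmod (hairpin_deriv 0 1 t) <= 2" using hairpin_bounds(5)[of 0 1 t] by simp
   ultimately have "cmod (hairpin_deriv 0 1 t)*(p j (F (?\<Gamma> t))*cmod (exp (- \<i>*?\<Gamma> t*zt))) <= 2*(?B*exp (- (ta - ta/2)*abs t))"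
    using p_nonneg[OF j] by (intro mult_mono[OF _ _ _ mult_nonneg_nonneg]) auto
   moreover have "ta - ta/2 = - Im zt/2" by (simp add: ta_def)
   ultimately show ?thesis by (simp only: norm_mult mult_ac)
  qed
  then show "\<exists>B. \<forall>t. t \<notin> ?S \<longrightarrow> cmod (?c t)*p j (F (?\<Gamma> t)) <= B*exp (- (- Im zt/2)*abs t)" by blast
 qed (use zt in auto)
 then obtain v where v: "\<And>ph. ph \<in> lc_dual sc A p ==> has_bochner_integral lborel (\<lambda>t. ?c t*ph (F (?\<Gamma> t))) (ph v)" by blast
 have "\<forall>ph\<in>lc_dual sc A p. \<forall>b. ereal b < a \<longrightarrow> ph v = hairpin_integral b 0 1 (fourier_integrand (\<lambda>z. ph (F z)) zt)"
 proof (intro ballI allI impI)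
  fix ph b' assume ph: "ph \<in> lc_dual sc A p" and b': "ereal b' < a"
  have "ph v = hairpin_integral b 0 1 (fourier_integrand (\<lambda>z. ph (F z)) zt)"
   using has_bochner_integral_integral_eq[OF v[OF ph]] by (simp add: hairpin_integral_def fourier_integrand_def mult_ac)
  also have "\<dots> = hairpin_integral b' 0 1 (fourier_integrand (\<lambda>z. ph (F z)) zt)"
   by (rule fourier_hairpin_independent[OF Oexp_right_slow_growth[OF F ph] zt b avb b' hairpin_avoids_rectangle]) simp
  finally show "ph v = hairpin_integral b' 0 1 (fourier_integrand (\<lambda>z. ph (F z)) zt)" .
 qed
 from someI[of "\<lambda>v. \<forall>ph\<in>lc_dual sc A p. \<forall>b. ereal b < a \<longrightarrow> ph v = hairpin_integral b 0 1 (fourier_integrand (\<lambda>z. ph (F z)) zt)", OF this]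
 have "ph (fourier_right a F zt) = hairpin_integral b 0 1 (fourier_integrand (\<lambda>z. ph (F z)) zt)"
  using ph b zt unfolding fourier_right_def by (simp only: if_True)
 also have "\<dots> = hairpin_integral l kp d (fourier_integrand (\<lambda>z. ph (F z)) zt)"
  by (rule fourier_hairpin_independent[OF Oexp_right_slow_growth[OF F ph] zt b avb b av])
 finally show ?thesis .
qed

text \<open>The threshold c0 depends only on the shape of the path, so the same small c serve all F
  at once.\<close>

lemma has_fourier_integral_right:
 assumes a: "a ~= -\<infinity>" and zt: "Im zt < 0"
 shows "\<forall>\<^sub>F c in at_right 0. \<forall>F\<in>Oexp sc A p {a..\<infinity>}. has_fourier_integral sc A p {a..\<infinity>} c F zt (fourier_right a F zt)"
proof -
 obtain c0 where c0: "0 < c0" "\<And>c. 0 < c ==> c < c0 ==>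
  \<exists>b c' l kp. ereal b < a \<and> hairpin_avoids b c' l kp c \<and> gamma {a..\<infinity>} c = hairpin l kp c" using gamma_right_hairpin[OF a] by blast
 have "has_fourier_integral sc A p {a..\<infinity>} c F zt (fourier_right a F zt)"
  if c: "0 < c" "c < c0" and F: "F \<in> Oexp sc A p {a..\<infinity>}" for c F
 proof -
  obtain b c' l kp where g: "ereal b < a" "hairpin_avoids b c' l kp c" "gamma {a..\<infinity>} c = hairpin l kp c" using c0(2)[OF c] by blast
  show ?thesis unfolding has_fourier_integral_def has_pettis_path_integral_def has_pettis_integral_def g(3)
  proof
   fix ph assume ph: "ph \<in> lc_dual sc A p"
   let ?h = "fourier_integrand (\<lambda>z. ph (F z)) zt"
   have "has_bochner_integral lborel (\<lambda>t. hairpin_deriv kp c t*?h (hairpin l kp c t)) (ph (fourier_right a F zt))"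
    unfolding has_bochner_integral_iff dual_fourier_right[OF F zt ph g(1,2)] hairpin_integral_def
    using fourier_hairpin_integrable[OF Oexp_right_slow_growth[OF F ph] g(1,2) zt] by simp
   then show "has_bochner_integral lborel (\<lambda>t. ph (sc (vector_derivative (hairpin l kp c) (at t)) (sc (exp (- \<i>*hairpin l kp c t*zt)) (F (hairpin l kp c t)))))
    (ph (fourier_right a F zt))"
   \<comment> \<open>At the two corners of the path the derivative carries no information; they form
     a null set.\<close>
   proof (rule has_bochner_integral_discrete_difference[where X = "{- (pi/2), pi/2}", THEN iffD1, rotated -1])
    fix t assume t: "t \<notin> {- (pi/2), pi/2}"
    show "hairpin_deriv kp c t*?h (hairpin l kp c t) =
      ph (sc (vector_derivative (hairpin l kp c) (at t)) (sc (exp (- \<i>*hairpin l kp c t*zt)) (F (hairpin l kp c t))))"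
     unfolding vector_derivative_at[OF hairpin_has_deriv[OF t]] lc_dual_scale[OF ph] fourier_integrand_def by (simp only: mult.commute)
   qed auto
  qed
 qed
 then show ?thesis unfolding eventually_at_right_field using c0(1) by blast
qed

text \<open>The path is taken at height ep with its left end at b; then its height is the growth
  rate in Re zt and its left end the coefficient of Im zt.\<close>

lemma fourier_right_bound:
 assumes b: "ereal b < a" and ep: "0 < ep" and ht: "0 < ht"
 obtains n C where "n >= 1" "0 <= C" "\<And>F j zt. F \<in> Oexp sc A p {a..\<infinity>} ==> j \<in> A ==> Im zt <= - ht ==>
  p j (fourier_right a F zt) <= C*Oexp_seminorm p {a..\<infinity>} n j F*exp (ep*cmod zt + b*Im zt)"
proof -
 obtain n where n: "n >= 1" "\<And>F j z. F \<in> Oexp sc A p {a..\<infinity>} ==> j \<in> A ==> Re z <= b \<or> ep <= abs (Im z) ==> (abs (Im z)) <= ep ==>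
  p j (F z) <= Oexp_seminorm p {a..\<infinity>} n j F*exp (ht/2*abs (Re z))" using Oexp_right_bound[OF b ep, of "ht/2" ep] ht by auto
 define D where "D = exp (ht/2*(abs b + 0 + 2) + 2*ht)"
 define C where "C = 2*(1 + 0 + ep)*D/(ht - ht/2)"
 have C: "0 <= C" using ep ht by (simp add: C_def D_def)
 show ?thesis
 proof (rule that[OF n(1) C])
  fix F j zt assume F: "F \<in> Oexp sc A p {a..\<infinity>}" and j: "j \<in> A" and zt: "Im zt <= - ht"
  let ?M = "Oexp_seminorm p {a..\<infinity>} n j F"
  have M: "0 <= ?M" using b by (intro Oexp_seminorm_nonneg[OF F n(1) j] S_set_right_nonempty n) auto
  have av: "hairpin_avoids b ep b 0 ep" using ep by (rule hairpin_avoids_rectangle)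
  show "p j (fourier_right a F zt) <= C*?M*exp (ep*cmod zt + b*Im zt)"
  proof (rule seminorm_le_dual[OF j])
   fix ph assume ph: "ph \<in> lc_dual sc A p" and le: "\<And>y. cmod (ph y) <= p j y"
   have "ph (fourier_right a F zt) = hairpin_integral b 0 ep (fourier_integrand (\<lambda>z. ph (F z)) zt)"
    using zt ht by (intro dual_fourier_right[OF F _ ph b av]) auto
   moreover have "cmod (hairpin_integral b 0 ep (fourier_integrand (\<lambda>z. ph (F z)) zt)) <=
     2*((1 + 0 + ep)*(?M*D*exp ((b - 0)*Im zt + ep*abs (Re zt))))/(ht - ht/2)" unfolding D_def
   proof (rule fourier_hairpin_bound(3)[OF dual_holomorphic[OF Oexp_right_holo[OF F] open_slit_plane ph] b av])
    show "cmod (ph (F z)) <= ?M*exp (ht/2*abs (Re z))" if "Re z <= b \<or> ep <= abs (Im z)" "abs (Im z) <= ep" for z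
     using le[of "F z"] n(2)[OF F j that] by linarith
   qed (use zt ht M in auto)
   ultimately have "cmod (ph (fourier_right a F zt)) <= C*?M*exp (b*Im zt + ep*abs (Re zt))"
    by (simp only: C_def diff_0_right mult_ac times_divide_eq_left times_divide_eq_right)
   also have "\<dots> <= C*?M*exp (ep*cmod zt + b*Im zt)"
   proof (rule mult_left_mono)
    have "ep*abs (Re zt) <= ep*cmod zt" using ep abs_Re_le_cmod by (intro mult_left_mono) auto
    then show "exp (b*Im zt + ep*abs (Re zt)) <= exp (ep*cmod zt + b*Im zt)" by simp
   qed (use C M in simp)
   finally show "cmod (ph (fourier_right a F zt)) <= C*?M*exp (ep*cmod zt + b*Im zt)" .
  qed
 qed
qed

lemma fourier_right_zero: "\<not> Im zt < 0 ==> fourier_right a F zt = 0" unfolding fourier_right_def by (simp only: if_False)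

lemma fourier_right_holo:
 assumes a: "a ~= -\<infinity>" and F: "F \<in> Oexp sc A p {a..\<infinity>}"
 shows "fourier_right a F \<in> holo_space sc A p {zt. Im zt < 0}"
proof (rule weakly_holomorphic_imp_holo)
 obtain b where b: "ereal b < a" using a ereal_dense2[of "-\<infinity>" a] by (auto simp: less_le)
 show "open {zt. Im zt < 0}" by (intro open_Collect_less continuous_intros)
 show "(\<lambda>zt. ph (fourier_right a F zt)) holomorphic_on {zt. Im zt < 0}" if ph: "ph \<in> lc_dual sc A p" for ph
 proof (rule holomorphic_transform)
  have av: "hairpin_avoids b 1 b 0 1" by (rule hairpin_avoids_rectangle) simp
  show "(\<lambda>zt. hairpin_integral b 0 1 (fourier_integrand (\<lambda>z. ph (F z)) zt)) holomorphic_on {zt. Im zt < 0}"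
   by (rule fourier_holomorphic[OF Oexp_right_slow_growth[OF F ph] b av])
  show "hairpin_integral b 0 1 (fourier_integrand (\<lambda>z. ph (F z)) zt) = ph (fourier_right a F zt)" if "zt \<in> {zt. Im zt < 0}" for zt
   using that by (intro dual_fourier_right[OF F _ ph b av, symmetric]) simp
 qed
 fix z j assume z: "z \<in> {zt. Im zt < 0}" and j: "j \<in> A"
 define r where "r = - Im z/2"
 have r: "0 < r" using z by (simp add: r_def)
 obtain n C where n: "n >= 1" "0 <= C" "\<And>F j zt. F \<in> Oexp sc A p {a..\<infinity>} ==> j \<in> A ==> Im zt <= - r ==>
  p j (fourier_right a F zt) <= C*Oexp_seminorm p {a..\<infinity>} n j F*exp (1*cmod zt + b*Im zt)" using fourier_right_bound[OF b, of 1 r] r by auto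
 let ?M = "C*Oexp_seminorm p {a..\<infinity>} n j F"
 have M: "0 <= ?M" by (intro mult_nonneg_nonneg n Oexp_seminorm_nonneg[OF F n(1) j] S_set_right_nonempty[OF a])
 have "p j (fourier_right a F w) <= ?M*exp ((1 + abs b)*(cmod z + r))" if w: "w \<in> ball z r" for w
 proof -
  have d: "cmod (w - z) < r" using w by (simp add: dist_norm norm_minus_commute)
  have "Im w <= - r" using d abs_Im_le_cmod[of "w - z"] by (simp add: r_def)
  from n(3)[OF F j this] have "p j (fourier_right a F w) <= ?M*exp (1*cmod w + b*Im w)" .
  also have "\<dots> <= ?M*exp ((1 + abs b)*(cmod z + r))"
  proof (rule mult_left_mono[OF _ M])
   have cw: "cmod w <= cmod z + r" using d norm_triangle_sub[of w z] by linarith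
   have "b*Im w <= abs b*abs (Im w)" by (simp flip: abs_mult)
   also have "\<dots> <= abs b*(cmod z + r)" using cw abs_Im_le_cmod[of w] by (intro mult_left_mono) auto
   finally show "exp (1*cmod w + b*Im w) <= exp ((1 + abs b)*(cmod z + r))" using cw by (simp add: distrib_right)
  qed
  finally show ?thesis .
 qed
 with r show "\<exists>r>0. \<exists>M. \<forall>w\<in>ball z r \<inter> {zt. Im zt < 0}. p j (fourier_right a F w) <= M" by blast
qed (simp add: fourier_right_zero)

lemma FO_I:
 assumes "f \<in> holo_space sc A p (half_plane K)"
  and "\<And>k j. k >= 1 ==> j \<in> A ==> \<exists>C. \<forall>z\<in>FO_domain K k. p j (f z)*FO_weight K k z <= C"
 shows "f \<in> FO sc A p K"
proof -
 have "bdd_above ((\<lambda>z. p j (f z)*FO_weight K k z) ` FO_domain K k)" if "k >= 1" "j \<in> A" for k j using assms(2)[OF that] by (auto intro: bdd_aboveI2)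
 with assms(1) show ?thesis by (simp add: FO_def)
qed

lemma fourier_right_FO_bound:
 assumes a: "a ~= -\<infinity>" and k: "k >= 1"
 obtains n C where "n >= 1" "0 <= C" "\<And>F j z. F \<in> Oexp sc A p {a..\<infinity>} ==> j \<in> A ==> z \<in> FO_domain {a..\<infinity>} k ==>
  p j (fourier_right a F z)*FO_weight {a..\<infinity>} k z <= C*Oexp_seminorm p {a..\<infinity>} n j F"
proof -
 obtain b ep where b: "ereal b < a" "0 < ep" "\<And>zt. zt \<in> FO_domain {a..\<infinity>} k ==> exp (ep*cmod zt + b*Im zt)*FO_weight {a..\<infinity>} k zt <= 1"
  using FO_weight_right_upper[OF a k] by metis
 have "0 < 1/real k" using k by simp
 from fourier_right_bound[OF b(1,2) this]
 obtain n C where n: "n >= 1" "0 <= C" "\<And>F j zt. F \<in> Oexp sc A p {a..\<infinity>} ==> j \<in> A ==> Im zt <= - (1/real k) ==>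
  p j (fourier_right a F zt) <= C*Oexp_seminorm p {a..\<infinity>} n j F*exp (ep*cmod zt + b*Im zt)" by metis
 show ?thesis
 proof (rule that[OF n(1,2)])
  fix F j z assume F: "F \<in> Oexp sc A p {a..\<infinity>}" and j: "j \<in> A" and z: "z \<in> FO_domain {a..\<infinity>} k"
  let ?M = "C*Oexp_seminorm p {a..\<infinity>} n j F"
  have M: "0 <= ?M" by (intro mult_nonneg_nonneg n Oexp_seminorm_nonneg[OF F n(1) j] S_set_right_nonempty[OF a])
  have "p j (fourier_right a F z)*FO_weight {a..\<infinity>} k z <= (?M*exp (ep*cmod z + b*Im z))*FO_weight {a..\<infinity>} k z"
   using z FO_weight_pos[of "{a..\<infinity>}" k z] by (intro mult_right_mono n(3) F j) (auto simp: FO_domain_right)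
  also have "\<dots> = ?M*(exp (ep*cmod z + b*Im z)*FO_weight {a..\<infinity>} k z)" by (simp only: mult.assoc)
  also have "\<dots> <= ?M*1" by (intro mult_left_mono[OF b(3)[OF z] M])
  finally show "p j (fourier_right a F z)*FO_weight {a..\<infinity>} k z <= ?M" by simp
 qed
qed

lemma fourier_right_FO:
 assumes a: "a ~= -\<infinity>" and F: "F \<in> Oexp sc A p {a..\<infinity>}"
 shows "fourier_right a F \<in> FO sc A p {a..\<infinity>}"
proof (rule FO_I)
 show "fourier_right a F \<in> holo_space sc A p (half_plane {a..\<infinity>})" unfolding half_plane_right by (rule fourier_right_holo[OF a F])
 fix k :: nat and j assume "k >= 1" and j: "j \<in> A"
 from fourier_right_FO_bound[OF a this(1)] obtain n C where "\<And>F j z. F \<in> Oexp sc A p {a..\<infinity>} ==> j \<in> A ==> z \<in> FO_domain {a..\<infinity>} k ==>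
  p j (fourier_right a F z)*FO_weight {a..\<infinity>} k z <= C*Oexp_seminorm p {a..\<infinity>} n j F" by metis
 from this[OF F j] show "\<exists>C. \<forall>z\<in>FO_domain {a..\<infinity>} k. p j (fourier_right a F z)*FO_weight {a..\<infinity>} k z <= C" by blast
qed

end

lemma ball_bounds:
 assumes "w \<in> ball z r"
 shows "\<bar>Re w - Re z\<bar> < r" "\<bar>Im w - Im z\<bar> < r"
proof -
 have "cmod (w - z) < r" using assms by (simp add: dist_norm norm_minus_commute)
 then show "\<bar>Re w - Re z\<bar> < r" "\<bar>Im w - Im z\<bar> < r" using abs_Re_le_cmod[of "w - z"] abs_Im_le_cmod[of "w - z"] by auto
qed

lemma slit_plane_ball:
 assumes z: "z \<in> slit_plane a" and a: "a ~= -\<infinity>"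
 obtains r c b where "0 < r" "0 < c" "ereal b < a" "\<And>w. w \<in> ball z r ==> Re w <= b \<or> c <= abs (Im w)"
proof (cases "Im z = 0")
 case True
 then have "ereal (Re z) < a" using z by (simp add: slit_plane_def)
 then obtain b where b: "Re z < b" "ereal b < a" using ereal_dense2[of "ereal (Re z)" a] by auto
 have "Re w <= b" if "w \<in> ball z (b - Re z)" for w using ball_bounds[OF that] by auto
 with b show ?thesis by (intro that[of "b - Re z" 1 b]) auto
next
 case False
 obtain b where b: "ereal b < a" using a ereal_dense2[of "-\<infinity>" a] by (auto simp: less_le)
 have "abs (Im z)/2 <= abs (Im w)" if "w \<in> ball z (abs (Im z)/2)" for w using ball_bounds(2)[OF that] by linarith
 with b False show ?thesis by (intro that[of "abs (Im z)/2" "abs (Im z)/2" b]) auto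
qed

section \<open>The inverse transform of vector-valued functions\<close>

context seq_complete_lc_space
begin

text \<open>For non-real z a single Pettis integral with the multiplier is enough. At a real point
  left of a there are two, one for the step weight on the horizontal line and one for the downward
  ray.\<close>

lemma inverse_fourier_pettis:
 assumes a: "a ~= -\<infinity>" and f: "f \<in> FO sc A p {a..\<infinity>}" and z: "z \<in> slit_plane a"
 shows "\<exists>v. \<forall>ph\<in>lc_dual sc A p. ph v = inverse_fourier (\<lambda>s. ph (f s)) z"
proof (cases "Im z = 0")
 case False
 then obtain sg where sg: "abs sg = 1" "0 < sg*Im z" using Im_sign by blast
 let ?c = "\<lambda>t. 1/(2*pi)*(mu sg (Complex t (- 1))*exp (\<i>*z*Complex t (- 1)))"
 define c where "c = sg*Im z"
 have c: "0 < c" using sg by (simp add: c_def)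
 obtain b where b: "ereal b < a" using a ereal_dense2[of "-\<infinity>" a] by (auto simp: less_le)
 have "\<exists>v. \<forall>ph\<in>lc_dual sc A p. has_bochner_integral lborel (\<lambda>t. ?c t*ph (f (Complex t (- 1)))) (ph v)"
 proof (rule pettis_integral_exists[OF FO_right_holo[OF f], of "{}" "c/2"])
  fix t :: real
  show "isCont (\<lambda>t. Complex t (- 1)) t" by (intro isCont_Complex continuous_intros)
  then show "isCont ?c t" by (intro continuous_intros isCont_o2[where f = "\<lambda>t. Complex t (- 1)" and g = "mu sg"] isCont_mu) auto
 next
  fix j assume j: "j \<in> A"
  obtain k where k: "k >= 1" "\<And>f j s. f \<in> FO sc A p {a..\<infinity>} ==> j \<in> A ==> Im s <= - 1 ==>
   p j (f s) <= FO_seminorm p {a..\<infinity>} k j f*exp (c/2*cmod s + b*Im s)" using FO_right_bound[OF b, of "c/2" 1] c by auto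
  have M: "0 <= FO_seminorm p {a..\<infinity>} k j f" by (rule FO_seminorm_nonneg[OF f k(1) j])
  have "0 <= c/2" using c by simp
  from mu_weight_bound[OF sg(1) order_refl this, of b "abs (Im z)" 1]
  obtain C where C: "C >= 0" "\<And>M x z' s. 0 <= M ==> x <= M*exp (c/2*cmod s + b*Im s) ==> 0 < c ==> c <= sg*Im z' ==> (abs (Im z')) <= abs (Im z) ==>
   (abs (Im s)) <= 1 ==> cmod (mu sg s*exp (\<i>*z' * s))*x <= C*M*exp (- (Re z'*Im s))*exp (- (c/2)*abs (Re s))" by blast
  have "cmod (?c t)*p j (f (Complex t (- 1))) <= 1/(2*pi)*(C*FO_seminorm p {a..\<infinity>} k j f*exp (Re z))*exp (- (c/2)*abs t)" for t
  proof -
   have "cmod (mu sg (Complex t (- 1))*exp (\<i>*z*Complex t (- 1)))*p j (f (Complex t (- 1))) <=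
     C*FO_seminorm p {a..\<infinity>} k j f*exp (- (Re z*Im (Complex t (- 1))))*exp (- (c/2)*\<bar>Re (Complex t (- 1))\<bar>)"
    by (rule C(2)[OF M k(2)[OF f j] c]) (simp_all add: c_def)
   then have "1/(2*pi)*(cmod (mu sg (Complex t (- 1))*exp (\<i>*z*Complex t (- 1)))*p j (f (Complex t (- 1)))) <=
     1/(2*pi)*(C*FO_seminorm p {a..\<infinity>} k j f*exp (Re z)*exp (- (c/2)*abs t))" by (intro mult_left_mono) auto
   moreover have "cmod (?c t) = 1/(2*pi)*cmod (mu sg (Complex t (- 1))*exp (\<i>*z*Complex t (- 1)))" by (simp add: norm_mult norm_divide)
   ultimately show ?thesis by (simp only: mult.assoc)
  qed
  then show "\<exists>B. \<forall>t. t \<notin> {} \<longrightarrow> cmod (?c t)*p j (f (Complex t (- 1))) <= B*exp (- (c/2)*abs t)" by blast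
 qed (use c in auto)
 then obtain v where v: "\<And>ph. ph \<in> lc_dual sc A p ==> has_bochner_integral lborel (\<lambda>t. ?c t*ph (f (Complex t (- 1)))) (ph v)" by blast
 have "ph v = inverse_fourier (\<lambda>s. ph (f s)) z" if ph: "ph \<in> lc_dual sc A p" for ph
 proof -
  have "ph v = (\<integral>t. 1/(2*pi)*(mu sg (Complex t (- 1))*inverse_integrand (\<lambda>s. ph (f s)) z (Complex t (- 1))) \<partial>lborel)"
   using has_bochner_integral_integral_eq[OF v[OF ph]] by (simp only: inverse_integrand_def mult_ac)
  also have "\<dots> = 1/(2*pi)*line_integral (- 1) (\<lambda>s. mu sg s*inverse_integrand (\<lambda>s. ph (f s)) z s)"
   by (simp only: integral_mult_right_zero line_integral_def)
  also have "\<dots> = inverse_fourier (\<lambda>s. ph (f s)) z"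
   by (rule inverse_fourier_mu[OF FO_right_half_plane_growth[OF f ph] a sg zero_less_one, symmetric])
  finally show ?thesis .
 qed
 then show ?thesis by blast
next
 case True
 then have za: "ereal (Re z) < a" using z by (simp add: slit_plane_def)
 then obtain b' where b': "Re z < b'" "ereal b' < a" using ereal_dense2[of "ereal (Re z)" a] by auto
 define ep where "ep = (b' - Re z)/2"
 have ep: "0 < ep" "0 <= ep" using b' by (auto simp: ep_def)
 obtain k where k: "k >= 1" "\<And>f j s. f \<in> FO sc A p {a..\<infinity>} ==> j \<in> A ==> Im s <= - 1 ==>
  p j (f s) <= FO_seminorm p {a..\<infinity>} k j f*exp (ep*cmod s + b'*Im s)" using FO_right_bound[OF b'(2) ep(1), of 1] by auto
 let ?c1 = "\<lambda>t. step_weight 1 t*exp (\<i>*z*Complex t (- 1))"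
 have "\<exists>v. \<forall>ph\<in>lc_dual sc A p. has_bochner_integral lborel (\<lambda>t. ?c1 t*ph (f (Complex t (- 1)))) (ph v)"
 proof (rule pettis_integral_exists[OF FO_right_holo[OF f], of "{0}" 1])
  show "isCont (\<lambda>t. Complex t (- 1)) t" for t by (intro isCont_Complex continuous_intros)
  then show "isCont ?c1 t" if "t \<notin> {0}" for t using that by (intro continuous_intros isCont_step_weight) auto
  fix j assume j: "j \<in> A"
  have M: "0 <= FO_seminorm p {a..\<infinity>} k j f" by (rule FO_seminorm_nonneg[OF f k(1) j])
  from step_weight_exp_bound[OF zero_less_one ep(2), of b' "abs (Im z)"]
  obtain C where C: "C >= 0" "\<And>M x z' t. 0 <= M ==> x <= M*exp (ep*cmod (Complex t (- 1)) + b'*- 1) ==> (abs (Im z')) <= abs (Im z) ==>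
   cmod (step_weight 1 t*exp (\<i>*z'*Complex t (- 1)))*x <= C*M*exp (1 * Re z')*exp (- 1*abs t)" by blast
  have "cmod (?c1 t)*p j (f (Complex t (- 1))) <= C*FO_seminorm p {a..\<infinity>} k j f*exp (1 * Re z)*exp (- 1*abs t)" for t
   using k(2)[OF f j, of "Complex t (- 1)"] by (intro C(2)[OF M]) auto
  then show "\<exists>B. \<forall>t. t \<notin> {0} \<longrightarrow> cmod (?c1 t)*p j (f (Complex t (- 1))) <= B*exp (- 1*abs t)" by blast
 qed auto
 then obtain v1 where v1: "\<And>ph. ph \<in> lc_dual sc A p ==> has_bochner_integral lborel (\<lambda>t. ?c1 t*ph (f (Complex t (- 1)))) (ph v1)" by blast
 \<comment> \<open>The absolute value keeps the points in the lower half-plane for negative t too,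
   where the indicator makes the integrand 0.\<close>
 let ?g = "\<lambda>t. Complex 0 (- 1 - abs t)"
 let ?c2 = "\<lambda>t. indicator {0<..} t *\<^sub>R (- \<i>*exp (\<i>*z*?g t))"
 have "\<exists>v. \<forall>ph\<in>lc_dual sc A p. has_bochner_integral lborel (\<lambda>t. ?c2 t*ph (f (?g t))) (ph v)"
 proof (rule pettis_integral_exists[OF FO_right_holo[OF f], of "{0}" ep])
  show g: "isCont ?g t" for t by (intro isCont_Complex continuous_intros)
  show "isCont ?c2 t" if "t \<notin> {0}" for t
  proof (rule isCont_scaleR)
   show "isCont (indicator {0<..} :: real => real) t" using that by (simp add: isCont_indicator frontier_def interior_open)
  qed (intro continuous_intros g)
  fix j assume j: "j \<in> A"
  let ?M = "FO_seminorm p {a..\<infinity>} k j f"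
  have M: "0 <= ?M" by (rule FO_seminorm_nonneg[OF f k(1) j])
  have "cmod (?c2 t)*p j (f (?g t)) <= ?M*exp (1*(ep - b'))*exp (1 * Re z)*exp (- ep*abs t)" for t
  proof (cases "t > 0")
   case True
   have "cmod (exp (\<i>*z*Complex 0 (- 1 - t)))*p j (f (Complex 0 (- 1 - t))) <=
     ?M*exp (1*(ep - b'))*exp (1 * Re z)*exp (- ((b' - Re z)/2)*t)"
    using True k(2)[OF f j, of "Complex 0 (- 1 - t)"] M ep by (intro down_ray_bound) (auto simp: ep_def)
   then show ?thesis using True by (simp add: norm_mult ep_def)
  qed (use M in simp)
  then show "\<exists>B. \<forall>t. t \<notin> {0} \<longrightarrow> cmod (?c2 t)*p j (f (?g t)) <= B*exp (- ep*abs t)" by blast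
 qed (use ep in auto)
 then obtain v2 where v2: "\<And>ph. ph \<in> lc_dual sc A p ==> has_bochner_integral lborel (\<lambda>t. ?c2 t*ph (f (?g t))) (ph v2)" by blast
 have "ph (sc (1/(2*pi)) (v1 + v2)) = inverse_fourier (\<lambda>s. ph (f s)) z" if ph: "ph \<in> lc_dual sc A p" for ph
 proof -
  have "ph v1 = step_integral 1 (\<lambda>s. ph (f s)) z"
   using has_bochner_integral_integral_eq[OF v1[OF ph]] unfolding step_integral_def inverse_integrand_def by (simp only: mult_ac)
  moreover have "?c2 t*ph (f (?g t)) =
    indicator {0<..} t *\<^sub>R (- \<i>*inverse_integrand (\<lambda>s. ph (f s)) z (Complex 0 (- 1) + - \<i> * of_real t))" for t
   unfolding down_ray_point inverse_integrand_def by (cases "t > 0") auto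
  then have "ph v2 = ray_integral (Complex 0 (- 1)) (- \<i>) (inverse_integrand (\<lambda>s. ph (f s)) z)"
   using has_bochner_integral_integral_eq[OF v2[OF ph]] unfolding ray_integral_def by (simp only:)
  ultimately have "ph (sc (1/(2*pi)) (v1 + v2)) = 1/(2*pi)*left_inverse 1 (\<lambda>s. ph (f s)) z"
   by (simp only: lc_dual_scale[OF ph] lc_dual_add[OF ph] left_inverse_def)
  also have "\<dots> = inverse_fourier (\<lambda>s. ph (f s)) z"
   by (rule inverse_fourier_left[OF FO_right_half_plane_growth[OF f ph] a zero_less_one za, symmetric])
  finally show ?thesis .
 qed
 then show ?thesis by blast
qed

definition inverse_right :: "ereal => (complex => 'a) => complex => 'a" where
 "inverse_right a f z = (if z \<in> slit_plane a
   then SOME v. \<forall>ph\<in>lc_dual sc A p. ph v = inverse_fourier (\<lambda>s. ph (f s)) z else 0)"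

lemma dual_inverse_right:
 assumes a: "a ~= -\<infinity>" and f: "f \<in> FO sc A p {a..\<infinity>}" and z: "z \<in> slit_plane a" and ph: "ph \<in> lc_dual sc A p"
 shows "ph (inverse_right a f z) = inverse_fourier (\<lambda>s. ph (f s)) z"
 using someI_ex[OF inverse_fourier_pettis[OF a f z]] z ph unfolding inverse_right_def by (simp only: if_True)

lemma inverse_right_zero: "z \<notin> slit_plane a ==> inverse_right a f z = 0" unfolding inverse_right_def by (simp only: if_False)

lemma inverse_right_bound:
 assumes b: "ereal b < a" and c: "0 < c" and ht: "0 < ht"
 obtains k C where "k >= 1" "0 <= C" "\<And>f j z. f \<in> FO sc A p {a..\<infinity>} ==> j \<in> A ==> Re z <= b \<or> c <= abs (Im z) ==> (abs (Im z)) <= Y ==>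
  p j (inverse_right a f z) <= C*FO_seminorm p {a..\<infinity>} k j f*exp (ht * Re z)"
proof -
 obtain b' where b': "b < b'" "ereal b' < a" using ereal_dense2[OF b] by auto
 define ep where "ep = min (c/2) ((b' - b)/2)"
 have ep: "0 < ep" using b' c by (simp add: ep_def)
 have ep': "ep <= c/2" "ep <= (b' - b)/2" unfolding ep_def by (rule min.cobounded1, rule min.cobounded2)
 have a: "a ~= -\<infinity>" using b by auto
 obtain k where k: "k >= 1" "\<And>f j s. f \<in> FO sc A p {a..\<infinity>} ==> j \<in> A ==> Im s <= - ht ==>
  p j (f s) <= FO_seminorm p {a..\<infinity>} k j f*exp (ep*cmod s + b'*Im s)" using FO_right_bound[OF b'(2) ep ht] by blast
 from inverse_fourier_bound[OF b'(1) b c ht a ep ep', of Y]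
 obtain C where C: "C >= 0" "\<And>M f z. 0 <= M ==> half_plane_growth a f ==> (\<And>s. Im s <= - ht ==> cmod (f s) <= M*exp (ep*cmod s + b'*Im s)) ==>
  Re z <= b \<or> c <= abs (Im z) ==> (abs (Im z)) <= Y ==> cmod (inverse_fourier f z) <= C*M*exp (ht * Re z)" by blast
 show ?thesis
 proof (rule that[OF k(1) C(1)])
  fix f j z assume f: "f \<in> FO sc A p {a..\<infinity>}" and j: "j \<in> A" and z: "Re z <= b \<or> c <= abs (Im z)" "abs (Im z) <= Y"
  have zs: "z \<in> slit_plane a" using z(1) c b by (auto simp: slit_plane_def intro: le_less_trans[of _ "ereal b"])
  show "p j (inverse_right a f z) <= C*FO_seminorm p {a..\<infinity>} k j f*exp (ht * Re z)"
  proof (rule seminorm_le_dual[OF j])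
   fix ph assume ph: "ph \<in> lc_dual sc A p" and le: "\<And>y. cmod (ph y) <= p j y"
   show "cmod (ph (inverse_right a f z)) <= C*FO_seminorm p {a..\<infinity>} k j f*exp (ht * Re z)" unfolding dual_inverse_right[OF a f zs ph]
   proof (rule C(2)[OF FO_seminorm_nonneg[OF f k(1) j] FO_right_half_plane_growth[OF f ph] _ z])
    fix s assume "Im s <= - ht"
    then show "cmod (ph (f s)) <= FO_seminorm p {a..\<infinity>} k j f*exp (ep*cmod s + b'*Im s)" by (rule order_trans[OF le k(2)[OF f j]])
   qed
  qed
 qed
qed

lemma inverse_right_holo:
 assumes a: "a ~= -\<infinity>" and f: "f \<in> FO sc A p {a..\<infinity>}"
 shows "inverse_right a f \<in> holo_space sc A p (slit_plane a)"
proof (rule weakly_holomorphic_imp_holo[OF open_slit_plane _ _ inverse_right_zero])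
 show "(\<lambda>z. ph (inverse_right a f z)) holomorphic_on slit_plane a" if ph: "ph \<in> lc_dual sc A p" for ph
  by (rule holomorphic_transform[OF inverse_fourier_holomorphic[OF FO_right_half_plane_growth[OF f ph] a]])
    (rule dual_inverse_right[OF a f _ ph, symmetric])
 fix z j assume z: "z \<in> slit_plane a" and j: "j \<in> A"
 obtain r c b where r: "0 < r" "0 < c" "ereal b < a" "\<And>w. w \<in> ball z r ==> Re w <= b \<or> c <= abs (Im w)" using slit_plane_ball[OF z a] by metis
 obtain k C where k: "k >= 1" "0 <= C" "\<And>f j w. f \<in> FO sc A p {a..\<infinity>} ==> j \<in> A ==> Re w <= b \<or> c <= abs (Im w) ==> (abs (Im w)) <= abs (Im z) + r ==>
  p j (inverse_right a f w) <= C*FO_seminorm p {a..\<infinity>} k j f*exp (1 * Re w)"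
  using inverse_right_bound[OF r(3,2) zero_less_one, of "abs (Im z) + r"] by metis
 have M: "0 <= C*FO_seminorm p {a..\<infinity>} k j f" by (intro mult_nonneg_nonneg k FO_seminorm_nonneg[OF f k(1) j])
 have "p j (inverse_right a f w) <= C*FO_seminorm p {a..\<infinity>} k j f*exp (1*(Re z + r))" if w: "w \<in> ball z r" for w
 proof -
  have i: "abs (Im w) <= abs (Im z) + r" "Re w <= Re z + r" using ball_bounds[OF w] by linarith+
  have "p j (inverse_right a f w) <= C*FO_seminorm p {a..\<infinity>} k j f*exp (1 * Re w)" by (rule k(3)[OF f j r(4)[OF w] i(1)])
  also have "\<dots> <= C*FO_seminorm p {a..\<infinity>} k j f*exp (1*(Re z + r))" using i(2) by (intro mult_left_mono[OF _ M]) simp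
  finally show ?thesis .
 qed
 with r(1) show "\<exists>r>0. \<exists>M. \<forall>w\<in>ball z r \<inter> slit_plane a. p j (inverse_right a f w) <= M" by blast
qed

lemma inverse_right_Oexp_bound:
 assumes a: "a ~= -\<infinity>" and n: "n >= 1"
 obtains k C where "k >= 1" "0 <= C" "\<And>f j z. f \<in> FO sc A p {a..\<infinity>} ==> j \<in> A ==> z \<in> S_set n {a..\<infinity>} ==>
  p j (inverse_right a f z) <= C*FO_seminorm p {a..\<infinity>} k j f*exp (1/real n*abs (Re z))"
proof -
 obtain b c where b: "ereal b < a" "0 < c" "\<And>z. z \<in> S_set n {a..\<infinity>} ==> (Re z <= b \<or> c <= abs (Im z)) \<and> abs (Im z) < real n"
  using S_set_right_subset[OF a n] by metis
 have "0 < 1/real n" using n by simp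
 from inverse_right_bound[OF b(1,2) this, of "real n"]
 obtain k C where k: "k >= 1" "0 <= C" "\<And>f j z. f \<in> FO sc A p {a..\<infinity>} ==> j \<in> A ==> Re z <= b \<or> c <= abs (Im z) ==> (abs (Im z)) <= real n ==>
  p j (inverse_right a f z) <= C*FO_seminorm p {a..\<infinity>} k j f*exp (1/real n * Re z)" by metis
 show ?thesis
 proof (rule that[OF k(1,2)])
  fix f j z assume f: "f \<in> FO sc A p {a..\<infinity>}" and j: "j \<in> A" and z: "z \<in> S_set n {a..\<infinity>}"
  have "p j (inverse_right a f z) <= C*FO_seminorm p {a..\<infinity>} k j f*exp (1/real n * Re z)" using b(3)[OF z] by (intro k(3) f j) auto
  also have "\<dots> <= C*FO_seminorm p {a..\<infinity>} k j f*exp (1/real n*abs (Re z))"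
  proof (rule mult_left_mono)
   show "exp (1/real n * Re z) <= exp (1/real n*abs (Re z))" unfolding exp_le_cancel_iff by (intro mult_left_mono) auto
  qed (intro mult_nonneg_nonneg k FO_seminorm_nonneg[OF f k(1) j])
  finally show "p j (inverse_right a f z) <= C*FO_seminorm p {a..\<infinity>} k j f*exp (1/real n*abs (Re z))" .
 qed
qed

lemma inverse_right_Oexp:
 assumes a: "a ~= -\<infinity>" and f: "f \<in> FO sc A p {a..\<infinity>}"
 shows "inverse_right a f \<in> Oexp sc A p {a..\<infinity>}"
proof (rule OexpI)
 show "inverse_right a f \<in> holo_space sc A p (- fin_part {a..\<infinity>})" unfolding compl_fin_part_right by (rule inverse_right_holo[OF a f])
 fix n :: nat and j assume "n >= 1" and j: "j \<in> A"
 from inverse_right_Oexp_bound[OF a this(1)] obtain k C where "\<And>f j z. f \<in> FO sc A p {a..\<infinity>} ==> j \<in> A ==> z \<in> S_set n {a..\<infinity>} ==>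
  p j (inverse_right a f z) <= C*FO_seminorm p {a..\<infinity>} k j f*exp (1/real n*abs (Re z))" by metis
 from this[OF f j] show "\<exists>C. \<forall>z\<in>S_set n {a..\<infinity>}. p j (inverse_right a f z) <= C*exp (1/real n*abs (Re z))" by blast
qed

lemma fourier_inverse_right:
 assumes a: "a ~= -\<infinity>" and f: "f \<in> FO sc A p {a..\<infinity>}"
 shows "fourier_right a (inverse_right a f) = f"
proof
 fix zt
 show "fourier_right a (inverse_right a f) zt = f zt"
 proof (cases "Im zt < 0")
  case False
  then show ?thesis using FO_right_holo[OF f] by (simp add: fourier_right_zero holo_space_def)
 next
  case True
  obtain b where b: "ereal b < a" using a ereal_dense2[of "-\<infinity>" a] by (auto simp: less_le)
  have av: "hairpin_avoids b 1 b 0 1" by (rule hairpin_avoids_rectangle) simp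
  show ?thesis
  proof (rule eq_if_dual_eq)
   fix ph assume ph: "ph \<in> lc_dual sc A p"
   have "ph (fourier_right a (inverse_right a f) zt) = hairpin_integral b 0 1 (fourier_integrand (\<lambda>z. ph (inverse_right a f z)) zt)"
    by (rule dual_fourier_right[OF inverse_right_Oexp[OF a f] True ph b av])
   also have "\<dots> = hairpin_integral b 0 1 (fourier_integrand (inverse_fourier (\<lambda>s. ph (f s))) zt)"
    unfolding hairpin_integral_def fourier_integrand_def dual_inverse_right[OF a f hairpin_in_slit_plane[OF av b] ph] ..
   also have "\<dots> = ph (f zt)" by (rule fourier_inverse_fourier[OF FO_right_half_plane_growth[OF f ph] b True])
   finally show "ph (fourier_right a (inverse_right a f) zt) = ph (f zt)" .
  qed
 qed
qed

end

section \<open>The kernel of the Fourier transform\<close>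

definition kernel_integrand :: "complex => complex => complex" where
 "kernel_integrand z w = gauss_kernel z w/(w - z)"

text \<open>Imaginary parts differ by at most 2, hence the constant 2^2/4 + 1 = 2 in exp 2. The
  kernel decays at rate 1 around Re z; at most half of this is spent on replacing ep*|Re w| by
  ep*|Re z|, so the integral inherits the growth rate of F.\<close>

lemma kernel_weight_bound:
 assumes w: "abs (Im w) <= 1" and z: "abs (Im z) <= 1" and r: "0 < r" "r <= cmod (w - z)"
  and ep: "0 <= ep" "ep <= 1/2" and M: "0 <= M" "0 <= x" "x <= M*exp (ep*abs (Re w))"
 shows "cmod (kernel_integrand z w)*x <= exp 2/r*M*exp (ep*abs (Re z))*exp (- (1/2)*\<bar>Re w - Re z\<bar>)"
proof -
 have "cmod (gauss_kernel z w) <= exp (2\<^sup>2/4 + 1)*exp (- \<bar>Re (w - z)\<bar>)" using w z by (intro gauss_kernel_bound) auto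
 then have "cmod (kernel_integrand z w) <= (exp 2*exp (- \<bar>Re w - Re z\<bar>))/r"
  unfolding kernel_integrand_def norm_divide using r by (intro frac_le) auto
 then have "cmod (kernel_integrand z w)*x <= ((exp 2*exp (- \<bar>Re w - Re z\<bar>))/r)*(M*exp (ep*abs (Re w)))"
  using M r by (intro mult_mono) auto
 also have "\<dots> = exp 2/r*M*(exp (- \<bar>Re w - Re z\<bar>)*exp (ep*abs (Re w)))" by simp
 also have "\<dots> <= exp 2/r*M*(exp (ep*abs (Re z))*exp (- (1/2)*\<bar>Re w - Re z\<bar>))"
 proof (rule mult_left_mono)
  have "ep*abs (Re w) <= ep*(abs (Re z) + \<bar>Re w - Re z\<bar>)" using ep by (intro mult_left_mono) auto
  moreover have "ep*\<bar>Re w - Re z\<bar> <= 1/2*\<bar>Re w - Re z\<bar>" using ep by (intro mult_right_mono) auto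
  ultimately have "- \<bar>Re w - Re z\<bar> + ep*abs (Re w) <= ep*abs (Re z) + - (1/2)*\<bar>Re w - Re z\<bar>" by (simp add: distrib_left)
  then show "exp (- \<bar>Re w - Re z\<bar>)*exp (ep*abs (Re w)) <= exp (ep*abs (Re z))*exp (- (1/2)*\<bar>Re w - Re z\<bar>)"
   unfolding mult_exp_exp exp_le_cancel_iff .
 qed (use r M in auto)
 finally show ?thesis by (simp only: mult.assoc)
qed

lemma hairpin_distance:
 assumes "b < Re z" "abs (Im z) < 1"
 shows "0 < min (Re z - b) (1 - abs (Im z))" "min (Re z - b) (1 - abs (Im z)) <= cmod (hairpin b 0 1 t - z)"
proof -
 show "0 < min (Re z - b) (1 - abs (Im z))" using assms by simp
 have "Re (hairpin b 0 1 t) <= b \<or> 1 <= \<bar>Im (hairpin b 0 1 t)\<bar>" using hairpin_avoids_rectangle[of 1 b] by (simp add: hairpin_avoids_def)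
 then show "min (Re z - b) (1 - abs (Im z)) <= cmod (hairpin b 0 1 t - z)"
  using abs_Re_le_cmod[of "hairpin b 0 1 t - z"] abs_Im_le_cmod[of "hairpin b 0 1 t - z"] by auto
qed

text \<open>The real part is b + |t| up to an error of 2, so a bump around x in the real part
  becomes one bump on each arm, at t = x - b or t = b - x. Their total mass does not depend on x,
  which is essential for bounds uniform in z.\<close>

lemma hairpin_Re_split:
 "exp (- (1/2)*\<bar>Re (hairpin b 0 c t) - x\<bar>) <= exp 1*(exp (- (1/2)*\<bar>t - (x - b)\<bar>) + exp (- (1/2)*\<bar>t - (b - x)\<bar>))"
proof -
 have "abs t - 2 <= Re (hairpin b 0 c t) - b" "Re (hairpin b 0 c t) - b <= abs t"
  using hairpin_bounds(1,3)[of 0 t b c] hairpin_bounds(3)[of 0 b c t] by auto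
 then have "\<bar>t - (x - b)\<bar> - 2 <= \<bar>Re (hairpin b 0 c t) - x\<bar> \<or> \<bar>t - (b - x)\<bar> - 2 <= \<bar>Re (hairpin b 0 c t) - x\<bar>" by linarith
 then have "exp (- (1/2)*\<bar>Re (hairpin b 0 c t) - x\<bar>) <= exp 1*exp (- (1/2)*\<bar>t - (x - b)\<bar>) \<or>
   exp (- (1/2)*\<bar>Re (hairpin b 0 c t) - x\<bar>) <= exp 1*exp (- (1/2)*\<bar>t - (b - x)\<bar>)" unfolding mult_exp_exp exp_le_cancel_iff
 proof (elim disjE)
  assume "\<bar>t - (x - b)\<bar> - 2 <= \<bar>Re (hairpin b 0 c t) - x\<bar>"
  then have "- (1/2)*\<bar>Re (hairpin b 0 c t) - x\<bar> <= 1 + - (1/2)*\<bar>t - (x - b)\<bar>" by simp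
  then show "- (1/2)*\<bar>Re (hairpin b 0 c t) - x\<bar> <= 1 + - (1/2)*\<bar>t - (x - b)\<bar> \<or>
   - (1/2)*\<bar>Re (hairpin b 0 c t) - x\<bar> <= 1 + - (1/2)*\<bar>t - (b - x)\<bar>" ..
 next
  assume "\<bar>t - (b - x)\<bar> - 2 <= \<bar>Re (hairpin b 0 c t) - x\<bar>"
  then have "- (1/2)*\<bar>Re (hairpin b 0 c t) - x\<bar> <= 1 + - (1/2)*\<bar>t - (b - x)\<bar>" by simp
  then show "- (1/2)*\<bar>Re (hairpin b 0 c t) - x\<bar> <= 1 + - (1/2)*\<bar>t - (x - b)\<bar> \<or>
   - (1/2)*\<bar>Re (hairpin b 0 c t) - x\<bar> <= 1 + - (1/2)*\<bar>t - (b - x)\<bar>" ..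
 qed
 then show ?thesis unfolding distrib_left
  using mult_pos_pos[OF exp_gt_zero exp_gt_zero, of 1 "- (1/2)*\<bar>t - (x - b)\<bar>"] mult_pos_pos[OF exp_gt_zero exp_gt_zero, of 1 "- (1/2)*\<bar>t - (b - x)\<bar>"]
  by linarith
qed

text \<open>A cruder form centred at t = 0, whose constant depends on x; it is meant for
  integrability at a fixed or locally bounded x.\<close>

lemma hairpin_Re_decay:
 "exp (- (1/2)*\<bar>Re (hairpin b 0 c t) - x\<bar>) <= exp (1 + (abs x + abs b)/2)*exp (- (1/2)*abs t)"
proof -
 have "abs t - 2 + b <= Re (hairpin b 0 c t)" using hairpin_bounds(1)[of 0 t b c] by simp
 then have "abs t - 2 - (abs x + abs b) <= \<bar>Re (hairpin b 0 c t) - x\<bar>" by linarith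
 then show ?thesis unfolding mult_exp_exp exp_le_cancel_iff by (simp add: field_simps)
qed

text \<open>The only dependence on z besides the distance r is the factor exp (ep*abs (Re z)). In
  16, the factor 2 bounds the derivative of the path and 8 is the mass of the two bumps; exp 3 is
  exp 2 from the kernel times exp 1 from the splitting.\<close>

lemma kernel_integral_bound:
 fixes F :: "complex => complex"
 assumes z: "abs (Im z) <= 1" and r: "0 < r" "\<And>t. r <= cmod (hairpin b 0 1 t - z)"
  and ep: "0 <= ep" "ep <= 1/2" and M: "0 <= M" "\<And>t. cmod (F (hairpin b 0 1 t)) <= M*exp (ep*\<bar>Re (hairpin b 0 1 t)\<bar>)"
 shows "cmod (hairpin_integral b 0 1 (\<lambda>w. F w*kernel_integrand z w)) <= 16*exp 3/r*M*exp (ep*abs (Re z))"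
proof -
 let ?D = "2*(exp 2/r*M*exp (ep*abs (Re z))*exp 1)"
 let ?g = "\<lambda>t. ?D*(exp (- (1/2)*\<bar>t - (Re z - b)\<bar>) + exp (- (1/2)*\<bar>t - (b - Re z)\<bar>))"
 have D: "0 <= ?D" using r M by simp
 have e: "has_bochner_integral lborel (\<lambda>t::real. exp (- (1/2)*\<bar>t - x\<bar>)) (2/(1/2))" for x
  using lborel_has_bochner_integral_real_affine_iff[where c = 1 and t = "- x", THEN iffD1, OF _ has_bochner_integral_exp_abs[of "1/2"]] by simp
 have g: "has_bochner_integral lborel ?g (?D*(2/(1/2) + 2/(1/2)))" by (intro has_bochner_integral_mult_right has_bochner_integral_add e)
 have "cmod (hairpin_deriv 0 1 t*(F (hairpin b 0 1 t)*kernel_integrand z (hairpin b 0 1 t))) <= ?g t" for t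
 proof -
  let ?w = "hairpin b 0 1 t"
  have "cmod (kernel_integrand z ?w)*cmod (F ?w) <= exp 2/r*M*exp (ep*abs (Re z))*exp (- (1/2)*\<bar>Re ?w - Re z\<bar>)"
   using hairpin_bounds(4)[of 0 b 1 t] by (intro kernel_weight_bound z r ep M) auto
  also have "\<dots> <= exp 2/r*M*exp (ep*abs (Re z))*(exp 1*(exp (- (1/2)*\<bar>t - (Re z - b)\<bar>) + exp (- (1/2)*\<bar>t - (b - Re z)\<bar>)))"
   using r M by (intro mult_left_mono hairpin_Re_split) auto
  finally have "cmod (hairpin_deriv 0 1 t)*(cmod (kernel_integrand z ?w)*cmod (F ?w)) <= 2 *
    (exp 2/r*M*exp (ep*abs (Re z))*(exp 1*(exp (- (1/2)*\<bar>t - (Re z - b)\<bar>) + exp (- (1/2)*\<bar>t - (b - Re z)\<bar>))))"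
   using hairpin_bounds(5)[of 0 1 t] by (intro mult_mono[OF _ _ _ mult_nonneg_nonneg]) auto
  then show ?thesis by (simp only: norm_mult mult_ac)
 qed
 note bound = this
 let ?f = "\<lambda>t. hairpin_deriv 0 1 t*(F (hairpin b 0 1 t)*kernel_integrand z (hairpin b 0 1 t))"
 have g_int: "integrable lborel ?g" using g by (simp only: has_bochner_integral_iff)
 have "cmod (integral\<^sup>L lborel ?f) <= integral\<^sup>L lborel ?g"
 proof (cases "integrable lborel ?f")
  case True
  then show ?thesis using g_int bound by (rule Bochner_Integration.integral_norm_bound_integral)
 next
  case False
  \<comment> \<open>A function that is not integrable has integral 0 by convention, so the bound
    persists.\<close>
  have "0 <= integral\<^sup>L lborel ?g" by (rule Bochner_Integration.integral_nonneg) (rule order_trans[OF norm_ge_zero bound])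
  then show ?thesis by (simp only: not_integrable_integral_eq[OF False] norm_zero)
 qed
 then have "cmod (hairpin_integral b 0 1 (\<lambda>w. F w*kernel_integrand z w)) <= integral\<^sup>L lborel ?g" by (simp only: hairpin_integral_def)
 also have "\<dots> = 16*(exp 2*exp 1)/r*M*exp (ep*abs (Re z))" unfolding has_bochner_integral_integral_eq[OF g] by simp
 also have "exp 2*exp 1 = exp (3::real)" by (simp add: mult_exp_exp)
 finally show ?thesis .
qed

lemma kernel_integral_holomorphic:
 assumes F: "slow_growth a F" and b: "ereal b < a"
 shows "(\<lambda>z. hairpin_integral b 0 1 (\<lambda>w. F w*kernel_integrand z w)) holomorphic_on {z. b < Re z \<and> abs (Im z) < 1}"
  (is "_ holomorphic_on ?D") unfolding hairpin_integral_def
proof (rule holomorphic_param_integral[where S = "{- (pi/2), pi/2}"])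
 let ?\<Gamma> = "hairpin b 0 1"
 have av: "hairpin_avoids b 1 b 0 1" by (rule hairpin_avoids_rectangle) simp
 have hol: "F holomorphic_on slit_plane a" using F by (simp add: slow_growth_def)
 have ne: "?\<Gamma> t - z ~= 0" if "z \<in> ?D" for t z using hairpin_distance(1)[of b z] hairpin_distance(2)[of b z t] that by auto
 show "open ?D" by (intro open_Collect_conj open_Collect_less continuous_intros)
 show "(\<lambda>z. hairpin_deriv 0 1 t*(F (?\<Gamma> t)*kernel_integrand z (?\<Gamma> t))) holomorphic_on ?D" for t
  unfolding kernel_integrand_def gauss_kernel_def using ne by (intro holomorphic_intros) auto
 show "isCont (\<lambda>t. hairpin_deriv 0 1 t*(F (?\<Gamma> t)*kernel_integrand z (?\<Gamma> t))) t" if "z \<in> ?D" "t \<notin> {- (pi/2), pi/2}" for z t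
 proof -
  have "isCont (\<lambda>t. F (?\<Gamma> t)) t"
   by (intro isCont_o2[where f = ?\<Gamma> and g = F] isCont_hairpin holomorphic_isCont[OF hol open_slit_plane] hairpin_in_slit_plane[OF av b])
  then show ?thesis unfolding kernel_integrand_def gauss_kernel_def
   using ne[OF that(1)] by (intro continuous_intros isCont_hairpin isCont_hairpin_deriv[OF that(2)]) auto
 qed
 fix z assume z: "z \<in> ?D"
 define r where "r = min (Re z - b) (1 - abs (Im z))/2"
 have r: "0 < r" "2*r <= Re z - b" "2*r <= 1 - abs (Im z)" using z by (auto simp: r_def)
 obtain B where B: "B >= 0" "\<And>w. Re w <= b \<or> 1 <= abs (Im w) ==> (abs (Im w)) <= 1 ==> cmod (F w) <= B*exp (1/2*abs (Re w))"
  using slow_growthD[OF F b zero_less_one, of "1/2" 1] by auto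
 let ?x = "abs (Re z) + r"
 let ?C = "2*(exp 2/r*B*exp (1/2*?x)*exp (1 + (?x + abs b)/2))"
 have "cmod (hairpin_deriv 0 1 t*(F (?\<Gamma> t)*kernel_integrand w (?\<Gamma> t))) <= ?C*exp (- (1/2)*abs t)"
  if w: "w \<in> ball z r" for w t
 proof -
  have wb: "abs (Re w) <= ?x" "r <= Re w - b" "r <= 1 - abs (Im w)" using ball_bounds[OF w] r by linarith+
  have d: "r <= cmod (?\<Gamma> t - w)" using hairpin_distance(2)[of b w t] wb r(1) by auto
  have "cmod (F (?\<Gamma> t)) <= B*exp (1/2*\<bar>Re (?\<Gamma> t)\<bar>)" using av hairpin_bounds(4)[of 0 b 1 t] by (intro B) (auto simp: hairpin_avoids_def)
  then have "cmod (kernel_integrand w (?\<Gamma> t))*cmod (F (?\<Gamma> t)) <= exp 2/r*B*exp (1/2*abs (Re w))*exp (- (1/2)*\<bar>Re (?\<Gamma> t) - Re w\<bar>)"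
   using hairpin_bounds(4)[of 0 b 1 t] wb r d B(1) by (intro kernel_weight_bound) auto
  also have "\<dots> <= exp 2/r*B*exp (1/2*?x)*(exp (1 + (?x + abs b)/2)*exp (- (1/2)*abs t))"
  proof (rule mult_mono)
   show "exp 2/r*B*exp (1/2*abs (Re w)) <= exp 2/r*B*exp (1/2*?x)" using wb r B(1) by (intro mult_left_mono) auto
   have "exp (- (1/2)*\<bar>Re (?\<Gamma> t) - Re w\<bar>) <= exp (1 + (abs (Re w) + abs b)/2)*exp (- (1/2)*abs t)" by (rule hairpin_Re_decay)
   also have "\<dots> <= exp (1 + (?x + abs b)/2)*exp (- (1/2)*abs t)" using wb(1) by (intro mult_right_mono) auto
   finally show "exp (- (1/2)*\<bar>Re (?\<Gamma> t) - Re w\<bar>) <= exp (1 + (?x + abs b)/2)*exp (- (1/2)*abs t)" .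
  qed (use r B(1) in auto)
  finally have "cmod (hairpin_deriv 0 1 t)*(cmod (kernel_integrand w (?\<Gamma> t))*cmod (F (?\<Gamma> t))) <= 2 *
    (exp 2/r*B*exp (1/2*?x)*(exp (1 + (?x + abs b)/2)*exp (- (1/2)*abs t)))"
   using hairpin_bounds(5)[of 0 1 t] by (intro mult_mono[OF _ _ _ mult_nonneg_nonneg]) auto
  then show ?thesis by (simp only: norm_mult mult_ac)
 qed
 then show "\<exists>r>0. \<exists>B. \<exists>dl>0. \<forall>w\<in>ball z r \<inter> ?D. \<forall>t. t \<notin> {- (pi/2), pi/2} \<longrightarrow>
   cmod (hairpin_deriv 0 1 t*(F (?\<Gamma> t)*kernel_integrand w (?\<Gamma> t))) <= B*exp (- dl*abs t)"
  using r(1) by (intro exI[of _ r] conjI exI[of _ ?C] exI[of _ "1/2"]) auto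
qed auto

text \<open>Real points of the slit plane are reached from above by continuity of both
  sides.\<close>

lemma kernel_representation':
 assumes F: "slow_growth a F" and b: "ereal b < a"
  and zero: "\<And>zt. Im zt < 0 ==> hairpin_integral b 0 1 (fourier_integrand F zt) = 0"
  and z: "b < Re z" "abs (Im z) < 1" "z \<in> slit_plane a"
 shows "- 1/(2*pi*\<i>)*hairpin_integral b 0 1 (\<lambda>w. F w*kernel_integrand z w) = F z"
proof -
 let ?J = "\<lambda>z. hairpin_integral b 0 1 (\<lambda>w. F w*kernel_integrand z w)"
 have *: "- 1/(2*pi*\<i>)*?J z = F z" if "b < Re z" "abs (Im z) < 1" "Im z ~= 0" for z
  using kernel_representation[OF F b zero that] by (simp add: kernel_integrand_def)
 show ?thesis
 proof (cases "Im z = 0")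
  case False
  then show ?thesis using z by (intro *) auto
 next
  case True
  let ?D = "{z. b < Re z \<and> abs (Im z) < 1}" and ?u = "\<lambda>t. z + \<i> * of_real t"
  have D: "open ?D" by (intro open_Collect_conj open_Collect_less continuous_intros)
  have hol: "F holomorphic_on slit_plane a" using F by (simp add: slow_growth_def)
  define G where "G w = - 1/(2*pi*\<i>)*?J w - F w" for w
  have "isCont G z" unfolding G_def[abs_def]
   using z holomorphic_isCont[OF kernel_integral_holomorphic[OF F b] D, of z] holomorphic_isCont[OF hol open_slit_plane z(3)]
   by (intro continuous_intros) auto
  then have "isCont (\<lambda>t. G (?u t)) 0" by (intro isCont_o2[where f = ?u and g = G and a = 0]) (auto intro!: continuous_intros)
  then have "((\<lambda>t. G (?u t)) \<longlongrightarrow> G z) (at_right 0)" unfolding isCont_def by (intro filterlim_at_split[THEN iffD1, THEN conjunct2]) simp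
  moreover have "\<forall>\<^sub>F t in at_right 0. G (?u t) = 0" unfolding eventually_at_right_field
  proof (intro exI[of _ 1] conjI allI impI)
   fix t :: real assume "0 < t" "t < 1"
   then show "G (?u t) = 0" using True z * by (simp add: G_def)
  qed simp
  then have "((\<lambda>t. G (?u t)) \<longlongrightarrow> 0) (at_right 0)" by (rule tendsto_eventually)
  ultimately have "G z = 0" by (rule tendsto_unique[OF trivial_limit_at_right_real])
  then show ?thesis by (simp add: G_def)
 qed
qed

text \<open>An entire integrand has a primitive on the whole plane, and the two ends of the path are
  joined by a vertical segment far to the right. This makes the transform well defined on
  classes.\<close>

lemma hairpin_integral_entire_vanishes:
 fixes H :: "complex => complex"
 assumes H: "H holomorphic_on UNIV" and ep: "0 < ep" "ep < - Im zt"
  and M: "0 <= M" "\<And>w. abs (Im w) <= 1 ==> cmod (H w) <= M*exp (ep*abs (Re w))"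
 shows "hairpin_integral b 0 1 (fourier_integrand H zt) = 0"
proof -
 let ?h = "fourier_integrand H zt"
 have h: "?h holomorphic_on UNIV" unfolding fourier_integrand_def[abs_def] by (intro holomorphic_intros H)
 from holomorphic_convex_primitive'[OF convex_UNIV open_UNIV this]
 obtain P where P: "\<And>w. (P has_field_derivative ?h w) (at w)" by auto
 have av: "hairpin_avoids b 1 b 0 1" by (rule hairpin_avoids_rectangle) simp
 \<comment> \<open>For a = \<infinity> the slit plane is the whole plane, so the general hairpin
   bound covers entire functions.\<close>
 have int: "integrable lborel (\<lambda>t. hairpin_deriv 0 1 t*?h (hairpin b 0 1 t))"
  by (rule fourier_hairpin_bound(2)[OF holomorphic_on_subset[OF H subset_UNIV] _ av ep order_refl M(1) M(2), of \<infinity>]) auto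
 have "((\<lambda>x. P (Complex x 1) - P (Complex x (- 1))) \<longlongrightarrow> hairpin_integral b 0 1 ?h) at_top" by (rule hairpin_integral_limit[OF P int])
 moreover have "((\<lambda>x. P (Complex x 1) - P (Complex x (- 1))) \<longlongrightarrow> 0) at_top"
 proof (rule primitive_difference_vanishes[where dl = "- Im zt - ep" and B = "M*exp (abs (Re zt))" and L = 2 and P = P and h = ?h
   and u = "\<lambda>x. Complex x 1" and v = "\<lambda>x. Complex x (- 1)"])
  fix x w assume x: "0 <= x" and "w \<in> closed_segment (Complex x 1) (Complex x (- 1))"
  then have w: "Re w = x" "abs (Im w) <= 1" using vertical_segment[of w x 1 "- 1"] by auto
  show "(P has_field_derivative ?h w) (at w)" by (rule P)
  have "Im w * Re zt <= abs (Im w)*abs (Re zt)" by (simp flip: abs_mult)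
  also have "\<dots> <= 1*abs (Re zt)" using w by (intro mult_right_mono) auto
  finally have "ep*abs (Re w) + (Re w*Im zt + Im w * Re zt) <= abs (Re zt) + - (- Im zt - ep)*x" using w x by (simp add: algebra_simps)
  then have E: "exp (ep*abs (Re w))*exp (Re w*Im zt + Im w * Re zt) <= exp (abs (Re zt))*exp (- (- Im zt - ep)*x)"
   unfolding mult_exp_exp exp_le_cancel_iff .
  have "cmod (?h w) <= (M*exp (ep*abs (Re w)))*exp (Re w*Im zt + Im w * Re zt)"
   unfolding fourier_integrand_def norm_mult cmod_exp_fourier by (intro mult_right_mono M(2) w) simp
  also have "\<dots> <= M*(exp (abs (Re zt))*exp (- (- Im zt - ep)*x))" using mult_left_mono[OF E M(1)] by (simp only: mult.assoc)
  finally show "cmod (?h w) <= M*exp (abs (Re zt))*exp (- (- Im zt - ep)*x)" by (simp only: mult.assoc)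
 next
  fix x :: real
  have "cmod (Complex x 1 - Complex x (- 1)) = 2" by (simp add: cmod_eq_Im)
  then show "cmod (Complex x 1 - Complex x (- 1)) <= 2*(1 + abs x)" by simp
 qed (use ep M in auto)
 ultimately show ?thesis by (rule tendsto_unique[OF trivial_limit_at_top_linorder])
qed

section \<open>Extension across K and the kernel of the transform\<close>

context seq_complete_lc_space
begin

lemma kernel_pettis:
 assumes F: "F \<in> Oexp sc A p {a..\<infinity>}" and b: "ereal b < a" and z: "b < Re z" "abs (Im z) < 1"
 shows "\<exists>v. \<forall>ph\<in>lc_dual sc A p. ph v = - 1/(2*pi*\<i>)*hairpin_integral b 0 1 (\<lambda>w. ph (F w)*kernel_integrand z w)"
proof -
 let ?\<Gamma> = "hairpin b 0 1" and ?S = "{- (pi/2), pi/2}"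
 let ?c = "\<lambda>t. - 1/(2*pi*\<i>)*(hairpin_deriv 0 1 t*kernel_integrand z (?\<Gamma> t))"
 have av: "hairpin_avoids b 1 b 0 1" by (rule hairpin_avoids_rectangle) simp
 define r where "r = min (Re z - b) (1 - abs (Im z))"
 have r: "0 < r" "\<And>t. r <= cmod (?\<Gamma> t - z)" using hairpin_distance[OF z] by (simp_all only: r_def)
 have ne: "?\<Gamma> t - z ~= 0" for t using r(2)[of t] r(1) by auto
 have "\<exists>v. \<forall>ph\<in>lc_dual sc A p. has_bochner_integral lborel (\<lambda>t. ?c t*ph (F (?\<Gamma> t))) (ph v)"
 proof (rule pettis_integral_exists[OF Oexp_right_holo[OF F], of ?S "1/2"])
  show "isCont ?c t" if "t \<notin> ?S" for t
   unfolding kernel_integrand_def gauss_kernel_def using ne by (intro continuous_intros isCont_hairpin isCont_hairpin_deriv[OF that]) auto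
  show "isCont ?\<Gamma> t" for t by (rule isCont_hairpin)
  show "?\<Gamma> t \<in> slit_plane a" for t by (rule hairpin_in_slit_plane[OF av b])
  fix j assume j: "j \<in> A"
  obtain n where n: "n >= 1" "\<And>F j z. F \<in> Oexp sc A p {a..\<infinity>} ==> j \<in> A ==> Re z <= b \<or> 1 <= abs (Im z) ==> (abs (Im z)) <= 1 ==>
   p j (F z) <= Oexp_seminorm p {a..\<infinity>} n j F*exp (1/2*abs (Re z))" using Oexp_right_bound[OF b zero_less_one, of "1/2" 1] by auto
  let ?M = "Oexp_seminorm p {a..\<infinity>} n j F"
  have M: "0 <= ?M" using b by (intro Oexp_seminorm_nonneg[OF F n(1) j] S_set_right_nonempty n) auto
  let ?D = "exp 2/r*?M*exp (1/2*abs (Re z))"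
  have "cmod (?c t)*p j (F (?\<Gamma> t)) <= cmod (- 1/(2*pi*\<i>))*(2*(?D*exp (1 + (abs (Re z) + abs b)/2)))*exp (- (1/2)*abs t)" for t
  proof -
   have "p j (F (?\<Gamma> t)) <= ?M*exp (1/2*\<bar>Re (?\<Gamma> t)\<bar>)" using av hairpin_bounds(4)[of 0 b 1 t] by (intro n(2) F j) (auto simp: hairpin_avoids_def)
   then have "cmod (kernel_integrand z (?\<Gamma> t))*p j (F (?\<Gamma> t)) <= ?D*exp (- (1/2)*\<bar>Re (?\<Gamma> t) - Re z\<bar>)"
    using hairpin_bounds(4)[of 0 b 1 t] z r M p_nonneg[OF j] by (intro kernel_weight_bound) auto
   also have "\<dots> <= ?D*(exp (1 + (abs (Re z) + abs b)/2)*exp (- (1/2)*abs t))" using r M by (intro mult_left_mono hairpin_Re_decay) auto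
   finally have "cmod (hairpin_deriv 0 1 t)*(cmod (kernel_integrand z (?\<Gamma> t))*p j (F (?\<Gamma> t))) <=
     2*(?D*(exp (1 + (abs (Re z) + abs b)/2)*exp (- (1/2)*abs t)))"
    using hairpin_bounds(5)[of 0 1 t] p_nonneg[OF j] by (intro mult_mono[OF _ _ _ mult_nonneg_nonneg]) auto
   then have "cmod (- 1/(2*pi*\<i>))*(cmod (hairpin_deriv 0 1 t)*(cmod (kernel_integrand z (?\<Gamma> t))*p j (F (?\<Gamma> t)))) <=
     cmod (- 1/(2*pi*\<i>))*(2*(?D*(exp (1 + (abs (Re z) + abs b)/2)*exp (- (1/2)*abs t))))" by (rule mult_left_mono) simp
   then show ?thesis by (simp only: norm_mult mult.assoc)
  qed
  then show "\<exists>B. \<forall>t. t \<notin> ?S \<longrightarrow> cmod (?c t)*p j (F (?\<Gamma> t)) <= B*exp (- (1/2)*abs t)" by blast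
 qed auto
 then obtain v where v: "\<And>ph. ph \<in> lc_dual sc A p ==> has_bochner_integral lborel (\<lambda>t. ?c t*ph (F (?\<Gamma> t))) (ph v)" by blast
 have "ph v = - 1/(2*pi*\<i>)*hairpin_integral b 0 1 (\<lambda>w. ph (F w)*kernel_integrand z w)" if ph: "ph \<in> lc_dual sc A p" for ph
 proof -
  have "?c t*ph (F (?\<Gamma> t)) = - 1/(2*pi*\<i>)*(hairpin_deriv 0 1 t*(ph (F (?\<Gamma> t))*kernel_integrand z (?\<Gamma> t)))" for t
   by (simp only: mult_ac)
  then show ?thesis using has_bochner_integral_integral_eq[OF v[OF ph]] unfolding hairpin_integral_def by (simp only: integral_mult_right_zero)
 qed
 then show ?thesis by blast
qed

lemma weakly_holomorphic_imp_Oexp_empty: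
 assumes hol: "\<And>ph. ph \<in> lc_dual sc A p ==> (\<lambda>z. ph (H z)) holomorphic_on UNIV"
  and bound: "\<And>n j. n >= 1 ==> j \<in> A ==> \<exists>C. \<forall>z. abs (Im z) <= real n \<longrightarrow> p j (H z) <= C*exp (1/real n*abs (Re z))"
 shows "H \<in> Oexp sc A p {}"
proof (rule OexpI)
 have "H \<in> holo_space sc A p UNIV"
 proof (rule weakly_holomorphic_imp_holo[OF open_UNIV hol])
  fix z j assume j: "j \<in> A"
  define n where "n = nat \<lceil>(abs (Im z)) + 1\<rceil>"
  have n: "abs (Im z) + 1 <= real n" unfolding n_def by (rule real_nat_ceiling_ge)
  then have n1: "n >= 1" by simp
  obtain C where C: "\<And>z. abs (Im z) <= real n ==> p j (H z) <= C*exp (1/real n*abs (Re z))" using bound[OF n1 j] by blast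
  have "p j (H w) <= abs C*exp (1/real n*(abs (Re z) + 1))" if w: "w \<in> ball z 1" for w
  proof -
   have i: "abs (Im w) <= real n" "abs (Re w) <= abs (Re z) + 1" using ball_bounds[OF w] n by linarith+
   have "p j (H w) <= C*exp (1/real n*abs (Re w))" by (rule C[OF i(1)])
   also have "\<dots> <= abs C*exp (1/real n*(abs (Re z) + 1))"
   proof (rule mult_mono)
    show "exp (1/real n*abs (Re w)) <= exp (1/real n*(abs (Re z) + 1))"
     unfolding exp_le_cancel_iff using i(2) by (intro mult_left_mono) auto
   qed auto
   finally show ?thesis .
  qed
  then show "\<exists>r>0. \<exists>M. \<forall>w\<in>ball z r \<inter> UNIV. p j (H w) <= M" using zero_less_one by blast
 qed auto
 then show "H \<in> holo_space sc A p (- fin_part {})" by simp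
 fix n :: nat and j assume n: "n >= 1" and j: "j \<in> A"
 obtain C where "\<And>z. abs (Im z) <= real n ==> p j (H z) <= C*exp (1/real n*abs (Re z))" using bound[OF n j] by blast
 then show "\<exists>C. \<forall>z\<in>S_set n {}. p j (H z) <= C*exp (1/real n*abs (Re z))" by (intro exI[of _ C] ballI) (simp add: S_set_empty)
qed

text \<open>The extension is F on the slit plane and the kernel integral V on K. Both agree on the
  half-strip Re z > b, |Im z| < 1 outside K, so every functional gives an entire function. Growth is
  read off from F where Re z <= b1 or |Im z| >= 1/2, and from the kernel integral elsewhere.\<close>

lemma fourier_right_zero_extends:
 assumes a: "a ~= -\<infinity>" and F: "F \<in> Oexp sc A p {a..\<infinity>}" and zero: "fourier_right a F = (\<lambda>_. 0)"
 shows "\<exists>H\<in>Oexp sc A p {}. \<forall>z\<in>slit_plane a. F z = H z"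
proof -
 obtain b1 where b1: "ereal b1 < a" using a ereal_dense2[of "-\<infinity>" a] by (auto simp: less_le)
 \<comment> \<open>The gap between b and b1 keeps the path around b at a fixed distance from the
   points with Re z > b1 and |Im z| < 1/2.\<close>
 define b where "b = b1 - 1"
 have b: "b < b1" "ereal b < a" using b1 by (auto simp: b_def intro: le_less_trans[of _ "ereal b1"])
 have av: "hairpin_avoids b 1 b 0 1" by (rule hairpin_avoids_rectangle) simp
 let ?D = "{z. b < Re z \<and> abs (Im z) < 1}"
 let ?J = "\<lambda>ph z. - 1/(2*pi*\<i>)*hairpin_integral b 0 1 (\<lambda>w. ph (F w)*kernel_integrand z w)"
 have "\<forall>z. \<exists>v. z \<in> ?D \<longrightarrow> (\<forall>ph\<in>lc_dual sc A p. ph v = ?J ph z)" using kernel_pettis[OF F b(2)] by blast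
 from choice[OF this] obtain V where V: "\<And>z ph. z \<in> ?D ==> ph \<in> lc_dual sc A p ==> ph (V z) = ?J ph z" by blast
 define H where "H z = (if z \<in> slit_plane a then F z else V z)" for z
 have H_slit: "H z = F z" if "z \<in> slit_plane a" for z using that by (simp add: H_def)
 have H_D: "ph (H z) = ?J ph z" if z: "z \<in> ?D" and ph: "ph \<in> lc_dual sc A p" for z ph
 proof (cases "z \<in> slit_plane a")
  case True
  have "?J ph z = ph (F z)"
  proof (rule kernel_representation'[OF Oexp_right_slow_growth[OF F ph] b(2) _ _ _ True])
   show "hairpin_integral b 0 1 (fourier_integrand (\<lambda>z. ph (F z)) zt) = 0" if "Im zt < 0" for zt
    using dual_fourier_right[OF F that ph b(2) av] by (simp add: zero lc_dual_zero[OF ph])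
  qed (use z in auto)
  with True show ?thesis by (simp add: H_slit)
 next
  case False
  then show ?thesis unfolding H_def using V[OF z ph] by (simp only: if_False)
 qed
 have UNIV_eq: "slit_plane a \<union> ?D = UNIV"
 proof -
  have "z \<in> ?D" if "z \<notin> slit_plane a" for z
  proof -
   have "Im z = 0" "a <= ereal (Re z)" using that by (auto simp: slit_plane_def not_less)
   moreover have "ereal b < ereal (Re z)" by (rule less_le_trans[OF b(2) \<open>a <= ereal (Re z)\<close>])
   ultimately show ?thesis by simp
  qed
  then show ?thesis by blast
 qed
 have "H \<in> Oexp sc A p {}"
 proof (rule weakly_holomorphic_imp_Oexp_empty)
  fix ph assume ph: "ph \<in> lc_dual sc A p"
  have D: "open ?D" by (intro open_Collect_conj open_Collect_less continuous_intros)
  have "(\<lambda>z. ph (H z)) holomorphic_on slit_plane a"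
   by (rule holomorphic_transform[OF dual_holomorphic[OF Oexp_right_holo[OF F] open_slit_plane ph]]) (simp add: H_slit)
  moreover have "(\<lambda>z. ph (H z)) holomorphic_on ?D"
  proof (rule holomorphic_transform)
   show "?J ph holomorphic_on ?D" by (intro holomorphic_intros kernel_integral_holomorphic[OF Oexp_right_slow_growth[OF F ph] b(2)])
  qed (rule H_D[OF _ ph, symmetric])
  ultimately have "(\<lambda>z. ph (H z)) holomorphic_on slit_plane a \<union> ?D" by (rule holomorphic_on_Un[OF _ _ open_slit_plane D])
  then show "(\<lambda>z. ph (H z)) holomorphic_on UNIV" by (simp only: UNIV_eq)
 next
  fix n :: nat and j assume n: "n >= 1" and j: "j \<in> A"
  \<comment> \<open>The bound 1/2 is what the kernel estimate tolerates, and 1/n is the growth rate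
    to be proved.\<close>
  define ep where "ep = min (1/2) (1/real n)"
  have ep: "0 < ep" "ep <= 1/2" "ep <= 1/real n" using n by (simp add: ep_def, auto simp: ep_def)
  define r where "r = min (b1 - b) (1/2)"
  have r: "0 < r" using b by (simp add: r_def)
  obtain m1 where m1: "m1 >= 1" "\<And>F j z. F \<in> Oexp sc A p {a..\<infinity>} ==> j \<in> A ==> Re z <= b1 \<or> 1/2 <= abs (Im z) ==> (abs (Im z)) <= real n ==>
   p j (F z) <= Oexp_seminorm p {a..\<infinity>} m1 j F*exp (ep*abs (Re z))" using Oexp_right_bound[OF b1 _ ep(1), of "1/2" "real n"] by auto
  obtain m2 where m2: "m2 >= 1" "\<And>F j z. F \<in> Oexp sc A p {a..\<infinity>} ==> j \<in> A ==> Re z <= b \<or> 1 <= abs (Im z) ==> (abs (Im z)) <= 1 ==>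
   p j (F z) <= Oexp_seminorm p {a..\<infinity>} m2 j F*exp (ep*abs (Re z))" using Oexp_right_bound[OF b(2) zero_less_one ep(1), of 1] by auto
  let ?M1 = "Oexp_seminorm p {a..\<infinity>} m1 j F" and ?M2 = "Oexp_seminorm p {a..\<infinity>} m2 j F"
  have M: "0 <= ?M1" "0 <= ?M2" by (intro Oexp_seminorm_nonneg[OF F _ j] S_set_right_nonempty[OF a] m1 m2)+
  let ?M2' = "cmod (- 1/(2*pi*\<i>))*(16*exp 3/r*?M2)"
  have M2': "0 <= ?M2'" using M r by simp
  have "p j (H z) <= (?M1 + ?M2')*exp (1/real n*abs (Re z))" if z: "abs (Im z) <= real n" for z
  proof -
   have "p j (H z) <= (?M1 + ?M2')*exp (ep*abs (Re z))"
   proof (cases "Re z <= b1 \<or> 1/2 <= abs (Im z)")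
    case True
    then have "z \<in> slit_plane a" using b1 by (auto simp: slit_plane_def intro: le_less_trans[of _ "ereal b1"])
    then have "p j (H z) <= ?M1*exp (ep*abs (Re z))" unfolding H_slit[OF \<open>z \<in> slit_plane a\<close>] by (intro m1(2) F j True z)
    also have "\<dots> <= (?M1 + ?M2')*exp (ep*abs (Re z))" using M2' by (intro mult_right_mono) auto
    finally show ?thesis .
   next
    case False
    then have zD: "z \<in> ?D" and z1: "b < Re z" "abs (Im z) < 1" "abs (Im z) <= 1" using b by auto
    have "p j (H z) <= ?M2'*exp (ep*abs (Re z))"
    proof (rule seminorm_le_dual[OF j])
     fix ph assume ph: "ph \<in> lc_dual sc A p" and le: "\<And>y. cmod (ph y) <= p j y"
     have "cmod (hairpin_integral b 0 1 (\<lambda>w. ph (F w)*kernel_integrand z w)) <= 16*exp 3/r*?M2*exp (ep*abs (Re z))"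
     proof (rule kernel_integral_bound[OF z1(3) r(1) _ less_imp_le[OF ep(1)] ep(2) M(2)])
      show "r <= cmod (hairpin b 0 1 t - z)" for t
       using hairpin_distance(2)[OF z1(1,2), of t] False b by (auto simp: r_def min_def split: if_splits)
      show "cmod (ph (F (hairpin b 0 1 t))) <= ?M2*exp (ep*\<bar>Re (hairpin b 0 1 t)\<bar>)" for t
       using av hairpin_bounds(4)[of 0 b 1 t] by (intro order_trans[OF le] m2(2) F j) (auto simp: hairpin_avoids_def)
     qed
     from mult_left_mono[OF this norm_ge_zero[of "- 1/(2*pi*\<i>)"]]
     show "cmod (ph (H z)) <= ?M2'*exp (ep*abs (Re z))" unfolding H_D[OF zD ph] by (simp only: norm_mult mult.assoc)
    qed
    also have "\<dots> <= (?M1 + ?M2')*exp (ep*abs (Re z))" using M by (intro mult_right_mono) auto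
    finally show ?thesis .
   qed
   also have "\<dots> <= (?M1 + ?M2')*exp (1/real n*abs (Re z))"
   proof (rule mult_left_mono)
    show "exp (ep*abs (Re z)) <= exp (1/real n*abs (Re z))" unfolding exp_le_cancel_iff using ep(3) by (intro mult_right_mono) auto
   qed (use M M2' in simp)
   finally show ?thesis .
  qed
  then show "\<exists>C. \<forall>z. abs (Im z) <= real n \<longrightarrow> p j (H z) <= C*exp (1/real n*abs (Re z))" by blast
 qed
 then show ?thesis by (rule bexI[rotated]) (simp add: H_slit)
qed

text \<open>On the path F coincides with the entire H, whose growth rate can be made smaller than
  the decay rate of the exponential.\<close>

lemma fourier_right_entire_zero:
 assumes a: "a ~= -\<infinity>" and F: "F \<in> Oexp sc A p {a..\<infinity>}" and H: "H \<in> Oexp sc A p {}" and eq: "\<And>z. z \<in> slit_plane a ==> F z = H z"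
 shows "fourier_right a F = (\<lambda>_. 0)"
proof
 fix zt
 show "fourier_right a F zt = 0"
 proof (cases "Im zt < 0")
  case True
  obtain b where b: "ereal b < a" using a ereal_dense2[of "-\<infinity>" a] by (auto simp: less_le)
  have av: "hairpin_avoids b 1 b 0 1" by (rule hairpin_avoids_rectangle) simp
  show ?thesis
  proof (rule eq_if_dual_eq)
   fix ph assume ph: "ph \<in> lc_dual sc A p"
   obtain S C where S: "finite S" "S \<subseteq> A" "0 < C" "\<And>x. cmod (ph x) <= C*(\<Sum>j\<in>S. p j x)" using lc_dual_bound[OF ph] by blast
   \<comment> \<open>With n >= 2/(- Im zt) the growth rate 1/n is below the decay rate; n >= 2 puts
     the closed strip |Im z| <= 1 into the open strip |Im z| < n.\<close>
   define n where "n = nat \<lceil>max 2 (2/- Im zt)\<rceil>"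
   have "max 2 (2/- Im zt) <= real n" unfolding n_def by (rule real_nat_ceiling_ge)
   then have n2: "2 <= real n" "2/- Im zt <= real n" by linarith+
   then have n: "n >= 1" "1/real n < - Im zt" using True by (auto simp: field_simps)
   have "H \<in> holo_space sc A p UNIV" using H by (simp add: Oexp_def)
   note hol = dual_holomorphic[OF this open_UNIV ph]
   have S_mem: "z \<in> S_set n {}" if "abs (Im z) <= 1" for z using that n2 by (simp add: S_set_empty)
   have M: "0 <= C*(\<Sum>j\<in>S. Oexp_seminorm p {} n j H)"
    using S Oexp_seminorm_nonneg[OF H n(1)] S_mem[of 0] by (intro mult_nonneg_nonneg sum_nonneg) auto
   have "ph (fourier_right a F zt) = hairpin_integral b 0 1 (fourier_integrand (\<lambda>z. ph (F z)) zt)" by (rule dual_fourier_right[OF F True ph b av])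
   also have "\<dots> = hairpin_integral b 0 1 (fourier_integrand (\<lambda>z. ph (H z)) zt)"
    unfolding hairpin_integral_def fourier_integrand_def eq[OF hairpin_in_slit_plane[OF av b]] ..
   also have "\<dots> = 0"
   proof (rule hairpin_integral_entire_vanishes[OF hol _ n(2) M])
    show "cmod (ph (H w)) <= C*(\<Sum>j\<in>S. Oexp_seminorm p {} n j H)*exp (1/real n*abs (Re w))" if "abs (Im w) <= 1" for w
     using S Oexp_seminorm_upper[OF H n(1) _ S_mem[OF that]] by (intro lc_dual_le_sum) auto
   qed (use n in simp)
   finally show "ph (fourier_right a F zt) = ph 0" by (simp add: lc_dual_zero[OF ph])
  qed
 qed (rule fourier_right_zero)
qed

end

section \<open>Maps between seminormed function spaces\<close>

text \<open>The radius d = e/(1 + sum of the constants) makes every product C*d smaller than e; the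
  1 covers the case that all constants vanish.\<close>

lemma finite_common_bound:
 fixes Q0 :: "'q set" and R :: "'r set"
 assumes Q0: "finite Q0" and ex: "\<forall>q\<in>Q0. \<exists>r\<in>R. \<exists>C\<ge>0::real. P q r C" and e: "0 < (e::real)"
 shows "\<exists>R0 d. finite R0 \<and> R0 \<subseteq> R \<and> 0 < d \<and> (\<forall>q\<in>Q0. \<exists>r\<in>R0. \<exists>C\<ge>0. P q r C \<and> C*d < e)"
proof -
 obtain r C where rC: "\<And>q. q \<in> Q0 ==> r q \<in> R \<and> 0 <= C q \<and> P q (r q) (C q)" using ex by metis
 let ?s = "\<Sum>q\<in>Q0. C q"
 have s: "0 <= ?s" using rC by (intro sum_nonneg) auto
 show ?thesis
 proof (intro exI[of _ "r ` Q0"] exI[of _ "e/(1 + ?s)"] conjI ballI)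
  show "0 < e/(1 + ?s)" using s e by simp
  fix q assume q: "q \<in> Q0"
  have "C q <= ?s" using rC Q0 q by (intro member_le_sum) auto
  then have "e*C q < e*(1 + ?s)" using e by (intro mult_strict_left_mono) auto
  then have "e*C q/(1 + ?s) < e" using s by (simp only: pos_divide_less_eq)
  then have "C q*(e/(1 + ?s)) < e" by (simp only: times_divide_eq_right mult.commute)
  then show "\<exists>r\<in>r ` Q0. \<exists>C\<ge>0. P q r C \<and> C*(e/(1 + ?s)) < e" using rC[OF q] q by blast
 qed (use Q0 rC in auto)
qed

text \<open>Openness rests on controlled preimages: \<open>L x w\<close> is mapped to w, and its
  distance to x is bounded by seminorms of w - T x. This stands in for the open mapping theorem,
  since the family of seminorms may be uncountable.\<close>

lemma seminorm_topology_continuous_open_map: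
 fixes V :: "'v::minus set" and W :: "'w::minus set"
 assumes V: "\<And>q x y z. q \<in> Q ==> x \<in> V ==> y \<in> V ==> z \<in> V ==> q (x - z) <= q (x - y) + q (y - z)"
   "\<And>q x. q \<in> Q ==> x \<in> V ==> q (x - x) = 0"
  and W: "\<And>r x y z. r \<in> R ==> x \<in> W ==> y \<in> W ==> z \<in> W ==> r (x - z) <= r (x - y) + r (y - z)"
   "\<And>r x. r \<in> R ==> x \<in> W ==> r (x - x) = 0"
  and T: "\<And>x. x \<in> V ==> T x \<in> W"
  and T_bound: "\<And>r. r \<in> R ==> \<exists>q\<in>Q. \<exists>C\<ge>0. \<forall>x\<in>V. \<forall>y\<in>V. r (T y - T x) <= C*q (y - x)"
  and L: "\<And>x w. x \<in> V ==> w \<in> W ==> L x w \<in> V \<and> T (L x w) = w"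
  and L_bound: "\<And>q. q \<in> Q ==> \<exists>r\<in>R. \<exists>C\<ge>0. \<forall>x\<in>V. \<forall>w\<in>W. q (L x w - x) <= C*r (w - T x)"
 shows "continuous_map (seminorm_topology V Q) (seminorm_topology W R) T"
  and "open_map (seminorm_topology V Q) (seminorm_topology W R) T"
proof -
 have openV: "openin (seminorm_topology V Q) U \<longleftrightarrow>
  U \<subseteq> V \<and> (\<forall>x\<in>U. \<exists>Q0 e. finite Q0 \<and> Q0 \<subseteq> Q \<and> 0 < e \<and> {y\<in>V. \<forall>q\<in>Q0. q (y - x) < e} \<subseteq> U)" for U
  by (rule openin_seminorm_topology) (erule (3) V(1), erule (1) V(2))
 have openW: "openin (seminorm_topology W R) U \<longleftrightarrow>
  U \<subseteq> W \<and> (\<forall>x\<in>U. \<exists>Q0 e. finite Q0 \<and> Q0 \<subseteq> R \<and> 0 < e \<and> {y\<in>W. \<forall>q\<in>Q0. q (y - x) < e} \<subseteq> U)" for U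
  by (rule openin_seminorm_topology) (erule (3) W(1), erule (1) W(2))
 show "continuous_map (seminorm_topology V Q) (seminorm_topology W R) T" unfolding continuous_map_def topspace_seminorm_topology
 proof (intro conjI allI impI)
  show "T \<in> V \<rightarrow> W" using T by blast
  fix U assume U: "openin (seminorm_topology W R) U"
  show "openin (seminorm_topology V Q) {x \<in> V. T x \<in> U}" unfolding openV
  proof (intro conjI ballI)
   fix x assume "x \<in> {x \<in> V. T x \<in> U}"
   then have x: "x \<in> V" "T x \<in> U" by auto
   have "\<exists>R0 e. finite R0 \<and> R0 \<subseteq> R \<and> 0 < e \<and> {y\<in>W. \<forall>q\<in>R0. q (y - T x) < e} \<subseteq> U" using U x(2) unfolding openW by (elim conjE) (rule bspec)
   then obtain R0 e where R0: "finite R0" "R0 \<subseteq> R" "0 < e" "{y\<in>W. \<forall>q\<in>R0. q (y - T x) < e} \<subseteq> U" by (elim exE conjE)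
   have ex: "\<forall>r\<in>R0. \<exists>q\<in>Q. \<exists>C\<ge>0. \<forall>x\<in>V. \<forall>y\<in>V. r (T y - T x) <= C*q (y - x)" by (intro ballI T_bound) (rule subsetD[OF R0(2)])
   obtain Q0 d where Q0: "finite Q0" "Q0 \<subseteq> Q" "0 < d"
    "\<forall>r\<in>R0. \<exists>q\<in>Q0. \<exists>C\<ge>0. (\<forall>x\<in>V. \<forall>y\<in>V. r (T y - T x) <= C*q (y - x)) \<and> C*d < e"
    using finite_common_bound[where P = "\<lambda>r q C. \<forall>x\<in>V. \<forall>y\<in>V. r (T y - T x) <= C*q (y - x)", OF R0(1) ex R0(3)] by (elim exE conjE)
   have "T y \<in> U" if y: "y \<in> V" "\<forall>q\<in>Q0. q (y - x) < d" for y
   proof -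
    have "r (T y - T x) < e" if r: "r \<in> R0" for r
    proof -
     obtain q C where q: "q \<in> Q0" "0 <= C" "\<forall>x\<in>V. \<forall>y\<in>V. r (T y - T x) <= C*q (y - x)" "C*d < e" using bspec[OF Q0(4) r] by (elim bexE exE conjE)
     have "r (T y - T x) <= C*q (y - x)" using q(3) x(1) y(1) by (elim ballE) auto
     also have "\<dots> <= C*d" using y(2) q(1,2) by (intro mult_left_mono) (auto intro: less_imp_le)
     finally show ?thesis using q(4) by simp
    qed
    then have "T y \<in> {y\<in>W. \<forall>q\<in>R0. q (y - T x) < e}" using T[OF y(1)] by simp
    then show ?thesis by (rule subsetD[OF R0(4)])
   qed
   then have "{y\<in>V. \<forall>q\<in>Q0. q (y - x) < d} \<subseteq> {x \<in> V. T x \<in> U}" by blast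
   then show "\<exists>Q0 e. finite Q0 \<and> Q0 \<subseteq> Q \<and> 0 < e \<and> {y\<in>V. \<forall>q\<in>Q0. q (y - x) < e} \<subseteq> {x \<in> V. T x \<in> U}" using Q0(1-3) by (intro exI conjI)
  qed blast
 qed
 show "open_map (seminorm_topology V Q) (seminorm_topology W R) T" unfolding open_map_def
 proof (intro allI impI)
  fix U assume U: "openin (seminorm_topology V Q) U"
  then have UV: "U \<subseteq> V" unfolding openV by (elim conjE)
  show "openin (seminorm_topology W R) (T ` U)" unfolding openW
  proof (intro conjI ballI)
   show "T ` U \<subseteq> W" using UV T by blast
   fix w0 assume "w0 \<in> T ` U"
   then obtain x where x: "x \<in> U" "w0 = T x" by blast
   have xV: "x \<in> V" using UV x(1) by (rule subsetD)
   have "\<exists>Q0 e. finite Q0 \<and> Q0 \<subseteq> Q \<and> 0 < e \<and> {y\<in>V. \<forall>q\<in>Q0. q (y - x) < e} \<subseteq> U" using U x(1) unfolding openV by (elim conjE) (rule bspec)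
   then obtain Q0 e where Q0: "finite Q0" "Q0 \<subseteq> Q" "0 < e" "{y\<in>V. \<forall>q\<in>Q0. q (y - x) < e} \<subseteq> U" by (elim exE conjE)
   have ex: "\<forall>q\<in>Q0. \<exists>r\<in>R. \<exists>C\<ge>0. \<forall>x\<in>V. \<forall>w\<in>W. q (L x w - x) <= C*r (w - T x)" by (intro ballI L_bound) (rule subsetD[OF Q0(2)])
   obtain R0 d where R0: "finite R0" "R0 \<subseteq> R" "0 < d"
    "\<forall>q\<in>Q0. \<exists>r\<in>R0. \<exists>C\<ge>0. (\<forall>x\<in>V. \<forall>w\<in>W. q (L x w - x) <= C*r (w - T x)) \<and> C*d < e"
    using finite_common_bound[where P = "\<lambda>q r C. \<forall>x\<in>V. \<forall>w\<in>W. q (L x w - x) <= C*r (w - T x)", OF Q0(1) ex Q0(3)] by (elim exE conjE)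
   have "w \<in> T ` U" if w: "w \<in> W" "\<forall>r\<in>R0. r (w - T x) < d" for w
   proof -
    have "q (L x w - x) < e" if q: "q \<in> Q0" for q
    proof -
     obtain r C where r: "r \<in> R0" "0 <= C" "\<forall>x\<in>V. \<forall>w\<in>W. q (L x w - x) <= C*r (w - T x)" "C*d < e" using bspec[OF R0(4) q] by (elim bexE exE conjE)
     have "q (L x w - x) <= C*r (w - T x)" using r(3) xV w(1) by (elim ballE) auto
     also have "\<dots> <= C*d" using w(2) r(1,2) by (intro mult_left_mono) (auto intro: less_imp_le)
     finally show ?thesis using r(4) by simp
    qed
    then have "L x w \<in> {y\<in>V. \<forall>q\<in>Q0. q (y - x) < e}" using L[OF xV w(1)] by simp
    then have "L x w \<in> U" by (rule subsetD[OF Q0(4)])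
    then show ?thesis using L[OF xV w(1)] by force
   qed
   then have "{w\<in>W. \<forall>r\<in>R0. r (w - w0) < d} \<subseteq> T ` U" unfolding x(2) by blast
   then show "\<exists>Q0 e. finite Q0 \<and> Q0 \<subseteq> R \<and> 0 < e \<and> {y\<in>W. \<forall>q\<in>Q0. q (y - w0) < e} \<subseteq> T ` U" using R0(1-3) by (intro exI conjI)
  qed
 qed
qed

section \<open>Linear structure of the function spaces\<close>

context seq_complete_lc_space
begin

lemma holo_space_add:
 assumes "f \<in> holo_space sc A p \<Omega>" "g \<in> holo_space sc A p \<Omega>"
 shows "(\<lambda>z. f z + g z) \<in> holo_space sc A p \<Omega>"
proof -
 have "\<exists>l. limitin (lc_topology A p) (\<lambda>w. sc (1/(w - z)) (f w + g w - (f z + g z))) l (at z)" if z: "z \<in> \<Omega>" for z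
 proof -
  obtain l where l: "limitin (lc_topology A p) (\<lambda>w. sc (1/(w - z)) (f w - f z)) l (at z)" using assms(1) z by (auto simp: holo_space_def)
  obtain m where m: "limitin (lc_topology A p) (\<lambda>w. sc (1/(w - z)) (g w - g z)) m (at z)" using assms(2) z by (auto simp: holo_space_def)
  have "limitin (lc_topology A p) (\<lambda>w. sc (1/(w - z)) (f w + g w - (f z + g z))) (l + m) (at z)" unfolding limitin_lc_topology
  proof
   fix j assume j: "j \<in> A"
   have "((\<lambda>w. p j (sc (1/(w - z)) (f w - f z) - l) + p j (sc (1/(w - z)) (g w - g z) - m)) \<longlongrightarrow> 0) (at z)"
    using tendsto_add[of _ 0 _ _ 0] l m j unfolding limitin_lc_topology by fastforce
   then show "((\<lambda>w. p j (sc (1/(w - z)) (f w + g w - (f z + g z)) - (l + m))) \<longlongrightarrow> 0) (at z)"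
   proof (rule Lim_null_comparison[rotated], intro always_eventually allI)
    fix w
    have "sc (1/(w - z)) (f w + g w - (f z + g z)) - (l + m) = (sc (1/(w - z)) (f w - f z) - l) + (sc (1/(w - z)) (g w - g z) - m)"
     by (simp add: scale_right_diff_distrib scale_right_distrib)
    then show "norm (p j (sc (1/(w - z)) (f w + g w - (f z + g z)) - (l + m)))
      <= p j (sc (1/(w - z)) (f w - f z) - l) + p j (sc (1/(w - z)) (g w - g z) - m)"
     using p_add[OF j] p_nonneg[OF j] by (simp only: real_norm_def abs_of_nonneg)
   qed
  qed
  then show ?thesis by blast
 qed
 then show ?thesis using assms by (simp add: holo_space_def)
qed

lemma holo_space_scale:
 assumes "f \<in> holo_space sc A p \<Omega>"
 shows "(\<lambda>z. sc c (f z)) \<in> holo_space sc A p \<Omega>"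
proof -
 have "\<exists>l. limitin (lc_topology A p) (\<lambda>w. sc (1/(w - z)) (sc c (f w) - sc c (f z))) l (at z)" if z: "z \<in> \<Omega>" for z
 proof -
  obtain l where l: "limitin (lc_topology A p) (\<lambda>w. sc (1/(w - z)) (f w - f z)) l (at z)" using assms z by (auto simp: holo_space_def)
  have "limitin (lc_topology A p) (\<lambda>w. sc (1/(w - z)) (sc c (f w) - sc c (f z))) (sc c l) (at z)" unfolding limitin_lc_topology
  proof
   fix j assume j: "j \<in> A"
   have eq: "sc (1/(w - z)) (sc c (f w) - sc c (f z)) - sc c l = sc c (sc (1/(w - z)) (f w - f z) - l)" for w
    by (simp add: scale_right_diff_distrib mult.commute)
   have "((\<lambda>w. cmod c*p j (sc (1/(w - z)) (f w - f z) - l)) \<longlongrightarrow> 0) (at z)"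
    using l j unfolding limitin_lc_topology by (intro tendsto_mult_right_zero) blast
   then show "((\<lambda>w. p j (sc (1/(w - z)) (sc c (f w) - sc c (f z)) - sc c l)) \<longlongrightarrow> 0) (at z)" unfolding eq p_scale[OF j] .
  qed
  then show ?thesis by blast
 qed
 then show ?thesis using assms by (simp add: holo_space_def)
qed

lemma holo_space_reflect:
 assumes f: "f \<in> holo_space sc A p \<Omega>" and \<Omega>: "\<And>z. z \<in> \<Omega>' \<longleftrightarrow> - z \<in> \<Omega>"
 shows "(\<lambda>z. f (- z)) \<in> holo_space sc A p \<Omega>'"
proof -
 have "\<exists>l. limitin (lc_topology A p) (\<lambda>w. sc (1/(w - z)) (f (- w) - f (- z))) l (at z)" if z: "z \<in> \<Omega>'" for z
 proof -
  obtain l where l: "limitin (lc_topology A p) (\<lambda>w. sc (1/(w - - z)) (f w - f (- z))) l (at (- z))" using f z \<Omega> by (auto simp: holo_space_def)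
  have "limitin (lc_topology A p) (\<lambda>w. sc (1/(w - z)) (f (- w) - f (- z))) (- l) (at z)" unfolding limitin_lc_topology
  proof
   fix j assume j: "j \<in> A"
   have "((\<lambda>w. p j (sc (1/(w - - z)) (f w - f (- z)) - l)) \<longlongrightarrow> 0) (at (- z))" using l j unfolding limitin_lc_topology by blast
   then have "((\<lambda>w. p j (sc (1/(- w - - z)) (f (- w) - f (- z)) - l)) \<longlongrightarrow> 0) (at z)"
    by (rule filterlim_compose) (auto simp: filterlim_at eventually_at_filter intro!: tendsto_eq_intros)
   moreover have "p j (sc (1/(- w - - z)) (f (- w) - f (- z)) - l) = p j (sc (1/(w - z)) (f (- w) - f (- z)) - - l)" for w
   proof -
    have "1/(- w - - z) = - (1/(w - z))" by (metis minus_diff_eq minus_divide_right minus_minus uminus_add_conv_diff add.commute diff_minus_eq_add)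
    then have "sc (1/(- w - - z)) (f (- w) - f (- z)) - l = - (sc (1/(w - z)) (f (- w) - f (- z)) - - l)"
     by (simp only: scale_minus_left minus_diff_eq) simp
    then show ?thesis by (simp only: p_minus[OF j])
   qed
   ultimately show "((\<lambda>w. p j (sc (1/(w - z)) (f (- w) - f (- z)) - - l)) \<longlongrightarrow> 0) (at z)" by (simp only:)
  qed
  then show ?thesis by blast
 qed
 moreover have "f (- z) = 0" if "z \<notin> \<Omega>'" for z using f \<Omega> that by (auto simp: holo_space_def)
 ultimately show ?thesis unfolding holo_space_def by blast
qed

lemma Oexp_add:
 assumes F: "F \<in> Oexp sc A p K" and G: "G \<in> Oexp sc A p K"
 shows "(\<lambda>z. F z + G z) \<in> Oexp sc A p K"
proof (rule OexpI)
 show "(\<lambda>z. F z + G z) \<in> holo_space sc A p (- fin_part K)" using F G by (intro holo_space_add) (auto simp: Oexp_def)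
 fix n :: nat and j assume n: "n >= 1" and j: "j \<in> A"
 have "p j (F z + G z) <= (Oexp_seminorm p K n j F + Oexp_seminorm p K n j G)*exp (1/real n*abs (Re z))" if "z \<in> S_set n K" for z
  using Oexp_seminorm_upper[OF F n j that] Oexp_seminorm_upper[OF G n j that] p_add[OF j, of "F z" "G z"] unfolding distrib_right by linarith
 then show "\<exists>C. \<forall>z\<in>S_set n K. p j (F z + G z) <= C*exp (1/real n*abs (Re z))" by blast
qed

lemma Oexp_scale:
 assumes F: "F \<in> Oexp sc A p K"
 shows "(\<lambda>z. sc c (F z)) \<in> Oexp sc A p K"
proof (rule OexpI)
 show "(\<lambda>z. sc c (F z)) \<in> holo_space sc A p (- fin_part K)" using F by (intro holo_space_scale) (auto simp: Oexp_def)
 fix n :: nat and j assume n: "n >= 1" and j: "j \<in> A"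
 have "p j (sc c (F z)) <= cmod c*Oexp_seminorm p K n j F*exp (1/real n*abs (Re z))" if "z \<in> S_set n K" for z
  using mult_left_mono[OF Oexp_seminorm_upper[OF F n j that], of "cmod c"] by (simp add: p_scale[OF j] mult.assoc)
 then show "\<exists>C. \<forall>z\<in>S_set n K. p j (sc c (F z)) <= C*exp (1/real n*abs (Re z))" by blast
qed

lemma FO_add:
 assumes f: "f \<in> FO sc A p K" and g: "g \<in> FO sc A p K"
 shows "(\<lambda>z. f z + g z) \<in> FO sc A p K"
proof (rule FO_I)
 show "(\<lambda>z. f z + g z) \<in> holo_space sc A p (half_plane K)" using f g by (intro holo_space_add) (auto simp: FO_def)
 fix k :: nat and j assume k: "k >= 1" and j: "j \<in> A"
 have "p j (f z + g z)*FO_weight K k z <= FO_seminorm p K k j f + FO_seminorm p K k j g" if "z \<in> FO_domain K k" for z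
  using FO_seminorm_upper[OF f k j that] FO_seminorm_upper[OF g k j that]
   mult_right_mono[OF p_add[OF j, of "f z" "g z"] less_imp_le[OF FO_weight_pos[of K k z]]] unfolding distrib_right by linarith
 then show "\<exists>C. \<forall>z\<in>FO_domain K k. p j (f z + g z)*FO_weight K k z <= C" by blast
qed

lemma FO_scale:
 assumes f: "f \<in> FO sc A p K"
 shows "(\<lambda>z. sc c (f z)) \<in> FO sc A p K"
proof (rule FO_I)
 show "(\<lambda>z. sc c (f z)) \<in> holo_space sc A p (half_plane K)" using f by (intro holo_space_scale) (auto simp: FO_def)
 fix k :: nat and j assume k: "k >= 1" and j: "j \<in> A"
 have "p j (sc c (f z))*FO_weight K k z <= cmod c*FO_seminorm p K k j f" if "z \<in> FO_domain K k" for z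
  using mult_left_mono[OF FO_seminorm_upper[OF f k j that], of "cmod c"] by (simp add: p_scale[OF j] mult.assoc)
 then show "\<exists>C. \<forall>z\<in>FO_domain K k. p j (sc c (f z))*FO_weight K k z <= C" by blast
qed

lemma minus_eq_scale: "f - g = (\<lambda>z. f z + sc (- 1) (g z))" by (simp add: fun_eq_iff)

lemma Oexp_diff: "F \<in> Oexp sc A p K ==> G \<in> Oexp sc A p K ==> F - G \<in> Oexp sc A p K" unfolding minus_eq_scale by (intro Oexp_add Oexp_scale)

lemma FO_diff: "f \<in> FO sc A p K ==> g \<in> FO sc A p K ==> f - g \<in> FO sc A p K" unfolding minus_eq_scale by (intro FO_add FO_scale)

lemma Oexp_seminorm_tri:
 assumes F: "F \<in> Oexp sc A p K" and G: "G \<in> Oexp sc A p K" and H: "H \<in> Oexp sc A p K"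
  and n: "n >= 1" and j: "j \<in> A" and S: "S_set n K ~= {}"
 shows "Oexp_seminorm p K n j (F - H) <= Oexp_seminorm p K n j (F - G) + Oexp_seminorm p K n j (G - H)"
proof (rule Oexp_seminorm_least[OF S])
 fix z assume z: "z \<in> S_set n K"
 show "p j ((F - H) z) <= (Oexp_seminorm p K n j (F - G) + Oexp_seminorm p K n j (G - H))*exp (1/real n*abs (Re z))"
  using p_tri[OF j, of "F z" "H z" "G z"] Oexp_seminorm_upper[OF Oexp_diff[OF F G] n j z] Oexp_seminorm_upper[OF Oexp_diff[OF G H] n j z]
  unfolding distrib_right minus_apply by linarith
qed

lemma Oexp_seminorm_zero: "j \<in> A ==> S_set n K ~= {} ==> Oexp_seminorm p K n j (F - F) = 0" unfolding Oexp_seminorm_def by simp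

lemma FO_seminorm_tri:
 assumes f: "f \<in> FO sc A p K" and g: "g \<in> FO sc A p K" and h: "h \<in> FO sc A p K"
  and k: "k >= 1" and j: "j \<in> A"
 shows "FO_seminorm p K k j (f - h) <= FO_seminorm p K k j (f - g) + FO_seminorm p K k j (g - h)" unfolding FO_seminorm_def[of p K k j "f - h"]
proof (rule cSUP_least[OF FO_domain_nonempty])
 fix z assume z: "z \<in> FO_domain K k"
 show "p j ((f - h) z)*FO_weight K k z <= FO_seminorm p K k j (f - g) + FO_seminorm p K k j (g - h)"
  using mult_right_mono[OF p_tri[OF j, of "f z" "h z" "g z"] less_imp_le[OF FO_weight_pos[of K k z]]]
   FO_seminorm_upper[OF FO_diff[OF f g] k j z] FO_seminorm_upper[OF FO_diff[OF g h] k j z] unfolding distrib_right minus_apply by linarith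
qed

lemma FO_seminorm_zero: "j \<in> A ==> FO_seminorm p K k j (f - f) = 0" unfolding FO_seminorm_def by (simp add: FO_domain_nonempty)

lemma has_fourier_integral_unique:
 assumes "has_fourier_integral sc A p K c F zt v" "has_fourier_integral sc A p K c F zt w"
 shows "v = w"
proof (rule eq_if_dual_eq)
 fix ph assume "ph \<in> lc_dual sc A p"
 then show "ph v = ph w" using assms unfolding has_fourier_integral_def has_pettis_path_integral_def has_pettis_integral_def
  by (blast intro: has_bochner_integral_eq)
qed

lemma has_fourier_integral_add:
 assumes "has_fourier_integral sc A p K c F zt v" "has_fourier_integral sc A p K c G zt w"
 shows "has_fourier_integral sc A p K c (\<lambda>z. F z + G z) zt (v + w)"
 using assms unfolding has_fourier_integral_def has_pettis_path_integral_def has_pettis_integral_def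
 by (auto simp: scale_right_distrib lc_dual_add intro!: has_bochner_integral_add)

lemma has_fourier_integral_scale:
 assumes "has_fourier_integral sc A p K c F zt v"
 shows "has_fourier_integral sc A p K c (\<lambda>z. sc d (F z)) zt (sc d v)"
 unfolding has_fourier_integral_def has_pettis_path_integral_def has_pettis_integral_def
proof
 fix ph assume ph: "ph \<in> lc_dual sc A p"
 let ?g = "gamma K c"
 have "has_bochner_integral lborel (\<lambda>t. d*ph (sc (vector_derivative ?g (at t)) (sc (exp (- \<i>*?g t*zt)) (F (?g t))))) (d*ph v)"
  using assms ph unfolding has_fourier_integral_def has_pettis_path_integral_def has_pettis_integral_def
  by (intro has_bochner_integral_mult_right) blast
 then show "has_bochner_integral lborel (\<lambda>t. ph (sc (vector_derivative ?g (at t)) (sc (exp (- \<i>*?g t*zt)) (sc d (F (?g t)))))) (ph (sc d v))"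
  unfolding lc_dual_scale[OF ph] by (simp only: mult_ac)
qed

end

section \<open>The isomorphism\<close>

text \<open>Collects what each kind of half-line has to supply. T is the transform on
  representatives, J a right inverse of it, and \<open>T_zero\<close> says that the kernel of T
  consists of the functions that extend across K. The indices and constants precede the functions,
  as continuity requires.\<close>

locale fourier_pair = seq_complete_lc_space sc A p
 for sc :: "complex => 'e::ab_group_add => 'e" and A :: "'i set" and p :: "'i => 'e => real" +
 fixes K :: "ereal set" and T J :: "(complex => 'e) => complex => 'e"
 assumes S_nonempty: "\<And>n. n >= 1 ==> S_set n K ~= {}"
  and T_integral: "\<And>zt. zt \<in> half_plane K ==>
   \<forall>\<^sub>F c in at_right 0. \<forall>F\<in>Oexp sc A p K. has_fourier_integral sc A p K c F zt (T F zt)"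
  and T_FO: "\<And>F. F \<in> Oexp sc A p K ==> T F \<in> FO sc A p K"
  and T_bound: "\<And>k. k >= 1 ==> \<exists>n\<ge>1. \<exists>C\<ge>0. \<forall>F\<in>Oexp sc A p K. \<forall>j\<in>A.
   FO_seminorm p K k j (T F) <= C*Oexp_seminorm p K n j F"
  and T_zero: "\<And>F. F \<in> Oexp sc A p K ==>
   T F = (\<lambda>_. 0) \<longleftrightarrow> (\<exists>H\<in>Oexp sc A p {}. \<forall>z\<in>- fin_part K. F z = H z)"
  and J_Oexp: "\<And>f. f \<in> FO sc A p K ==> J f \<in> Oexp sc A p K"
  and T_J: "\<And>f. f \<in> FO sc A p K ==> T (J f) = f"
  and J_bound: "\<And>n. n >= 1 ==> \<exists>k\<ge>1. \<exists>C\<ge>0. \<forall>f\<in>FO sc A p K. \<forall>j\<in>A.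
   Oexp_seminorm p K n j (J f) <= C*FO_seminorm p K k j f"
begin

abbreviation "\<O> \<equiv> Oexp sc A p K"

lemma T_outside: "F \<in> \<O> ==> zt \<notin> half_plane K ==> T F zt = 0" using T_FO[of F] by (simp add: FO_def holo_space_def)

text \<open>The filter of small positive c is not trivial, so two values that are both eventually
  the integral coincide.\<close>

lemma T_unique:
 assumes F: "F \<in> \<O>" and zt: "zt \<in> half_plane K" and v: "\<forall>\<^sub>F c in at_right 0. has_fourier_integral sc A p K c F zt v"
 shows "T F zt = v"
proof -
 have "\<forall>\<^sub>F c in at_right 0. has_fourier_integral sc A p K c F zt (T F zt)" using T_integral[OF zt] by eventually_elim (rule bspec[OF _ F])
 with v have "\<forall>\<^sub>F c in at_right (0::real). T F zt = v" by eventually_elim (rule has_fourier_integral_unique)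
 then show ?thesis by (simp add: eventually_False)
qed

text \<open>Linearity is derived from the uniqueness of the Fourier integrals, whose values T F is
  assumed to be.\<close>

lemma T_add:
 assumes F: "F \<in> \<O>" and G: "G \<in> \<O>"
 shows "T (\<lambda>z. F z + G z) = (\<lambda>zt. T F zt + T G zt)"
proof
 fix zt
 note FG = Oexp_add[OF F G]
 show "T (\<lambda>z. F z + G z) zt = T F zt + T G zt"
 proof (cases "zt \<in> half_plane K")
  case True
  show ?thesis
  proof (rule T_unique[OF FG True])
   show "\<forall>\<^sub>F c in at_right 0. has_fourier_integral sc A p K c (\<lambda>z. F z + G z) zt (T F zt + T G zt)"
    using T_integral[OF True] by eventually_elim (intro has_fourier_integral_add; erule bspec; fact)
  qed
 next
  case False
  then show ?thesis using T_outside[OF FG] T_outside[OF F] T_outside[OF G] by simp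
 qed
qed

lemma T_scale:
 assumes F: "F \<in> \<O>"
 shows "T (\<lambda>z. sc c (F z)) = (\<lambda>zt. sc c (T F zt))"
proof
 fix zt
 note cF = Oexp_scale[OF F, of c]
 show "T (\<lambda>z. sc c (F z)) zt = sc c (T F zt)"
 proof (cases "zt \<in> half_plane K")
  case True
  show ?thesis
  proof (rule T_unique[OF cF True])
   show "\<forall>\<^sub>F d in at_right 0. has_fourier_integral sc A p K d (\<lambda>z. sc c (F z)) zt (sc c (T F zt))"
    using T_integral[OF True] by eventually_elim (intro has_fourier_integral_scale; erule bspec; fact)
  qed
 next
  case False
  then show ?thesis using T_outside[OF cF] T_outside[OF F] by simp
 qed
qed

lemma T_diff: "F \<in> \<O> ==> G \<in> \<O> ==> T (F - G) = T F - T G" unfolding minus_eq_scale by (simp only: T_add T_scale Oexp_scale)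

text \<open>By linearity, two functions are equivalent when their difference lies in the kernel of
  T; the classes are therefore the fibres of T.\<close>

lemma bv_rel_eq: "bv_rel sc A p K = {(F, G). F \<in> \<O> \<and> G \<in> \<O> \<and> T F = T G}"
proof -
 have "(\<exists>H\<in>Oexp sc A p {}. \<forall>z\<in>- fin_part K. F z - G z = H z) \<longleftrightarrow> T F = T G" if "F \<in> \<O>" "G \<in> \<O>" for F G
 proof -
  have "(\<exists>H\<in>Oexp sc A p {}. \<forall>z\<in>- fin_part K. F z - G z = H z) \<longleftrightarrow> T (F - G) = (\<lambda>_. 0)" using T_zero[OF Oexp_diff[OF that]] by (simp only: minus_apply)
  also have "\<dots> \<longleftrightarrow> T F = T G" unfolding T_diff[OF that] by (simp add: fun_eq_iff)
  finally show ?thesis .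
 qed
 then show ?thesis unfolding bv_rel_def by blast
qed

lemma bv_class_eq: "F \<in> \<O> ==> bv_class sc A p K F = {G \<in> \<O>. T G = T F}" unfolding bv_class_def bv_rel_eq by auto

lemma bv_quotient: "\<O> // bv_rel sc A p K = bv_class sc A p K ` \<O>" by (auto simp: quotient_def bv_class_def)

lemma fourier_bv_class:
 assumes F: "F \<in> \<O>"
 shows "fourier sc A p K (bv_class sc A p K F) = T F"
proof
 fix zt
 show "fourier sc A p K (bv_class sc A p K F) zt = T F zt"
 proof (cases "zt \<in> half_plane K")
  case True
  have "(THE v. \<forall>\<^sub>F c in at_right 0. \<forall>F\<in>bv_class sc A p K F. has_fourier_integral sc A p K c F zt v) = T F zt"
  proof (rule the_equality)
   show "\<forall>\<^sub>F c in at_right 0. \<forall>G\<in>bv_class sc A p K F. has_fourier_integral sc A p K c G zt (T F zt)" using T_integral[OF True]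
   proof eventually_elim
    fix c :: real assume c: "\<forall>F\<in>\<O>. has_fourier_integral sc A p K c F zt (T F zt)"
    show "\<forall>G\<in>bv_class sc A p K F. has_fourier_integral sc A p K c G zt (T F zt)"
    proof
     fix G assume "G \<in> bv_class sc A p K F"
     then have G: "G \<in> \<O>" "T G = T F" by (auto simp: bv_class_eq[OF F])
     show "has_fourier_integral sc A p K c G zt (T F zt)" using bspec[OF c G(1)] by (simp only: G(2))
    qed
   qed
   have FF: "F \<in> bv_class sc A p K F" using F by (simp add: bv_class_eq)
   fix v assume "\<forall>\<^sub>F c in at_right 0. \<forall>G\<in>bv_class sc A p K F. has_fourier_integral sc A p K c G zt v"
   then have "\<forall>\<^sub>F c in at_right 0. has_fourier_integral sc A p K c F zt v" by eventually_elim (rule bspec[OF _ FF])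
   from T_unique[OF F True this] show "v = T F zt" ..
  qed
  with True show ?thesis by (simp only: fourier_def if_True)
 next
  case False
  then show ?thesis unfolding fourier_def using T_outside[OF F False] by (simp only: if_False)
 qed
qed

lemma bv_add_class:
 assumes F: "F \<in> \<O>" and G: "G \<in> \<O>"
 shows "bv_add sc A p K (bv_class sc A p K F) (bv_class sc A p K G) = bv_class sc A p K (\<lambda>z. F z + G z)"
proof -
 have "bv_class sc A p K (\<lambda>z. F' z + G' z) = bv_class sc A p K (\<lambda>z. F z + G z)"
  if F': "F' \<in> bv_class sc A p K F" and G': "G' \<in> bv_class sc A p K G" for F' G'
 proof -
  have f: "F' \<in> \<O>" "T F' = T F" using F' by (auto simp: bv_class_eq[OF F])
  have g: "G' \<in> \<O>" "T G' = T G" using G' by (auto simp: bv_class_eq[OF G])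
  show ?thesis unfolding bv_class_eq[OF Oexp_add[OF f(1) g(1)]] bv_class_eq[OF Oexp_add[OF F G]]
   T_add[OF f(1) g(1)] T_add[OF F G] f(2) g(2) ..
 qed
 moreover have "F \<in> bv_class sc A p K F" "G \<in> bv_class sc A p K G" using F G by (simp_all add: bv_class_eq)
 ultimately show ?thesis unfolding bv_add_def by blast
qed

lemma bv_scale_class:
 assumes F: "F \<in> \<O>"
 shows "bv_scale sc A p K c (bv_class sc A p K F) = bv_class sc A p K (\<lambda>z. sc c (F z))"
proof -
 have "bv_class sc A p K (\<lambda>z. sc c (F' z)) = bv_class sc A p K (\<lambda>z. sc c (F z))" if F': "F' \<in> bv_class sc A p K F" for F'
 proof -
  have f: "F' \<in> \<O>" "T F' = T F" using F' by (auto simp: bv_class_eq[OF F])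
  show ?thesis unfolding bv_class_eq[OF Oexp_scale[OF f(1)]] bv_class_eq[OF Oexp_scale[OF F]] T_scale[OF f(1)] T_scale[OF F] f(2) ..
 qed
 moreover have "F \<in> bv_class sc A p K F" using F by (simp add: bv_class_eq)
 ultimately show ?thesis unfolding bv_scale_def by blast
qed

text \<open>T is continuous, open and onto, the last two by means of J.\<close>

lemma T_quotient_map: "quotient_map (Oexp_topology sc A p K) (FO_topology sc A p K) T"
proof (rule continuous_open_imp_quotient_map)
 let ?Q = "{Oexp_seminorm p K n j | n j. n >= 1 \<and> j \<in> A}" and ?R = "{FO_seminorm p K k j | k j. k >= 1 \<and> j \<in> A}"
 \<comment> \<open>F is corrected by \<open>J (f - T F)\<close>, whose seminorms are controlled by
   those of f - T F.\<close>
 let ?L = "\<lambda>F f. (\<lambda>z. F z + J (f - T F) z)"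
 have L: "?L F f \<in> \<O> \<and> T (?L F f) = f \<and> ?L F f - F = J (f - T F)" if F: "F \<in> \<O>" and f: "f \<in> FO sc A p K" for F f
 proof -
  have d: "f - T F \<in> FO sc A p K" by (rule FO_diff[OF f T_FO[OF F]])
  show ?thesis using Oexp_add[OF F J_Oexp[OF d]] by (simp add: T_add[OF F J_Oexp[OF d]] T_J[OF d] fun_eq_iff)
 qed
 have V: "q (x - z) <= q (x - y) + q (y - z)" if qQ: "q \<in> ?Q" and xyz: "x \<in> \<O>" "y \<in> \<O>" "z \<in> \<O>" for q x y z
 proof -
  obtain n j where q: "q = Oexp_seminorm p K n j" "n >= 1" "j \<in> A" using qQ by blast
  show ?thesis unfolding q(1) by (rule Oexp_seminorm_tri[OF xyz q(2,3) S_nonempty[OF q(2)]])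
 qed
 have V0: "q (x - x) = 0" if qQ: "q \<in> ?Q" and "x \<in> \<O>" for q x
 proof -
  obtain n j where q: "q = Oexp_seminorm p K n j" "n >= 1" "j \<in> A" using qQ by blast
  show ?thesis unfolding q(1) by (rule Oexp_seminorm_zero[OF q(3) S_nonempty[OF q(2)]])
 qed
 have W: "r (x - z) <= r (x - y) + r (y - z)" if rR: "r \<in> ?R" and xyz: "x \<in> FO sc A p K" "y \<in> FO sc A p K" "z \<in> FO sc A p K" for r x y z
 proof -
  obtain k j where r: "r = FO_seminorm p K k j" "k >= 1" "j \<in> A" using rR by blast
  show ?thesis unfolding r(1) by (rule FO_seminorm_tri[OF xyz r(2,3)])
 qed
 have W0: "r (x - x) = 0" if rR: "r \<in> ?R" and "x \<in> FO sc A p K" for r x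
 proof -
  obtain k j where r: "r = FO_seminorm p K k j" "k >= 1" "j \<in> A" using rR by blast
  show ?thesis unfolding r(1) by (rule FO_seminorm_zero[OF r(3)])
 qed
 have TB: "\<exists>q\<in>?Q. \<exists>C\<ge>0. \<forall>x\<in>\<O>. \<forall>y\<in>\<O>. r (T y - T x) <= C*q (y - x)" if rR: "r \<in> ?R" for r
 proof -
  obtain k j where r: "r = FO_seminorm p K k j" "k >= 1" "j \<in> A" using rR by blast
  obtain n C where n: "n >= 1" "C >= 0" "\<forall>F\<in>\<O>. \<forall>j\<in>A. FO_seminorm p K k j (T F) <= C*Oexp_seminorm p K n j F"
   using T_bound[OF r(2)] by (elim exE conjE)
  show ?thesis
  proof (intro bexI[of _ "Oexp_seminorm p K n j"] exI[of _ C] conjI ballI)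
   fix x y assume xy: "x \<in> \<O>" "y \<in> \<O>"
   show "r (T y - T x) <= C*Oexp_seminorm p K n j (y - x)"
    unfolding r(1) T_diff[OF xy(2,1), symmetric] using bspec[OF bspec[OF n(3) Oexp_diff[OF xy(2,1)]] r(3)] .
  next
   show "Oexp_seminorm p K n j \<in> ?Q" using n(1) r(3) by blast
  qed (rule n(2))
 qed
 have LB: "\<exists>r\<in>?R. \<exists>C\<ge>0. \<forall>x\<in>\<O>. \<forall>w\<in>FO sc A p K. q (?L x w - x) <= C*r (w - T x)" if qQ: "q \<in> ?Q" for q
 proof -
  obtain n j where q: "q = Oexp_seminorm p K n j" "n >= 1" "j \<in> A" using qQ by blast
  obtain k C where k: "k >= 1" "C >= 0" "\<forall>f\<in>FO sc A p K. \<forall>j\<in>A. Oexp_seminorm p K n j (J f) <= C*FO_seminorm p K k j f"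
   using J_bound[OF q(2)] by (elim exE conjE)
  show ?thesis
  proof (intro bexI[of _ "FO_seminorm p K k j"] exI[of _ C] conjI ballI)
   fix x w assume x: "x \<in> \<O>" and w: "w \<in> FO sc A p K"
   show "q (?L x w - x) <= C*FO_seminorm p K k j (w - T x)"
    unfolding q(1) L[OF x w, THEN conjunct2, THEN conjunct2] using bspec[OF bspec[OF k(3) FO_diff[OF w T_FO[OF x]]] q(3)] .
  next
   show "FO_seminorm p K k j \<in> ?R" using k(1) q(3) by blast
  qed (rule k(2))
 qed
 have L': "?L x w \<in> \<O> \<and> T (?L x w) = w" if "x \<in> \<O>" "w \<in> FO sc A p K" for x w using L[OF that] by blast
 have "continuous_map (seminorm_topology \<O> ?Q) (seminorm_topology (FO sc A p K) ?R) T"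
  and "open_map (seminorm_topology \<O> ?Q) (seminorm_topology (FO sc A p K) ?R) T" by (rule seminorm_topology_continuous_open_map[where L = ?L];
    (erule (3) V | erule (1) V0 | erule (3) W | erule (1) W0 | erule T_FO | erule TB | erule (1) L' | erule LB))+
 then show "continuous_map (Oexp_topology sc A p K) (FO_topology sc A p K) T"
  and "open_map (Oexp_topology sc A p K) (FO_topology sc A p K) T" by (simp_all only: Oexp_topology_def FO_topology_def)
 have "T ` \<O> = FO sc A p K"
 proof
  show "T ` \<O> \<subseteq> FO sc A p K" using T_FO by blast
  show "FO sc A p K \<subseteq> T ` \<O>"
  proof
   fix f assume f: "f \<in> FO sc A p K"
   show "f \<in> T ` \<O>" using T_J[OF f] J_Oexp[OF f] by (rule image_eqI[OF sym])
  qed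
 qed
 then show "T ` topspace (Oexp_topology sc A p K) = topspace (FO_topology sc A p K)"
  by (simp only: Oexp_topology_def FO_topology_def topspace_seminorm_topology)
qed

text \<open>T is the composition of the class map with the transform on classes. As T and the class
  map are quotient maps, so is the transform on classes, and it is injective because the classes are
  the fibres of T.\<close>

lemma fourier_homeomorphic_map:
 "homeomorphic_map (bv_topology sc A p K) (FO_topology sc A p K) (fourier sc A p K)" unfolding homeomorphic_map_def
proof
 have top: "topspace (Oexp_topology sc A p K) = \<O>" by (simp add: Oexp_topology_def)
 have "quotient_map (Oexp_topology sc A p K) (FO_topology sc A p K) (fourier sc A p K \<circ> bv_class sc A p K)"
  by (rule quotient_map_eq[OF T_quotient_map]) (simp only: top o_apply fourier_bv_class)
 then show "quotient_map (bv_topology sc A p K) (FO_topology sc A p K) (fourier sc A p K)"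
  unfolding bv_topology_def by (simp only: quotient_map_compose_eq[OF quotient_map_quotient_topology])
 show "inj_on (fourier sc A p K) (topspace (bv_topology sc A p K))" unfolding topspace_bv_topology bv_quotient
 proof (rule inj_onI, elim imageE)
  fix X Y F G assume *: "fourier sc A p K X = fourier sc A p K Y" "X = bv_class sc A p K F" "F \<in> \<O>" "Y = bv_class sc A p K G" "G \<in> \<O>"
  then have "T F = T G" by (simp only: fourier_bv_class)
  then show "X = Y" unfolding *(2,4) bv_class_eq[OF *(3)] bv_class_eq[OF *(5)] by (simp only:)
 qed
qed

theorem fourier_isomorphism:
 "(\<forall>zt\<in>half_plane K. \<forall>\<^sub>F c in at_right 0. \<forall>F\<in>\<O>.
   has_fourier_integral sc A p K c F zt (fourier sc A p K (bv_class sc A p K F) zt))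
  \<and> bv_FO_topological_isomorphism sc A p K (fourier sc A p K)"
proof
 show "\<forall>zt\<in>half_plane K. \<forall>\<^sub>F c in at_right 0. \<forall>F\<in>\<O>.
   has_fourier_integral sc A p K c F zt (fourier sc A p K (bv_class sc A p K F) zt)"
 proof
  fix zt assume "zt \<in> half_plane K"
  from T_integral[OF this] show "\<forall>\<^sub>F c in at_right 0. \<forall>F\<in>\<O>. has_fourier_integral sc A p K c F zt (fourier sc A p K (bv_class sc A p K F) zt)"
   by eventually_elim (simp add: fourier_bv_class)
 qed
 have add: "fourier sc A p K (bv_add sc A p K X Y) = (\<lambda>zt. fourier sc A p K X zt + fourier sc A p K Y zt)"
  if XY: "X \<in> \<O> // bv_rel sc A p K" "Y \<in> \<O> // bv_rel sc A p K" for X Y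
 proof -
  obtain F G where F: "F \<in> \<O>" "X = bv_class sc A p K F" and G: "G \<in> \<O>" "Y = bv_class sc A p K G" using XY unfolding bv_quotient by blast
  show ?thesis unfolding F(2) G(2) bv_add_class[OF F(1) G(1)] fourier_bv_class[OF Oexp_add[OF F(1) G(1)]]
   fourier_bv_class[OF F(1)] fourier_bv_class[OF G(1)] by (rule T_add[OF F(1) G(1)])
 qed
 have scale: "fourier sc A p K (bv_scale sc A p K c X) = (\<lambda>zt. sc c (fourier sc A p K X zt))"
  if X: "X \<in> \<O> // bv_rel sc A p K" for c X
 proof -
  obtain F where F: "F \<in> \<O>" "X = bv_class sc A p K F" using X unfolding bv_quotient by blast
  show ?thesis unfolding F(2) bv_scale_class[OF F(1)] fourier_bv_class[OF Oexp_scale[OF F(1)]] fourier_bv_class[OF F(1)] by (rule T_scale[OF F(1)])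
 qed
 show "bv_FO_topological_isomorphism sc A p K (fourier sc A p K)"
  unfolding bv_FO_topological_isomorphism_def using add scale fourier_homeomorphic_map by blast
qed

end

lemma (in seq_complete_lc_space) fourier_pair_right:
 assumes a: "a ~= -\<infinity>"
 shows "fourier_pair sc A p {a..\<infinity>} (fourier_right a) (inverse_right a)"
proof unfold_locales
 show "S_set n {a..\<infinity>} ~= {}" if "n >= 1" for n by (rule S_set_right_nonempty[OF a that])
 show "\<forall>\<^sub>F c in at_right 0. \<forall>F\<in>Oexp sc A p {a..\<infinity>}. has_fourier_integral sc A p {a..\<infinity>} c F zt (fourier_right a F zt)"
  if "zt \<in> half_plane {a..\<infinity>}" for zt using that unfolding half_plane_right by (intro has_fourier_integral_right[OF a]) simp
 show "fourier_right a F \<in> FO sc A p {a..\<infinity>}" if "F \<in> Oexp sc A p {a..\<infinity>}" for F by (rule fourier_right_FO[OF a that])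
 show "\<exists>n\<ge>1. \<exists>C\<ge>0. \<forall>F\<in>Oexp sc A p {a..\<infinity>}. \<forall>j\<in>A. FO_seminorm p {a..\<infinity>} k j (fourier_right a F) <= C*Oexp_seminorm p {a..\<infinity>} n j F"
  if k: "k >= 1" for k
 proof -
  obtain n C where n: "n >= 1" "0 <= C" "\<And>F j z. F \<in> Oexp sc A p {a..\<infinity>} ==> j \<in> A ==> z \<in> FO_domain {a..\<infinity>} k ==>
   p j (fourier_right a F z)*FO_weight {a..\<infinity>} k z <= C*Oexp_seminorm p {a..\<infinity>} n j F" using fourier_right_FO_bound[OF a k] by metis
  show ?thesis
  proof (intro exI[of _ n] exI[of _ C] conjI ballI n)
   fix F j assume "F \<in> Oexp sc A p {a..\<infinity>}" "j \<in> A"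
   then show "FO_seminorm p {a..\<infinity>} k j (fourier_right a F) <= C*Oexp_seminorm p {a..\<infinity>} n j F"
    unfolding FO_seminorm_def by (intro cSUP_least[OF FO_domain_nonempty] n(3))
  qed
 qed
 show "fourier_right a F = (\<lambda>_. 0) \<longleftrightarrow> (\<exists>H\<in>Oexp sc A p {}. \<forall>z\<in>- fin_part {a..\<infinity>}. F z = H z)" if F: "F \<in> Oexp sc A p {a..\<infinity>}" for F
  unfolding compl_fin_part_right
 proof
  show "\<exists>H\<in>Oexp sc A p {}. \<forall>z\<in>slit_plane a. F z = H z" if "fourier_right a F = (\<lambda>_. 0)" by (rule fourier_right_zero_extends[OF a F that])
  assume "\<exists>H\<in>Oexp sc A p {}. \<forall>z\<in>slit_plane a. F z = H z"
  then obtain H where H: "H \<in> Oexp sc A p {}" "\<forall>z\<in>slit_plane a. F z = H z" by (elim bexE)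
  show "fourier_right a F = (\<lambda>_. 0)" by (rule fourier_right_entire_zero[OF a F H(1) bspec[OF H(2)]])
 qed
 show "inverse_right a f \<in> Oexp sc A p {a..\<infinity>}" "fourier_right a (inverse_right a f) = f" if "f \<in> FO sc A p {a..\<infinity>}" for f
  by (rule inverse_right_Oexp[OF a that], rule fourier_inverse_right[OF a that])
 show "\<exists>k\<ge>1. \<exists>C\<ge>0. \<forall>f\<in>FO sc A p {a..\<infinity>}. \<forall>j\<in>A. Oexp_seminorm p {a..\<infinity>} n j (inverse_right a f) <= C*FO_seminorm p {a..\<infinity>} k j f"
  if n: "n >= 1" for n
 proof -
  obtain k C where k: "k >= 1" "0 <= C" "\<And>f j z. f \<in> FO sc A p {a..\<infinity>} ==> j \<in> A ==> z \<in> S_set n {a..\<infinity>} ==>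
   p j (inverse_right a f z) <= C*FO_seminorm p {a..\<infinity>} k j f*exp (1/real n*abs (Re z))" using inverse_right_Oexp_bound[OF a n] by metis
  show ?thesis
  proof (intro exI[of _ k] exI[of _ C] conjI ballI k)
   fix f j assume "f \<in> FO sc A p {a..\<infinity>}" "j \<in> A"
   then show "Oexp_seminorm p {a..\<infinity>} n j (inverse_right a f) <= C*FO_seminorm p {a..\<infinity>} k j f"
    by (intro Oexp_seminorm_least[OF S_set_right_nonempty[OF a n]] k(3))
  qed
 qed
qed

section \<open>Reflection\<close>

lemma eq_uminus_imageI:
 fixes X X' :: "complex set"
 assumes "\<And>z. z \<in> X' \<longleftrightarrow> - z \<in> X"
 shows "X' = uminus ` X"
proof (rule set_eqI)
 fix z
 have "z \<in> uminus ` X \<longleftrightarrow> - z \<in> X" by (metis image_iff minus_minus)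
 with assms show "z \<in> X' \<longleftrightarrow> z \<in> uminus ` X" by blast
qed

lemma fin_part_iff: "z \<in> fin_part K \<longleftrightarrow> Im z = 0 \<and> ereal (Re z) \<in> K"
proof
 assume "Im z = 0 \<and> ereal (Re z) \<in> K"
 then have "z = complex_of_real (Re z)" "ereal (Re z) \<in> K" by (simp_all add: complex_eq_iff)
 then show "z \<in> fin_part K" unfolding fin_part_def by blast
qed (auto simp: fin_part_def)

lemma fin_part_reflect: "fin_part {-\<infinity>..a} = uminus ` fin_part {- a..\<infinity>}"
proof -
 have "ereal (Re z) <= a \<longleftrightarrow> - a <= ereal (- Re z)" for z by (cases a) auto
 then have "z \<in> fin_part {-\<infinity>..a} \<longleftrightarrow> - z \<in> fin_part {- a..\<infinity>}" for z by (simp add: fin_part_iff)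
 then show ?thesis by (rule eq_uminus_imageI)
qed

lemma edist_uminus: "edist z (uminus ` M) = edist (- z) M"
proof -
 have "cmod (z - - w) = cmod (- z - w)" for w by (metis minus_diff_commute norm_minus_cancel minus_diff_eq diff_minus_eq_add add.commute)
 then show ?thesis unfolding edist_def image_image by (simp only:)
qed

lemma U_nbhd_reflect:
 assumes "a ~= \<infinity>"
 shows "U_nbhd c {-\<infinity>..a} = uminus ` U_nbhd c {- a..\<infinity>}"
proof -
 have inf: "\<infinity> \<notin> {-\<infinity>..a}" "-\<infinity> \<notin> {- a..\<infinity>}" "-\<infinity> \<in> {-\<infinity>..a}" "\<infinity> \<in> {- a..\<infinity>}" using assms by (cases a; simp)+
 have "z \<in> U_nbhd c {-\<infinity>..a} \<longleftrightarrow> - z \<in> U_nbhd c {- a..\<infinity>}" for z unfolding U_nbhd_def fin_part_reflect edist_uminus using inf by auto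
 then show ?thesis by (rule eq_uminus_imageI)
qed

lemma S_set_reflect:
 assumes "a ~= \<infinity>"
 shows "S_set n {-\<infinity>..a} = uminus ` S_set n {- a..\<infinity>}"
proof -
 let ?U = "U_nbhd (1/real n) {- a..\<infinity>}"
 have "closure (uminus ` ?U) = uminus ` closure ?U" using closure_scaleR[of "- 1" ?U] by simp
 then have "z \<in> closure (U_nbhd (1/real n) {-\<infinity>..a}) \<longleftrightarrow> - z \<in> closure ?U" for z unfolding U_nbhd_reflect[OF assms] by (force simp: image_iff)
 then have "z \<in> S_set n {-\<infinity>..a} \<longleftrightarrow> - z \<in> S_set n {- a..\<infinity>}" for z by (simp add: S_set_def)
 then show ?thesis by (rule eq_uminus_imageI)
qed

lemma Sup_left: "Sup {-\<infinity>..a::ereal} = a" by (rule Sup_eqI) auto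

lemma half_plane_reflect: "a ~= \<infinity> ==> half_plane {-\<infinity>..a} = uminus ` half_plane {- a..\<infinity>}" by (rule eq_uminus_imageI) (auto simp: half_plane_def)

lemma FO_domain_reflect: "a ~= \<infinity> ==> FO_domain {-\<infinity>..a} k = uminus ` FO_domain {- a..\<infinity>} k" by (rule eq_uminus_imageI) (auto simp: FO_domain_def)

lemma FO_weight_reflect:
 assumes "a ~= \<infinity>"
 shows "FO_weight {-\<infinity>..a} k (- z) = FO_weight {- a..\<infinity>} k z"
proof -
 have "\<infinity> \<notin> {-\<infinity>..a}" "\<infinity> \<in> {- a..\<infinity>}" using assms by auto
 moreover have "- (if a = -\<infinity> then - real k else real_of_ereal a) = (if - a = \<infinity> then real k else real_of_ereal (- a))" by (cases a) auto
 ultimately show ?thesis unfolding FO_weight_def Sup_left Inf_right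
  by (simp only: if_True if_False norm_minus_cancel uminus_complex.sel abs_minus_cancel diff_conv_add_uminus mult_minus_left[symmetric])
qed

lemma gamma_reflect:
 assumes "a ~= \<infinity>"
 shows "gamma {-\<infinity>..a} c = (\<lambda>t. - gamma {- a..\<infinity>} c t)"
proof -
 have "\<infinity> \<notin> {-\<infinity>..a}" "\<infinity> \<in> {- a..\<infinity>}" using assms by auto
 then show ?thesis unfolding gamma_def Sup_left Inf_right by (simp only: if_True if_False)
qed

context seq_complete_lc_space
begin

lemma Oexp_reflect:
 assumes F: "F \<in> Oexp sc A p K" and fin: "fin_part K' = uminus ` fin_part K" and S: "\<And>n. S_set n K' = uminus ` S_set n K"
 shows "(\<lambda>z. F (- z)) \<in> Oexp sc A p K'"
  and "Oexp_seminorm p K' n j (\<lambda>z. F (- z)) = Oexp_seminorm p K n j F"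
proof -
 have eq: "(\<lambda>z. p j (F (- z))*exp (- (1/real n)*abs (Re z))) ` S_set n K' = (\<lambda>z. p j (F z)*exp (- (1/real n)*abs (Re z))) ` S_set n K" for n j
  unfolding S image_image by simp
 have "(\<lambda>z. F (- z)) \<in> holo_space sc A p (- fin_part K')"
 proof (rule holo_space_reflect)
  show "F \<in> holo_space sc A p (- fin_part K)" using F by (simp add: Oexp_def)
  show "z \<in> - fin_part K' \<longleftrightarrow> - z \<in> - fin_part K" for z unfolding fin by (force simp: image_iff)
 qed
 with F show "(\<lambda>z. F (- z)) \<in> Oexp sc A p K'" unfolding Oexp_def mem_Collect_eq eq by (elim conjE) (intro conjI)
 show "Oexp_seminorm p K' n j (\<lambda>z. F (- z)) = Oexp_seminorm p K n j F" unfolding Oexp_seminorm_def eq ..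
qed

text \<open>The minus sign is that of dz under z to -z: the transform of F at zt is minus the
  transform of the reflected function at -zt.\<close>

lemma FO_reflect:
 assumes f: "f \<in> FO sc A p K" and half: "half_plane K' = uminus ` half_plane K"
  and dom: "\<And>k. FO_domain K' k = uminus ` FO_domain K k" and weight: "\<And>k z. FO_weight K' k (- z) = FO_weight K k z"
 shows "(\<lambda>z. - f (- z)) \<in> FO sc A p K'"
  and "j \<in> A ==> FO_seminorm p K' k j (\<lambda>z. - f (- z)) = FO_seminorm p K k j f"
proof -
 have eq: "(\<lambda>z. p j (- f (- z))*FO_weight K' k z) ` FO_domain K' k = (\<lambda>z. p j (f z)*FO_weight K k z) ` FO_domain K k" if "j \<in> A" for k j
  unfolding dom image_image by (simp add: weight p_minus[OF that])
 have "(\<lambda>z. f (- z)) \<in> holo_space sc A p (half_plane K')"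
 proof (rule holo_space_reflect)
  show "f \<in> holo_space sc A p (half_plane K)" using f by (simp add: FO_def)
  show "z \<in> half_plane K' \<longleftrightarrow> - z \<in> half_plane K" for z unfolding half by (force simp: image_iff)
 qed
 from holo_space_scale[OF this, of "- 1"] have "(\<lambda>z. - f (- z)) \<in> holo_space sc A p (half_plane K')" by simp
 with f show "(\<lambda>z. - f (- z)) \<in> FO sc A p K'" unfolding FO_def by (simp add: eq)
 show "FO_seminorm p K' k j (\<lambda>z. - f (- z)) = FO_seminorm p K k j f" if "j \<in> A" unfolding FO_seminorm_def eq[OF that] ..
qed

text \<open>The product of point and frequency in the exponent is unchanged, whereas the derivative
  of the path changes sign. The hairpin form of the path is used to know its derivative away from
  the corners.\<close>

lemma has_fourier_integral_reflect:
 assumes v: "has_fourier_integral sc A p K c (\<lambda>z. F (- z)) (- zt) v"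
  and g: "gamma K c = hairpin l kp c" "gamma K' c = (\<lambda>t. - gamma K c t)"
 shows "has_fourier_integral sc A p K' c F zt (- v)" unfolding has_fourier_integral_def has_pettis_path_integral_def has_pettis_integral_def g
proof
 let ?h = "hairpin l kp c"
 fix ph assume ph: "ph \<in> lc_dual sc A p"
 have m: "ph (- x) = - ph x" for x using lc_dual_diff[OF ph, of 0 x] lc_dual_zero[OF ph] by simp
 have "has_bochner_integral lborel (\<lambda>t. - ph (sc (vector_derivative ?h (at t)) (sc (exp (- \<i>*?h t*- zt)) (F (- ?h t))))) (- ph v)"
  using v ph unfolding has_fourier_integral_def has_pettis_path_integral_def has_pettis_integral_def g by (intro has_bochner_integral_minus) blast
 then have "has_bochner_integral lborel (\<lambda>t. - ph (sc (vector_derivative ?h (at t)) (sc (exp (- \<i>*?h t*- zt)) (F (- ?h t))))) (ph (- v))"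
  by (simp only: m)
 then show "has_bochner_integral lborel (\<lambda>t. ph (sc (vector_derivative (\<lambda>t. - ?h t) (at t)) (sc (exp (- \<i>*- ?h t*zt)) (F (- ?h t))))) (ph (- v))"
 proof (rule has_bochner_integral_discrete_difference[where X = "{- (pi/2), pi/2}", THEN iffD1, rotated -1])
  fix t assume t: "t \<notin> {- (pi/2), pi/2}"
  have d: "vector_derivative (\<lambda>t. - ?h t) (at t) = - vector_derivative ?h (at t)"
   unfolding vector_derivative_at[OF hairpin_has_deriv[OF t]] by (rule vector_derivative_at[OF has_vector_derivative_minus[OF hairpin_has_deriv[OF t]]])
  show "- ph (sc (vector_derivative ?h (at t)) (sc (exp (- \<i>*?h t*- zt)) (F (- ?h t)))) =
    ph (sc (vector_derivative (\<lambda>t. - ?h t) (at t)) (sc (exp (- \<i>*- ?h t*zt)) (F (- ?h t))))"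
   unfolding d by (simp add: lc_dual_scale[OF ph] scale_minus_left m)
 qed auto
qed

text \<open>T and J are conjugated with the reflection, which preserves all seminorms and maps
  admissible paths to admissible paths.\<close>

lemma fourier_pair_reflect:
 assumes fp: "fourier_pair sc A p {- a..\<infinity>} T J" and a: "a ~= \<infinity>"
 shows "fourier_pair sc A p {-\<infinity>..a} (\<lambda>F zt. - T (\<lambda>z. F (- z)) (- zt)) (\<lambda>f z. J (\<lambda>zt. - f (- zt)) (- z))"
proof -
 let ?K = "{- a..\<infinity>}" and ?K' = "{-\<infinity>..a}"
 interpret fp: fourier_pair sc A p ?K T J by (rule fp)
 \<comment> \<open>Reflection is an involution, so the same transport lemmas serve both
   directions.\<close>
 have inv: "X' = uminus ` X ==> X = uminus ` X'" for X X' :: "complex set" by (simp add: image_image)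
 note fin = fin_part_reflect[of a] and S = S_set_reflect[OF a] and half = half_plane_reflect[OF a]
  and dom = FO_domain_reflect[OF a] and weight = FO_weight_reflect[OF a]
 have weight': "FO_weight ?K k (- z) = FO_weight ?K' k z" for k z using weight[of k "- z"] by simp
 note O_right = Oexp_reflect[OF _ inv[OF fin] inv[OF S]] and O_left = Oexp_reflect[OF _ fin S]
  and O_empty = Oexp_reflect[where K = "{}" and K' = "{}"]
 note FO_right = FO_reflect[OF _ inv[OF half] inv[OF dom] weight'] and FO_left = FO_reflect[OF _ half dom weight]
 show ?thesis
 proof unfold_locales
  show "S_set n ?K' ~= {}" if "n >= 1" for n using fp.S_nonempty[OF that] unfolding S by simp
  show "\<forall>\<^sub>F c in at_right 0. \<forall>F\<in>Oexp sc A p ?K'. has_fourier_integral sc A p ?K' c F zt (- T (\<lambda>z. F (- z)) (- zt))"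
   if zt: "zt \<in> half_plane ?K'" for zt
  proof -
   have "- a ~= -\<infinity>" using a by (cases a) auto
   then obtain c0 where c0: "0 < c0" "\<And>c. 0 < c ==> c < c0 ==> \<exists>b c' l kp. ereal b < - a \<and> hairpin_avoids b c' l kp c \<and> gamma ?K c = hairpin l kp c"
    using gamma_right_hairpin[of "- a"] by metis
   have "\<forall>\<^sub>F c in at_right 0. 0 < c \<and> c < c0" unfolding eventually_at_right_field using c0(1) by blast
   moreover have "- zt \<in> half_plane ?K" using zt unfolding half by (force simp: image_iff)
   from fp.T_integral[OF this]
   have "\<forall>\<^sub>F c in at_right 0. \<forall>F\<in>fp.\<O>. has_fourier_integral sc A p ?K c F (- zt) (T F (- zt))" .
   ultimately show ?thesis
   proof eventually_elim
    fix c assume c: "0 < c \<and> c < c0" and *: "\<forall>F\<in>fp.\<O>. has_fourier_integral sc A p ?K c F (- zt) (T F (- zt))"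
    obtain l kp where g: "gamma ?K c = hairpin l kp c" using c0(2) c by blast
    show "\<forall>F\<in>Oexp sc A p ?K'. has_fourier_integral sc A p ?K' c F zt (- T (\<lambda>z. F (- z)) (- zt))"
    proof
     fix F assume "F \<in> Oexp sc A p ?K'"
     from bspec[OF * O_right(1)[OF this]]
     show "has_fourier_integral sc A p ?K' c F zt (- T (\<lambda>z. F (- z)) (- zt))" by (rule has_fourier_integral_reflect[OF _ g gamma_reflect[OF a]])
    qed
   qed
  qed
  show "(\<lambda>zt. - T (\<lambda>z. F (- z)) (- zt)) \<in> FO sc A p ?K'" if "F \<in> Oexp sc A p ?K'" for F by (rule FO_left(1)[OF fp.T_FO[OF O_right(1)[OF that]]])
  show "\<exists>n\<ge>1. \<exists>C\<ge>0. \<forall>F\<in>Oexp sc A p ?K'. \<forall>j\<in>A. FO_seminorm p ?K' k j (\<lambda>zt. - T (\<lambda>z. F (- z)) (- zt)) <= C*Oexp_seminorm p ?K' n j F"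
   if "k >= 1" for k
  proof -
   from fp.T_bound[OF that] obtain n C where n: "n >= 1" "C >= 0"
    "\<forall>F\<in>fp.\<O>. \<forall>j\<in>A. FO_seminorm p ?K k j (T F) <= C*Oexp_seminorm p ?K n j F" by (elim exE conjE)
   show ?thesis
   proof (intro exI[of _ n] exI[of _ C] conjI ballI n(1,2))
    fix F j assume F: "F \<in> Oexp sc A p ?K'" and j: "j \<in> A"
    show "FO_seminorm p ?K' k j (\<lambda>zt. - T (\<lambda>z. F (- z)) (- zt)) <= C*Oexp_seminorm p ?K' n j F" using bspec[OF bspec[OF n(3) O_right(1)[OF F]] j]
     unfolding FO_left(2)[OF fp.T_FO[OF O_right(1)[OF F]] j] O_right(2)[OF F] .
   qed
  qed
  show "(\<lambda>zt. - T (\<lambda>z. F (- z)) (- zt)) = (\<lambda>_. 0) \<longleftrightarrow> (\<exists>H\<in>Oexp sc A p {}. \<forall>z\<in>- fin_part ?K'. F z = H z)"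
   if F: "F \<in> Oexp sc A p ?K'" for F
  proof -
   have "(\<lambda>zt. - T (\<lambda>z. F (- z)) (- zt)) = (\<lambda>_. 0) \<longleftrightarrow> T (\<lambda>z. F (- z)) = (\<lambda>_. 0)"
   proof
    assume *: "(\<lambda>zt. - T (\<lambda>z. F (- z)) (- zt)) = (\<lambda>_. 0)"
    show "T (\<lambda>z. F (- z)) = (\<lambda>_. 0)"
    proof
     fix zt show "T (\<lambda>z. F (- z)) zt = 0" using fun_cong[OF *, of "- zt"] by simp
    qed
   qed simp
   also have "\<dots> \<longleftrightarrow> (\<exists>H\<in>Oexp sc A p {}. \<forall>z\<in>- fin_part ?K. F (- z) = H z)" by (rule fp.T_zero[OF O_right(1)[OF F]])
   also have "\<dots> \<longleftrightarrow> (\<exists>H\<in>Oexp sc A p {}. \<forall>z\<in>- fin_part ?K'. F z = H z)"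
   proof -
    \<comment> \<open>The empty set is its own reflection, so the subspace that is divided out is
      preserved.\<close>
    have S0: "S_set n {} = uminus ` S_set n {}" for n by (rule eq_uminus_imageI) (simp add: S_set_empty)
    have F0: "fin_part {} = uminus ` fin_part {}" by simp
    note refl = Oexp_reflect(1)[OF _ F0 S0]
    have mem: "z \<in> - fin_part ?K' \<longleftrightarrow> - z \<in> - fin_part ?K" for z unfolding fin by (force simp: image_iff)
    show ?thesis
    proof
     assume "\<exists>H\<in>Oexp sc A p {}. \<forall>z\<in>- fin_part ?K. F (- z) = H z"
     then obtain H where H: "H \<in> Oexp sc A p {}" "\<forall>z\<in>- fin_part ?K. F (- z) = H z" by (elim bexE)
     show "\<exists>H\<in>Oexp sc A p {}. \<forall>z\<in>- fin_part ?K'. F z = H z"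
     proof (rule bexI[OF _ refl[OF H(1)]], rule ballI)
      fix z assume "z \<in> - fin_part ?K'"
      then have "- z \<in> - fin_part ?K" by (simp only: mem)
      from bspec[OF H(2) this] show "F z = H (- z)" by simp
     qed
    next
     assume "\<exists>H\<in>Oexp sc A p {}. \<forall>z\<in>- fin_part ?K'. F z = H z"
     then obtain H where H: "H \<in> Oexp sc A p {}" "\<forall>z\<in>- fin_part ?K'. F z = H z" by (elim bexE)
     show "\<exists>H\<in>Oexp sc A p {}. \<forall>z\<in>- fin_part ?K. F (- z) = H z"
     proof (rule bexI[OF _ refl[OF H(1)]], rule ballI)
      fix z assume "z \<in> - fin_part ?K"
      then have "- z \<in> - fin_part ?K'" by (simp only: mem minus_minus)
      from bspec[OF H(2) this] show "F (- z) = H (- z)" .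
     qed
    qed
   qed
   finally show ?thesis .
  qed
  show "(\<lambda>z. J (\<lambda>zt. - f (- zt)) (- z)) \<in> Oexp sc A p ?K'"
   and "(\<lambda>zt. - T (\<lambda>z. J (\<lambda>zt. - f (- zt)) (- (- z))) (- zt)) = f" if "f \<in> FO sc A p ?K'" for f
   by (rule O_left(1)[OF fp.J_Oexp[OF FO_right(1)[OF that]]], simp add: fp.T_J[OF FO_right(1)[OF that]])
  show "\<exists>k\<ge>1. \<exists>C\<ge>0. \<forall>f\<in>FO sc A p ?K'. \<forall>j\<in>A. Oexp_seminorm p ?K' n j (\<lambda>z. J (\<lambda>zt. - f (- zt)) (- z)) <= C*FO_seminorm p ?K' k j f"
   if "n >= 1" for n
  proof -
   from fp.J_bound[OF that] obtain k C where k: "k >= 1" "C >= 0"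
    "\<forall>f\<in>FO sc A p ?K. \<forall>j\<in>A. Oexp_seminorm p ?K n j (J f) <= C*FO_seminorm p ?K k j f" by (elim exE conjE)
   show ?thesis
   proof (intro exI[of _ k] exI[of _ C] conjI ballI k(1,2))
    fix f j assume f: "f \<in> FO sc A p ?K'" and j: "j \<in> A"
    show "Oexp_seminorm p ?K' n j (\<lambda>z. J (\<lambda>zt. - f (- zt)) (- z)) <= C*FO_seminorm p ?K' k j f"
     using bspec[OF bspec[OF k(3) FO_right(1)[OF f]] j] unfolding O_left(2)[OF fp.J_Oexp[OF FO_right(1)[OF f]]] FO_right(2)[OF f j] .
   qed
  qed
 qed
qed

end

theorem theorem3p5:
  fixes sc :: "complex \<Rightarrow> 'e::ab_group_add \<Rightarrow> 'e"
    and A :: "'i set"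
    and p :: "'i \<Rightarrow> 'e \<Rightarrow> real"
    and a :: ereal
    and K :: "ereal set"
  assumes "vector_space sc"
    and "\<And>\<alpha>. \<alpha> \<in> A \<Longrightarrow> seminorm sc (p \<alpha>)"
    and "directed_seminorms A p"
    and "Hausdorff_space (lc_topology A p)"
    and "seq_complete A p"
    and "K = {a..\<infinity>} \<or> K = {-\<infinity>..a}"
    and "K \<noteq> UNIV"
  shows "(\<forall>\<zeta>\<in>half_plane K. \<forall>\<^sub>F c in at_right 0. \<forall>F\<in>Oexp sc A p K.
            has_fourier_integral sc A p K c F \<zeta> (fourier sc A p K (bv_class sc A p K F) \<zeta>))
       \<and> bv_FO_topological_isomorphism sc A p K (fourier sc A p K)"
proof -
  interpret seq_complete_lc_space sc A p
    by (intro seq_complete_lc_space.intro seminormed_space.intro seminormed_space_axioms.intro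
        seq_complete_lc_space_axioms.intro assms)
  from assms(6) show ?thesis
  proof
    assume K: "K = {a..\<infinity>}"
    with assms(7) have "a \<noteq> -\<infinity>" by auto
    from fourier_pair.fourier_isomorphism[OF fourier_pair_right[OF this]] show ?thesis unfolding K .
  next
    assume K: "K = {-\<infinity>..a}"
    with assms(7) have a: "a \<noteq> \<infinity>" by auto
    then have "- a \<noteq> -\<infinity>" by (cases a) auto
    from fourier_pair.fourier_isomorphism[OF fourier_pair_reflect[OF fourier_pair_right[OF this] a]]
    show ?thesis unfolding K .
  qed
qed

end
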